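(* Let $G$ be a locally compact group and suppose that $G$ is either (a) nilpotent, or (b) has a compact neighbourhood of the identity that is invariant under inner automorphisms (i.e. $G$ is an [IN]-group), or (c) connected but not totally minimal. Then $(\varepsilon_{\mathcal{WAP}},G^{\mathcal{WAP}})\not\leq(\varepsilon_{\mathcal{E}},G^{\mathcal{E}})$. In particular, in this case, $(G^{\mathcal{WAP}})^{\mathcal{CH}}$ is a proper quotient of $G^{\mathcal{WAP}}$.
   Context: For a semitopological semigroup $H$ (separately continuous multiplication), a semitopological compactification of $H$ is a pair $(\delta,S)$ with $S$ a compact Hausdorff semitopological semigroup and $\delta:H\to S$ a continuous homomorphism with dense range; $(\delta,S)\leq(\epsilon,T)$ means there is a continuous homomorphism $\theta:T\to S$ with $\theta\circ\epsilon=\delta$. $(\varepsilon_{\mathcal{WAP}},G^{\mathcal{WAP}})$ is the weakly almost periodic compactification of $G$: the Gelfand spectrum, with evaluation map, of the C*-algebra $\mathcal{WAP}(G)$ of continuous bounded functions whose set of translates is relatively weakly compact in the space $\mathcal{CB}(G)$ of continuous bounded functions on $G$ with the uniform norm. It is the universal semitopological compactification of $G$. The Eberlein compactification $(\varepsilon_{\mathcal{E}},G^{\mathcal{E}})$ is $(\omega_G,\overline{\omega_G(G)}^{w^*})$, where $\omega_G$ is the universal unitary representation of $G$ (direct sum of all cyclic representations arising from continuous positive definite functions $u$ with $u(e)=1$); equivalently it is the Gelfand spectrum, with evaluation map, of the uniform closure $\mathcal{E}(G)$ of the Fourier–Stieltjes algebra $\mathrm{B}(G)$ (the algebra of all matrix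 coefficients of continuous unitary representations of $G$). For a semitopological semigroup $H$, a (CH)-compactification $(\delta,S)$ is a compactification with $S$ isomorphic (algebraically and topologically) to a weak*-closed semigroup of contractions on some Hilbert space; $(\varepsilon_{\mathcal{CH}},H^{\mathcal{CH}})$ is the universal one, i.e. the (CH)-compactification of $H$ of which every (CH)-compactification is a factor. For compact $H$, $H^{\mathcal{CH}}$ is a quotient of $H$ via $\varepsilon_{\mathcal{CH}}$; it is a proper quotient if this map is not injective. A topological group is totally minimal if every continuous homomorphism from it into another (Hausdorff) topological group has closed range.
   Formalization: In cases (a) and (b) the group G is additionally assumed non-compact; for compact G the claim fails, since then WAP(G) = E(G) = C(G) and both compactifications equal G. *)

theory Defs
  imports "HOL-Analysis.Analysis" "HOL-Algebra.Generated_Groups" "HOL-Algebra.Module"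
begin

section \<open>Topological groups\<close>

text \<open>A group with a topology on its carrier; as usual, topological groups are Hausdorff.\<close>

definition topological_group :: "'a monoid \<Rightarrow> 'a topology \<Rightarrow> bool" where
  "topological_group G T \<longleftrightarrow>
     group G \<and> topspace T = carrier G \<and> Hausdorff_space T \<and>
     continuous_map (prod_topology T T) T (\<lambda>(x, y). x \<otimes>\<^bsub>G\<^esub> y) \<and>
     continuous_map T T (\<lambda>x. inv\<^bsub>G\<^esub> x)"

definition locally_compact_group :: "'a monoid \<Rightarrow> 'a topology \<Rightarrow> bool" where
  "locally_compact_group G T \<longleftrightarrow> topological_group G T \<and> locally_compact_space T"

primrec lower_central :: "'a monoid \<Rightarrow> nat \<Rightarrow> 'a set" where
  "lower_central G 0 = carrier G"
| "lower_central G (Suc n) =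
     generate G (\<Union>x\<in>lower_central G n. \<Union>y\<in>carrier G.
       {x \<otimes>\<^bsub>G\<^esub> y \<otimes>\<^bsub>G\<^esub> inv\<^bsub>G\<^esub> x \<otimes>\<^bsub>G\<^esub> inv\<^bsub>G\<^esub> y})"

definition nilpotent_group :: "'a monoid \<Rightarrow> bool" where
  "nilpotent_group G \<longleftrightarrow> (\<exists>n. lower_central G n = {\<one>\<^bsub>G\<^esub>})"

definition IN_group :: "'a monoid \<Rightarrow> 'a topology \<Rightarrow> bool" where
  "IN_group G T \<longleftrightarrow>
     (\<exists>K. compactin T K \<and> (\<exists>U. openin T U \<and> \<one>\<^bsub>G\<^esub> \<in> U \<and> U \<subseteq> K) \<and>
          (\<forall>g\<in>carrier G. (\<lambda>x. g \<otimes>\<^bsub>G\<^esub> x \<otimes>\<^bsub>G\<^esub> inv\<^bsub>G\<^esub> g) ` K = K))"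

text \<open>
  HOL cannot quantify over types inside a formula, so the type carrying the target groups
  is a parameter. Total minimality is the conjunction of the instances over all \<open>'b\<close>;
  hence a theorem with the hypothesis \<open>\<not> totally_minimal TYPE('b) G T\<close>, for a type
  variable \<open>'b\<close>, covers every group that is not totally minimal.
\<close>

definition totally_minimal :: "'b itself \<Rightarrow> 'a monoid \<Rightarrow> 'a topology \<Rightarrow> bool" where
  "totally_minimal _ G T \<longleftrightarrow>
     (\<forall>(G' :: 'b monoid) T' \<phi>.
        topological_group G' T' \<and> \<phi> \<in> hom G G' \<and> continuous_map T T' \<phi>
          \<longrightarrow> closedin T' (\<phi> ` carrier G))"


section \<open>Semitopological semigroups and their compactifications\<close>

text \<open>The underlying set of the semigroup is the \<open>topspace\<close> of its topology.\<close>

record 'a top_semigroup =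
  sg_top :: "'a topology"
  sg_mult :: "'a \<Rightarrow> 'a \<Rightarrow> 'a" (infixl \<open>\<cdot>\<index>\<close> 70)

abbreviation sg_carrier :: "'a top_semigroup \<Rightarrow> 'a set" where
  "sg_carrier S \<equiv> topspace (sg_top S)"

definition semitopological_semigroup :: "'a top_semigroup \<Rightarrow> bool" where
  "semitopological_semigroup S \<longleftrightarrow>
     (\<forall>x\<in>sg_carrier S. \<forall>y\<in>sg_carrier S. x \<cdot>\<^bsub>S\<^esub> y \<in> sg_carrier S) \<and>
     (\<forall>x\<in>sg_carrier S. \<forall>y\<in>sg_carrier S. \<forall>z\<in>sg_carrier S.
        (x \<cdot>\<^bsub>S\<^esub> y) \<cdot>\<^bsub>S\<^esub> z = x \<cdot>\<^bsub>S\<^esub> (y \<cdot>\<^bsub>S\<^esub> z)) \<and>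
     (\<forall>x\<in>sg_carrier S. continuous_map (sg_top S) (sg_top S) (\<lambda>y. x \<cdot>\<^bsub>S\<^esub> y)) \<and>
     (\<forall>y\<in>sg_carrier S. continuous_map (sg_top S) (sg_top S) (\<lambda>x. x \<cdot>\<^bsub>S\<^esub> y))"

definition multiplicative_map :: "'a top_semigroup \<Rightarrow> 'b top_semigroup \<Rightarrow> ('a \<Rightarrow> 'b) \<Rightarrow> bool" where
  "multiplicative_map S S' f \<longleftrightarrow>
     (\<forall>x\<in>sg_carrier S. \<forall>y\<in>sg_carrier S. f (x \<cdot>\<^bsub>S\<^esub> y) = f x \<cdot>\<^bsub>S'\<^esub> f y)"

definition continuous_hom :: "'a top_semigroup \<Rightarrow> 'b top_semigroup \<Rightarrow> ('a \<Rightarrow> 'b) \<Rightarrow> bool" where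
  "continuous_hom S S' f \<longleftrightarrow>
     continuous_map (sg_top S) (sg_top S') f \<and> multiplicative_map S S' f"

definition semigroup_iso :: "'a top_semigroup \<Rightarrow> 'b top_semigroup \<Rightarrow> ('a \<Rightarrow> 'b) \<Rightarrow> bool" where
  "semigroup_iso S S' f \<longleftrightarrow>
     homeomorphic_map (sg_top S) (sg_top S') f \<and> multiplicative_map S S' f"

definition group_semigroup :: "'a monoid \<Rightarrow> 'a topology \<Rightarrow> 'a top_semigroup" where
  "group_semigroup G T = \<lparr>sg_top = T, sg_mult = mult G\<rparr>"

definition compactification ::
    "'a top_semigroup \<Rightarrow> ('a \<Rightarrow> 's) \<Rightarrow> 's top_semigroup \<Rightarrow> bool" where
  "compactification H \<delta> S \<longleftrightarrow>
     semitopological_semigroup S \<and> compact_space (sg_top S) \<and> Hausdorff_space (sg_top S) \<and>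
     continuous_hom H S \<delta> \<and> sg_top S closure_of (\<delta> ` sg_carrier H) = sg_carrier S"

text \<open>\<open>compactification_le H \<delta> S \<epsilon> R\<close> is the relation \<open>(\<delta>, S) \<le> (\<epsilon>, R)\<close>.\<close>

definition compactification_le ::
    "'a top_semigroup \<Rightarrow> ('a \<Rightarrow> 's) \<Rightarrow> 's top_semigroup \<Rightarrow> ('a \<Rightarrow> 'r) \<Rightarrow> 'r top_semigroup \<Rightarrow> bool"
  where
  "compactification_le H \<delta> S \<epsilon> R \<longleftrightarrow>
     (\<exists>\<theta>. continuous_hom R S \<theta> \<and> (\<forall>x\<in>sg_carrier H. \<theta> (\<epsilon> x) = \<delta> x))"


section \<open>Complex Hilbert spaces and their operators\<close>

definition complex_ring :: "complex ring" where
  "complex_ring = \<lparr>carrier = UNIV, mult = (*), one = 1, zero = 0, add = (+)\<rparr>"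

record 'h hilbert = "(complex, 'h) module" +
  hinner :: "'h \<Rightarrow> 'h \<Rightarrow> complex"

definition hnorm :: "'h hilbert \<Rightarrow> 'h \<Rightarrow> real" where
  "hnorm H x = sqrt (Re (hinner H x x))"

definition hdist :: "'h hilbert \<Rightarrow> 'h \<Rightarrow> 'h \<Rightarrow> real" where
  "hdist H x y = hnorm H (x \<ominus>\<^bsub>H\<^esub> y)"

text \<open>The ring multiplication and unit that the record inherits are unused.\<close>

definition hilbert_space :: "'h hilbert \<Rightarrow> bool" where
  "hilbert_space H \<longleftrightarrow>
     Module.module complex_ring H \<and>
     (\<forall>x\<in>carrier H. \<forall>y\<in>carrier H. \<forall>z\<in>carrier H.
        hinner H (x \<oplus>\<^bsub>H\<^esub> y) z = hinner H x z + hinner H y z) \<and>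
     (\<forall>c. \<forall>x\<in>carrier H. \<forall>y\<in>carrier H. hinner H (c \<odot>\<^bsub>H\<^esub> x) y = c * hinner H x y) \<and>
     (\<forall>x\<in>carrier H. \<forall>y\<in>carrier H. hinner H y x = cnj (hinner H x y)) \<and>
     (\<forall>x\<in>carrier H. 0 \<le> Re (hinner H x x)) \<and>
     (\<forall>x\<in>carrier H. hinner H x x = 0 \<longrightarrow> x = \<zero>\<^bsub>H\<^esub>) \<and>
     Metric_space.mcomplete (carrier H) (hdist H)"

definition linear_operators :: "'h hilbert \<Rightarrow> ('h \<Rightarrow> 'h) set" where
  "linear_operators H =
     {A \<in> carrier H \<rightarrow>\<^sub>E carrier H.
        (\<forall>x\<in>carrier H. \<forall>y\<in>carrier H. A (x \<oplus>\<^bsub>H\<^esub> y) = A x \<oplus>\<^bsub>H\<^esub> A y) \<and>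
        (\<forall>c. \<forall>x\<in>carrier H. A (c \<odot>\<^bsub>H\<^esub> x) = c \<odot>\<^bsub>H\<^esub> A x)}"

definition bounded_operators :: "'h hilbert \<Rightarrow> ('h \<Rightarrow> 'h) set" where
  "bounded_operators H =
     {A \<in> linear_operators H. \<exists>C. \<forall>x\<in>carrier H. hnorm H (A x) \<le> C * hnorm H x}"

definition contractions :: "'h hilbert \<Rightarrow> ('h \<Rightarrow> 'h) set" where
  "contractions H =
     {A \<in> linear_operators H. \<forall>x\<in>carrier H. hnorm H (A x) \<le> hnorm H x}"

definition unitaries :: "'h hilbert \<Rightarrow> ('h \<Rightarrow> 'h) set" where
  "unitaries H =
     {A \<in> linear_operators H. bij_betw A (carrier H) (carrier H) \<and>
        (\<forall>x\<in>carrier H. \<forall>y\<in>carrier H. hinner H (A x) (A y) = hinner H x y)}"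

definition square_summable :: "'h hilbert \<Rightarrow> (nat \<Rightarrow> 'h) set" where
  "square_summable H = {\<xi>. range \<xi> \<subseteq> carrier H \<and> summable (\<lambda>n. (hnorm H (\<xi> n))\<^sup>2)}"

text \<open>
  The predual of the bounded operators (the trace class) consists of the functionals
  \<open>A \<mapsto> (\<Sum>n. \<langle>A \<xi>\<^sub>n, \<eta>\<^sub>n\<rangle>)\<close> with square-summable \<open>\<xi>\<close>, \<open>\<eta>\<close>.
\<close>

definition weak_star_topology :: "'h hilbert \<Rightarrow> ('h \<Rightarrow> 'h) topology" where
  "weak_star_topology H =
     pullback_topology (bounded_operators H)
       (\<lambda>A. \<lambda>p \<in> square_summable H \<times> square_summable H.
          \<Sum>n. hinner H (A (fst p n)) (snd p n))
       (product_topology (\<lambda>_. euclidean) (square_summable H \<times> square_summable H))"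

definition operator_semigroup :: "'h hilbert \<Rightarrow> ('h \<Rightarrow> 'h) set \<Rightarrow> ('h \<Rightarrow> 'h) top_semigroup" where
  "operator_semigroup H C =
     \<lparr>sg_top = subtopology (weak_star_topology H) C, sg_mult = compose (carrier H)\<rparr>"

definition closed_contraction_semigroup :: "'h hilbert \<Rightarrow> ('h \<Rightarrow> 'h) set \<Rightarrow> bool" where
  "closed_contraction_semigroup H C \<longleftrightarrow>
     C \<subseteq> contractions H \<and> (\<forall>A\<in>C. \<forall>B\<in>C. compose (carrier H) A B \<in> C) \<and>
     closedin (weak_star_topology H) C"


section \<open>(CH)-compactifications\<close>

text \<open>
  The Hilbert space is sought on the type \<open>'s \<Rightarrow> complex\<close>, which loses no generality.
  If \<open>S\<close> is a semigroup of contractions, choose for each pair of distinct elements a vector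
  that they map differently. The direct sum of the restrictions of \<open>S\<close> to the closed
  invariant subspaces generated by these vectors is injective on \<open>S\<close>, hence, \<open>S\<close> being
  compact, still an isomorphism onto a weak*-closed semigroup. Its Hilbert space is
  finite-dimensional if \<open>S\<close> is finite, and has a dense subset of size at most \<open>|S|\<close>
  otherwise; in both cases it has at most \<open>|'s \<Rightarrow> complex|\<close> points.
\<close>

definition CH_semigroup :: "'s top_semigroup \<Rightarrow> bool" where
  "CH_semigroup S \<longleftrightarrow>
     (\<exists>(H :: ('s \<Rightarrow> complex) hilbert) C \<Phi>.
        hilbert_space H \<and> closed_contraction_semigroup H C \<and>
        semigroup_iso S (operator_semigroup H C) \<Phi>)"

definition CH_compactification ::
    "'a top_semigroup \<Rightarrow> ('a \<Rightarrow> 's) \<Rightarrow> 's top_semigroup \<Rightarrow> bool" where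
  "CH_compactification H \<delta> S \<longleftrightarrow> compactification H \<delta> S \<and> CH_semigroup S"

text \<open>
  A compact Hausdorff space with a dense image of \<open>'a\<close> has at most \<open>|'a set set|\<close> points,
  so it suffices to test universality on that type.
\<close>

definition universal_CH_compactification ::
    "'a top_semigroup \<Rightarrow> ('a \<Rightarrow> 's) \<Rightarrow> 's top_semigroup \<Rightarrow> bool" where
  "universal_CH_compactification H \<epsilon> R \<longleftrightarrow>
     CH_compactification H \<epsilon> R \<and>
     (\<forall>\<delta> (S :: 'a set set top_semigroup).
        CH_compactification H \<delta> S \<longrightarrow> compactification_le H \<delta> S \<epsilon> R)"

definition proper_quotient :: "'a top_semigroup \<Rightarrow> ('a \<Rightarrow> 's) \<Rightarrow> 's top_semigroup \<Rightarrow> bool" where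
  "proper_quotient H \<epsilon> R \<longleftrightarrow>
     multiplicative_map H R \<epsilon> \<and> quotient_map (sg_top H) (sg_top R) \<epsilon> \<and>
     \<not> inj_on \<epsilon> (sg_carrier H)"


section \<open>Function algebras on a group\<close>

text \<open>Functions on the group are represented as extensional functions on its carrier.\<close>

definition CB :: "'a monoid \<Rightarrow> 'a topology \<Rightarrow> ('a \<Rightarrow> complex) set" where
  "CB G T = {f \<in> extensional (carrier G). continuous_map T euclidean f \<and> bounded (f ` carrier G)}"

definition uniform_norm :: "'a monoid \<Rightarrow> ('a \<Rightarrow> complex) \<Rightarrow> real" where
  "uniform_norm G f = (SUP x\<in>carrier G. cmod (f x))"

definition CB_dual :: "'a monoid \<Rightarrow> 'a topology \<Rightarrow> (('a \<Rightarrow> complex) \<Rightarrow> complex) set" where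
  "CB_dual G T =
     {\<phi> \<in> extensional (CB G T).
        (\<forall>f\<in>CB G T. \<forall>g\<in>CB G T. \<phi> (\<lambda>x\<in>carrier G. f x + g x) = \<phi> f + \<phi> g) \<and>
        (\<forall>c. \<forall>f\<in>CB G T. \<phi> (\<lambda>x\<in>carrier G. c * f x) = c * \<phi> f) \<and>
        (\<exists>C. \<forall>f\<in>CB G T. cmod (\<phi> f) \<le> C * uniform_norm G f)}"

definition CB_weak_topology :: "'a monoid \<Rightarrow> 'a topology \<Rightarrow> ('a \<Rightarrow> complex) topology" where
  "CB_weak_topology G T =
     pullback_topology (CB G T) (\<lambda>f. \<lambda>\<phi>\<in>CB_dual G T. \<phi> f)
       (product_topology (\<lambda>_. euclidean) (CB_dual G T))"

definition translate :: "'a monoid \<Rightarrow> 'a \<Rightarrow> ('a \<Rightarrow> complex) \<Rightarrow> 'a \<Rightarrow> complex" where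
  "translate G x f = (\<lambda>y\<in>carrier G. f (x \<otimes>\<^bsub>G\<^esub> y))"

text \<open>
  The translates used are \<open>y \<mapsto> f (x y)\<close>; by Grothendieck's double limit criterion
  the translates \<open>y \<mapsto> f (y x)\<close> define the same algebra.
\<close>

definition WAP :: "'a monoid \<Rightarrow> 'a topology \<Rightarrow> ('a \<Rightarrow> complex) set" where
  "WAP G T =
     {f \<in> CB G T.
        compactin (CB_weak_topology G T)
          (CB_weak_topology G T closure_of ((\<lambda>x. translate G x f) ` carrier G))}"

definition unitary_representation ::
    "'a monoid \<Rightarrow> 'a topology \<Rightarrow> 'h hilbert \<Rightarrow> ('a \<Rightarrow> 'h \<Rightarrow> 'h) \<Rightarrow> bool" where
  "unitary_representation G T H \<pi> \<longleftrightarrow>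
     hilbert_space H \<and> \<pi> \<in> carrier G \<rightarrow> unitaries H \<and>
     (\<forall>x\<in>carrier G. \<forall>y\<in>carrier G. \<pi> (x \<otimes>\<^bsub>G\<^esub> y) = compose (carrier H) (\<pi> x) (\<pi> y)) \<and>
     (\<forall>\<xi>\<in>carrier H.
        continuous_map T (Metric_space.mtopology (carrier H) (hdist H)) (\<lambda>x. \<pi> x \<xi>))"

text \<open>
  Hilbert spaces on the type \<open>'a \<Rightarrow> complex\<close> yield all matrix coefficients: for the
  coefficient \<open>\<langle>\<pi>(x) \<xi>, \<eta>\<rangle>\<close> one may assume \<open>\<xi>\<close> cyclic (project \<open>\<eta>\<close> to the cyclic
  subspace), and then \<open>v \<mapsto> (x \<mapsto> \<langle>v, \<pi>(x) \<xi>\<rangle>)\<close> embeds the space into the functions on \<open>G\<close>.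
\<close>

definition fourier_stieltjes :: "'a monoid \<Rightarrow> 'a topology \<Rightarrow> ('a \<Rightarrow> complex) set" where
  "fourier_stieltjes G T =
     {u. \<exists>(H :: ('a \<Rightarrow> complex) hilbert) \<pi> \<xi> \<eta>.
           unitary_representation G T H \<pi> \<and> \<xi> \<in> carrier H \<and> \<eta> \<in> carrier H \<and>
           u = (\<lambda>x\<in>carrier G. hinner H (\<pi> x \<xi>) \<eta>)}"

definition eberlein_algebra :: "'a monoid \<Rightarrow> 'a topology \<Rightarrow> ('a \<Rightarrow> complex) set" where
  "eberlein_algebra G T =
     {f \<in> CB G T. \<forall>e>0. \<exists>u\<in>fourier_stieltjes G T.
        uniform_norm G (\<lambda>x\<in>carrier G. f x - u x) < e}"


section \<open>The compactification of a group given by the spectrum of a function algebra\<close>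

definition gelfand_spectrum ::
    "'a monoid \<Rightarrow> ('a \<Rightarrow> complex) set \<Rightarrow> (('a \<Rightarrow> complex) \<Rightarrow> complex) set" where
  "gelfand_spectrum G A =
     {\<mu> \<in> extensional A.
        (\<forall>f\<in>A. \<forall>g\<in>A. \<mu> (\<lambda>x\<in>carrier G. f x + g x) = \<mu> f + \<mu> g) \<and>
        (\<forall>c. \<forall>f\<in>A. \<mu> (\<lambda>x\<in>carrier G. c * f x) = c * \<mu> f) \<and>
        (\<forall>f\<in>A. \<forall>g\<in>A. \<mu> (\<lambda>x\<in>carrier G. f x * g x) = \<mu> f * \<mu> g) \<and>
        (\<exists>f\<in>A. \<mu> f \<noteq> 0)}"

definition evaluation :: "('a \<Rightarrow> complex) set \<Rightarrow> 'a \<Rightarrow> ('a \<Rightarrow> complex) \<Rightarrow> complex" where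
  "evaluation A x = (\<lambda>f\<in>A. f x)"

text \<open>
  The topology is the weak* topology, i.e. pointwise convergence on \<open>A\<close>. The product
  \<open>(\<mu> \<nu>)(f) = \<mu> (x \<mapsto> \<nu> (y \<mapsto> f (x y)))\<close> is the unique separately continuous one that
  makes the evaluation map a homomorphism.
\<close>

definition spectrum_semigroup ::
    "'a monoid \<Rightarrow> ('a \<Rightarrow> complex) set \<Rightarrow> (('a \<Rightarrow> complex) \<Rightarrow> complex) top_semigroup" where
  "spectrum_semigroup G A =
     \<lparr>sg_top = subtopology (product_topology (\<lambda>_. euclidean) A) (gelfand_spectrum G A),
      sg_mult = (\<lambda>\<mu> \<nu>. \<lambda>f\<in>A. \<mu> (\<lambda>x\<in>carrier G. \<nu> (translate G x f)))\<rparr>"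

definition WAP_compactification ::
    "'a monoid \<Rightarrow> 'a topology \<Rightarrow> (('a \<Rightarrow> complex) \<Rightarrow> complex) top_semigroup" where
  "WAP_compactification G T = spectrum_semigroup G (WAP G T)"

definition eberlein_compactification ::
    "'a monoid \<Rightarrow> 'a topology \<Rightarrow> (('a \<Rightarrow> complex) \<Rightarrow> complex) top_semigroup" where
  "eberlein_compactification G T = spectrum_semigroup G (eberlein_algebra G T)"

end

theory Submission
  imports Defs "HOL-Complex_Analysis.Great_Picard" "HOL-Library.Ramsey"
begin

text \<open>
  A weakly almost periodic function \<open>f\<close> need not bound the length \<open>n\<close> of its half graphs, that is,
  of finite sequences \<open>a i\<close>, \<open>b j\<close> in \<open>G\<close> with \<open>f (a i b j) = 1\<close> for \<open>i < j < n\<close> and \<open>0\<close> for \<open>j \<le> i < n\<close>: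
  Grothendieck's iterated limit condition concerns infinite sequences only. A coefficient
  \<open>(x, y) \<mapsto> \<langle>\<pi> (x y) \<xi>, \<eta>\<rangle> = \<langle>\<pi> y \<xi>, (\<pi> x)\<^sup>* \<eta>\<rangle>\<close> of a semigroup of contractions does bound it, by the
  parallelogram law, and this persists under uniform approximation. In each of the three cases finite
  half graphs of every length can be placed in \<open>G\<close> so far apart that the smeared indicator of the
  points \<open>a i b j\<close> with \<open>i < j\<close> is weakly almost periodic: in a nilpotent or [IN]-group because a
  non-compact subgroup normalizes a compact neighbourhood of the identity, and for a homomorphism
  \<open>\<phi>\<close> with non-closed range by choosing the \<open>b j\<close> close to the identity in the topology induced by \<open>\<phi>\<close>,
  but outside large compact sets. This function is not in the uniform closure of the coefficients, and
  the points of \<open>G\<^sup>W\<^sup>A\<^sup>P\<close> that it separates are not all separated by (CH)-compactifications.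
\<close>

section \<open>Iterated limits and weak compactness\<close>

text \<open>A comparison of the compactifications does not turn \<open>f\<close> into a coefficient:
  it only makes \<open>f\<close> a continuous function of possibly infinitely many of them. Bounded
  half graph length survives this, because on a compact space continuity leaves finitely many
  coefficients to watch, and Ramsey's theorem makes these nearly constant above and below the
  diagonal of a long sub-half-graph.

  On the group side the obstacle is the diagonal. In a non-abelian group \<open>p d d' p^-1\<close>,
  with \<open>d\<close> and \<open>d'\<close> near the identity, cannot be driven to infinity, so a
  point paired with itself is asked to avoid only compact sets off a fixed compact
  \<open>C0\<close>. Also, the group need not be \<sigma>-compact; the compact sets to be avoided
  come from powers of a neighbourhood in the connected case and from a countable subgroup otherwise.

  Representations are treated as positive definite kernels: sums, products and limits of kernels
  replace direct sums, tensor products and completions, and the Hilbert space of a kernel lives on a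
  prescribed type of functions.\<close>

abbreviation (input) tends_to :: "(nat => 'a::topological_space) => 'a => bool" (infix "---->" 60)
 where "X ----> a \<equiv> X \<longlonglongrightarrow> a"

text \<open>Dependent choice in which every step may look back at all earlier ones. Histories are
  functions, so that users can write \<open>h i\<close>; \<open>local\<close> says that their values
  from \<open>n\<close> on do not matter. The proof chooses growing lists and reads the sequence off
  their last entries.\<close>

lemma history_choice:
 fixes Q :: "nat => (nat => 'b) => 'b => bool"
 assumes ex: "!!n h. (!!i. i < n ==> h i : A) ==> EX v:A. Q n h v"
  and local: "!!n h h' v. (!!i. i < n ==> h i = h' i) ==> Q n h v ==> Q n h' v"
 shows "EX x. ALL n. x n : A & Q n x (x n)"
proof -
 define P where "P = (%n (l::'b list). length l = n & set l \<subseteq> A & (ALL i<n. Q i ((!) l) (l ! i)))"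
 have "EX f. ALL n. P n (f n) & (EX v. f (Suc n) = f n @ [v])"
 proof (rule dependent_nat_choice)
  show "EX l. P 0 l" by (simp add: P_def)
  fix l n assume l: "P n l"
  have "!!i. i < n ==> l ! i : A" using l by (auto simp: P_def)
  then obtain v where v: "v : A" "Q n ((!) l) v" using ex[of n "(!) l"] by blast
  have "P (Suc n) (l @ [v])"
   unfolding P_def
  proof (intro conjI allI impI)
   fix i assume i: "i < Suc n"
   show "Q i ((!) (l @ [v])) ((l @ [v]) ! i)"
   proof (cases "i < n")
    case True
    have "Q i ((!) l) (l ! i)" using l True by (auto simp: P_def)
    then show ?thesis using l True local[of i "(!) l" "(!) (l @ [v])"] by (auto simp: P_def nth_append)
   next
    case False
    then have "i = n" using i by simp
    then show ?thesis using l v local[of n "(!) l" "(!) (l @ [v])"] by (auto simp: P_def nth_append)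
   qed
  qed (use l v in \<open>auto simp: P_def\<close>)
  then show "EX l'. P (Suc n) l' & (EX v. l' = l @ [v])" by blast
 qed
 then obtain f where f: "!!n. P n (f n)" "!!n. EX v. f (Suc n) = f n @ [v]" by blast
 define x where "x = (%n. f (Suc n) ! n)"
 have len: "length (f n) = n" for n using f(1) by (simp add: P_def)
 have pre: "i < n ==> f n ! i = x i" for i n
 proof (induction n)
  case (Suc n)
  obtain v where v: "f (Suc n) = f n @ [v]" using f(2) by blast
  show ?case
  proof (cases "i = n")
   case False
   then have "i < n" using Suc by simp
   then show ?thesis using Suc v len by (simp add: nth_append)
  qed (simp add: x_def)
 qed simp
 have "x n : A & Q n x (x n)" for n
 proof
  show "x n : A" using f(1)[of "Suc n"] unfolding P_def x_def by (metis lessI nth_mem subsetD)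
  have "Q n ((!) (f (Suc n))) (x n)" using f(1)[of "Suc n"] unfolding P_def x_def by blast
  then show "Q n x (x n)" by (rule local[rotated]) (simp add: pre)
 qed
 then show ?thesis by blast
qed

text \<open>Rounding to a grid of mesh \<open>\<eta> / 2\<close> is a finite colouring of every
  disc. It serves as total boundedness here and as the colouring for Ramsey's theorem later.\<close>

lemma finite_complex_grid:
 assumes "0 < \<eta>"
 obtains key :: "complex => int \<times> int" where
  "!!z z'. key z = key z' ==> cmod (z - z') < \<eta>"
  "!!B. finite (key ` cball 0 B)"
proof
 define key where "key = (%z. (\<lfloor>2 * Re z / \<eta>\<rfloor>, \<lfloor>2 * Im z / \<eta>\<rfloor>))"
 have r: "\<bar>x - y\<bar> < \<eta> / 2" if "\<lfloor>2 * x / \<eta>\<rfloor> = \<lfloor>2 * y / \<eta>\<rfloor>" for x y :: real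
 proof -
  have "\<bar>2 * x / \<eta> - 2 * y / \<eta>\<bar> < 1" using that by linarith
  moreover have "2 * x / \<eta> - 2 * y / \<eta> = (x - y) * (2 / \<eta>)" by (simp add: algebra_simps diff_divide_distrib)
  ultimately show ?thesis using assms by (simp add: abs_mult field_simps abs_if split: if_splits)
 qed
 show "cmod (z - z') < \<eta>" if "key z = key z'" for z z'
 proof -
  have "\<bar>Re z - Re z'\<bar> < \<eta> / 2" "\<bar>Im z - Im z'\<bar> < \<eta> / 2" using that r by (auto simp: key_def)
  then show ?thesis using cmod_le[of "z - z'"] by simp
 qed
 show "finite (key ` cball 0 B)" for B
 proof (rule finite_subset)
  define m where "m = \<lceil>2 * \<bar>B\<bar> / \<eta>\<rceil> + 1"
  have b: "\<lfloor>2 * x / \<eta>\<rfloor> : {-m..m}" if "\<bar>x\<bar> <= B" for x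
  proof -
   have "2 * x / \<eta> <= 2 * \<bar>B\<bar> / \<eta>" "- (2 * \<bar>B\<bar> / \<eta>) <= 2 * x / \<eta>" using that assms
    by (auto simp: field_simps)
   then show ?thesis unfolding m_def by (simp; linarith)
  qed
  show "key ` cball 0 B \<subseteq> {-m..m} \<times> {-m..m}"
  proof
   fix p assume "p : key ` cball 0 B"
   then obtain z where z: "cmod z <= B" "p = key z" by auto
   have "\<bar>Re z\<bar> <= B" "\<bar>Im z\<bar> <= B" using z abs_Re_le_cmod abs_Im_le_cmod order_trans by blast+
   then have "\<lfloor>2 * Re z / \<eta>\<rfloor> : {-m..m}" "\<lfloor>2 * Im z / \<eta>\<rfloor> : {-m..m}" using b by blast+
   then show "p : {-m..m} \<times> {-m..m}" using z unfolding key_def by blast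
  qed
 qed simp
qed

text \<open>Total boundedness of the image of \<open>A\<close> in complex \<open>m\<close>-space.
  The net takes one point of \<open>A\<close> for each list of grid cells that occurs, so
  \<open>A\<close> needs no topology.\<close>

lemma finite_net_of_bounded_functions:
 fixes g :: "nat => 'x => complex"
 assumes bd: "!!i x. i < m ==> x : A ==> cmod (g i x) <= B" and eta: "0 < \<eta>"
 obtains Y where "finite Y" "Y \<subseteq> A" "!!z. z : A ==> EX y:Y. ALL i<m. cmod (g i z - g i y) < \<eta>"
proof -
 obtain key :: "complex => int \<times> int" where key:
  "!!z z'. key z = key z' ==> cmod (z - z') < \<eta>" "!!B. finite (key ` cball 0 B)"
  using finite_complex_grid[OF eta] by metis
 define k where "k = (%x. map (%i. key (g i x)) [0..<m])"
 have "k ` A \<subseteq> {l. set l \<subseteq> key ` cball 0 B & length l = m}"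
  using bd by (auto simp: k_def)
 then have fin: "finite (k ` A)"
  using finite_lists_length_eq[OF key(2)] finite_subset by blast
 define Y where "Y = (inv_into A k) ` (k ` A)"
 show thesis
 proof
  show "finite Y" using fin by (simp add: Y_def)
  show "Y \<subseteq> A" unfolding Y_def by (auto intro: inv_into_into)
  fix z assume z: "z : A"
  define y where "y = inv_into A k (k z)"
  have "k y = k z" unfolding y_def using z by (simp add: f_inv_into_f)
  then have "ALL i<m. key (g i z) = key (g i y)"
   unfolding k_def by (auto simp: list_eq_iff_nth_eq)
  moreover have "y : Y" unfolding Y_def y_def using z by blast
  ultimately show "EX y:Y. ALL i<m. cmod (g i z - g i y) < \<eta>" using key(1) by blast
 qed
qed

text \<open>The column subsequence \<open>s1\<close> serves all rows and the row subsequence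
  \<open>r1\<close> all columns, so the two can be combined freely. A second thinning of each makes
  the row limits and the column limits converge.\<close>

lemma iterated_limits_exist_along_subsequences:
 fixes c :: "nat => nat => 'b::{real_normed_vector,heine_borel}"
 assumes bd: "!!i j. norm (c i j) <= B"
 obtains r s :: "nat => nat" and \<alpha> \<beta> a b where "strict_mono r" "strict_mono s"
  "!!i. (%j. c (r i) (s j)) ----> \<alpha> i" "\<alpha> ----> a"
  "!!j. (%i. c (r i) (s j)) ----> \<beta> j" "\<beta> ----> b"
proof -
 have sub: "EX k. strict_mono k & (ALL x. EX l. (%n. f (k n) x) ----> l)"
  if "!!n x. norm (f n x) <= B" for f :: "nat => nat => 'b"
  using function_convergent_subsequence[of "UNIV :: nat set" f B] that by (metis UNIV_I countableI_type)
 obtain s1 where s1: "strict_mono s1" "!!i. EX l. (%j. c i (s1 j)) ----> l"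
  using sub[of "%j i. c i j"] bd by blast
 then obtain \<alpha>1 where a1: "!!i. (%j. c i (s1 j)) ----> \<alpha>1 i" by metis
 obtain r1 where r1: "strict_mono r1" "!!j. EX l. (%i. c (r1 i) j) ----> l"
  using sub[of "%i j. c i j"] bd by blast
 then obtain \<beta>1 where b1: "!!j. (%i. c (r1 i) j) ----> \<beta>1 j" by metis
 have na: "norm (\<alpha>1 i) <= B" for i
  using a1[of i] bd by (intro Lim_bounded[where f="%j. norm (c i (s1 j))" and M=0]) (auto intro: tendsto_norm)
 have nb: "norm (\<beta>1 i) <= B" for i
  using b1[of i] bd by (intro Lim_bounded[where f="%j. norm (c (r1 j) i)" and M=0]) (auto intro: tendsto_norm)
 obtain r2 where r2: "strict_mono r2" "!!j::nat. EX l. (%i. \<alpha>1 (r1 (r2 i))) ----> l"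
  using sub[of "%i j. \<alpha>1 (r1 i)"] na by blast
 then obtain a where a: "(%i. \<alpha>1 (r1 (r2 i))) ----> a" by blast
 obtain s2 where s2: "strict_mono s2" "!!j::nat. EX l. (%i. \<beta>1 (s1 (s2 i))) ----> l"
  using sub[of "%i j. \<beta>1 (s1 i)"] nb by blast
 then obtain b where b: "(%i. \<beta>1 (s1 (s2 i))) ----> b" by blast
 show thesis
 proof
  show "strict_mono (r1 \<circ> r2)" "strict_mono (s1 \<circ> s2)"
   using r1 r2 s1 s2 strict_mono_o by blast+
  show "(%j. c ((r1 \<circ> r2) i) ((s1 \<circ> s2) j)) ----> \<alpha>1 (r1 (r2 i))" for i
   using LIMSEQ_subseq_LIMSEQ[OF a1[of "r1 (r2 i)"] s2(1)] by (simp add: o_def)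
  show "(%i. c ((r1 \<circ> r2) i) ((s1 \<circ> s2) j)) ----> \<beta>1 (s1 (s2 j))" for j
   using LIMSEQ_subseq_LIMSEQ[OF b1[of "s1 (s2 j)"] r2(1)] by (simp add: o_def)
 qed (use a b in auto)
qed

section \<open>Ptak's combinatorial lemma\<close>

definition ptak_bad :: "(nat => 'y => bool) => 'y set => real => nat => bool" where
 "ptak_bad R Z e N \<longleftrightarrow> (ALL l A. finite A --> A \<subseteq> {N..} --> (ALL n. (0::real) <= l n) --> sum l A = 1 -->
   (EX y:Z. e <= (\<Sum>n\<in>{n\<in>A. R n y}. l n)))"

text \<open>Otherwise averages on successive blocks could be stacked: a point \<open>y\<close> may
  have weight up to 1 in the first block it meets, but then it belongs to the reduced set and has
  weight below \<open>e'\<close> in every later block. After \<open>k\<close> blocks its share is at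
  most \<open>1 / k + e'\<close>, which is below \<open>e\<close> for large
  \<open>k\<close>.\<close>

lemma ptak_step:
 assumes bad: "ptak_bad R Z e N" and e: "0 < e'" "e' < e"
 obtains S N' where "finite S" "S \<subseteq> {N..}" "N < N'" "ptak_bad R {y\<in>Z. EX n:S. R n y} e' N'"
proof (rule ccontr)
 note found = that
 assume none: "~ thesis"
 have nb: "~ ptak_bad R {y\<in>Z. EX n:S. R n y} e' N'" if "finite S" "S \<subseteq> {N..}" "N < N'" for S N'
  using found[OF that] none by blast
 have avg: "EX A l. finite A & A \<subseteq> {N..} & (ALL n. (0::real) <= l n) & sum l A = real k &
   (ALL y:Z. (\<Sum>n\<in>{n\<in>A. R n y}. l n) <= 1 + real k * e')" for k
 proof (induction k)
  case 0 show ?case by (rule exI[of _ "{}"]) (auto intro: exI[of _ "%n. 0"])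
 next
  case (Suc k)
  then obtain A l where A: "finite A" "A \<subseteq> {N..}" "!!n. (0::real) <= l n" "sum l A = real k"
   and l: "!!y. y : Z ==> (\<Sum>n\<in>{n\<in>A. R n y}. l n) <= 1 + real k * e'" by metis
  \<comment> \<open>The next block starts beyond the previous ones. This makes the blocks disjoint,
    and the negated conclusion applies with \<open>A\<close> as \<open>S\<close>.\<close>
  define N' where "N' = Suc (Max (insert N A))"
  have N': "N < N'" "!!n. n : A ==> n < N'" using A by (auto simp: N'_def less_Suc_eq_le)
  obtain l' A' where "finite A' & A' \<subseteq> {N'..} & (ALL n. (0::real) <= l' n) & sum l' A' = 1 &
    (ALL y:{y\<in>Z. EX n:A. R n y}. ~ e' <= (\<Sum>n\<in>{n\<in>A'. R n y}. l' n))"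
   using nb[OF A(1,2) N'(1)] unfolding ptak_bad_def by blast
  then have A': "finite A'" "A' \<subseteq> {N'..}" "!!n. (0::real) <= l' n" "sum l' A' = 1"
   and l': "!!y. y : Z ==> EX n:A. R n y ==> (\<Sum>n\<in>{n\<in>A'. R n y}. l' n) < e'"
   by (auto simp: not_le)
  have dis: "A \<inter> A' = {}" using N' A' by fastforce
  define m where "m = (%n. if n : A then l n else l' n)"
  have mA: "sum m B = sum l B" if "B \<subseteq> A" for B using that by (intro sum.cong) (auto simp: m_def)
  have mA': "sum m B = sum l' B" if "B \<subseteq> A'" for B using that dis by (intro sum.cong) (auto simp: m_def)
  have "(\<Sum>n\<in>{n\<in>A\<union>A'. R n y}. m n) <= 1 + real (Suc k) * e'" if y: "y : Z" for y
  proof -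
   have "{n\<in>A\<union>A'. R n y} = {n\<in>A. R n y} \<union> {n\<in>A'. R n y}" by auto
   then have "(\<Sum>n\<in>{n\<in>A\<union>A'. R n y}. m n) = sum m {n\<in>A. R n y} + sum m {n\<in>A'. R n y}"
    using A(1) A'(1) dis by (simp add: sum.union_disjoint disjoint_iff)
   also have "\<dots> = sum l {n\<in>A. R n y} + sum l' {n\<in>A'. R n y}" by (subst mA, simp, subst mA') auto
   also have "\<dots> <= 1 + real (Suc k) * e'"
   proof (cases "EX n:A. R n y")
    case True
    then show ?thesis using l[OF y] l'[OF y True] by (simp add: algebra_simps)
   next
    case False
    then have "{n\<in>A. R n y} = {}" by auto
    then have "sum l {n\<in>A. R n y} = 0" by (simp only: sum.empty)
    moreover have "sum l' {n\<in>A'. R n y} <= 1"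
     using A'(1,3) unfolding A'(4)[symmetric] by (intro sum_mono2) auto
    moreover have "0 <= real (Suc k) * e'" using e by simp
    ultimately show ?thesis by linarith
   qed
   finally show ?thesis .
  qed
  moreover have "sum m (A \<union> A') = real (Suc k)"
   using A A' dis mA[of A] mA'[of A'] by (simp add: sum.union_disjoint)
  moreover have "A \<union> A' \<subseteq> {N..}" using A A' N' by fastforce
  ultimately show ?case using A A' by (intro exI[of _ "A \<union> A'"] exI[of _ m]) (auto simp: m_def)
 qed
 \<comment> \<open>\<open>k * (e - e') > 1\<close> makes the bound \<open>1 + k * e'\<close> on the
   unnormalized weights fall below \<open>k * e\<close>.\<close>
 obtain k :: nat where k: "1 / (e - e') < real k" using reals_Archimedean2 by blast
 then have kpos: "0 < real k" using e by (smt (verit) divide_pos_pos)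
 obtain A l where A: "finite A" "A \<subseteq> {N..}" "!!n. (0::real) <= l n" "sum l A = real k"
   and l: "!!y. y : Z ==> (\<Sum>n\<in>{n\<in>A. R n y}. l n) <= 1 + real k * e'" using avg by metis
 have "sum (%n. l n / real k) A = 1" using A kpos by (simp flip: sum_divide_distrib)
 then obtain y where y: "y : Z" "e <= (\<Sum>n\<in>{n\<in>A. R n y}. l n / real k)"
  using bad[unfolded ptak_bad_def, rule_format, OF A(1,2), of "%n. l n / real k"] A(3) kpos by auto
 have "e * real k <= (\<Sum>n\<in>{n\<in>A. R n y}. l n)"
  using y(2) kpos by (simp add: field_simps flip: sum_divide_distrib)
 also have "\<dots> <= 1 + real k * e'" using l y by blast
 finally have "real k * (e - e') <= 1" by (simp add: algebra_simps)
 then show False using k e by (simp add: field_simps)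
qed

text \<open>Ptak's combinatorial lemma. Iterating the previous lemma with thresholds decreasing to \<open>e / 2\<close>.\<close>

lemma ptak:
 fixes R :: "nat => 'y => bool"
 assumes e: "0 < e"
  and noavg: "!!(l::nat=>real) A. finite A ==> (!!n. 0 <= l n) ==> sum l A = 1 ==>
   EX y. e <= (\<Sum>n\<in>{n\<in>A. R n y}. l n)"
 obtains S where "!!i. finite (S i)" "!!i n. n : S i ==> i <= n"
  "!!k::nat. EX y. ALL i<k. EX n:S i. R n y"
proof -
 define th where "th = (%i::nat. e * (1/2 + 1/2^(Suc i)))"
 have th: "0 < th i" "th (Suc i) < th i" for i using e
  by (auto simp: th_def field_simps add_pos_pos)
 \<comment> \<open>The clause \<open>i <= N\<close> puts \<open>S i\<close> beyond \<open>i\<close>;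
   in the application this drives the selected indices to infinity.\<close>
 define P where "P = (%i (Z, N, S::nat set). ptak_bad R Z (th i) N & i <= N)"
 define Q where "Q = (%(i::nat) (Z, N, S::nat set) (Z', N'::nat, S'). finite S' & S' \<subseteq> {N..} & Z' = {y\<in>Z. EX n:S'. R n y})"
 have "EX f. ALL i. P i (f i) & Q i (f i) (f (Suc i))"
 proof (rule dependent_nat_choice)
  have "P 0 (UNIV, 0, {})" using noavg by (auto simp: P_def ptak_bad_def th_def)
  then show "EX x. P 0 x" by blast
  fix x i assume x: "P i x"
  obtain Z N S0 where xx: "x = (Z, N, S0)" by (cases x)
  have b: "ptak_bad R Z (th i) N" and iN: "i <= N" using x by (auto simp: P_def xx)
  obtain S N' where "finite S" "S \<subseteq> {N..}" "N < N'" "ptak_bad R {y\<in>Z. EX n:S. R n y} (th (Suc i)) N'"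
   by (rule ptak_step[OF b th])
  then have "P (Suc i) ({y\<in>Z. EX n:S. R n y}, N', S) & Q i x ({y\<in>Z. EX n:S. R n y}, N', S)"
   using iN by (auto simp: P_def Q_def xx)
  then show "EX y. P (Suc i) y & Q i x y" by blast
 qed
 then obtain f where f: "!!i. P i (f i)" "!!i. Q i (f i) (f (Suc i))" by blast
 define Z where "Z = (%i. fst (f i))"
 define N where "N = (%i. fst (snd (f i)))"
 define S where "S = (%i. snd (snd (f (Suc i))))"
 have fi: "f i = (Z i, N i, snd (snd (f i)))" for i by (simp add: Z_def N_def)
 have bad: "ptak_bad R (Z i) (th i) (N i)" and iN: "i <= N i" for i
  using f(1)[of i] by (subst (asm) fi, simp add: P_def)+
 have q: "finite (S i)" "S i \<subseteq> {N i..}" "Z (Suc i) = {y\<in>Z i. EX n:S i. R n y}" for i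
  using f(2)[of i] by (auto simp: Q_def S_def Z_def N_def split: prod.splits)
 have ZS: "y : Z k ==> ALL i<k. EX n:S i. R n y" for y k
  by (induction k) (auto simp: q(3) less_Suc_eq)
 show thesis
 proof
  show "finite (S i)" for i by (rule q)
  show "i <= n" if "n : S i" for i n using that q(2)[of i] iN[of i] by auto
  show "EX y. ALL i<k. EX n:S i. R n y" for k
  proof -
   \<comment> \<open>Badness, applied to the unit mass at \<open>N k\<close>, already yields a
     point.\<close>
   have "EX y. y : Z k"
    using bad[of k, unfolded ptak_bad_def, rule_format, of "{N k}" "%_. 1"] by auto
   then show ?thesis using ZS by blast
  qed
 qed
qed

lemma closure_of_product_approx:
 fixes \<xi> :: "'i => complex"
 assumes "\<xi> : product_topology (%_. euclidean) I closure_of A" "finite F" "F \<subseteq> I" "0 < e"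
 shows "EX a:A. ALL i:F. cmod (a i - \<xi> i) < e"
proof -
 define U where "U = (%i. if i : F then ball (\<xi> i) e else UNIV)"
 have "finite {i : I. U i ~= UNIV}" using assms(2) by (rule finite_subset[rotated]) (auto simp: U_def)
 then have op: "openin (product_topology (%_. euclidean) I) (PiE I U)"
  by (subst openin_PiE_gen) (auto simp: U_def)
 have "\<xi> : extensional I" using assms(1) by (auto simp: in_closure_of PiE_def)
 then have "\<xi> : PiE I U" using assms(4) by (auto simp: U_def PiE_def)
 then obtain a where "a : A" "a : PiE I U" using assms(1) op unfolding in_closure_of by blast
 then show ?thesis using assms(3) by (force simp: U_def PiE_iff dist_norm norm_minus_commute)
qed

lemma closure_of_product_approx_iff:
 fixes \<xi> :: "'i => complex"
 assumes ext: "\<xi> : extensional I"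
 shows "\<xi> : product_topology (%_. euclidean) I closure_of A \<longleftrightarrow>
  (ALL F e. finite F --> F \<subseteq> I --> 0 < e --> (EX a:A \<inter> extensional I. ALL i:F. cmod (a i - \<xi> i) < e))"
  (is "_ \<longleftrightarrow> ?R")
proof
 assume l: "\<xi> : product_topology (%_. euclidean) I closure_of A"
 have "\<xi> : product_topology (%_. euclidean) I closure_of (A \<inter> extensional I)"
  using l by (subst (asm) closure_of_restrict) (simp add: PiE_def Int_commute)
 then show ?R using closure_of_product_approx by blast
next
 assume r: ?R
 show "\<xi> : product_topology (%_. euclidean) I closure_of A"
  unfolding in_closure_of
 proof (intro conjI allI impI)
  show "\<xi> : topspace (product_topology (%_. euclidean) I)" using ext by (simp add: PiE_def)
  fix O' assume "\<xi> : O' & openin (product_topology (%_. euclidean) I) O'"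
  then obtain U where U: "finite {i : I. U i ~= UNIV}" "!!i. i : I ==> open (U i)"
   "\<xi> : PiE I U" "PiE I U \<subseteq> O'"
   unfolding openin_product_topology_alt by auto
  define F where "F = {i : I. U i ~= UNIV}"
  have "EX d. 0 < d & ball (\<xi> i) d \<subseteq> U i" if "i : I" for i
   using U(2,3) that open_contains_ball[of "U i"] by (auto simp: PiE_iff)
  then obtain d where d: "!!i. i : I ==> 0 < d i & ball (\<xi> i) (d i) \<subseteq> U i" by metis
  define e where "e = Min (insert 1 (d ` F))"
  have e: "0 < e" "!!i. i : F ==> e <= d i" using U(1) d by (auto simp: e_def F_def)
  obtain a where a: "a : A" "a : extensional I" "ALL i:F. cmod (a i - \<xi> i) < e"
   using r[rule_format, of F e] U(1) e by (auto simp: F_def)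
  have "a i : U i" if "i : I" for i
  proof (cases "i : F")
   case True
   then have "a i : ball (\<xi> i) (d i)" using a(3) e(2)[OF True] by (auto simp: dist_norm norm_minus_commute)
   then show ?thesis using d[OF that] by blast
  qed (use that in \<open>auto simp: F_def\<close>)
  then have "a : PiE I U" using a by (auto simp: PiE_iff)
  then show "EX y. y : A & y : O'" using a U(4) by blast
 qed
qed

text \<open>Open sets of the pullback are preimages, so a cover of the preimage of \<open>K\<close>
  pushes forward to a cover of \<open>K\<close>, provided that every point of \<open>K\<close> is
  attained on \<open>A\<close>.\<close>

lemma compactin_pullback_topology:
 assumes "compactin X K" "K \<subseteq> f ` A"
 shows "compactin (pullback_topology A f X) (f -` K \<inter> A)"
 unfolding compactin_def
proof (intro conjI allI impI)
 show "f -` K \<inter> A \<subseteq> topspace (pullback_topology A f X)"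
  using compactin_subset_topspace[OF assms(1)] by (auto simp: topspace_pullback_topology)
 fix \<U> assume \<U>: "Ball \<U> (openin (pullback_topology A f X)) & f -` K \<inter> A \<subseteq> \<Union> \<U>"
 then have "ALL U:\<U>. EX V. openin X V & U = f -` V \<inter> A" by (auto simp: openin_pullback_topology)
 then obtain v where v: "!!U. U : \<U> ==> openin X (v U) & U = f -` v U \<inter> A" by metis
 have "K \<subseteq> \<Union> (v ` \<U>)"
 proof
  fix k assume k: "k : K"
  then obtain a where a: "a : A" "k = f a" using assms(2) by blast
  then obtain U where "U : \<U>" "a : U" using \<U> k by blast
  then show "k : \<Union> (v ` \<U>)" using v a by blast
 qed
 then obtain \<F> where "finite \<F>" "\<F> \<subseteq> v ` \<U>" "K \<subseteq> \<Union> \<F>"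
  using compactinD[OF assms(1), of "v ` \<U>"] v by auto
 then obtain \<G> where \<G>: "finite \<G>" "\<G> \<subseteq> \<U>" "K \<subseteq> \<Union> (v ` \<G>)" by (metis finite_subset_image)
 have "f -` K \<inter> A \<subseteq> \<Union> \<G>" using \<G> v by blast
 then show "EX \<F>. finite \<F> & \<F> \<subseteq> \<U> & f -` K \<inter> A \<subseteq> \<Union> \<F>" using \<G> by blast
qed

lemma compactin_finite_cover:
 assumes "compactin X K" "!!z. z : K ==> openin X (u z) & z : u z"
 obtains F where "finite F" "F \<subseteq> K" "K \<subseteq> (\<Union>z\<in>F. u z)"
proof -
 have "EX \<F>. finite \<F> & \<F> \<subseteq> u ` K & K \<subseteq> \<Union> \<F>"
  by (rule compactinD[OF assms(1)]) (use assms(2) in blast)+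
 then show thesis using that by (metis finite_subset_image)
qed

lemma compactin_sequence_cluster_point:
 assumes "compactin X K" "!!n::nat. s n : K"
 obtains z where "z : K" "!!U. openin X U ==> z : U ==> infinite {n. s n : U}"
proof (rule ccontr)
 note found = that
 assume "~ thesis"
 then have "ALL z:K. EX U. openin X U & z : U & finite {n. s n : U}" using found by blast
 then obtain u where u: "!!z. z : K ==> openin X (u z) & z : u z & finite {n. s n : u z}" by metis
 obtain F where F: "finite F" "F \<subseteq> K" "K \<subseteq> \<Union> (u ` F)"
  by (rule compactin_finite_cover[OF assms(1), of u]) (use u in auto)
 have "UNIV = (\<Union>z\<in>F. {n. s n : u z})" using F(3) assms(2) by blast
 then have "finite (UNIV :: nat set)" using F(1,2) u by (metis (no_types, lifting) finite_UN subsetD)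
 then show False by simp
qed

text \<open>Grothendieck's condition, for a pairing instead of a function on the group, so that its
  two sides can be exchanged.\<close>

definition iterated_limits_agree :: "'x set => 'y set => ('x => 'y => complex) => bool" where
 "iterated_limits_agree A B c \<longleftrightarrow>
   (ALL x y \<alpha> \<beta> a b. range x \<subseteq> A --> range y \<subseteq> B -->
    (ALL i. (%j::nat. c (x i) (y j)) ----> \<alpha> i) --> \<alpha> ----> a -->
    (ALL j. (%i::nat. c (x i) (y j)) ----> \<beta> j) --> \<beta> ----> b --> a = b)"

lemma iterated_limits_agreeD:
 assumes "iterated_limits_agree A B c" "range x \<subseteq> A" "range y \<subseteq> B"
  "!!i::nat. (%j::nat. c (x i) (y j)) ----> \<alpha> i" "\<alpha> ----> a"
  "!!j. (%i. c (x i) (y j)) ----> \<beta> j" "\<beta> ----> b"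
 shows "a = b"
 using assms unfolding iterated_limits_agree_def by blast

lemma iterated_limits_agree_swap:
 "iterated_limits_agree A B c ==> iterated_limits_agree B A (%y x. c x y)"
 unfolding iterated_limits_agree_def[of B A]
 by (intro allI impI, rule sym, rule iterated_limits_agreeD[of A B c]) auto

section \<open>Bounded continuous functions on a group and their dual space\<close>

locale top_grp =
 fixes G :: "'a monoid" (structure) and T :: "'a topology"
 assumes tg: "topological_group G T"
begin

sublocale group G using tg by (simp add: topological_group_def)

lemma topspace_T [simp]: "topspace T = carrier G" using tg by (simp add: topological_group_def)

lemma Hausdorff_T: "Hausdorff_space T" using tg by (simp add: topological_group_def)

lemma continuous_map_mult [continuous_intros]:
 "continuous_map X T f ==> continuous_map X T g ==> continuous_map X T (%x. f x \<otimes> g x)"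
proof -
 assume fg: "continuous_map X T f" "continuous_map X T g"
 have m: "continuous_map (prod_topology T T) T (%(x, y). x \<otimes> y)" using tg by (simp add: topological_group_def)
 have "continuous_map X (prod_topology T T) (%x. (f x, g x))" using fg by (simp add: continuous_map_pairedI)
 from continuous_map_compose[OF this m] show ?thesis by (simp add: o_def)
qed

lemma continuous_map_inv [continuous_intros]:
 "continuous_map X T f ==> continuous_map X T (%x. inv (f x))"
proof -
 assume f: "continuous_map X T f"
 have m: "continuous_map T T (%x. inv x)" using tg by (simp add: topological_group_def)
 from continuous_map_compose[OF f m] show ?thesis by (simp add: o_def)
qed

lemma continuous_map_lmult: "x : carrier G ==> continuous_map T T (%y. x \<otimes> y)"
 by (intro continuous_map_mult) auto

lemma continuous_map_rmult: "x : carrier G ==> continuous_map T T (%y. y \<otimes> x)"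
 by (intro continuous_map_mult) auto

abbreviation (input) restrict_G (binder "FN " 10) where "restrict_G f \<equiv> restrict f (carrier G)"
abbreviation (input) "avoid \<phi> d C p q \<equiv> \<phi> (p \<otimes> d \<otimes> inv q) ~: \<phi> ` C & \<phi> (inv p \<otimes> d \<otimes> q) ~: \<phi> ` C"
abbreviation (input) "avoid2 \<phi> d d' C p q \<equiv>
 \<phi> (p \<otimes> d \<otimes> d' \<otimes> inv q) ~: \<phi> ` C & \<phi> (inv p \<otimes> d \<otimes> d' \<otimes> q) ~: \<phi> ` C"
abbreviation (input) "avoids \<phi> D C p q \<equiv> ALL d:D. avoid \<phi> d C p q"
abbreviation (input) "avoids2 \<phi> D C p q \<equiv> ALL d:D. ALL d':D. avoid2 \<phi> d d' C p q"

abbreviation "CBG \<equiv> CB G T"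
abbreviation "nrm \<equiv> uniform_norm G"

lemma CB_bound:
 assumes "f : CBG" obtains B where "0 < B" "!!x. x : carrier G ==> cmod (f x) <= B"
 using assms unfolding CB_def bounded_pos by auto

lemma cmod_le_uniform_norm: "f : CBG ==> x : carrier G ==> cmod (f x) <= nrm f"
 unfolding uniform_norm_def
 by (rule cSUP_upper, assumption) (meson CB_bound bdd_aboveI2)

lemma uniform_norm_le: "(!!x. x : carrier G ==> cmod (f x) <= c) ==> nrm f <= c"
 unfolding uniform_norm_def by (rule cSUP_least) auto

lemma uniform_norm_nonneg: "f : CBG ==> 0 <= nrm f"
 using cmod_le_uniform_norm[of f \<one>] by (meson norm_ge_zero one_closed order_trans)

lemma CB_image2:
 assumes f: "f : CBG" and g: "g : CBG" and K: "closed K" "!!x. x : carrier G ==> (f x, g x) : K"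
  and cont: "continuous_on K (\<Phi> :: complex \<times> complex => complex)"
 shows "(FN x. \<Phi> (f x, g x)) : CBG"
proof -
 obtain B1 where B1: "!!x. x : carrier G ==> cmod (f x) <= B1" using CB_bound[OF f] by blast
 obtain B2 where B2: "!!x. x : carrier G ==> cmod (g x) <= B2" using CB_bound[OF g] by blast
 define L where "L = K \<inter> (cball 0 B1 \<times> cball 0 B2)"
 have "compact L" using K unfolding L_def by (intro closed_Int_compact compact_Times) auto
 moreover have cL: "continuous_on L \<Phi>" using cont by (rule continuous_on_subset) (auto simp: L_def)
 ultimately have "bounded (\<Phi> ` L)" by (intro compact_imp_bounded compact_continuous_image)
 moreover have fgL: "(f x, g x) : L" if "x : carrier G" for x using that K B1 B2 by (auto simp: L_def)
 ultimately have bd: "bounded ((FN x. \<Phi> (f x, g x)) ` carrier G)"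
  by (auto intro: bounded_subset)
 have "continuous_map T euclidean f" "continuous_map T euclidean g" using f g by (auto simp: CB_def)
 then have "continuous_map T (prod_topology euclidean euclidean) (%x. (f x, g x))"
  by (rule continuous_map_pairedI)
 then have "continuous_map T (subtopology euclidean L) (%x. (f x, g x))"
  using fgL by (auto simp: continuous_map_in_subtopology euclidean_product_topology)
 then have "continuous_map T euclidean (\<Phi> \<circ> (%x. (f x, g x)))"
  by (rule continuous_map_compose) (use cL in simp)
 then have "continuous_map T euclidean (FN x. \<Phi> (f x, g x))"
  by (rule continuous_map_eq) auto
 then show ?thesis using bd by (simp add: CB_def)
qed

lemma CB_add: "f : CBG ==> g : CBG ==> (FN x. f x + g x) : CBG"
 using CB_image2[of f g UNIV "%(a,b). a + b"] by (simp add: case_prod_unfold continuous_intros)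

lemma CB_mult: "f : CBG ==> g : CBG ==> (FN x. f x * g x) : CBG"
 using CB_image2[of f g UNIV "%(a,b). a * b"] by (simp add: case_prod_unfold continuous_intros)

lemma CB_scale: "f : CBG ==> (FN x. c * f x) : CBG"
 using CB_image2[of f f UNIV "%(a,b). c * a"] by (simp add: case_prod_unfold continuous_intros)

lemma CB_const: "(FN x. c) : CBG"
proof -
 have "continuous_map T euclidean (FN x. c)"
  by (rule continuous_map_eq[of _ _ "%_. c"]) auto
 then show ?thesis by (auto simp: CB_def bounded_iff)
qed

lemma CB_sum: "finite A ==> (!!n. n : A ==> g n : CBG) ==> (FN x. \<Sum>n\<in>A. c n * g n x) : CBG"
proof (induction A rule: finite_induct)
 case (insert a A)
 have "(FN x. (FN x. c a * g a x) x + (FN x. \<Sum>n\<in>A. c n * g n x) x) : CBG"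
  using insert by (intro CB_add CB_scale) auto
 also have "(FN x. (FN x. c a * g a x) x + (FN x. \<Sum>n\<in>A. c n * g n x) x)
  = (FN x. \<Sum>n\<in>insert a A. c n * g n x)"
  using insert by (intro restrict_ext) simp
 finally show ?case .
qed (simp add: CB_const)

lemma translate_CB:
 assumes "f : CBG" "x : carrier G" shows "translate G x f : CBG"
proof -
 have "continuous_map T euclidean (f \<circ> (%y. x \<otimes> y))"
  using assms by (intro continuous_map_compose[OF continuous_map_lmult]) (auto simp: CB_def)
 then have "continuous_map T euclidean (translate G x f)"
  by (rule continuous_map_eq) (auto simp: translate_def)
 moreover have "bounded (translate G x f ` carrier G)"
  by (rule bounded_subset[of "f ` carrier G"]) (use assms in \<open>auto simp: CB_def translate_def\<close>)
 ultimately show ?thesis by (simp add: CB_def translate_def)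
qed

abbreviation "D \<equiv> CB_dual G T"

lemma dual_add: "\<phi> : D ==> f : CBG ==> g : CBG ==> \<phi> (FN x. f x + g x) = \<phi> f + \<phi> g"
 by (simp add: CB_dual_def)

lemma dual_scale: "\<phi> : D ==> f : CBG ==> \<phi> (FN x. c * f x) = c * \<phi> f"
 by (simp add: CB_dual_def)

lemma dual_bound:
 assumes "\<phi> : D" obtains C where "0 < C" "!!f. f : CBG ==> cmod (\<phi> f) <= C * nrm f"
proof -
 obtain C where C: "!!f. f : CBG ==> cmod (\<phi> f) <= C * nrm f"
  using assms unfolding CB_dual_def by blast
 have "cmod (\<phi> f) <= (\<bar>C\<bar> + 1) * nrm f" if "f : CBG" for f
  by (rule order_trans[OF C[OF that] mult_right_mono]) (use uniform_norm_nonneg[OF that] in auto)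
 then show thesis by (intro that[of "\<bar>C\<bar> + 1"]) auto
qed

lemma dual_sum: "finite A ==> \<phi> : D ==> (!!n. n : A ==> g n : CBG) ==>
  \<phi> (FN x. \<Sum>n\<in>A. c n * g n x) = (\<Sum>n\<in>A. c n * \<phi> (g n))"
proof (induction A rule: finite_induct)
 case empty
 have "\<phi> (FN x. 0 * (FN x. 0) x) = 0" 
  using dual_scale[OF empty(1) CB_const[of 0], of 0] by (simp only: mult_zero_left)
 moreover have "(FN x. 0 * (FN x. (0::complex)) x) = (FN x. 0)" by (intro restrict_ext) simp
 ultimately show ?case by (simp only: sum.empty)
next
 case (insert a A)
 have "(FN x. \<Sum>n\<in>insert a A. c n * g n x) =
   (FN x. (FN x. c a * g a x) x + (FN x. \<Sum>n\<in>A. c n * g n x) x)"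
  using insert by (intro restrict_ext) simp
 then have "\<phi> (FN x. \<Sum>n\<in>insert a A. c n * g n x) = \<phi> (FN x.
   (FN x. c a * g a x) x + (FN x. \<Sum>n\<in>A. c n * g n x) x)" by (simp only:)
 also have "\<dots> = \<phi> (FN x. c a * g a x) + \<phi> (FN x. \<Sum>n\<in>A. c n * g n x)"
  by (intro dual_add CB_scale CB_sum) (use insert in blast)+
 also have "\<phi> (FN x. c a * g a x) = c a * \<phi> (g a)" using insert by (intro dual_scale) auto
 also have "\<phi> (FN x. \<Sum>n\<in>A. c n * g n x) = (\<Sum>n\<in>A. c n * \<phi> (g n))" using insert by blast
 finally show ?case using insert by simp
qed

lemma eval_dual: "y : carrier G ==> (\<lambda>f\<in>CBG. f y) : D"
 unfolding CB_dual_def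
 using cmod_le_uniform_norm by (auto simp: CB_add CB_scale intro!: exI[of _ 1])

text \<open>The canonical map into the bidual, whose elements are viewed as functions on the dual.
  The weak topology is pulled back along it, so weak closures can be studied in a product of
  planes.\<close>

definition J where "J f = (\<lambda>\<phi>\<in>D. \<phi> f)"
abbreviation "PD \<equiv> product_topology (%_. euclidean :: complex topology) D"

lemma weak_def: "CB_weak_topology G T = pullback_topology CBG J PD"
 by (simp add: CB_weak_topology_def J_def[abs_def])

lemma topspace_weak: "topspace (CB_weak_topology G T) = CBG"
 by (auto simp: weak_def topspace_pullback_topology J_def)

lemma continuous_map_J: "continuous_map (CB_weak_topology G T) PD J"
 using continuous_map_pullback[OF continuous_map_id, of CBG J PD] by (simp add: weak_def)

lemma openin_weak_dual:
 assumes "\<phi> : D" "open U" shows "openin (CB_weak_topology G T) {f : CBG. \<phi> f : U}"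
proof -
 have "continuous_map (CB_weak_topology G T) euclidean ((%h. h \<phi>) \<circ> J)"
  by (rule continuous_map_compose[OF continuous_map_J continuous_map_product_projection[OF assms(1)]])
 then have "openin (CB_weak_topology G T) {f : topspace (CB_weak_topology G T). ((%h. h \<phi>) \<circ> J) f : U}"
  by (rule openin_continuous_map_preimage) (use assms(2) in simp)
 then show ?thesis using assms(1) by (simp add: topspace_weak J_def)
qed

text \<open>A norm bounded set has compact closure in the product of planes by Tychonoff's theorem.
  It is relatively weakly compact once this closure contains nothing but images of
  functions.\<close>

lemma weakly_compact_closure:
 assumes S: "S \<subseteq> CBG" and B: "!!f. f : S ==> nrm f <= B"
  and cl: "PD closure_of (J ` S) \<subseteq> J ` CBG"
 shows "compactin (CB_weak_topology G T) (CB_weak_topology G T closure_of S)"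
proof -
 have "EX C>0. ALL f:CBG. cmod (\<phi> f) <= C * nrm f" if "\<phi> : D" for \<phi>
  by (rule dual_bound[OF that]) blast
 then obtain C where C: "!!\<phi>. \<phi> : D ==> 0 < C \<phi> & (ALL f:CBG. cmod (\<phi> f) <= C \<phi> * nrm f)"
  by metis
 define Z where "Z = PiE D (%\<phi>. cball (0::complex) (C \<phi> * B))"
 have Z: "compactin PD Z" unfolding Z_def by (simp add: compactin_PiE)
 have "J f : Z" if "f : S" for f
 proof -
  have "cmod (\<phi> f) <= C \<phi> * B" if p: "\<phi> : D" for \<phi>
  proof -
   have "cmod (\<phi> f) <= C \<phi> * nrm f" using C[OF p] \<open>f : S\<close> S by blast
   also have "\<dots> <= C \<phi> * B" using B[OF \<open>f : S\<close>] C[OF p] by (intro mult_left_mono) auto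
   finally show ?thesis .
  qed
  then show ?thesis by (auto simp: Z_def J_def)
 qed
 then have "J ` S \<subseteq> Z" by blast
 moreover have "closedin PD Z"
  using Z by (intro compactin_imp_closedin) (simp_all add: Hausdorff_space_product_topology)
 ultimately have "PD closure_of (J ` S) \<subseteq> Z" by (simp add: closure_of_minimal)
 then have K: "compactin PD (PD closure_of (J ` S))"
  using Z closed_compactin closedin_closure_of by blast
 have "compactin (CB_weak_topology G T) (J -` (PD closure_of (J ` S)) \<inter> CBG)"
  unfolding weak_def by (rule compactin_pullback_topology[OF K cl])
 moreover have "CB_weak_topology G T closure_of S \<subseteq> J -` (PD closure_of (J ` S)) \<inter> CBG"
  using continuous_map_image_closure_subset[OF continuous_map_J, of S] closure_of_subset_topspace topspace_weak
  by fastforce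
 ultimately show ?thesis using closed_compactin closedin_closure_of by blast
qed

text \<open>Alaoglu's theorem for a sequence in the dual ball. A cluster point in the product of
  discs is linear, because some \<open>\<psi> n\<close> approximates it on finitely many functions
  at once; where the sequence converges, the cluster point takes the limit as its value.\<close>

lemma cluster_functional:
 fixes \<psi> :: "nat => ('a => complex) => complex"
 assumes \<psi>: "!!j. \<psi> j : D" "!!j f. f : CBG ==> cmod (\<psi> j f) <= nrm f"
 obtains \<phi> where "\<phi> : D" "!!f a. f : CBG ==> (%j. \<psi> j f) ----> a ==> \<phi> f = a"
proof -
 define X where "X = product_topology (%_. euclidean :: complex topology) CBG"
 define Z where "Z = PiE CBG (%f. cball (0::complex) (nrm f))"
 define s where "s = \<psi>"
 have Z: "compactin X Z" unfolding Z_def X_def by (simp add: compactin_PiE)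
 have "s j : Z" for j using \<psi>(2) \<psi>(1)[of j] by (auto simp: s_def Z_def CB_dual_def PiE_iff)
 then obtain \<phi> where \<phi>: "\<phi> : Z" "!!U. openin X U ==> \<phi> : U ==> infinite {n. s n : U}"
  using compactin_sequence_cluster_point[OF Z] by blast
 have ap: "infinite {n. ALL f:F. cmod (\<psi> n f - \<phi> f) < e}" if F: "finite F" "F \<subseteq> CBG" "0 < e" for F e
 proof -
  define U where "U = (%f. if f : F then ball (\<phi> f) e else UNIV)"
  have "finite {i : CBG. U i ~= UNIV}" using F(1) by (rule finite_subset[rotated]) (auto simp: U_def)
  then have "openin X (PiE CBG U)" unfolding X_def
   by (subst openin_PiE_gen) (auto simp: U_def)
  moreover have "\<phi> : PiE CBG U" using \<phi>(1) F by (auto simp: Z_def U_def PiE_iff)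
  ultimately have "infinite {n. s n : PiE CBG U}" using \<phi>(2) by blast
  moreover have "{n. s n : PiE CBG U} \<subseteq> {n. ALL f:F. cmod (\<psi> n f - \<phi> f) < e}"
   using F by (force simp: s_def U_def PiE_iff dist_norm norm_minus_commute)
  ultimately show ?thesis using finite_subset by blast
 qed
 then have ap1: "EX n. ALL f:F. cmod (\<psi> n f - \<phi> f) < e" if "finite F" "F \<subseteq> CBG" "0 < e" for F e
  using that by (metis (mono_tags, lifting) Collect_empty_eq finite.emptyI)
 have small: "z = 0" if "!!e. 0 < e ==> cmod z <= e" for z :: complex
  using that by (meson dense_ge norm_le_zero_iff not_less)
 show thesis
 proof
  show "\<phi> : D"
   unfolding CB_dual_def
  proof (intro CollectI conjI ballI allI)
   show "\<phi> : extensional CBG" using \<phi>(1) by (auto simp: Z_def PiE_iff)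
   show "EX C. ALL f:CBG. cmod (\<phi> f) <= C * nrm f" using \<phi>(1) by (intro exI[of _ 1]) (auto simp: Z_def PiE_iff)
   fix f assume f: "f : CBG"
   show "\<phi> (FN x. f x + g x) = \<phi> f + \<phi> g" if g: "g : CBG" for g
   proof -
    have "cmod (\<phi> (FN x. f x + g x) - (\<phi> f + \<phi> g)) <= e" if "0 < e" for e
    proof -
     let ?h = "FN x. f x + g x"
     have "EX n. ALL h:{f, g, ?h}. cmod (\<psi> n h - \<phi> h) < e/3"
      by (rule ap1) (use f g CB_add[OF f g] that in auto)
     then obtain n where n: "ALL h:{f, g, ?h}. cmod (\<psi> n h - \<phi> h) < e/3" by blast
     then have "cmod (\<psi> n f - \<phi> f) < e/3" "cmod (\<psi> n g - \<phi> g) < e/3"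
      "cmod (\<psi> n f + \<psi> n g - \<phi> ?h) < e/3" using dual_add[OF \<psi>(1) f g] by (simp_all del: restrict_apply)
     moreover have "cmod (\<phi> ?h - (\<phi> f + \<phi> g)) = cmod ((\<psi> n f - \<phi> f) + (\<psi> n g - \<phi> g) - (\<psi> n f + \<psi> n g - \<phi> ?h))"
      by (rule arg_cong[of _ _ cmod]) (simp add: algebra_simps)
     ultimately show ?thesis
      using norm_triangle_ineq4[of "(\<psi> n f - \<phi> f) + (\<psi> n g - \<phi> g)" "\<psi> n f + \<psi> n g - \<phi> ?h"]
       norm_triangle_ineq[of "\<psi> n f - \<phi> f" "\<psi> n g - \<phi> g"] by linarith
    qed
    then show ?thesis using small by force
   qed
   show "\<phi> (FN x. c * f x) = c * \<phi> f" for c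
   proof -
    have "cmod (\<phi> (FN x. c * f x) - c * \<phi> f) <= e" if "0 < e" for e
    proof -
     let ?h = "FN x. c * f x"
     define d where "d = e / (2 * (1 + cmod c))"
     have d: "0 < d" "d <= e/2" "cmod c * d <= e/2" using that
      by (auto simp: d_def field_simps add_pos_nonneg)
     have "EX n. ALL h:{f, ?h}. cmod (\<psi> n h - \<phi> h) < d"
      by (rule ap1) (use f CB_scale[OF f] d in auto)
     then obtain n where n: "ALL h:{f, ?h}. cmod (\<psi> n h - \<phi> h) < d" by blast
     then have "cmod (\<psi> n f - \<phi> f) < d" and h: "cmod (c * \<psi> n f - \<phi> ?h) < d"
      using dual_scale[OF \<psi>(1) f] by (simp_all del: restrict_apply)
     then have "cmod (c * (\<psi> n f - \<phi> f)) <= cmod c * d" by (simp add: norm_mult mult_left_mono)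
     moreover have "cmod (\<phi> ?h - c * \<phi> f) = cmod (c * (\<psi> n f - \<phi> f) - (c * \<psi> n f - \<phi> ?h))"
      by (rule arg_cong[of _ _ cmod]) (simp add: algebra_simps)
     ultimately show ?thesis using h d norm_triangle_ineq4[of "c * (\<psi> n f - \<phi> f)" "c * \<psi> n f - \<phi> ?h"]
      by linarith
    qed
    then show ?thesis using small by force
   qed
  qed
  fix f a assume f: "f : CBG" and a: "(%j. \<psi> j f) ----> a"
  have "cmod (\<phi> f - a) <= e" if "0 < e" for e
  proof -
   obtain N where N: "!!n. n >= N ==> cmod (\<psi> n f - a) < e/2"
    using a \<open>0 < e\<close> unfolding LIMSEQ_iff by (meson half_gt_zero)
   have "infinite {n. ALL g:{f}. cmod (\<psi> n g - \<phi> g) < e/2}" using ap[of "{f}" "e/2"] f that by auto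
   then obtain n where "n >= N" "cmod (\<psi> n f - \<phi> f) < e/2"
    unfolding infinite_nat_iff_unbounded_le by auto
   then show ?thesis using N[of n] norm_triangle_ineq4[of "\<psi> n f - a" "\<psi> n f - \<phi> f"] by simp
  qed
  then show "\<phi> f = a" using small by force
 qed
qed

text \<open>The easy half of Grothendieck's criterion: a weak cluster point \<open>F\<close> of the
  translates is paired with a cluster point \<phi> of the functionals, and \<open>\<phi> F\<close>
  is evaluated in both orders. Functionals instead of points are what \<open>WAP_introverted\<close>
  requires.\<close>

lemma WAP_iterated_limits_functionals:
 assumes f_WAP: "f : WAP G T" and x: "range x \<subseteq> carrier G"
  and \<psi>: "!!j. \<psi> j : D" "!!j f. f : CBG ==> cmod (\<psi> j f) <= nrm f"
  and al: "!!i::nat. (%j::nat. \<psi> j (translate G (x i) f)) ----> \<alpha> i" "\<alpha> ----> a"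
  and be: "!!j. (%i. \<psi> j (translate G (x i) f)) ----> \<beta> j" "\<beta> ----> b"
 shows "a = b"
proof -
 let ?W = "CB_weak_topology G T"
 let ?S = "(%x. translate G x f) ` carrier G"
 have f: "f : CBG" and K: "compactin ?W (?W closure_of ?S)" using f_WAP by (auto simp: WAP_def)
 have xc: "x i : carrier G" for i using x by auto
 have "?S \<subseteq> ?W closure_of ?S"
  by (rule closure_of_subset) (use f translate_CB topspace_weak in auto)
 then have "translate G (x i) f : ?W closure_of ?S" for i using xc by blast
 then obtain F where F: "F : ?W closure_of ?S" "!!U. openin ?W U ==> F : U ==> infinite {i. translate G (x i) f : U}"
  using compactin_sequence_cluster_point[OF K, of "%i. translate G (x i) f"] by metis
 have FC: "F : CBG" using F(1) closure_of_subset_topspace topspace_weak by fastforce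
 have cl: "\<phi> F = c" if p: "\<phi> : D" and lim: "(%i. \<phi> (translate G (x i) f)) ----> c" for \<phi> c
 proof (rule ccontr)
  assume ne: "\<phi> F ~= c"
  define e where "e = dist (\<phi> F) c / 2"
  have e: "0 < e" using ne by (simp add: e_def)
  obtain N where N: "!!n. n >= N ==> dist (\<phi> (translate G (x n) f)) c < e"
   using lim e unfolding lim_sequentially by blast
  have "infinite {i. translate G (x i) f : {g : CBG. \<phi> g : ball (\<phi> F) e}}"
   by (rule F(2)[OF openin_weak_dual[OF p]]) (use FC e in auto)
  then obtain n where "n >= N" "dist (\<phi> F) (\<phi> (translate G (x n) f)) < e"
   unfolding infinite_nat_iff_unbounded_le by auto
  then show False using N[of n] dist_triangle[of "\<phi> F" c "\<phi> (translate G (x n) f)"] e_def by simp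
 qed
 have F\<psi>: "\<psi> j F = \<beta> j" for j by (rule cl[OF \<psi>(1) be(1)])
 obtain \<phi> where \<phi>: "\<phi> : D" "!!f a. f : CBG ==> (%j. \<psi> j f) ----> a ==> \<phi> f = a"
  by (rule cluster_functional[of \<psi>]) (use \<psi> in auto)
 have "\<phi> (translate G (x i) f) = \<alpha> i" for i by (rule \<phi>(2)[OF translate_CB[OF f xc] al(1)])
 then have "\<phi> F = a" using cl[OF \<phi>(1)] al(2) by simp
 moreover have "\<phi> F = b" by (rule \<phi>(2)[OF FC]) (use be(2) F\<psi> in simp)
 ultimately show "a = b" by simp
qed

end

section \<open>Grothendieck's double limit criterion\<close>

lemma continuous_map_to_metric_iff:
 fixes f :: "'a => 'b::metric_space"
 shows "continuous_map X euclidean f \<longleftrightarrow>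
  (ALL x:topspace X. ALL e>0. EX U. openin X U & x : U & (ALL y:U. dist (f y) (f x) < e))"
 using Met_TC.continuous_map_to_metric[of X f] by (simp add: dist_commute mtopology_is_euclidean)

lemma LIMSEQ_if_eventually_close:
 fixes f :: "nat => 'a::real_normed_vector"
 assumes "!!n. n >= N ==> norm (f n - l) < 1 / (real n + 1)"
 shows "f ----> l"
proof -
 have "(%n. f n - l) ----> 0"
 proof (rule Lim_null_comparison)
  show "\<forall>\<^sub>F n in sequentially. norm (f n - l) <= 1 / (real n + 1)"
   using assms less_imp_le by (auto simp: eventually_sequentially)
  show "(%n. 1 / (real n + 1)) ----> 0"
   using LIMSEQ_inverse_real_of_nat by (simp add: inverse_eq_divide add.commute)
 qed
 then show ?thesis by (simp add: LIM_zero_iff)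
qed

text \<open>If \<open>F\<close> jumps at \<open>y0\<close>, elements \<open>x n\<close> and
  \<open>y n\<close> are chosen in turn: \<open>x n\<close> fits \<open>F\<close> at
  \<open>y0\<close> and at the earlier \<open>y j\<close>, while \<open>y n\<close> looks like
  \<open>y0\<close> to the earlier \<open>x i\<close> but lies on the far side of the jump. One
  iterated limit is then \<open>F y0\<close>, the other a limit of the values
  \<open>F (y n)\<close>.\<close>

lemma continuous_map_pointwise_limit:
 fixes c :: "'x => 'y => complex"
 assumes dl: "iterated_limits_agree A (topspace Y) c"
  and cont: "!!x. x : A ==> continuous_map Y euclidean (c x)"
  and bd: "!!y. y : topspace Y ==> cmod (F y) <= B"
  and ap: "!!S e. finite S ==> S \<subseteq> topspace Y ==> 0 < e ==> EX x:A. ALL y:S. cmod (c x y - F y) < e"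
 shows "continuous_map Y euclidean F"
 unfolding continuous_map_to_metric_iff
proof (rule ccontr)
 assume "~ (ALL x:topspace Y. ALL e>0. EX U. openin Y U & x : U & (ALL y:U. dist (F y) (F x) < e))"
 then obtain y0 e where y0: "y0 : topspace Y" and e: "0 < e"
  and no: "!!U. openin Y U ==> y0 : U ==> EX y:U. e <= dist (F y) (F y0)" by (force simp: not_less)
 define Q where "Q = (%n h p. (ALL j<n. cmod (c (fst p) (snd (h j)) - F (snd (h j))) < 1 / (real n + 1)) &
   cmod (c (fst p) y0 - F y0) < 1 / (real n + 1) &
   (ALL i<n. cmod (c (fst (h i)) (snd p) - c (fst (h i)) y0) < 1 / (real n + 1)) &
   e <= dist (F (snd p)) (F y0))"
 have "EX p. ALL n. p n : A \<times> topspace Y & Q n p (p n)"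
 proof (rule history_choice)
  show "Q n h' v" if "!!i. i < n ==> h i = h' i" "Q n h v" for n h h' v
   using that unfolding Q_def by auto
  fix n :: nat and h assume h: "!!i. i < n ==> h i : A \<times> topspace Y"
  define r where "r = 1 / (real n + 1)"
  have r: "0 < r" by (simp add: r_def)
  obtain x where x: "x : A" "!!y. y : insert y0 ((%j. snd (h j)) ` {..<n}) ==> cmod (c x y - F y) < r"
   using ap[of "insert y0 ((%j. snd (h j)) ` {..<n})" r] h y0 r by fastforce
  have "EX U. openin Y U & y0 : U & (ALL y:U. dist (c (fst (h i)) y) (c (fst (h i)) y0) < r)" if "i < n" for i
   using cont[of "fst (h i)"] h[OF that] y0 r unfolding continuous_map_to_metric_iff by (metis mem_Times_iff)
  then obtain U where U: "!!i. i < n ==> openin Y (U i) & y0 : U i & (ALL y:U i. dist (c (fst (h i)) y) (c (fst (h i)) y0) < r)"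
   by metis
  define V where "V = (if n = 0 then topspace Y else \<Inter>(U ` {..<n}))"
  have "openin Y V" using U by (auto simp: V_def intro!: openin_Inter)
  moreover have "y0 : V" using U y0 by (auto simp: V_def)
  ultimately obtain y where y: "y : V" "e <= dist (F y) (F y0)" using no by blast
  have "y : topspace Y" using y \<open>openin Y V\<close> openin_subset by blast
  moreover have "Q n h (x, y)"
   unfolding Q_def r_def[symmetric] using x y U by (auto simp: V_def dist_norm split: if_splits)
  ultimately show "EX p:A \<times> topspace Y. Q n h p" using x by blast
 qed
 then obtain p where p: "!!n. p n : A \<times> topspace Y" "!!n. Q n p (p n)" by blast
 define x where "x = fst \<circ> p"
 define y where "y = snd \<circ> p"
 have xy: "x n : A" "y n : topspace Y" for n using p(1)[of n] by (auto simp: x_def y_def)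
 \<comment> \<open>Only \<open>y\<close> is thinned out; the remaining limits exist along the full
   sequences by the choice of \<open>Q\<close>.\<close>
 have "bounded (range (F \<circ> y))" using bd xy by (auto simp: bounded_iff)
 then obtain b s where s: "strict_mono s" "((F \<circ> y) \<circ> s) ----> b" using bounded_imp_convergent_subsequence by blast
 have q: "cmod (c (x n) (y j) - F (y j)) < 1 / (real n + 1)" "cmod (c (x j) (y n) - c (x j) y0) < 1 / (real n + 1)" if "j < n" for n j
  using p(2)[of n] that by (auto simp: Q_def x_def y_def)
 have q0: "cmod (c (x n) y0 - F y0) < 1 / (real n + 1)" "e <= dist (F (y n)) (F y0)" for n
  using p(2)[of n] by (auto simp: Q_def x_def y_def)
 have "F y0 = b"
 proof (rule iterated_limits_agreeD[OF dl, of x "y \<circ> s"])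
  show "(%j. c (x i) ((y \<circ> s) j)) ----> c (x i) y0" for i
   using LIMSEQ_subseq_LIMSEQ[OF LIMSEQ_if_eventually_close[of "Suc i" "%n. c (x i) (y n)"] s(1)] q(2)
   by (simp add: o_def)
  show "(%i. c (x i) y0) ----> F y0" by (rule LIMSEQ_if_eventually_close) (rule q0)
  show "(%i. c (x i) ((y \<circ> s) j)) ----> F ((y \<circ> s) j)" for j
   by (rule LIMSEQ_if_eventually_close[of "Suc (s j)"]) (use q(1) in auto)
 qed (use xy s in \<open>auto simp: o_def\<close>)
 moreover have "e <= dist b (F y0)"
  by (rule Lim_bounded2[OF tendsto_dist[OF s(2) tendsto_const], of 0]) (use q0 in auto)
 ultimately show False using e by simp
qed

context top_grp
begin

abbreviation "WAPG \<equiv> WAP G T"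
abbreviation "iterated f \<equiv> iterated_limits_agree (carrier G) (carrier G) (%x y. f (x \<otimes> y))"

lemma WAP_imp_iterated: assumes "f : WAPG" shows "iterated f"
 unfolding iterated_limits_agree_def
proof (intro allI impI)
 fix x y :: "nat => 'a" and \<alpha> \<beta> a b
 assume x: "range x \<subseteq> carrier G" and y: "range y \<subseteq> carrier G"
  and al: "ALL i. (%j. f (x i \<otimes> y j)) ----> \<alpha> i" "\<alpha> ----> a"
  and be: "ALL j. (%i. f (x i \<otimes> y j)) ----> \<beta> j" "\<beta> ----> b"
 have f: "f : CBG" using assms by (simp add: WAP_def)
 have eq: "(\<lambda>f\<in>CBG. f (y j)) (translate G (x i) f) = f (x i \<otimes> y j)" for i j
  using translate_CB[OF f] x y by (simp add: translate_def range_subsetD)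
 show "a = b"
 proof (rule WAP_iterated_limits_functionals[OF assms x])
  fix j show "(\<lambda>f\<in>CBG. f (y j)) : D" using y by (intro eval_dual) auto
  show "cmod ((\<lambda>f\<in>CBG. f (y j)) f) <= nrm f" if "f : CBG" for f
   using that y cmod_le_uniform_norm by (simp add: range_subsetD)
 qed (use al be eq in auto)
qed

text \<open>The hard half of Grothendieck's criterion. A point \<xi> of the closure in the bidual
  restricts to a continuous function \<open>F\<close>, and a functional \<phi> with
  \<open>\<xi> \<phi> ~= \<phi> F\<close> has to be excluded. By Ptak's lemma either a convex
  combination of translates is uniformly close to \<open>F\<close>, so that \<phi> cannot separate
  the two, or there are points at which translates of arbitrarily late index stay away from
  \<open>F\<close>, and these violate the iterated limit condition.\<close>

lemma iterated_imp_WAP: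
 assumes f: "f : CBG" and dl: "iterated f"
 shows "f : WAPG"
proof -
 let ?S = "(%x. translate G x f) ` carrier G"
 obtain B where B: "0 < B" "!!x. x : carrier G ==> cmod (f x) <= B" using CB_bound[OF f] by blast
 have "compactin (CB_weak_topology G T) (CB_weak_topology G T closure_of ?S)"
 proof (rule weakly_compact_closure)
  show "?S \<subseteq> CBG" using translate_CB[OF f] by blast
  show "nrm g <= B" if "g : ?S" for g
   using that B by (auto intro!: uniform_norm_le simp: translate_def)
  show "PD closure_of (J ` ?S) \<subseteq> J ` CBG"
  proof
   fix \<xi> assume \<xi>: "\<xi> : PD closure_of (J ` ?S)"
   define ev where "ev = (%y. \<lambda>g\<in>CBG. (g y :: complex))"
   define F where "F = (FN y. \<xi> (ev y))"
   have ev: "ev y : D" if "y : carrier G" for y unfolding ev_def by (rule eval_dual[OF that])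
   have ap: "EX x:carrier G. (ALL y:Y. cmod (f (x \<otimes> y) - F y) < e) & (ALL \<phi>:\<Phi>. cmod (\<phi> (translate G x f) - \<xi> \<phi>) < e)"
    if "finite Y" "Y \<subseteq> carrier G" "finite \<Phi>" "\<Phi> \<subseteq> D" "0 < e" for Y \<Phi> e
   proof -
    have "EX a:J ` ?S. ALL \<phi>:\<Phi> \<union> ev ` Y. cmod (a \<phi> - \<xi> \<phi>) < e"
     by (rule closure_of_product_approx[OF \<xi>]) (use that ev in auto)
    then obtain x where x: "x : carrier G" "!!\<phi>. \<phi> : \<Phi> \<union> ev ` Y ==> cmod (J (translate G x f) \<phi> - \<xi> \<phi>) < e" by blast
    have "cmod (f (x \<otimes> y) - F y) < e" if "y : Y" for y
     using x(2)[of "ev y"] that \<open>Y \<subseteq> carrier G\<close> ev translate_CB[OF f x(1)]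
     by (auto simp: J_def F_def ev_def translate_def subset_iff)
    moreover have "cmod (\<phi> (translate G x f) - \<xi> \<phi>) < e" if "\<phi> : \<Phi>" for \<phi>
     using x(2)[of \<phi>] that \<open>\<Phi> \<subseteq> D\<close> by (auto simp: J_def)
    ultimately show ?thesis using x(1) by blast
   qed
   have Fb: "cmod (F y) <= B + 1" if y: "y : carrier G" for y
   proof -
    obtain x where "x : carrier G" "cmod (f (x \<otimes> y) - F y) < 1" using ap[of "{y}" "{}" 1] y by auto
    then show ?thesis using B(2)[of "x \<otimes> y"] y norm_triangle_ineq4[of "f (x \<otimes> y)" "f (x \<otimes> y) - F y"] by simp
   qed
   have "continuous_map T euclidean F"
   proof (rule continuous_map_pointwise_limit)
    show "iterated_limits_agree (carrier G) (topspace T) (%x y. f (x \<otimes> y))" using dl by simp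
    show "continuous_map T euclidean (%y. f (x \<otimes> y))" if "x : carrier G" for x
     using continuous_map_compose[OF continuous_map_lmult[OF that], of euclidean f] f by (simp add: CB_def o_def)
    show "EX x:carrier G. ALL y:S. cmod (f (x \<otimes> y) - F y) < e" if "finite S" "S \<subseteq> topspace T" "0 < e" for S e
     using ap[of S "{}" e] that by auto
   qed (use Fb in auto)
   then have F: "F : CBG" using Fb by (auto simp: CB_def F_def bounded_iff)
   have "\<xi> \<phi> = \<phi> F" if \<phi>: "\<phi> : D" for \<phi>
   proof (rule ccontr)
    assume "\<xi> \<phi> ~= \<phi> F"
    define d where "d = cmod (\<xi> \<phi> - \<phi> F)"
    have d: "0 < d" using \<open>\<xi> \<phi> ~= \<phi> F\<close> by (simp add: d_def)
    obtain C where C: "0 < C" "!!g. g : CBG ==> cmod (\<phi> g) <= C * nrm g" using dual_bound[OF \<phi>] by blast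
    define M where "M = 2 * B + 1"
    have M: "0 < M" using B by (simp add: M_def)
    have fF: "cmod (f (x \<otimes> y) - F y) <= M" if "x : carrier G" "y : carrier G" for x y
     using B(2)[of "x \<otimes> y"] Fb[of y] that norm_triangle_ineq4[of "f (x \<otimes> y)" "F y"] by (simp add: M_def)
    \<comment> \<open>If at \<open>y\<close> the translates that are \<delta>-far from
      \<open>F\<close> have total weight below \<open>e\<close>, the average is off by at most
      \<open>\<delta> + M * e\<close>. The constants make \<phi> of such an error smaller than
      \<open>d / 2\<close>; the other half of \<open>d\<close> is spent on
      \<open>\<phi> (translate G (x n) f)\<close> approximating \<open>\<xi> \<phi>\<close>.\<close>
    define \<delta> where "\<delta> = d / (8 * C)"
    define e where "e = d / (8 * C * M)"
    have de: "0 < \<delta>" "0 < e" "C * (\<delta> + M * e) < d / 2" using d C M by (auto simp: \<delta>_def e_def field_simps)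
    \<comment> \<open>Along with \<open>x n\<close> a finite net \<open>Y n\<close> is carried that
      resolves \<open>F\<close> and the earlier translates up to \<open>1 / (n + 1)\<close>, and
      \<open>x n\<close> reproduces \<open>F\<close> on it. As the nets increase, the translates
      converge to \<open>F\<close> at every net point.\<close>
    define Q where "Q = (%n (h :: nat => 'a \<times> 'a set) p. cmod (\<phi> (translate G (fst p) f) - \<xi> \<phi>) < d / 2 &
      (ALL z:carrier G. EX y:snd p. (ALL i<n. cmod (f (fst (h i) \<otimes> z) - f (fst (h i) \<otimes> y)) < 1 / (real n + 1)) &
       cmod (F z - F y) < 1 / (real n + 1)) &
      (ALL i<n. snd (h i) \<subseteq> snd p) & (ALL y:snd p. cmod (f (fst p \<otimes> y) - F y) < 1 / (real n + 1)))"
    have "EX p. ALL n. p n : carrier G \<times> {Y. finite Y & Y \<subseteq> carrier G} & Q n p (p n)"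
    proof (rule history_choice)
     show "Q n h' v" if "!!i. i < n ==> h i = h' i" "Q n h v" for n h h' v
      using that unfolding Q_def by simp
     fix n :: nat and h assume h: "!!i. i < n ==> h i : carrier G \<times> {Y. finite Y & Y \<subseteq> carrier G}"
     define g where "g = (%i z. if i < n then f (fst (h i) \<otimes> z) else F z)"
     have gb: "cmod (g i z) <= B + 1" if "z : carrier G" for i z
      using B(2)[of "fst (h i) \<otimes> z"] h[of i] Fb that by (auto simp: g_def mem_Times_iff intro: order_trans)
     obtain Y where Y: "finite Y" "Y \<subseteq> carrier G" "!!z. z : carrier G ==> EX y:Y. ALL i<Suc n. cmod (g i z - g i y) < 1 / (real n + 1)"
      using finite_net_of_bounded_functions[of "Suc n" "carrier G" g "B + 1" "1 / (real n + 1)"] gb by auto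
     define Y' where "Y' = Y \<union> (\<Union>i<n. snd (h i))"
     have hi: "finite (snd (h i)) & snd (h i) \<subseteq> carrier G" if "i < n" for i
      using h[OF that] by (auto simp: mem_Times_iff)
     then have Y': "finite Y'" "Y' \<subseteq> carrier G" using Y(1,2) by (auto simp: Y'_def)
     obtain x where x: "x : carrier G" "ALL y:Y'. cmod (f (x \<otimes> y) - F y) < min (d/2) (1 / (real n + 1))"
       "cmod (\<phi> (translate G x f) - \<xi> \<phi>) < min (d/2) (1 / (real n + 1))"
      using ap[OF Y', of "{\<phi>}" "min (d/2) (1 / (real n + 1))"] \<phi> d by auto
     have net: "EX y:Y'. (ALL i<n. cmod (f (fst (h i) \<otimes> z) - f (fst (h i) \<otimes> y)) < 1 / (real n + 1)) &
       cmod (F z - F y) < 1 / (real n + 1)" if z: "z : carrier G" for z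
     proof -
      obtain y where y: "y : Y" "!!i. i < Suc n ==> cmod (g i z - g i y) < 1 / (real n + 1)" using Y(3)[OF z] by blast
      have "cmod (F z - F y) < 1 / (real n + 1)" using y(2)[of n] by (simp add: g_def)
      moreover have "cmod (f (fst (h i) \<otimes> z) - f (fst (h i) \<otimes> y)) < 1 / (real n + 1)" if "i < n" for i
       using y(2)[of i] that by (simp add: g_def)
      ultimately show ?thesis using y(1) by (auto simp: Y'_def)
     qed
     have "Q n h (x, Y')" unfolding Q_def using x net by (auto simp: Y'_def)
     then show "EX p:carrier G \<times> {Y. finite Y & Y \<subseteq> carrier G}. Q n h p" using x(1) Y' by blast
    qed
    then obtain p where p: "!!n. p n : carrier G \<times> {Y. finite Y & Y \<subseteq> carrier G}" "!!n. Q n p (p n)" by blast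
    define x where "x = (%n. fst (p n))"
    define Y where "Y = (%n. snd (p n))"
    have xc: "x n : carrier G" and Yc: "Y n \<subseteq> carrier G" for n using p(1)[of n] by (auto simp: x_def Y_def mem_Times_iff)
    have x\<phi>: "cmod (\<phi> (translate G (x n) f) - \<xi> \<phi>) < d / 2"
     and net: "!!z. z : carrier G ==> EX y:Y n. (ALL i<n. cmod (f (x i \<otimes> z) - f (x i \<otimes> y)) < 1 / (real n + 1)) & cmod (F z - F y) < 1 / (real n + 1)"
     and Ymono: "!!i. i < n ==> Y i \<subseteq> Y n"
     and close: "!!y. y : Y n ==> cmod (f (x n \<otimes> y) - F y) < 1 / (real n + 1)" for n
     using p(2)[of n] unfolding Q_def x_def Y_def by blast+
    define R where "R = (%n y. y : carrier G & \<delta> <= cmod (f (x n \<otimes> y) - F y))"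
    \<comment> \<open>A combination with only small bad weights would be uniformly close to
      \<open>F\<close>, whereas \<phi> is close to \<open>\<xi> \<phi>\<close> on each of its terms
      and hence on the combination.\<close>
    have noavg: "EX y. e <= (\<Sum>n\<in>{n\<in>A. R n y}. l n)" if A: "finite A" "!!n. 0 <= l n" "sum l A = 1" for A and l :: "nat => real"
    proof (rule ccontr)
     assume "~ ?thesis"
     then have small: "(\<Sum>n\<in>{n\<in>A. R n y}. l n) < e" for y by (auto simp: not_le)
     define g0 where "g0 = (FN y. \<Sum>n\<in>A. complex_of_real (l n) * translate G (x n) f y)"
     define g where "g = (FN y. g0 y + (FN y. -1 * F y) y)"
     have tC: "translate G (x n) f : CBG" for n by (rule translate_CB[OF f xc])
     have g0: "g0 : CBG" unfolding g0_def by (rule CB_sum[OF A(1) tC])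
     have g: "g : CBG" unfolding g_def by (rule CB_add[OF g0 CB_scale[OF F]])
     have gy: "cmod (g y) <= \<delta> + M * e" if y: "y : carrier G" for y
     proof -
      have "g y = (\<Sum>n\<in>A. complex_of_real (l n) * f (x n \<otimes> y)) - complex_of_real (sum l A) * F y"
       using y A(3) by (simp add: g_def g0_def translate_def)
      also have "\<dots> = (\<Sum>n\<in>A. complex_of_real (l n) * (f (x n \<otimes> y) - F y))"
       by (simp add: sum_subtractf right_diff_distrib sum_distrib_right)
      also have "cmod \<dots> <= (\<Sum>n\<in>A. l n * cmod (f (x n \<otimes> y) - F y))"
       by (rule order_trans[OF norm_sum]) (simp add: norm_mult A(2))
      also have "\<dots> <= (\<Sum>n\<in>A. l n * \<delta> + (if R n y then l n else 0) * M)"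
      proof (rule sum_mono)
       fix n
       show "l n * cmod (f (x n \<otimes> y) - F y) <= l n * \<delta> + (if R n y then l n else 0) * M"
       proof (cases "R n y")
        case True
        have "l n * cmod (f (x n \<otimes> y) - F y) <= l n * M" by (rule mult_left_mono[OF fF[OF xc y] A(2)])
        then show ?thesis using True A(2)[of n] de by (simp add: add_increasing)
       next
        case False
        then show ?thesis using y A(2)[of n] by (simp add: R_def mult_left_mono)
       qed
      qed
      also have "\<dots> = \<delta> + (\<Sum>n\<in>{n\<in>A. R n y}. l n) * M"
       using A(1,3) by (simp add: sum.distrib flip: sum_distrib_right) (simp add: sum.inter_filter)
      also have "\<dots> <= \<delta> + M * e" using small[of y] M by (simp add: mult.commute)
      finally show ?thesis .
     qed
     have "cmod (\<phi> g) <= C * nrm g" by (rule C(2)[OF g])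
     also have "\<dots> <= C * (\<delta> + M * e)" using C(1) by (intro mult_left_mono uniform_norm_le gy) auto
     finally have small\<phi>: "cmod (\<phi> g) < d / 2" using de(3) by linarith
     have "\<phi> g = \<phi> g0 + \<phi> (FN y. -1 * F y)" unfolding g_def by (rule dual_add[OF \<phi> g0 CB_scale[OF F]])
     also have "\<phi> (FN y. -1 * F y) = -1 * \<phi> F" by (rule dual_scale[OF \<phi> F])
     also have "\<phi> g0 = (\<Sum>n\<in>A. complex_of_real (l n) * \<phi> (translate G (x n) f))"
      unfolding g0_def by (rule dual_sum[OF A(1) \<phi> tC])
     finally have "\<phi> g = (\<Sum>n\<in>A. complex_of_real (l n) * \<phi> (translate G (x n) f)) - complex_of_real (sum l A) * \<xi> \<phi> + (\<xi> \<phi> - \<phi> F)"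
      using A(3) by simp
     also have "(\<Sum>n\<in>A. complex_of_real (l n) * \<phi> (translate G (x n) f)) - complex_of_real (sum l A) * \<xi> \<phi> =
       (\<Sum>n\<in>A. complex_of_real (l n) * (\<phi> (translate G (x n) f) - \<xi> \<phi>))"
      by (simp add: sum_subtractf right_diff_distrib sum_distrib_right)
     finally have eq: "\<xi> \<phi> - \<phi> F = \<phi> g - (\<Sum>n\<in>A. complex_of_real (l n) * (\<phi> (translate G (x n) f) - \<xi> \<phi>))" by simp
     have "cmod (\<Sum>n\<in>A. complex_of_real (l n) * (\<phi> (translate G (x n) f) - \<xi> \<phi>)) <= (\<Sum>n\<in>A. l n * (d/2))"
     proof (rule order_trans[OF norm_sum sum_mono])
      fix n show "cmod (complex_of_real (l n) * (\<phi> (translate G (x n) f) - \<xi> \<phi>)) <= l n * (d/2)"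
       using mult_left_mono[OF less_imp_le[OF x\<phi>[of n]] A(2)[of n]] by (simp add: norm_mult A(2))
     qed
     also have "\<dots> = d / 2" using A(3) by (simp flip: sum_distrib_right sum_divide_distrib)
     finally have "d < d / 2 + d / 2" using small\<phi> norm_triangle_ineq4[of "\<phi> g" "\<Sum>n\<in>A. complex_of_real (l n) * (\<phi> (translate G (x n) f) - \<xi> \<phi>)"]
      unfolding d_def eq by linarith
     then show False by simp
    qed
    obtain S where S: "!!i. finite (S i)" "!!i n. n : S i ==> i <= n" "!!k::nat. EX y. ALL i<k. EX n:S i. R n y"
    proof (rule ptak[of e R])
     show "0 < e" by (rule de(2))
     show "EX y. e <= (\<Sum>n\<in>{n\<in>A. R n y}. l n)"
      if "finite A" "!!n. 0 <= l n" "sum l A = 1" for A and l :: "nat => real"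
      by (rule noavg[OF that])
    qed (rule that)
    have "EX y:carrier G. (ALL i<k. EX n:S i. \<delta>/2 <= cmod (f (x n \<otimes> y) - F y)) & (EX m. ALL n>=m. cmod (f (x n \<otimes> y) - F y) < 1 / (real n + 1))" for k
    proof -
     \<comment> \<open>\<open>Suc k\<close> instead of \<open>k\<close> provides at least one index,
       from which membership of \<open>y0\<close> in the group is read off \<open>R\<close>.\<close>
     obtain y0 where y0: "!!i. i < Suc k ==> EX n:S i. R n y0" using S(3)[of "Suc k"] by blast
     have y0c: "y0 : carrier G" using y0[of 0] by (auto simp: R_def)
     obtain m0 :: nat where m0: "4 / \<delta> < real m0" using reals_Archimedean2 by blast
     define m where "m = Suc (Max (insert m0 (\<Union>i<k. S i)))"
     have "finite (insert m0 (\<Union>i<k. S i))" using S(1) by simp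
     then have "n < m" if "n : insert m0 (\<Union>i<k. S i)" for n
      unfolding m_def less_Suc_eq_le using that by (rule Max_ge)
     then have m: "m0 < m" "!!i n. i < k ==> n : S i ==> n < m" by blast+
     have rm: "2 / (real m + 1) <= \<delta> / 2"
     proof -
      have "4 / \<delta> <= real m + 1" using m0 m(1) by linarith
      then show ?thesis using de(1) by (simp add: field_simps)
     qed
     \<comment> \<open>Ptak's point is replaced by a net point, where the translates are known to
       converge. As \<open>m\<close> exceeds every index in the sets \<open>S i\<close> with
       \<open>i < k\<close>, the relevant translates hardly notice the difference.\<close>
     obtain y where y: "y : Y m" "!!i. i < m ==> cmod (f (x i \<otimes> y0) - f (x i \<otimes> y)) < 1 / (real m + 1)" "cmod (F y0 - F y) < 1 / (real m + 1)"
      using net[OF y0c, of m] by blast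
     have "EX n:S i. \<delta>/2 <= cmod (f (x n \<otimes> y) - F y)" if i: "i < k" for i
     proof -
      obtain n where n: "n : S i" "R n y0" using y0[of i] i by auto
      have "f (x n \<otimes> y0) - F y0 = (f (x n \<otimes> y0) - f (x n \<otimes> y)) + (f (x n \<otimes> y) - F y) - (F y0 - F y)" by simp
      then have "cmod (f (x n \<otimes> y0) - F y0) <= cmod (f (x n \<otimes> y0) - f (x n \<otimes> y)) + cmod (f (x n \<otimes> y) - F y) + cmod (F y0 - F y)"
       by (metis norm_triangle_ineq norm_triangle_ineq4 add_right_mono order_trans)
      then have "\<delta>/2 <= cmod (f (x n \<otimes> y) - F y)" using n(2) y(2)[OF m(2)[OF i n(1)]] y(3) rm by (simp add: R_def)
      then show ?thesis using n(1) by blast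
     qed
     moreover have "cmod (f (x n \<otimes> y) - F y) < 1 / (real n + 1)" if "n >= m" for n
      using close[of y n] y(1) Ymono[of m n] that by (cases "n = m") auto
     ultimately show ?thesis using y(1) Yc by blast
    qed
    then obtain yy where yy: "!!k. yy k : carrier G" "!!k i. i < k ==> EX n:S i. \<delta>/2 <= cmod (f (x n \<otimes> yy k) - F (yy k))"
     "!!k. EX m. ALL n>=m. cmod (f (x n \<otimes> yy k) - F (yy k)) < 1 / (real n + 1)" by metis
    have lim1: "(%n. f (x n \<otimes> yy k)) ----> F (yy k)" for k
    proof -
     obtain m where "!!n. n >= m ==> cmod (f (x n \<otimes> yy k) - F (yy k)) < 1 / (real n + 1)"
      using yy(3)[of k] by blast
     then show ?thesis by (rule LIMSEQ_if_eventually_close)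
    qed
    \<comment> \<open>\<open>F\<close> takes index 0 and the translates the later ones, so that a
      single diagonal subsequence makes all of them converge along \<open>yy\<close>.\<close>
    define fam where "fam = (%k i. if i = 0 then F (yy k) else f (x (i - 1) \<otimes> yy k))"
    have "cmod (fam k i) <= B + 1" for k i
     using Fb[OF yy(1)] B(2)[of "x (i - 1) \<otimes> yy k"] xc yy(1) by (auto simp: fam_def intro: order_trans)
    then obtain s where s: "strict_mono s" "!!i. EX l. (%k. fam (s k) i) ----> l"
     using function_convergent_subsequence[of "UNIV :: nat set" fam "B + 1"] by (metis UNIV_I countableI_type)
    obtain b where b: "(%k. F (yy (s k))) ----> b" using s(2)[of 0] by (auto simp: fam_def)
    have "EX l. (%k. f (x n \<otimes> yy (s k))) ----> l" for n using s(2)[of "Suc n"] by (simp add: fam_def)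
    then obtain a where a: "!!n. (%k. f (x n \<otimes> yy (s k))) ----> a n" by metis
    \<comment> \<open>Finiteness of \<open>S i\<close> lets one of its indices stay far from
      \<open>F\<close> in the limit over \<open>k\<close>.\<close>
    have "EX n:S i. \<delta>/2 <= cmod (a n - b)" for i
    proof (rule ccontr)
     assume "~ ?thesis"
     then have lt: "!!n. n : S i ==> cmod (a n - b) < \<delta>/2" by (simp add: not_le)
     have "ALL n:S i. \<forall>\<^sub>F k in sequentially. cmod (f (x n \<otimes> yy (s k)) - F (yy (s k))) < \<delta>/2"
      by (intro ballI order_tendstoD(2)[OF tendsto_norm[OF tendsto_diff[OF a b]]] lt)
     then have "\<forall>\<^sub>F k in sequentially. ALL n:S i. cmod (f (x n \<otimes> yy (s k)) - F (yy (s k))) < \<delta>/2"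
      using S(1) by (simp add: eventually_ball_finite)
     then obtain N where N: "!!k. k >= N ==> ALL n:S i. cmod (f (x n \<otimes> yy (s k)) - F (yy (s k))) < \<delta>/2"
      by (auto simp: eventually_sequentially)
     have "i < s (max N (Suc i))" using seq_suble[OF s(1), of "max N (Suc i)"] by linarith
     then show False using yy(2)[of i "s (max N (Suc i))"] N[of "max N (Suc i)"] by force
    qed
    then obtain nn where nn: "!!i. nn i : S i" "!!i. \<delta>/2 <= cmod (a (nn i) - b)" by metis
    have an: "cmod (a n) <= B" for n
     by (rule Lim_bounded[OF tendsto_norm[OF a[of n]], of 0]) (use B(2) xc yy(1) in auto)
    then have "bounded (range (%i. a (nn i)))" by (auto simp: bounded_iff)
    then obtain a' r where r: "strict_mono r" "((%i. a (nn i)) \<circ> r) ----> a'" using bounded_imp_convergent_subsequence by blast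
    have top: "filterlim (%i. nn (r i)) at_top sequentially"
    proof (rule filterlim_at_top_mono[OF filterlim_subseq[OF r(1)]])
     show "\<forall>\<^sub>F i in sequentially. r i <= nn (r i)" using S(2) nn(1) by auto
    qed
    have "a' = b"
    proof (rule iterated_limits_agreeD[OF dl, of "%i. x (nn (r i))" "%k. yy (s k)"])
     show "(%k. f (x (nn (r i)) \<otimes> yy (s k))) ----> a (nn (r i))" for i by (rule a)
     show "(%i. f (x (nn (r i)) \<otimes> yy (s k))) ----> F (yy (s k))" for k
      using filterlim_compose[OF lim1[of "s k"] top] by simp
    qed (use r b xc yy(1) in \<open>auto simp: o_def\<close>)
    moreover have "\<delta>/2 <= cmod (a' - b)"
     by (rule Lim_bounded2[OF tendsto_norm[OF tendsto_diff[OF r(2) tendsto_const]], of 0]) (use nn in auto)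
    ultimately show False using de(1) by simp
   qed
   moreover have "\<xi> : extensional D" using \<xi> closure_of_subset_topspace by (fastforce simp: PiE_def)
   ultimately have "\<xi> = J F" by (auto simp: J_def extensional_def fun_eq_iff)
   then show "\<xi> : J ` CBG" using F by blast
  qed
 qed
 then show ?thesis using f by (simp add: WAP_def)
qed

lemma WAP_iff: "f : WAPG \<longleftrightarrow> f : CBG & iterated f"
 using iterated_imp_WAP WAP_imp_iterated by (auto simp: WAP_def)

end

section \<open>The weakly almost periodic compactification\<close>

context top_grp
begin

definition function_algebra :: "('a => complex) set => bool" where
 "function_algebra A \<longleftrightarrow> A \<subseteq> CBG & (FN x. 1) : A &
   (ALL f:A. ALL g:A. (FN x. f x + g x) : A) &
   (ALL c. ALL f:A. (FN x. c * f x) : A) &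
   (ALL f:A. ALL g:A. (FN x. f x * g x) : A)"

lemma
 assumes "function_algebra A"
 shows function_algebra_CB: "f : A ==> f : CBG"
  and function_algebra_one: "(FN x. 1) : A"
  and function_algebra_add: "f : A ==> g : A ==> (FN x. f x + g x) : A"
  and function_algebra_scale: "f : A ==> (FN x. c * f x) : A"
  and function_algebra_mult: "f : A ==> g : A ==> (FN x. f x * g x) : A"
 using assms unfolding function_algebra_def by blast+

abbreviation "prodtop A \<equiv> product_topology (%_. euclidean :: complex topology) A"

lemma continuous_map_coord: "f : A ==> continuous_map (prodtop A) euclidean (%\<mu>. \<mu> f)"
 by (rule continuous_map_product_projection)

lemma compactin_closure_of_evaluations:
 assumes A: "A \<subseteq> CBG"
 shows "compactin (prodtop A) (prodtop A closure_of (evaluation A ` carrier G))"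
  and "\<mu> : prodtop A closure_of (evaluation A ` carrier G) ==> f : A ==> cmod (\<mu> f) <= nrm f"
proof -
 define Z where "Z = PiE A (%f. cball (0::complex) (nrm f))"
 have Z: "compactin (prodtop A) Z" unfolding Z_def by (simp add: compactin_PiE)
 have "evaluation A ` carrier G \<subseteq> Z"
  using cmod_le_uniform_norm A by (auto simp: Z_def evaluation_def)
 moreover have "closedin (prodtop A) Z"
  using Z by (intro compactin_imp_closedin) (simp_all add: Hausdorff_space_product_topology)
 ultimately have sub: "prodtop A closure_of (evaluation A ` carrier G) \<subseteq> Z" by (simp add: closure_of_minimal)
 then show "compactin (prodtop A) (prodtop A closure_of (evaluation A ` carrier G))"
  using Z closed_compactin closedin_closure_of by blast
 show "cmod (\<mu> f) <= nrm f" if "\<mu> : prodtop A closure_of (evaluation A ` carrier G)" "f : A"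
  using that sub by (auto simp: Z_def PiE_iff)
qed

text \<open>The identities that define a character are closed conditions and hold at evaluations;
  the value 1 at the constant function excludes the zero functional.\<close>

lemma closure_of_evaluations_subset_spectrum:
 assumes A: "function_algebra A"
 shows "prodtop A closure_of (evaluation A ` carrier G) \<subseteq> gelfand_spectrum G A"
proof
 fix \<mu> assume \<mu>: "\<mu> : prodtop A closure_of (evaluation A ` carrier G)"
 note fa = function_algebra_one[OF A] function_algebra_add[OF A] function_algebra_scale[OF A] function_algebra_mult[OF A]
 have eq: "u \<mu> = v \<mu>" if "continuous_map (prodtop A) euclidean u" "continuous_map (prodtop A) euclidean v"
  "!!x. x : carrier G ==> u (evaluation A x) = v (evaluation A x)" for u v :: "(('a => complex) => complex) => complex"
  by (rule forall_in_closure_of_eq[OF \<mu> _ that(1,2)]) (use that(3) in auto)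
 have ev: "evaluation A x h = h x" if "h : A" for h x using that by (simp add: evaluation_def)
 show "\<mu> : gelfand_spectrum G A"
  unfolding gelfand_spectrum_def
 proof (intro CollectI conjI ballI allI)
  show "\<mu> : extensional A" using \<mu> closure_of_subset_topspace by (fastforce simp: PiE_def)
  fix f assume f: "f : A"
  show "\<mu> (FN x. c * f x) = c * \<mu> f" for c
  proof (rule eq[of "%\<mu>. \<mu> (FN x. c * f x)" "%\<mu>. c * \<mu> f"])
   show "continuous_map (prodtop A) euclidean (%\<mu>. c * \<mu> f)"
    using continuous_map_compose[OF continuous_map_coord[OF f], of euclidean "%z. c * z"]
    by (simp add: o_def continuous_intros)
   show "evaluation A x (FN x. c * f x) = c * evaluation A x f" if "x : carrier G" for x
    unfolding ev[OF fa(3)[OF f]] ev[OF f] using that by simp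
  qed (rule continuous_map_coord[OF fa(3)[OF f]])
  fix g assume g: "g : A"
  show "\<mu> (FN x. f x + g x) = \<mu> f + \<mu> g"
  proof (rule eq[of "%\<mu>. \<mu> (FN x. f x + g x)" "%\<mu>. \<mu> f + \<mu> g"])
   show "evaluation A x (FN x. f x + g x) = evaluation A x f + evaluation A x g" if "x : carrier G" for x
    unfolding ev[OF fa(2)[OF f g]] ev[OF f] ev[OF g] using that by simp
  qed (intro continuous_map_coord continuous_map_add fa f g)+
  show "\<mu> (FN x. f x * g x) = \<mu> f * \<mu> g"
  proof (rule eq[of "%\<mu>. \<mu> (FN x. f x * g x)" "%\<mu>. \<mu> f * \<mu> g"])
   show "continuous_map (prodtop A) euclidean (%\<mu>. \<mu> f * \<mu> g)"
    using continuous_map_compose[OF continuous_map_pairedI[OF continuous_map_coord[OF f] continuous_map_coord[OF g]],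
      of euclidean "%z. fst z * snd z"]
    by (simp add: o_def continuous_intros euclidean_product_topology)
   show "evaluation A x (FN x. f x * g x) = evaluation A x f * evaluation A x g" if "x : carrier G" for x
    unfolding ev[OF fa(4)[OF f g]] ev[OF f] ev[OF g] using that by simp
  qed (rule continuous_map_coord[OF fa(4)[OF f g]])
 next
  have "\<mu> (FN x. 1) = 1"
  proof (rule eq[of "%\<mu>. \<mu> (FN x. 1)" "%\<mu>. 1"])
   show "evaluation A x (FN x. 1) = 1" if "x : carrier G" for x
    unfolding ev[OF fa(1)] using that by simp
  qed (simp_all only: continuous_map_coord[OF fa(1)] continuous_map_const topspace_euclidean UNIV_I simp_thms)
  then show "EX f:A. \<mu> f ~= 0" using fa(1) by (metis zero_neq_one)
 qed
qed

lemma evaluation_in_spectrum: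
 assumes "function_algebra A" "x : carrier G"
 shows "evaluation A x : prodtop A closure_of (evaluation A ` carrier G)" "evaluation A x : gelfand_spectrum G A"
proof -
 show "evaluation A x : prodtop A closure_of (evaluation A ` carrier G)"
  by (rule subsetD[OF closure_of_subset]) (use assms in \<open>auto simp: evaluation_def\<close>)
 then show "evaluation A x : gelfand_spectrum G A" using closure_of_evaluations_subset_spectrum[OF assms(1)] by blast
qed

text \<open>Along subsequences for which the pair has all iterated limits, both limits of the
  composite are \<Phi> of the same point. Continuity is asked only on a closed set \<open>K\<close>
  containing all values, so that inversion away from zero is covered.\<close>

lemma iterated_image2:
 assumes f: "f : CBG" "iterated f" and g: "g : CBG" "iterated g"
  and K: "closed K" "!!x. x : carrier G ==> (f x, g x) : K" "continuous_on K (\<Phi> :: complex \<times> complex => complex)"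
 shows "iterated (FN x. \<Phi> (f x, g x))"
 unfolding iterated_limits_agree_def
proof (intro allI impI)
 fix x y :: "nat => 'a" and \<alpha> \<beta> a b
 assume x: "range x \<subseteq> carrier G" and y: "range y \<subseteq> carrier G"
  and al: "ALL i. (%j. (FN x. \<Phi> (f x, g x)) (x i \<otimes> y j)) ----> \<alpha> i" "\<alpha> ----> a"
  and be: "ALL j. (%i. (FN x. \<Phi> (f x, g x)) (x i \<otimes> y j)) ----> \<beta> j" "\<beta> ----> b"
 have xy: "x i \<otimes> y j : carrier G" for i j using x y by (simp add: range_subsetD)
 obtain B1 where B1: "!!x. x : carrier G ==> cmod (f x) <= B1" using CB_bound[OF f(1)] by blast
 obtain B2 where B2: "!!x. x : carrier G ==> cmod (g x) <= B2" using CB_bound[OF g(1)] by blast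
 define c where "c = (%i j. (f (x i \<otimes> y j), g (x i \<otimes> y j)))"
 have cb: "norm (c i j) <= B1 + B2" for i j
  using norm_Pair_le[of "f (x i \<otimes> y j)" "g (x i \<otimes> y j)"] B1[OF xy] B2[OF xy] by (simp add: c_def add_mono order_trans)
 obtain r s p q a' b' where rs: "strict_mono r" "strict_mono s"
  "!!i. (%j. c (r i) (s j)) ----> p i" "p ----> a'" "!!j. (%i. c (r i) (s j)) ----> q j" "q ----> b'"
  by (rule iterated_limits_exist_along_subsequences[of c, OF cb], rule that)
 have fst: "fst a' = fst b'"
  by (rule iterated_limits_agreeD[OF f(2), of "x \<circ> r" "y \<circ> s" "%i. fst (p i)" _ "%j. fst (q j)"])
   (use x y tendsto_fst[OF rs(3)] tendsto_fst[OF rs(4)] tendsto_fst[OF rs(5)] tendsto_fst[OF rs(6)] in \<open>auto simp: c_def\<close>)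
 have snd: "snd a' = snd b'"
  by (rule iterated_limits_agreeD[OF g(2), of "x \<circ> r" "y \<circ> s" "%i. snd (p i)" _ "%j. snd (q j)"])
   (use x y tendsto_snd[OF rs(3)] tendsto_snd[OF rs(4)] tendsto_snd[OF rs(5)] tendsto_snd[OF rs(6)] in \<open>auto simp: c_def\<close>)
 have cK: "c i j : K" for i j using K(2)[OF xy] by (simp add: c_def)
 have pK: "p i : K" for i by (rule Lim_in_closed_set[OF K(1) _ _ rs(3)]) (use cK in auto)
 have qK: "q i : K" for i by (rule Lim_in_closed_set[OF K(1) _ _ rs(5)]) (use cK in auto)
 have aK: "a' : K" by (rule Lim_in_closed_set[OF K(1) _ _ rs(4)]) (use pK in auto)
 have bK: "b' : K" by (rule Lim_in_closed_set[OF K(1) _ _ rs(6)]) (use qK in auto)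
 note cont = continuous_on_tendsto_compose[OF K(3)]
 have "\<alpha> (r i) = \<Phi> (p i)" for i
 proof (rule LIMSEQ_unique)
  show "(%j. \<Phi> (c (r i) (s j))) ----> \<alpha> (r i)"
   using LIMSEQ_subseq_LIMSEQ[OF al(1)[rule_format, of "r i"] rs(2)] xy by (simp add: c_def o_def)
  show "(%j. \<Phi> (c (r i) (s j))) ----> \<Phi> (p i)" by (rule cont[OF rs(3) pK]) (simp add: cK)
 qed
 moreover have "\<beta> (s j) = \<Phi> (q j)" for j
 proof (rule LIMSEQ_unique)
  show "(%i. \<Phi> (c (r i) (s j))) ----> \<beta> (s j)"
   using LIMSEQ_subseq_LIMSEQ[OF be(1)[rule_format, of "s j"] rs(1)] xy by (simp add: c_def o_def)
  show "(%i. \<Phi> (c (r i) (s j))) ----> \<Phi> (q j)" by (rule cont[OF rs(5) qK]) (simp add: cK)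
 qed
 moreover have "(%i. \<Phi> (p i)) ----> \<Phi> a'" by (rule cont[OF rs(4) aK]) (simp add: pK)
 moreover have "(%i. \<Phi> (q i)) ----> \<Phi> b'" by (rule cont[OF rs(6) bK]) (simp add: qK)
 ultimately have "a = \<Phi> a'" "b = \<Phi> b'"
  using LIMSEQ_subseq_LIMSEQ[OF al(2) rs(1)] LIMSEQ_subseq_LIMSEQ[OF be(2) rs(2)] LIMSEQ_unique
  by (auto simp: o_def)
 moreover have "a' = b'" using fst snd by (rule prod_eqI)
 ultimately show "a = b" by simp
qed

lemma WAP_image2:
 assumes "f : WAPG" "g : WAPG" "closed K" "!!x. x : carrier G ==> (f x, g x) : K"
  "continuous_on K (\<Phi> :: complex \<times> complex => complex)"
 shows "(FN x. \<Phi> (f x, g x)) : WAPG"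
proof (rule iterated_imp_WAP)
 have fg: "f : CBG" "iterated f" "g : CBG" "iterated g" using assms(1,2) by (simp_all add: WAP_iff)
 show "(FN x. \<Phi> (f x, g x)) : CBG" by (rule CB_image2[OF fg(1,3) assms(3-5)])
 show "iterated (FN x. \<Phi> (f x, g x))" by (rule iterated_image2[OF fg assms(3-5)])
qed

lemma WAP_CB: "f : WAPG ==> f : CBG" by (simp add: WAP_def)

lemma function_algebra_WAP: "function_algebra WAPG"
 unfolding function_algebra_def
proof (intro conjI ballI allI)
 show "WAPG \<subseteq> CBG" using WAP_CB by blast
 have "iterated (FN x. 1)"
  unfolding iterated_limits_agree_def
 proof (intro allI impI)
  fix x y :: "nat => 'a" and \<alpha> \<beta> a b
  assume x: "range x \<subseteq> carrier G" and y: "range y \<subseteq> carrier G"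
   and al: "ALL i. (%j. (FN x. (1::complex)) (x i \<otimes> y j)) ----> \<alpha> i" "\<alpha> ----> a"
   and be: "ALL j. (%i. (FN x. (1::complex)) (x i \<otimes> y j)) ----> \<beta> j" "\<beta> ----> b"
  have xy: "x i \<otimes> y j : carrier G" for i j using x y by (simp add: range_subsetD)
  have "\<alpha> = (%_. 1)" "\<beta> = (%_. 1)" using al(1) be(1) xy by (auto simp: LIMSEQ_const_iff fun_eq_iff)
  then show "a = b" using al(2) be(2) by (simp add: LIMSEQ_const_iff)
 qed
 then show "(FN x. 1) : WAPG" by (simp add: WAP_iff CB_const)
 fix f assume f: "f : WAPG"
 show "(FN x. c * f x) : WAPG" for c
  using WAP_image2[OF f f, of UNIV "%p. c * fst p"] by (simp add: continuous_intros)
 fix g assume g: "g : WAPG"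
 show "(FN x. f x + g x) : WAPG"
  using WAP_image2[OF f g, of UNIV "%p. fst p + snd p"] by (simp add: continuous_intros)
 show "(FN x. f x * g x) : WAPG"
  using WAP_image2[OF f g, of UNIV "%p. fst p * snd p"] by (simp add: continuous_intros)
qed

text \<open>Density of the evaluations. If a character \<mu> is far from all of them on
  \<open>F\<close>, the sum of the squares of \<open>cmod (f - \<mu> f)\<close> lies in its kernel,
  and yet it is bounded away from zero and so invertible in the algebra.\<close>

lemma spectrum_WAP_approx:
 assumes \<mu>: "\<mu> : gelfand_spectrum G WAPG" and F: "finite F" "F \<subseteq> WAPG" and e: "0 < e"
 shows "EX x:carrier G. ALL f:F. cmod (f x - \<mu> f) < e"
proof (rule ccontr)
 assume no: "~ ?thesis"
 note fa = function_algebra_one[OF function_algebra_WAP] function_algebra_add[OF function_algebra_WAP]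
  function_algebra_scale[OF function_algebra_WAP] function_algebra_mult[OF function_algebra_WAP]
 have add: "f : WAPG ==> g : WAPG ==> \<mu> (FN x. f x + g x) = \<mu> f + \<mu> g" for f g
  using \<mu> by (simp add: gelfand_spectrum_def)
 have mult: "f : WAPG ==> g : WAPG ==> \<mu> (FN x. f x * g x) = \<mu> f * \<mu> g" for f g
  using \<mu> by (simp add: gelfand_spectrum_def)
 have scale: "f : WAPG ==> \<mu> (FN x. c * f x) = c * \<mu> f" for f c
  using \<mu> by (simp add: gelfand_spectrum_def)
 define one where "one = (FN x. (1::complex))"
 have one: "one : WAPG" using fa(1) by (simp add: one_def)
 obtain f0 where f0: "f0 : WAPG" "\<mu> f0 ~= 0" using \<mu> by (auto simp: gelfand_spectrum_def)
 have "f0 : extensional (carrier G)" using WAP_CB[OF f0(1)] by (simp add: CB_def)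
 then have "(FN x. one x * f0 x) = f0" by (auto simp: one_def fun_eq_iff extensional_def)
 then have mu1: "\<mu> one = 1" using mult[OF one f0(1)] f0(2) by simp
 have "EX g:WAPG. (ALL x:carrier G. g x = of_real (\<Sum>f\<in>F. (cmod (f x - \<mu> f))\<^sup>2)) & \<mu> g = 0"
  using F
 proof (induction F rule: finite_induct)
  case empty
  define z where "z = (FN x. 0 * one x)"
  have "\<mu> z = 0" "z : WAPG" using scale[OF one, of 0] fa(3)[OF one, of 0] by (simp_all only: z_def mult_zero_left)
  moreover have "ALL x:carrier G. z x = 0" by (simp add: z_def)
  ultimately show ?case by auto
 next
  case (insert f F)
  then obtain g where g: "g : WAPG" "!!x. x : carrier G ==> g x = of_real (\<Sum>f\<in>F. (cmod (f x - \<mu> f))\<^sup>2)" "\<mu> g = 0" by auto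
  have f: "f : WAPG" using insert by simp
  define m where "m = (FN x. (- \<mu> f) * one x)"
  have m: "m : WAPG" "\<mu> m = - \<mu> f" using fa(3)[OF one] scale[OF one, of "- \<mu> f"] mu1 by (simp_all only: m_def mult_1_right)
  define p where "p = (FN x. f x + m x)"
  have p: "p : WAPG" "\<mu> p = 0" using fa(2)[OF f m(1)] add[OF f m(1)] m(2) by (simp_all only: p_def add.right_inverse)
  define q where "q = (FN x. cnj (p x))"
  have q: "q : WAPG" unfolding q_def
   using WAP_image2[OF p(1) p(1), of UNIV "%z. cnj (fst z)"] by (simp add: continuous_intros)
  define r where "r = (FN x. p x * q x)"
  have r: "r : WAPG" "\<mu> r = 0" using fa(4)[OF p(1) q] mult[OF p(1) q] p(2) by (simp_all only: r_def mult_zero_left)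
  define h where "h = (FN x. r x + g x)"
  have h: "h : WAPG" "\<mu> h = 0" using fa(2)[OF r(1) g(1)] add[OF r(1) g(1)] r(2) g(3) by (simp_all only: h_def add_0)
  have "h x = of_real (\<Sum>f\<in>insert f F. (cmod (f x - \<mu> f))\<^sup>2)" if x: "x : carrier G" for x
  proof -
   have "p x = f x - \<mu> f" using x by (simp add: p_def m_def one_def)
   then have "r x = of_real ((cmod (f x - \<mu> f))\<^sup>2)" using x by (simp only: r_def q_def restrict_apply' complex_norm_square)
   then show ?thesis using insert x by (simp add: h_def g(2))
  qed
  then show ?case using h by blast
 qed
 then obtain g where g: "g : WAPG" "!!x. x : carrier G ==> g x = of_real (\<Sum>f\<in>F. (cmod (f x - \<mu> f))\<^sup>2)" "\<mu> g = 0" by blast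
 have ge: "e\<^sup>2 <= Re (g x)" if x: "x : carrier G" for x
 proof -
  obtain f where f: "f : F" "e <= cmod (f x - \<mu> f)" using no x by (auto simp: not_less)
  have "e\<^sup>2 <= (cmod (f x - \<mu> f))\<^sup>2" using f e by (intro power_mono) auto
  also have "\<dots> <= (\<Sum>f\<in>F. (cmod (f x - \<mu> f))\<^sup>2)" using f F by (intro member_le_sum) auto
  finally show ?thesis using g(2)[OF x] by simp
 qed
 define K where "K = {p :: complex \<times> complex. e\<^sup>2 <= Re (fst p)}"
 have nz: "fst p ~= 0" if "p : K" for p using that e by (auto simp: K_def)
 have "closed K" unfolding K_def by (intro closed_Collect_le continuous_intros)
 moreover have "continuous_on K (%p. inverse (fst p))" using nz by (intro continuous_intros) auto
 ultimately have inv: "(FN x. inverse (g x)) : WAPG"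
  using WAP_image2[OF g(1) g(1), of K "%p. inverse (fst p)"] ge by (simp add: K_def)
 have "(FN x. g x * (FN x. inverse (g x)) x) = one"
 proof -
  have "g x ~= 0" if "x : carrier G" for x using ge[OF that] e by auto
  then show ?thesis by (auto simp: one_def fun_eq_iff)
 qed
 then have "\<mu> one = 0" using mult[OF g(1) inv] g(3) by simp
 then show False using mu1 by simp
qed

lemma spectrum_WAP: "gelfand_spectrum G WAPG = prodtop WAPG closure_of (evaluation WAPG ` carrier G)"
proof
 show "gelfand_spectrum G WAPG \<subseteq> prodtop WAPG closure_of (evaluation WAPG ` carrier G)"
 proof
  fix \<mu> assume \<mu>: "\<mu> : gelfand_spectrum G WAPG"
  then have ext: "\<mu> : extensional WAPG" by (simp add: gelfand_spectrum_def)
  show "\<mu> : prodtop WAPG closure_of (evaluation WAPG ` carrier G)"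
   unfolding closure_of_product_approx_iff[OF ext]
  proof (intro allI impI)
   fix F e assume F: "finite F" "F \<subseteq> WAPG" and e: "0 < (e::real)"
   obtain x where "x : carrier G" "ALL f:F. cmod (f x - \<mu> f) < e" using spectrum_WAP_approx[OF \<mu> F e] by blast
   then show "EX a:evaluation WAPG ` carrier G \<inter> extensional WAPG. ALL i:F. cmod (a i - \<mu> i) < e"
    using F(2) by (intro bexI[of _ "evaluation WAPG x"]) (auto simp: evaluation_def)
  qed
 qed
qed (rule closure_of_evaluations_subset_spectrum[OF function_algebra_WAP])

abbreviation "WC \<equiv> WAP_compactification G T"

lemma sg_top_WC: "sg_top WC = subtopology (prodtop WAPG) (gelfand_spectrum G WAPG)"
 by (simp add: WAP_compactification_def spectrum_semigroup_def)

lemma sg_carrier_WC: "sg_carrier WC = gelfand_spectrum G WAPG"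
 unfolding sg_top_WC spectrum_WAP topspace_subtopology using closure_of_subset_topspace by fastforce

lemma compact_WC: "compact_space (sg_top WC)"
 unfolding sg_top_WC spectrum_WAP
 by (intro compact_space_subtopology compactin_closure_of_evaluations(1)) (use WAP_CB in blast)

lemma sg_mult_WC: "\<mu> \<cdot>\<^bsub>WC\<^esub> \<nu> = (\<lambda>f\<in>WAPG. \<mu> (FN x. \<nu> (translate G x f)))"
 by (simp add: WAP_compactification_def spectrum_semigroup_def)

lemma translate_WAP:
 assumes f: "f : WAPG" and x: "x : carrier G" shows "translate G x f : WAPG"
 unfolding WAP_iff
proof
 show "translate G x f : CBG" using f x by (intro translate_CB) (auto simp: WAP_CB)
 show "iterated (translate G x f)"
  unfolding iterated_limits_agree_def
 proof (intro allI impI)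
  fix u v :: "nat => 'a" and \<alpha> \<beta> a b
  assume u: "range u \<subseteq> carrier G" and v: "range v \<subseteq> carrier G"
  and al: "ALL i. (%j. translate G x f (u i \<otimes> v j)) ----> \<alpha> i" "\<alpha> ----> a"
  and be: "ALL j. (%i. translate G x f (u i \<otimes> v j)) ----> \<beta> j" "\<beta> ----> b"
  have eq: "translate G x f (u i \<otimes> v j) = f ((x \<otimes> u i) \<otimes> v j)" for i j
   using u v x by (simp add: translate_def range_subsetD m_assoc)
  show "a = b"
   by (rule iterated_limits_agreeD[OF WAP_imp_iterated[OF f], of "%i. x \<otimes> u i" v])
    (use u v x al be in \<open>auto simp: eq\<close>)
 qed
qed

text \<open>An extension of norm at most one obtained from compactness: restriction sends the
  compact closure of the evaluations on \<open>CB\<close> onto a closed set, which contains the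
  evaluations on \<open>WAP\<close> and hence the spectrum.\<close>

lemma spectrum_WAP_functional:
 assumes \<nu>: "\<nu> : gelfand_spectrum G WAPG"
 obtains \<phi> where "\<phi> : D" "!!f. f : CBG ==> cmod (\<phi> f) <= nrm f" "!!f. f : WAPG ==> \<phi> f = \<nu> f"
proof -
 let ?K = "prodtop CBG closure_of (evaluation CBG ` carrier G)"
 have fa: "function_algebra CBG" unfolding function_algebra_def
  using CB_const CB_add CB_mult CB_scale by blast
 have K: "compactin (prodtop CBG) ?K" by (rule compactin_closure_of_evaluations) simp
 have KD: "\<phi> : D" "!!f. f : CBG ==> cmod (\<phi> f) <= nrm f" if \<phi>: "\<phi> : ?K" for \<phi>
 proof -
  show bd: "!!f. f : CBG ==> cmod (\<phi> f) <= nrm f"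
   by (rule compactin_closure_of_evaluations(2)[OF _ \<phi>]) auto
  have "\<phi> : gelfand_spectrum G CBG" using closure_of_evaluations_subset_spectrum[OF fa] \<phi> by blast
  then show "\<phi> : D" unfolding CB_dual_def gelfand_spectrum_def
   using bd by (auto intro!: exI[of _ 1])
 qed
 have res: "continuous_map (prodtop CBG) (prodtop WAPG) (%\<phi>. restrict \<phi> WAPG)"
  unfolding continuous_map_componentwise
  using WAP_CB by (auto intro: continuous_map_coord)
 have "compactin (prodtop WAPG) ((%\<phi>. restrict \<phi> WAPG) ` ?K)" by (rule image_compactin[OF K res])
 then have "closedin (prodtop WAPG) ((%\<phi>. restrict \<phi> WAPG) ` ?K)"
  by (rule compactin_imp_closedin[rotated]) (simp add: Hausdorff_space_product_topology)
 moreover have "evaluation WAPG ` carrier G \<subseteq> (%\<phi>. restrict \<phi> WAPG) ` ?K"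
 proof
  fix \<mu> assume "\<mu> : evaluation WAPG ` carrier G"
  then obtain x where x: "x : carrier G" "\<mu> = evaluation WAPG x" by blast
  have "\<mu> = restrict (evaluation CBG x) WAPG" using WAP_CB by (auto simp: x(2) evaluation_def fun_eq_iff)
  then show "\<mu> : (%\<phi>. restrict \<phi> WAPG) ` ?K" using evaluation_in_spectrum(1)[OF fa x(1)] by blast
 qed
 ultimately have "prodtop WAPG closure_of (evaluation WAPG ` carrier G) \<subseteq> (%\<phi>. restrict \<phi> WAPG) ` ?K"
  by (simp add: closure_of_minimal)
 then obtain \<phi> where \<phi>: "\<phi> : ?K" "\<nu> = restrict \<phi> WAPG" using \<nu> spectrum_WAP by blast
 show thesis by (rule that[of \<phi>]) (use KD[OF \<phi>(1)] \<phi>(2) in auto)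
qed

text \<open>Makes the product of the spectrum well defined. The function is a pointwise limit of
  right translates of \<open>f\<close>, because evaluations approximate \<nu>, and so it is
  continuous. For the iterated limits the right factor \<open>y j\<close> is absorbed into the
  functional.\<close>

lemma WAP_introverted:
 assumes \<nu>: "\<nu> : gelfand_spectrum G WAPG" and f: "f : WAPG"
 shows "(FN x. \<nu> (translate G x f)) : WAPG"
proof -
 obtain \<phi> where \<phi>: "\<phi> : D" "!!f. f : CBG ==> cmod (\<phi> f) <= nrm f" "!!f. f : WAPG ==> \<phi> f = \<nu> f"
  using spectrum_WAP_functional[OF \<nu>] by metis
 define h where "h = (FN x. \<phi> (translate G x f))"
 have h_eq: "h = (FN x. \<nu> (translate G x f))"
  unfolding h_def using \<phi>(3)[OF translate_WAP[OF f]] by (intro restrict_ext) auto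
 have fC: "f : CBG" by (rule WAP_CB[OF f])
 have bd: "cmod (h x) <= nrm f" if "x : carrier G" for x
 proof -
  have "cmod (h x) <= nrm (translate G x f)" using \<phi>(2)[OF translate_CB[OF fC that]] that by (simp add: h_def)
  also have "\<dots> <= nrm f" using that cmod_le_uniform_norm[OF fC] by (intro uniform_norm_le) (auto simp: translate_def)
  finally show ?thesis .
 qed
 have "continuous_map T euclidean h"
 proof (rule continuous_map_pointwise_limit)
  show "iterated_limits_agree (carrier G) (topspace T) (%z x. f (x \<otimes> z))"
   using iterated_limits_agree_swap[OF WAP_imp_iterated[OF f]] by simp
  show "continuous_map T euclidean (%x. f (x \<otimes> z))" if "z : carrier G" for z
   using continuous_map_compose[OF continuous_map_rmult[OF that], of euclidean f] fC by (simp add: CB_def o_def)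
  show "EX z:carrier G. ALL x:S. cmod (f (x \<otimes> z) - h x) < e" if S: "finite S" "S \<subseteq> topspace T" "0 < e" for S e
  proof -
   have "EX z:carrier G. ALL g:(%x. translate G x f) ` S. cmod (g z - \<nu> g) < e"
    by (rule spectrum_WAP_approx[OF \<nu>]) (use S translate_WAP[OF f] in auto)
   then show ?thesis using S(2) by (auto simp: h_eq translate_def subset_iff)
  qed
 qed (use bd in auto)
 then have hC: "h : CBG" using bd by (auto simp: CB_def bounded_iff h_def)
 moreover have "iterated h"
  unfolding iterated_limits_agree_def
 proof (intro allI impI)
  fix x y :: "nat => 'a" and \<alpha> \<beta> a b
  assume x: "range x \<subseteq> carrier G" and y: "range y \<subseteq> carrier G"
   and al: "ALL i. (%j. h (x i \<otimes> y j)) ----> \<alpha> i" "\<alpha> ----> a"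
   and be: "ALL j. (%i. h (x i \<otimes> y j)) ----> \<beta> j" "\<beta> ----> b"
  define \<psi> where "\<psi> = (%j. \<lambda>g\<in>CBG. \<phi> (translate G (y j) g))"
  have yc: "y j : carrier G" and xc: "x j : carrier G" for j using x y by auto
  have \<psi>n: "cmod (\<psi> j g) <= nrm g" if g: "g : CBG" for j g
  proof -
   have "cmod (\<psi> j g) <= nrm (translate G (y j) g)" using \<phi>(2)[OF translate_CB[OF g yc]] g by (simp add: \<psi>_def)
   also have "\<dots> <= nrm g" using yc cmod_le_uniform_norm[OF g] by (intro uniform_norm_le) (auto simp: translate_def)
   finally show ?thesis .
  qed
  have \<psi>D: "\<psi> j : D" for j
   unfolding CB_dual_def
  proof (intro CollectI conjI ballI allI)
   show "\<psi> j : extensional CBG" by (simp add: \<psi>_def)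
   show "EX C. ALL f:CBG. cmod (\<psi> j f) <= C * nrm f" using \<psi>n by (intro exI[of _ 1]) auto
   fix g1 assume g1: "g1 : CBG"
   have "translate G (y j) (FN x. c * g1 x) = (FN x. c * translate G (y j) g1 x)" for c
    using yc by (auto simp: translate_def fun_eq_iff)
   then show "\<psi> j (FN x. c * g1 x) = c * \<psi> j g1" for c
    unfolding \<psi>_def using CB_scale[OF g1] g1 dual_scale[OF \<phi>(1) translate_CB[OF g1 yc]] by (simp del: restrict_apply add: restrict_apply')
   fix g2 assume g2: "g2 : CBG"
   have "translate G (y j) (FN x. g1 x + g2 x) = (FN x. translate G (y j) g1 x + translate G (y j) g2 x)"
    using yc by (auto simp: translate_def fun_eq_iff)
   then show "\<psi> j (FN x. g1 x + g2 x) = \<psi> j g1 + \<psi> j g2"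
    unfolding \<psi>_def using CB_add[OF g1 g2] g1 g2 dual_add[OF \<phi>(1) translate_CB[OF g1 yc] translate_CB[OF g2 yc]]
    by (simp del: restrict_apply add: restrict_apply')
  qed
  have eq: "\<psi> j (translate G (x i) f) = h (x i \<otimes> y j)" for i j
  proof -
   have "translate G (y j) (translate G (x i) f) = translate G (x i \<otimes> y j) f"
    using xc yc by (auto simp: translate_def fun_eq_iff m_assoc)
   then show ?thesis using xc yc translate_CB[OF fC xc] by (simp add: \<psi>_def h_def)
  qed
  show "a = b"
   by (rule WAP_iterated_limits_functionals[OF f x \<psi>D \<psi>n]) (use al be eq in auto)
 qed
 ultimately show ?thesis by (simp add: WAP_iff h_eq)
qed

lemma WC_mult_closed:
 assumes \<mu>: "\<mu> : sg_carrier WC" and \<nu>: "\<nu> : sg_carrier WC"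
 shows "\<mu> \<cdot>\<^bsub>WC\<^esub> \<nu> : sg_carrier WC"
proof -
 note fa = function_algebra_add[OF function_algebra_WAP] function_algebra_scale[OF function_algebra_WAP]
  function_algebra_mult[OF function_algebra_WAP] function_algebra_one[OF function_algebra_WAP]
 have \<mu>': "\<mu> : gelfand_spectrum G WAPG" and \<nu>': "\<nu> : gelfand_spectrum G WAPG" using assms by (simp_all add: sg_carrier_WC)
 \<comment> \<open>\<open>I\<close> is an algebra homomorphism of \<open>WAP\<close> into itself,
   and the product is \<mu> composed with \<open>I\<close>; this is why it is again a
   character.\<close>
 define I where "I = (%f. FN x. \<nu> (translate G x f))"
 have I: "f : WAPG ==> I f : WAPG" for f unfolding I_def by (rule WAP_introverted[OF \<nu>'])
 have m: "(\<mu> \<cdot>\<^bsub>WC\<^esub> \<nu>) f = \<mu> (I f)" if "f : WAPG" for f using that by (simp add: sg_mult_WC I_def)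
 have t: "translate G x (FN x. u (f x) (g x)) = (FN y. u (translate G x f y) (translate G x g y))"
  if "x : carrier G" for x f g and u :: "complex => complex => complex"
  using that by (auto simp: translate_def fun_eq_iff)
 note tW = translate_WAP
 have Iadd: "I (FN x. f x + g x) = (FN x. I f x + I g x)" if f: "f : WAPG" and g: "g : WAPG" for f g
  unfolding I_def
 proof (intro restrict_ext)
  fix x assume x: "x : carrier G"
  show "\<nu> (translate G x (FN x. f x + g x)) = (FN x. \<nu> (translate G x f)) x + (FN x. \<nu> (translate G x g)) x"
   unfolding t[OF x, of "(+)"] using tW[OF f x] tW[OF g x] \<nu>' x by (simp add: gelfand_spectrum_def)
 qed
 have Imult: "I (FN x. f x * g x) = (FN x. I f x * I g x)" if f: "f : WAPG" and g: "g : WAPG" for f g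
  unfolding I_def
 proof (intro restrict_ext)
  fix x assume x: "x : carrier G"
  show "\<nu> (translate G x (FN x. f x * g x)) = (FN x. \<nu> (translate G x f)) x * (FN x. \<nu> (translate G x g)) x"
   unfolding t[OF x, of "(*)"] using tW[OF f x] tW[OF g x] \<nu>' x by (simp add: gelfand_spectrum_def)
 qed
 have Iscale: "I (FN x. c * f x) = (FN x. c * I f x)" if f: "f : WAPG" for f c
  unfolding I_def
 proof (intro restrict_ext)
  fix x assume x: "x : carrier G"
  show "\<nu> (translate G x (FN x. c * f x)) = c * (FN x. \<nu> (translate G x f)) x"
   unfolding t[OF x, of "%a b. c * a"] using tW[OF f x] \<nu>' x by (simp add: gelfand_spectrum_def)
 qed
 have one1: "\<rho> (FN x. 1) = 1" if \<rho>: "\<rho> : gelfand_spectrum G WAPG" for \<rho>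
 proof -
  obtain f0 where f0: "f0 : WAPG" "\<rho> f0 ~= 0" using \<rho> by (auto simp: gelfand_spectrum_def)
  have "f0 : extensional (carrier G)" using WAP_CB[OF f0(1)] by (simp add: CB_def)
  then have "(FN x. (FN x. 1) x * f0 x) = f0" by (auto simp: fun_eq_iff extensional_def)
  moreover have "\<rho> (FN x. (FN x. 1) x * f0 x) = \<rho> (FN x. 1) * \<rho> f0"
   using \<rho> fa(4) f0(1) unfolding gelfand_spectrum_def by blast
  ultimately show ?thesis using f0(2) by simp
 qed
 have "I (FN x. 1) = (FN x. 1)"
  unfolding I_def
 proof (intro restrict_ext)
  fix x assume x: "x : carrier G"
  have "translate G x (FN x. (1::complex)) = (FN x. 1)" using x by (auto simp: translate_def fun_eq_iff)
  then show "\<nu> (translate G x (FN x. 1)) = 1" using one1[OF \<nu>'] by simp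
 qed
 then have "(\<mu> \<cdot>\<^bsub>WC\<^esub> \<nu>) (FN x. 1) = 1" using m[OF fa(4)] one1[OF \<mu>'] by simp
 then have nz: "EX f:WAPG. (\<mu> \<cdot>\<^bsub>WC\<^esub> \<nu>) f ~= 0" using fa(4) by force
 have \<mu>p: "!!f g. f : WAPG ==> g : WAPG ==> \<mu> (FN x. f x + g x) = \<mu> f + \<mu> g"
  "!!f g. f : WAPG ==> g : WAPG ==> \<mu> (FN x. f x * g x) = \<mu> f * \<mu> g"
  "!!f c. f : WAPG ==> \<mu> (FN x. c * f x) = c * \<mu> f"
  using \<mu>' unfolding gelfand_spectrum_def by blast+
 show ?thesis
  unfolding sg_carrier_WC gelfand_spectrum_def
 proof (intro CollectI conjI ballI allI nz)
  show "\<mu> \<cdot>\<^bsub>WC\<^esub> \<nu> : extensional WAPG" by (simp add: sg_mult_WC)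
  fix f assume f: "f : WAPG"
  show "(\<mu> \<cdot>\<^bsub>WC\<^esub> \<nu>) (FN x. c * f x) = c * (\<mu> \<cdot>\<^bsub>WC\<^esub> \<nu>) f" for c
   unfolding m[OF fa(2)[OF f]] m[OF f] Iscale[OF f] by (rule \<mu>p(3)[OF I[OF f]])
  fix g assume g: "g : WAPG"
  show "(\<mu> \<cdot>\<^bsub>WC\<^esub> \<nu>) (FN x. f x + g x) = (\<mu> \<cdot>\<^bsub>WC\<^esub> \<nu>) f + (\<mu> \<cdot>\<^bsub>WC\<^esub> \<nu>) g"
   unfolding m[OF fa(1)[OF f g]] m[OF f] m[OF g] Iadd[OF f g] by (rule \<mu>p(1)[OF I[OF f] I[OF g]])
  show "(\<mu> \<cdot>\<^bsub>WC\<^esub> \<nu>) (FN x. f x * g x) = (\<mu> \<cdot>\<^bsub>WC\<^esub> \<nu>) f * (\<mu> \<cdot>\<^bsub>WC\<^esub> \<nu>) g"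
   unfolding m[OF fa(3)[OF f g]] m[OF f] m[OF g] Imult[OF f g] by (rule \<mu>p(2)[OF I[OF f] I[OF g]])
 qed
qed

lemma evaluation_mult:
 assumes "x : carrier G" "y : carrier G"
 shows "evaluation WAPG x \<cdot>\<^bsub>WC\<^esub> evaluation WAPG y = evaluation WAPG (x \<otimes> y)"
proof -
 have "(FN z. evaluation WAPG y (translate G z f)) : WAPG" if "f : WAPG" for f
  by (rule WAP_introverted[OF evaluation_in_spectrum(2)[OF function_algebra_WAP assms(2)] that])
 then show ?thesis
  using assms translate_WAP by (auto simp: sg_mult_WC evaluation_def fun_eq_iff translate_def)
qed

end

section \<open>Compact sets and bumps in a topological group\<close>

context top_grp
begin

lemma inv_cancel:
 assumes "x : carrier G" "y : carrier G"
 shows "inv x \<otimes> (x \<otimes> y) = y" "x \<otimes> (inv x \<otimes> y) = y"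
 using assms by (simp_all add: m_assoc[symmetric])

lemmas grp_simps = m_assoc inv_mult_group inv_cancel

lemma compactin_carrier: "compactin T A ==> A \<subseteq> carrier G"
 using compactin_subset_topspace by fastforce

lemma compactin_set_mult: "compactin T A ==> compactin T B ==> compactin T (A <#> B)"
proof -
 assume AB: "compactin T A" "compactin T B"
 have "A <#> B = (%p. fst p \<otimes> snd p) ` (A \<times> B)" unfolding set_mult_def by force
 moreover have "continuous_map (prod_topology T T) T (%p. fst p \<otimes> snd p)"
  by (intro continuous_map_mult continuous_map_fst continuous_map_snd)
 moreover have "compactin (prod_topology T T) (A \<times> B)" using AB by (simp add: compactin_Times)
 ultimately show ?thesis using image_compactin by metis
qed

lemma compactin_inverses: "compactin T A ==> compactin T ((%x. inv x) ` A)"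
 by (rule image_compactin[OF _ continuous_map_inv]) auto

lemma compactin_single: "x : carrier G ==> compactin T {x}" by simp

lemma mem_set_multI: "a : A ==> b : B ==> a \<otimes> b : A <#> B" by (auto simp: set_mult_def)

lemma openin_rtranslate: "openin T U ==> c : carrier G ==> openin T {z : carrier G. z \<otimes> c : U}"
 using openin_continuous_map_preimage[OF continuous_map_rmult] by simp

lemma openin_ltranslate: "openin T U ==> c : carrier G ==> openin T {z : carrier G. c \<otimes> z : U}"
 using openin_continuous_map_preimage[OF continuous_map_lmult] by simp

lemma symmetric_compact_neighbourhood:
 assumes "locally_compact_space T"
 obtains U V where "openin T U" "\<one> : U" "U \<subseteq> V" "compactin T V" "!!v. v : V ==> inv v : V"
proof -
 obtain U K where UK: "openin T U" "compactin T K" "\<one> : U" "U \<subseteq> K"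
  using bspec[OF assms[unfolded locally_compact_space_def], of \<one>] by auto
 define V where "V = K \<union> (%x. inv x) ` K"
 show thesis
 proof (rule that[of U V])
  show "compactin T V" unfolding V_def using UK compactin_inverses by (simp add: compactin_Un)
  show "inv v : V" if "v : V" for v using that compactin_carrier[OF UK(2)] by (auto simp: V_def subset_iff)
 qed (use UK in \<open>auto simp: V_def\<close>)
qed

text \<open>Off \<open>V <#> V\<close> neither \<open>z\<close> nor \<open>u \<otimes> z\<close>
  meets the support, since \<open>V\<close> is symmetric. On the compact set \<open>V <#> V\<close>
  the tube lemma finds one neighbourhood of the identity for all \<open>z\<close>.\<close>

lemma uniformly_continuous_bump:
 assumes lc: "locally_compact_space T" and U: "openin T U" "\<one> : U" "U \<subseteq> V" and V: "compactin T V"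
  and sym: "!!v. v : V ==> inv v : V"
 obtains h :: "'a => real" where "h \<one> = 1" "!!x. 0 <= h x & h x <= 1" "!!x. x : carrier G - V ==> h x = 0"
  "!!e. 0 < e ==> EX W. openin T W & \<one> : W & (ALL u:W. ALL z:carrier G. \<bar>h (u \<otimes> z) - h z\<bar> <= e)"
proof -
 have cr: "completely_regular_space T"
  using locally_compact_regular_imp_completely_regular_space[OF lc] Hausdorff_T by blast
 have "closedin T (carrier G - U)" using U(1) by (metis closedin_topspace openin_diff closedin_diff topspace_T)
 then obtain f0 where f0: "continuous_map T (top_of_set {0..1::real}) f0" "f0 \<one> = 0" "f0 ` (carrier G - U) \<subseteq> {1}"
  using cr[unfolded completely_regular_space_def] U(2) by (metis DiffD2 DiffI one_closed topspace_T)
 define h where "h = (%x. if x : carrier G then 1 - f0 x else 0)"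
 have f01: "f0 x : {0..1}" if "x : carrier G" for x using f0(1) that by (auto simp: continuous_map_in_subtopology)
 have hU: "h x = 0" if "x : carrier G" "x ~: U" for x using f0(3) that by (auto simp: h_def)
 have "continuous_map T euclideanreal (%x. 1 - f0 x)"
  using f0(1) by (intro continuous_map_diff) (auto simp: continuous_map_in_subtopology)
 then have hc: "continuous_map T euclideanreal h" by (rule continuous_map_eq) (simp add: h_def)
 show thesis
 proof (rule that[of h])
  show "h \<one> = 1" using f0(2) by (simp add: h_def)
  show "0 <= h x & h x <= 1" for x using f01 by (auto simp: h_def)
  show "h x = 0" if "x : carrier G - V" for x using hU that U(3) by blast
  fix e :: real assume e: "0 < e"
  let ?W = "{p : topspace (prod_topology T T). h (fst p \<otimes> snd p) - h (snd p) : {-e<..<e}}"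
  have "continuous_map (prod_topology T T) euclideanreal (%p. h (fst p \<otimes> snd p) - h (snd p))"
  proof (intro continuous_map_diff)
   have "continuous_map (prod_topology T T) T (%p. fst p \<otimes> snd p)"
    by (intro continuous_map_mult continuous_map_fst continuous_map_snd)
   from continuous_map_compose[OF this hc]
   show "continuous_map (prod_topology T T) euclideanreal (%p. h (fst p \<otimes> snd p))" by (simp add: o_def)
   have "continuous_map (prod_topology T T) T snd" by (rule continuous_map_snd)
   from continuous_map_compose[OF this hc]
   show "continuous_map (prod_topology T T) euclideanreal (%p. h (snd p))" by (simp add: o_def)
  qed
  then have W: "openin (prod_topology T T) ?W" by (rule openin_continuous_map_preimage) simp
  have K: "compactin T (V <#> V)" by (rule compactin_set_mult[OF V V])
  have Vc: "V \<subseteq> carrier G" "V <#> V \<subseteq> carrier G" using V K compactin_carrier by blast+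
  have "{\<one>} \<times> (V <#> V) \<subseteq> ?W" using Vc(2) e by auto
  from tube_lemma_right[OF W K _ this] obtain A B where AB: "openin T A" "\<one> : A" "V <#> V \<subseteq> B" "A \<times> B \<subseteq> ?W" by auto
  have "\<bar>h (u \<otimes> z) - h z\<bar> <= e" if u: "u : A \<inter> U" and z: "z : carrier G" for u z
  proof (cases "z : V <#> V")
   case True
   then have "(u, z) : ?W" using AB u by blast
   then show ?thesis by auto
  next
   case False
   have uc: "u : carrier G" "u : V" using u U Vc by auto
   have oneV: "\<one> : V" using U by blast
   have "z ~: V" using False mem_set_multI[of z V \<one> V] oneV z by auto
   moreover have "u \<otimes> z ~: V"
   proof
    assume "u \<otimes> z : V"
    then have "inv u \<otimes> (u \<otimes> z) : V <#> V" using sym uc by (intro mem_set_multI) auto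
    then show False using False uc z by (simp add: m_assoc[symmetric])
   qed
   ultimately have "h z = 0" "h (u \<otimes> z) = 0" using hU U(3) uc z by auto
   then show ?thesis using e by simp
  qed
  then show "EX W. openin T W & \<one> : W & (ALL u:W. ALL z:carrier G. \<bar>h (u \<otimes> z) - h z\<bar> <= e)"
   using AB U by (intro exI[of _ "A \<inter> U"]) auto
 qed
qed

end

text \<open>Covers the case in which one of the two sequences of group elements has a cluster point:
  its translates return uniformly close to a fixed function \<open>g\<close>, and both iterated
  limits are the limit of \<open>g\<close>.\<close>

lemma iterated_limits_eqI:
 fixes c :: "nat => nat => complex"
 assumes al: "!!i. (%j. c i j) ----> \<alpha> i" "\<alpha> ----> a"
  and be: "!!j. (%i. c i j) ----> \<beta> j" "\<beta> ----> b"
  and near: "!!e. 0 < e ==> infinite {i. ALL j. cmod (c i j - g j) <= e}"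
 shows "a = b"
proof -
 have inf: "EX i>=N. ALL j. cmod (c i j - g j) <= e" if "0 < e" for e N
  using near[OF that] unfolding infinite_nat_iff_unbounded_le by blast
 have small: "z = 0" if "!!e. 0 < e ==> cmod z <= 2 * e" for z :: complex
 proof (rule ccontr)
  assume "z ~= 0" then show False using that[of "cmod z / 4"] by simp
 qed
 have bg: "\<beta> j = g j" for j
 proof -
  have "cmod (\<beta> j - g j) <= 2 * e" if e: "0 < e" for e
  proof -
   obtain N where N: "!!i. i >= N ==> cmod (c i j - \<beta> j) < e" using be(1)[of j] e unfolding LIMSEQ_iff by blast
   obtain i where "i >= N" "cmod (c i j - g j) <= e" using inf[OF e] by blast
   then show ?thesis using N[of i] norm_triangle_ineq4[of "c i j - g j" "c i j - \<beta> j"] by simp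
  qed
  then show ?thesis using small[of "\<beta> j - g j"] by simp
 qed
 have "cmod (a - b) <= 2 * e" if e: "0 < e" for e
 proof -
  obtain N where N: "!!i. i >= N ==> cmod (\<alpha> i - a) < e" using al(2) e unfolding LIMSEQ_iff by blast
  obtain i where i: "i >= N" "!!j. cmod (c i j - g j) <= e" using inf[OF e] by blast
  have "cmod (\<alpha> i - b) <= e"
   by (rule Lim_bounded[OF tendsto_norm[OF tendsto_diff[OF al(1)[of i] be(2)]], of 0]) (simp add: bg i)
  then show ?thesis using N[OF i(1)] norm_triangle_ineq4[of "\<alpha> i - b" "\<alpha> i - a"] by simp
 qed
 then show ?thesis using small[of "a - b"] by simp
qed

section \<open>Smeared indicators of sparse sets\<close>

text \<open>
  Smearing the indicator of \<open>E\<close> by a bump on both sides makes it uniformly continuous on both sides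
  for an arbitrary group, without any control over conjugation.
\<close>

locale smeared_set = top_grp G T + Q: group Q
 for G :: "'a monoid" (structure) and T and Q :: "'b monoid" +
 fixes \<phi> :: "'a => 'b" and V E :: "'a set" and h :: "'a => real"
 assumes hom: "\<phi> : hom G Q"
  and V: "compactin T V" "!!v. v : V ==> inv v : V"
  and E: "E \<subseteq> carrier G"
  and h01: "!!x. 0 <= h x & h x <= 1" and h_out: "!!x. x : carrier G - V ==> h x = 0"
  and h_uc: "!!e. 0 < e ==> EX W. openin T W & \<one> : W & (ALL u:W. ALL z:carrier G. \<bar>h (u \<otimes> z) - h z\<bar> <= e)"
begin

sublocale \<phi>: group_hom G Q \<phi> using hom by (simp add: group_hom_def group_hom_axioms_def)

text \<open>Equality is required only after \<phi>, so that the smeared function factors through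
  \<phi>. The argument \<open>inv w\<close> turns a right translation of \<open>x\<close> into a
  left translation inside \<open>h\<close>, whence left uniform continuity of \<open>h\<close>
  serves both sides. The inserted 0 keeps the supremum defined away from the thickened set.\<close>

definition vals :: "'a => real set" where
 "vals x = insert 0 {min (h v) (h (inv w)) | v p w. v : carrier G & p : E & w : carrier G & \<phi> x = \<phi> (v \<otimes> p \<otimes> w)}"

definition smear :: "'a => real" where "smear x = Sup (vals x)"

lemma vals_bounds: "y : vals x ==> 0 <= y & y <= 1"
 using h01 by (auto simp: vals_def min_def)

lemma bdd_vals: "bdd_above (vals x)" using vals_bounds by (meson bdd_aboveI)

lemma smear_ge: "y : vals x ==> y <= smear x"
 unfolding smear_def by (rule cSup_upper[OF _ bdd_vals])

lemma smear_leI: "0 <= c ==> (!!v p w. v : carrier G ==> p : E ==> w : carrier G ==> \<phi> x = \<phi> (v \<otimes> p \<otimes> w)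
  ==> min (h v) (h (inv w)) <= c) ==> smear x <= c"
 unfolding smear_def by (rule cSup_least) (auto simp: vals_def)

lemma smear_mem: "v : carrier G ==> p : E ==> w : carrier G ==> \<phi> x = \<phi> (v \<otimes> p \<otimes> w)
  ==> min (h v) (h (inv w)) <= smear x"
 by (rule smear_ge) (auto simp: vals_def)

lemma smear_bounds: "0 <= smear x & smear x <= 1"
 using smear_ge[of 0 x] smear_leI[of 1 x] h01 by (auto simp: vals_def min_def)

lemma smear_cong: "\<phi> x = \<phi> y ==> smear x = smear y"
 by (simp add: smear_def vals_def)

lemma smear_nonzero:
 assumes "smear x ~= 0"
 obtains v p w where "v : V" "p : E" "w : V" "\<phi> x = \<phi> (v \<otimes> p \<otimes> w)"
proof (rule ccontr)
 note found = that
 assume none: "~ thesis"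
 have "smear x <= 0"
 proof (rule smear_leI)
  fix v p w assume vpw: "v : carrier G" "p : E" "w : carrier G" "\<phi> x = \<phi> (v \<otimes> p \<otimes> w)"
  have "v ~: V \<or> inv w ~: V"
  proof (rule ccontr)
   assume "~ ?thesis"
   then have "v : V" "w : V" using V(2)[of "inv w"] vpw(3) by auto
   then show False using none found vpw by blast
  qed
  then show "min (h v) (h (inv w)) <= 0" using h_out vpw h01 by (auto simp: min_def)
 qed simp
 then show False using smear_bounds[of x] assms by simp
qed

definition close :: "real => 'a => bool" where
 "close e u \<longleftrightarrow> u : carrier G & (ALL z:carrier G. \<bar>h (u \<otimes> z) - h z\<bar> <= e)"

lemma close_inv: "close e u ==> close e (inv u)"
 unfolding close_def
proof (intro conjI ballI; elim conjE)
 fix z assume u: "u : carrier G" "ALL z:carrier G. \<bar>h (u \<otimes> z) - h z\<bar> <= e" and z: "z : carrier G"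
 have "\<bar>h (u \<otimes> (inv u \<otimes> z)) - h (inv u \<otimes> z)\<bar> <= e" using u z by simp
 then show "\<bar>h (inv u \<otimes> z) - h z\<bar> <= e" using u(1) z by (simp add: m_assoc[symmetric] abs_minus_commute)
qed simp

lemma smear_left1:
 assumes u: "close e u" and x: "x : carrier G" shows "smear x <= smear (u \<otimes> x) + e"
proof (rule smear_leI)
 have uc: "u : carrier G" using u by (simp add: close_def)
 have "0 <= e" using u unfolding close_def by (meson abs_ge_zero one_closed order_trans)
 then show "0 <= smear (u \<otimes> x) + e" using smear_bounds[of "u \<otimes> x"] by simp
 fix v p w assume vpw: "v : carrier G" "p : E" "w : carrier G" "\<phi> x = \<phi> (v \<otimes> p \<otimes> w)"
 have pc: "p : carrier G" using vpw E by blast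
 have "\<phi> (u \<otimes> x) = \<phi> ((u \<otimes> v) \<otimes> p \<otimes> w)" using vpw uc pc x by (simp add: Q.m_assoc)
 then have "min (h (u \<otimes> v)) (h (inv w)) <= smear (u \<otimes> x)" using vpw uc by (intro smear_mem) auto
 moreover have "\<bar>h (u \<otimes> v) - h v\<bar> <= e" using u vpw(1) by (simp add: close_def)
 ultimately show "min (h v) (h (inv w)) <= smear (u \<otimes> x) + e" using \<open>0 <= e\<close> by linarith
qed

lemma smear_right1:
 assumes u: "close e u" and x: "x : carrier G" shows "smear x <= smear (x \<otimes> inv u) + e"
proof (rule smear_leI)
 have uc: "u : carrier G" using u by (simp add: close_def)
 have "0 <= e" using u unfolding close_def by (meson abs_ge_zero one_closed order_trans)
 then show "0 <= smear (x \<otimes> inv u) + e" using smear_bounds[of "x \<otimes> inv u"] by simp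
 fix v p w assume vpw: "v : carrier G" "p : E" "w : carrier G" "\<phi> x = \<phi> (v \<otimes> p \<otimes> w)"
 have pc: "p : carrier G" using vpw E by blast
 have "\<phi> (x \<otimes> inv u) = \<phi> (v \<otimes> p \<otimes> (w \<otimes> inv u))" using vpw uc pc x by (simp add: Q.m_assoc)
 then have "min (h v) (h (inv (w \<otimes> inv u))) <= smear (x \<otimes> inv u)" using vpw uc by (intro smear_mem) auto
 moreover have "h (inv (w \<otimes> inv u)) = h (u \<otimes> inv w)" using vpw uc by (simp add: inv_mult_group)
 moreover have "\<bar>h (u \<otimes> inv w) - h (inv w)\<bar> <= e" using u vpw(3) by (simp add: close_def)
 ultimately show "min (h v) (h (inv w)) <= smear (x \<otimes> inv u) + e" using \<open>0 <= e\<close> by linarith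
qed

lemma smear_left: "close e u ==> x : carrier G ==> \<bar>smear (u \<otimes> x) - smear x\<bar> <= e"
 using smear_left1[of e u x] smear_left1[OF close_inv, of e u "u \<otimes> x"]
 by (auto simp: close_def m_assoc[symmetric] abs_le_iff)

lemma smear_right: "close e u ==> x : carrier G ==> \<bar>smear (x \<otimes> u) - smear x\<bar> <= e"
 using smear_right1[OF close_inv, of e u x] smear_right1[of e u "x \<otimes> u"]
 by (auto simp: close_def m_assoc abs_le_iff)

lemma close_nbhd: "0 < e ==> EX W. openin T W & \<one> : W & (ALL u:W. close e u)"
 using h_uc[of e] openin_subset[of T] unfolding close_def by (metis subsetD topspace_T)

definition F :: "'a => complex" where "F = (FN x. of_real (smear x))"

lemma F_CB: "F : CB G T"
proof -
 have "continuous_map T euclidean F"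
  unfolding continuous_map_to_metric_iff
 proof (intro ballI allI impI)
  fix x and e :: real assume x: "x : topspace T" and e: "0 < e"
  obtain W where W: "openin T W" "\<one> : W" "!!u. u : W ==> close (e/2) u" using close_nbhd[of "e/2"] e by auto
  define U where "U = {z : carrier G. z \<otimes> inv x : W}"
  have U: "openin T U" "x : U" using openin_rtranslate[OF W(1)] x W(2) by (auto simp: U_def)
  have "dist (F y) (F x) < e" if y: "y : U" for y
  proof -
   have yc: "y : carrier G" "close (e/2) (y \<otimes> inv x)" using y W(3) by (auto simp: U_def)
   have "\<bar>smear ((y \<otimes> inv x) \<otimes> x) - smear x\<bar> <= e/2" using smear_left[OF yc(2)] x by simp
   then have "\<bar>smear y - smear x\<bar> <= e/2" using yc x by (simp add: m_assoc)
   then show ?thesis using e yc x by (simp add: F_def dist_norm flip: of_real_diff)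
  qed
  then show "EX U. openin T U & x : U & (ALL y:U. dist (F y) (F x) < e)" using U by blast
 qed
 moreover have "bounded (F ` carrier G)"
 proof -
  have "\<bar>smear x\<bar> <= 1" for x using smear_bounds[of x] by simp
  then show ?thesis unfolding bounded_iff by (intro exI[of _ 1]) (auto simp: F_def)
 qed
 ultimately show ?thesis by (simp add: CB_def F_def)
qed

text \<open>Escape is meant modulo the kernel of \<phi>, because the smeared function depends on
  \<open>\<phi> x\<close> only.\<close>

definition escapes :: "(nat => 'a) => bool" where
 "escapes x \<longleftrightarrow> (ALL C. compactin T C --> (\<forall>\<^sub>F i in sequentially. \<phi> (x i) ~: \<phi> ` C))"

lemma not_escapes:
 assumes "range x \<subseteq> carrier G" "~ escapes x"
 obtains c where "c : carrier G" "!!e. 0 < e ==> infinite {i. EX y:carrier G. \<phi> (x i) = \<phi> y & close e (y \<otimes> inv c) & close e (inv c \<otimes> y)}"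
proof -
 obtain C where C: "compactin T C" "~ (\<forall>\<^sub>F i in sequentially. \<phi> (x i) ~: \<phi> ` C)" using assms(2) by (auto simp: escapes_def)
 then have "infinite {i. \<phi> (x i) : \<phi> ` C}" by (simp add: eventually_sequentially infinite_nat_iff_unbounded_le)
 then obtain r :: "nat => nat" where r: "strict_mono r" "!!n. r n : {i. \<phi> (x i) : \<phi> ` C}"
  using infinite_enumerate by metis
 then have "ALL n. EX y:C. \<phi> (x (r n)) = \<phi> y" by blast
 then obtain y where y: "!!n. y n : C" "!!n. \<phi> (x (r n)) = \<phi> (y n)" by metis
 obtain c where c: "c : C" "!!U. openin T U ==> c : U ==> infinite {n. y n : U}"
  using compactin_sequence_cluster_point[OF C(1), of y] y(1) by metis
 have cc: "c : carrier G" using c compactin_carrier[OF C(1)] by blast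
 show thesis
 proof (rule that[OF cc])
  fix e :: real assume e: "0 < e"
  obtain W where W: "openin T W" "\<one> : W" "!!u. u : W ==> close e u" using close_nbhd[OF e] by blast
  define U where "U = {z : carrier G. z \<otimes> inv c : W} \<inter> {z : carrier G. inv c \<otimes> z : W}"
  have "openin T U" "c : U" using openin_rtranslate[OF W(1)] openin_ltranslate[OF W(1)] W(2) cc by (auto simp: U_def)
  then have "infinite (r ` {n. y n : U})"
   using c(2) strict_mono_imp_inj_on[OF r(1)] finite_imageD inj_on_subset by blast
  moreover have "r ` {n. y n : U} \<subseteq> {i. EX y:carrier G. \<phi> (x i) = \<phi> y & close e (y \<otimes> inv c) & close e (inv c \<otimes> y)}"
   using y W(3) by (auto simp: U_def)
  ultimately show "infinite {i. EX y:carrier G. \<phi> (x i) = \<phi> y & close e (y \<otimes> inv c) & close e (inv c \<otimes> y)}"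
   using finite_subset by blast
 qed
qed

lemma escapes_inv:
 assumes "escapes x" "!!i. x i : carrier G"
 shows "escapes (%i. inv (x i))"
 unfolding escapes_def
proof (intro allI impI)
 fix C assume C: "compactin T C"
 have "\<forall>\<^sub>F i in sequentially. \<phi> (x i) ~: \<phi> ` (%z. inv z) ` C"
  using assms(1) compactin_inverses[OF C] unfolding escapes_def by blast
 then show "\<forall>\<^sub>F i in sequentially. \<phi> (inv (x i)) ~: \<phi> ` C"
 proof (rule eventually_mono, intro notI)
  fix i assume n: "\<phi> (x i) ~: \<phi> ` (%z. inv z) ` C" and "\<phi> (inv (x i)) : \<phi> ` C"
  then obtain c where c: "c : C" "\<phi> (inv (x i)) = \<phi> c" by blast
  then have cc: "c : carrier G" using compactin_carrier[OF C] by blast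
  have "\<phi> (x i) = inv\<^bsub>Q\<^esub> \<phi> (inv (x i))" using assms(2) by simp
  then have "\<phi> (x i) = \<phi> (inv c)" using c(2) cc by simp
  then show False using n c(1) by blast
 qed
qed

text \<open>For two late indices \<open>N\<close> and \<open>k\<close> both
  \<open>x N \<otimes> y j\<close> and \<open>x k \<otimes> y j\<close> lie in \<open>V E' V\<close>
  for large \<open>j\<close>. The element \<open>z\<close>, which is \<open>x k\<close> times the
  inverse of \<open>x N\<close>, does not depend on \<open>j\<close> and ties the two points of
  \<open>E'\<close> together through the compact set \<open>V z V\<close>. As this set misses
  \<open>C0\<close>, only finitely many pairs are possible, and \<open>y j\<close> is confined to a
  compact set.\<close>

lemma iterated_limit_zero:
 fixes K :: "nat => nat => complex"
 assumes C0: "compactin T C0" and E: "E' \<subseteq> carrier G"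
  and fin: "!!C. compactin T C ==> \<phi> ` C \<inter> \<phi> ` C0 = {} ==>
   finite {(p, q). p : E' & q : E' & (EX d:V. EX d':V. \<phi> (p \<otimes> d \<otimes> d' \<otimes> inv q) : \<phi> ` C)}"
  and xc: "!!i. x i : carrier G" and yc: "!!i. y i : carrier G" and esc: "escapes x" "escapes y"
  and K0: "!!i j. K i j ~= 0 ==> EX v:V. EX p:E'. EX w:V. \<phi> (x i \<otimes> y j) = \<phi> (v \<otimes> p \<otimes> w)"
  and lim: "!!i. (%j. K i j) ----> \<alpha> i" "\<alpha> ----> a"
 shows "a = 0"
proof (rule ccontr)
 have Vc: "V \<subseteq> carrier G" and C0c: "C0 \<subseteq> carrier G" using V(1) C0 compactin_carrier by blast+
 have K: thesis if "K i j ~= 0" "!!v p w. v : V ==> p : E' ==> w : V ==> \<phi> (x i \<otimes> y j) = \<phi> (v \<otimes> p \<otimes> w) ==> thesis" for i j thesis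
  using K0[OF that(1)] that(2) by blast
 assume "a ~= 0"
 then obtain N where N: "!!i. i >= N ==> \<alpha> i ~= 0"
  using tendsto_imp_eventually_ne[OF lim(2)] by (auto simp: eventually_sequentially)
 \<comment> \<open>The shape of \<open>C1\<close> is dictated by what follows: \<open>x k\<close>
   outside it, modulo \<phi>, means exactly that \<open>V z V\<close> does not meet
   \<open>C0\<close>.\<close>
 define C1 where "C1 = V <#> C0 <#> V <#> {x N}"
 have "compactin T C1" unfolding C1_def by (intro compactin_set_mult V C0 compactin_single xc)
 then have "\<forall>\<^sub>F i in sequentially. \<phi> (x i) ~: \<phi> ` C1" using esc(1) by (auto simp: escapes_def)
 then obtain k where k: "k >= N" "\<phi> (x k) ~: \<phi> ` C1" by (auto simp: eventually_sequentially) (meson nat_le_linear)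
 define z where "z = x k \<otimes> inv (x N)"
 have z: "z : carrier G" using xc by (simp add: z_def)
 define C where "C = V <#> {z} <#> V"
 have C: "compactin T C" unfolding C_def by (intro compactin_set_mult V compactin_single z)
 have "\<phi> ` C \<inter> \<phi> ` C0 = {}"
 proof (rule ccontr)
  assume "~ ?thesis"
  then obtain v w c where vwc: "v : V" "w : V" "c : C0" "\<phi> (v \<otimes> z \<otimes> w) = \<phi> c"
   by (auto simp: C_def set_mult_def)
  have cc: "v : carrier G" "w : carrier G" "c : carrier G" using vwc Vc C0c by auto
  have "\<phi> (inv v \<otimes> c \<otimes> inv w \<otimes> x N) = inv\<^bsub>Q\<^esub> (\<phi> v) \<otimes>\<^bsub>Q\<^esub> \<phi> (v \<otimes> z \<otimes> w) \<otimes>\<^bsub>Q\<^esub> inv\<^bsub>Q\<^esub> (\<phi> w) \<otimes>\<^bsub>Q\<^esub> \<phi> (x N)"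
   using cc xc by (simp add: vwc(4))
  also have "\<dots> = \<phi> (inv v \<otimes> (v \<otimes> z \<otimes> w) \<otimes> inv w \<otimes> x N)" using cc xc z by simp
  also have "inv v \<otimes> (v \<otimes> z \<otimes> w) \<otimes> inv w \<otimes> x N = x k"
   using cc xc by (simp add: z_def grp_simps)
  finally have "\<phi> (x k) : \<phi> ` C1"
   using vwc V(2) by (auto simp: C1_def intro!: image_eqI[OF sym] mem_set_multI)
  then show False using k by blast
 qed
 from fin[OF C this] have fin: "finite {(p, q). p : E' & q : E' & (EX d:V. EX d':V. \<phi> (p \<otimes> d \<otimes> d' \<otimes> inv q) : \<phi> ` C)}" (is "finite ?\<Pi>") .
 define C2 where "C2 = (\<Union>q\<in>snd ` ?\<Pi>. {inv (x N)} <#> V <#> {q} <#> V)"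
 have "compactin T C2"
  unfolding C2_def
 proof (rule compactin_Union)
  show "finite ((%q. {inv (x N)} <#> V <#> {q} <#> V) ` snd ` ?\<Pi>)" using fin by simp
  fix S assume "S : (%q. {inv (x N)} <#> V <#> {q} <#> V) ` snd ` ?\<Pi>"
  then obtain q where "q : E'" "S = {inv (x N)} <#> V <#> {q} <#> V" by auto
  then show "compactin T S" using E xc by (auto intro!: compactin_set_mult V compactin_single)
 qed
 then have ev3: "\<forall>\<^sub>F j in sequentially. \<phi> (y j) ~: \<phi> ` C2" using esc(2) by (auto simp: escapes_def)
 have ev1: "\<forall>\<^sub>F j in sequentially. K N j ~= 0" by (rule tendsto_imp_eventually_ne[OF lim(1) N]) simp
 have ev2: "\<forall>\<^sub>F j in sequentially. K k j ~= 0" by (rule tendsto_imp_eventually_ne[OF lim(1) N[OF k(1)]])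
 obtain j where j: "K N j ~= 0" "K k j ~= 0" "\<phi> (y j) ~: \<phi> ` C2"
  using eventually_happens'[OF sequentially_bot eventually_conj[OF ev1 eventually_conj[OF ev2 ev3]]] by blast
 obtain v p w where vpw: "v : V" "p : E'" "w : V" "\<phi> (x k \<otimes> y j) = \<phi> (v \<otimes> p \<otimes> w)" by (rule K[OF j(2)], rule that)
 obtain v' q w' where vqw: "v' : V" "q : E'" "w' : V" "\<phi> (x N \<otimes> y j) = \<phi> (v' \<otimes> q \<otimes> w')" by (rule K[OF j(1)], rule that)
 have cc: "v : carrier G" "w : carrier G" "p : carrier G" "v' : carrier G" "w' : carrier G" "q : carrier G"
  using vpw vqw Vc E by auto
 have "\<phi> z = \<phi> (x k \<otimes> y j) \<otimes>\<^bsub>Q\<^esub> inv\<^bsub>Q\<^esub> \<phi> (x N \<otimes> y j)"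
 proof -
  have "(x k \<otimes> y j) \<otimes> inv (x N \<otimes> y j) = z"
   using xc yc by (simp add: z_def grp_simps)
  then show ?thesis using xc yc by (metis \<phi>.hom_inv \<phi>.hom_mult inv_closed m_closed)
 qed
 then have pz: "\<phi> z = \<phi> (v \<otimes> p \<otimes> w \<otimes> inv (v' \<otimes> q \<otimes> w'))" using vpw(4) vqw(4) cc by simp
 have "\<phi> (p \<otimes> w \<otimes> inv w' \<otimes> inv q) = \<phi> (inv v \<otimes> (v \<otimes> p \<otimes> w \<otimes> inv (v' \<otimes> q \<otimes> w')) \<otimes> v')"
  using cc by (intro arg_cong[of _ _ \<phi>]) (simp add: grp_simps)
 also have "\<dots> = \<phi> (inv v \<otimes> z \<otimes> v')" using cc z pz by simp
 also have "\<dots> : \<phi> ` C" using vpw vqw V(2) by (auto simp: C_def intro!: imageI mem_set_multI)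
 finally have "(p, q) : ?\<Pi>" using vpw vqw V(2) by blast
 then have q: "q : snd ` ?\<Pi>" by force
 have "\<phi> (y j) = \<phi> (inv (x N) \<otimes> (x N \<otimes> y j))" using xc yc by (simp add: grp_simps)
 also have "\<dots> = \<phi> (inv (x N) \<otimes> v' \<otimes> q \<otimes> w')"
  using xc yc cc vqw(4) by (simp add: Q.m_assoc)
 finally have "\<phi> (y j) = \<phi> (inv (x N) \<otimes> v' \<otimes> q \<otimes> w')" .
 moreover have "inv (x N) \<otimes> v' \<otimes> q \<otimes> w' : {inv (x N)} <#> V <#> {q} <#> V"
  using vqw by (intro mem_set_multI) auto
 then have "\<phi> (inv (x N) \<otimes> v' \<otimes> q \<otimes> w') : \<phi> ` C2" unfolding C2_def using q by blast
 ultimately show False using j(3) by simp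
qed

text \<open>If one sequence does not escape, its cluster point and uniform continuity on that side
  decide. If both escape, sparseness of \<open>E\<close> forces both iterated limits to
  vanish.\<close>

lemma iterated_F:
 assumes C0: "compactin T C0"
  and fin1: "!!C. compactin T C ==> \<phi> ` C \<inter> \<phi> ` C0 = {} ==>
   finite {(p, q). p : E & q : E & (EX d:V. EX d':V. \<phi> (p \<otimes> d \<otimes> d' \<otimes> inv q) : \<phi> ` C)}"
  and fin2: "!!C. compactin T C ==> \<phi> ` C \<inter> \<phi> ` C0 = {} ==>
   finite {(p, q). p : E & q : E & (EX d:V. EX d':V. \<phi> (inv p \<otimes> d \<otimes> d' \<otimes> q) : \<phi> ` C)}"
 shows "iterated F"
 unfolding iterated_limits_agree_def
proof (intro allI impI)
 fix x y :: "nat => 'a" and \<alpha> \<beta> a b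
 assume x: "range x \<subseteq> carrier G" and y: "range y \<subseteq> carrier G"
  and al: "ALL i. (%j. F (x i \<otimes> y j)) ----> \<alpha> i" "\<alpha> ----> a"
  and be: "ALL j. (%i. F (x i \<otimes> y j)) ----> \<beta> j" "\<beta> ----> b"
 have xc: "x i : carrier G" and yc: "y i : carrier G" for i using x y by auto
 have Vc: "V \<subseteq> carrier G" and C0c: "C0 \<subseteq> carrier G" using V(1) C0 compactin_carrier by blast+
 have \<phi>c: "z : carrier G ==> \<phi> z : carrier Q" for z by simp
 consider (1) "~ escapes x" | (2) "~ escapes y" | (3) "escapes x" "escapes y" by blast
 then show "a = b"
 proof cases
  case 1
  obtain c where c: "c : carrier G" "!!e. 0 < e ==> infinite {i. EX y:carrier G. \<phi> (x i) = \<phi> y & close e (y \<otimes> inv c) & close e (inv c \<otimes> y)}"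
   by (rule not_escapes[OF x 1], rule that)
  show ?thesis
  proof (rule iterated_limits_eqI[of "%i j. F (x i \<otimes> y j)" \<alpha> _ \<beta> _ "%j. F (c \<otimes> y j)"])
   fix e :: real assume e: "0 < e"
   have "{i. EX y:carrier G. \<phi> (x i) = \<phi> y & close e (y \<otimes> inv c) & close e (inv c \<otimes> y)}
     \<subseteq> {i. ALL j. cmod (F (x i \<otimes> y j) - F (c \<otimes> y j)) <= e}"
   proof clarify
    fix i z j assume z: "z : carrier G" "\<phi> (x i) = \<phi> z" "close e (z \<otimes> inv c)"
    have "smear (x i \<otimes> y j) = smear (z \<otimes> y j)" by (rule smear_cong) (simp add: xc yc z)
    moreover have "\<bar>smear ((z \<otimes> inv c) \<otimes> (c \<otimes> y j)) - smear (c \<otimes> y j)\<bar> <= e"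
     by (rule smear_left[OF z(3)]) (simp add: c yc)
    moreover have "(z \<otimes> inv c) \<otimes> (c \<otimes> y j) = z \<otimes> y j"
     using c(1) z(1) yc by (simp add: grp_simps)
    ultimately show "cmod (F (x i \<otimes> y j) - F (c \<otimes> y j)) <= e"
     using c(1) xc yc by (simp add: F_def flip: of_real_diff)
   qed
   then show "infinite {i. ALL j. cmod (F (x i \<otimes> y j) - F (c \<otimes> y j)) <= e}" using c(2)[OF e] finite_subset by blast
  qed (use al be in auto)
 next
  case 2
  obtain c where c: "c : carrier G" "!!e. 0 < e ==> infinite {i. EX z:carrier G. \<phi> (y i) = \<phi> z & close e (z \<otimes> inv c) & close e (inv c \<otimes> z)}"
   by (rule not_escapes[OF y 2], rule that)
  have "b = a"
  proof (rule iterated_limits_eqI[of "%i j. F (x j \<otimes> y i)" \<beta> _ \<alpha> _ "%j. F (x j \<otimes> c)"])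
   fix e :: real assume e: "0 < e"
   have "{i. EX z:carrier G. \<phi> (y i) = \<phi> z & close e (z \<otimes> inv c) & close e (inv c \<otimes> z)}
     \<subseteq> {i. ALL j. cmod (F (x j \<otimes> y i) - F (x j \<otimes> c)) <= e}"
   proof clarify
    fix i z j assume z: "z : carrier G" "\<phi> (y i) = \<phi> z" "close e (inv c \<otimes> z)"
    have "smear (x j \<otimes> y i) = smear (x j \<otimes> z)" by (rule smear_cong) (simp add: xc yc z)
    moreover have "\<bar>smear ((x j \<otimes> c) \<otimes> (inv c \<otimes> z)) - smear (x j \<otimes> c)\<bar> <= e"
     by (rule smear_right[OF z(3)]) (simp add: c xc)
    moreover have "(x j \<otimes> c) \<otimes> (inv c \<otimes> z) = x j \<otimes> z"
     using c(1) z(1) xc by (simp add: grp_simps)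
    ultimately show "cmod (F (x j \<otimes> y i) - F (x j \<otimes> c)) <= e"
     using c(1) xc yc by (simp add: F_def flip: of_real_diff)
   qed
   then show "infinite {i. ALL j. cmod (F (x j \<otimes> y i) - F (x j \<otimes> c)) <= e}" using c(2)[OF e] finite_subset by blast
  qed (use al be in auto)
  then show ?thesis by simp
 next
  case 3
  have nz: "smear (x i \<otimes> y j) ~= 0" if "F (x i \<otimes> y j) ~= 0" for i j
   using that xc yc by (simp add: F_def)
  have "a = 0"
  proof (rule iterated_limit_zero[OF C0 E(1) fin1 xc yc 3])
   show "EX v:V. EX p:E. EX w:V. \<phi> (x i \<otimes> y j) = \<phi> (v \<otimes> p \<otimes> w)" if "F (x i \<otimes> y j) ~= 0" for i j
    by (rule smear_nonzero[OF nz[OF that]]) blast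
  qed (use al in auto)
  moreover have "b = 0"
  \<comment> \<open>Inversion exchanges the two factors, so the second iterated limit is an instance
    of the first, with \<open>fin2\<close> in the place of \<open>fin1\<close>.\<close>
  proof (rule iterated_limit_zero[OF C0, of "(%p. inv p) ` E" "%j. inv (y j)" "%i. inv (x i)" "%j i. F (x i \<otimes> y j)" \<beta>])
   fix C assume C: "compactin T C" "\<phi> ` C \<inter> \<phi> ` C0 = {}"
   show "finite {(p, q). p : (%p. inv p) ` E & q : (%p. inv p) ` E & (EX d:V. EX d':V. \<phi> (p \<otimes> d \<otimes> d' \<otimes> inv q) : \<phi> ` C)}"
    by (rule finite_subset[OF _ finite_imageI[OF fin2[OF C], of "%(p, q). (inv p, inv q)"]])
     (use E in \<open>force simp: subset_iff\<close>)
  next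
   fix i j assume "F (x j \<otimes> y i) ~= 0"
   then obtain v p w where vpw: "v : V" "p : E" "w : V" "\<phi> (x j \<otimes> y i) = \<phi> (v \<otimes> p \<otimes> w)"
    using smear_nonzero[OF nz] by metis
   have cc: "v : carrier G" "w : carrier G" "p : carrier G" using vpw Vc E by auto
   have "\<phi> (inv (y i) \<otimes> inv (x j)) = inv\<^bsub>Q\<^esub> \<phi> (x j \<otimes> y i)"
    using xc yc by (metis \<phi>.hom_inv inv_mult_group m_closed)
   also have "\<dots> = \<phi> (inv w \<otimes> inv p \<otimes> inv v)" unfolding vpw(4)
    using cc by (metis \<phi>.hom_inv inv_mult_group m_closed m_assoc inv_closed)
   finally show "EX v:V. EX p:(%p. inv p) ` E. EX w:V. \<phi> (inv (y i) \<otimes> inv (x j)) = \<phi> (v \<otimes> p \<otimes> w)" using vpw V(2) by blast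
  next
   show "escapes (%j. inv (y j))" "escapes (%i. inv (x i))" using 3 xc yc by (auto intro: escapes_inv)
  qed (use al be xc yc E in auto)
  ultimately show ?thesis by simp
 qed
qed

end

section \<open>Half graphs of weakly almost periodic functions\<close>

definition half_graphs :: "'a monoid => ('a => complex) => bool" where
 "half_graphs G f \<longleftrightarrow> (ALL N::nat. EX a b. range a \<subseteq> carrier G & range b \<subseteq> carrier G &
   (ALL i<N. ALL j<N. f (a i \<otimes>\<^bsub>G\<^esub> b j) = (if i < j then 1 else 0)))"

text \<open>\<open>off\<close> drives thickened quotients of distinct points out of every compact
  set as the later stage grows. For a point with itself only compact sets off \<open>C0\<close> can
  be asked for in \<open>diag\<close>, because the conjugates of \<open>V V\<close> contain the
  identity. \<open>sep\<close> keeps the smeared points with \<open>i < j\<close> from reaching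
  those with \<open>j <= i\<close>.\<close>

lemma (in top_grp) half_graphs_from_stages:
 fixes Q :: "'b monoid" and \<phi> :: "'a => 'b" and a b :: "nat => nat => 'a"
 assumes lc: "locally_compact_space T" and Q: "group Q" and hom: "\<phi> : hom G Q"
  and U: "openin T U" "\<one> : U" "U \<subseteq> V" and V: "compactin T V" "!!v. v : V ==> inv v : V"
  and C0: "compactin T C0"
  and ab: "!!n i. a n i : carrier G" "!!n i. b n i : carrier G"
  and off: "!!C. compactin T C ==> EX n0. ALL n>=n0. ALL m<=n. ALL i<n. ALL j<n. ALL k<m. ALL l<m. (n, i, j) ~= (m, k, l) -->
    (avoids2 \<phi> V C (a n i \<otimes> b n j) (a m k \<otimes> b m l))"
  and diag: "!!C. compactin T C ==> \<phi> ` C \<inter> \<phi> ` C0 = {} ==> EX n0. ALL n>=n0. ALL i<n. ALL j<n.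
    (avoids2 \<phi> V C (a n i \<otimes> b n j) (a n i \<otimes> b n j))"
  and sep: "!!n i j m k l v v'. i < n ==> j < n ==> k < m ==> l < m ==> (n, i, j) ~= (m, k, l) ==>
    v : V ==> v' : V ==> \<phi> (a n i \<otimes> b n j) ~= \<phi> (v \<otimes> (a m k \<otimes> b m l) \<otimes> v')"
 shows "EX f:WAP G T. half_graphs G f"
proof -
 obtain h :: "'a => real" where h: "h \<one> = 1" "!!x. 0 <= h x & h x <= 1" "!!x. x : carrier G - V ==> h x = 0"
  "!!e. 0 < e ==> EX W. openin T W & \<one> : W & (ALL u:W. ALL z:carrier G. \<bar>h (u \<otimes> z) - h z\<bar> <= e)"
  by (rule uniformly_continuous_bump[OF lc U V(1)], erule V(2), rule that)
 define p where "p = (%(n, i, j). a n i \<otimes> b n j)"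
 define I where "I = {(n, i, j). i < j & j < (n::nat)}"
 define E where "E = p ` I"
 have pc: "p t : carrier G" for t using ab by (auto simp: p_def split: prod.splits)
 have Ec: "E \<subseteq> carrier G" using pc by (auto simp: E_def)
 interpret S: smeared_set G T Q \<phi> V E h
 proof -
  interpret Q: group Q by (rule Q)
  show "smeared_set G T Q \<phi> V E h"
   by unfold_locales (use hom V Ec h in auto)
 qed
 have Vc: "V \<subseteq> carrier G" using V(1) compactin_carrier by blast
 have fin: "finite {(x, y). x : E & y : E & (EX d:V. EX d':V. \<psi> x y d d' : \<phi> ` C)}"
  if bound: "EX n0. ALL s:I. ALL t:I. n0 <= max (fst s) (fst t) --> (ALL d:V. ALL d':V. \<psi> (p s) (p t) d d' ~: \<phi> ` C)"
  for \<psi> :: "'a => 'a => 'a => 'a => 'b" and C :: "'a set"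
 proof -
  obtain n0 where n0: "!!s t d d'. s : I ==> t : I ==> n0 <= max (fst s) (fst t) ==> d : V ==> d' : V ==> \<psi> (p s) (p t) d d' ~: \<phi> ` C"
   using bound by blast
  define I0 where "I0 = {..<n0} \<times> {..<n0} \<times> {..<n0}"
  have "{(x, y). x : E & y : E & (EX d:V. EX d':V. \<psi> x y d d' : \<phi> ` C)} \<subseteq> p ` I0 \<times> p ` I0"
  proof
   fix xy assume "xy : {(x, y). x : E & y : E & (EX d:V. EX d':V. \<psi> x y d d' : \<phi> ` C)}"
   then obtain x y d d' where xy: "x : E" "y : E" "d : V" "d' : V" "\<psi> x y d d' : \<phi> ` C" "xy = (x, y)" by blast
   obtain s t where st: "s : I" "t : I" "x = p s" "y = p t" using xy by (auto simp: E_def)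
   then have "max (fst s) (fst t) < n0" using n0[OF st(1,2) _ xy(3,4)] xy(5) by force
   then have "s : I0" "t : I0" using st by (auto simp: I_def I0_def)
   then show "xy : p ` I0 \<times> p ` I0" using st xy(6) by blast
  qed
  then show "finite {(x, y). x : E & y : E & (EX d:V. EX d':V. \<psi> x y d d' : \<phi> ` C)}"
   by (rule finite_subset) (simp add: I0_def)
 qed
 have swap: "\<phi> (inv x) : \<phi> ` (%x. inv x) ` C \<longleftrightarrow> \<phi> x : \<phi> ` C" if "x : carrier G" "C \<subseteq> carrier G" for x C
 proof
  assume "\<phi> (inv x) : \<phi> ` (%x. inv x) ` C"
  then obtain c where c: "c : C" "\<phi> (inv x) = \<phi> (inv c)" by blast
  then have "inv\<^bsub>Q\<^esub> \<phi> (inv x) = inv\<^bsub>Q\<^esub> \<phi> (inv c)" by simp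
  then have "\<phi> x = \<phi> c" using that c by (auto simp: subset_iff)
  then show "\<phi> x : \<phi> ` C" using c by blast
 next
  assume "\<phi> x : \<phi> ` C"
  then obtain c where c: "c : C" "\<phi> x = \<phi> c" by blast
  then have "\<phi> (inv x) = \<phi> (inv c)" using that by (simp add: subset_iff)
  then show "\<phi> (inv x) : \<phi> ` (%x. inv x) ` C" using c by blast
 qed
 have main: "EX n0. ALL s:I. ALL t:I. n0 <= max (fst s) (fst t) --> (avoids2 \<phi> V C (p s) (p t))"
  if C: "compactin T C" "\<phi> ` C \<inter> \<phi> ` C0 = {}" for C
 proof -
  let ?iC = "(%x. inv x) ` C"
  have Cc: "C \<subseteq> carrier G" using C(1) compactin_carrier by blast
  define ok where "ok = (%C n m i j k l. avoids2 \<phi> V C (a n i \<otimes> b n j) (a m k \<otimes> b m l))"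
  obtain n1 where n1: "ALL n>=n1. ALL m<=n. ALL i<n. ALL j<n. ALL k<m. ALL l<m. (n, i, j) ~= (m, k, l) --> ok C n m i j k l"
   unfolding ok_def using off[OF C(1)] by (rule exE)
  obtain n2 where n2: "ALL n>=n2. ALL m<=n. ALL i<n. ALL j<n. ALL k<m. ALL l<m. (n, i, j) ~= (m, k, l) --> ok ?iC n m i j k l"
   unfolding ok_def using off[OF compactin_inverses[OF C(1)]] by (rule exE)
  obtain n3 where n3: "ALL n>=n3. ALL i<n. ALL j<n. ok C n n i j i j"
   unfolding ok_def using diag[OF C] by (rule exE)
  define n0 where "n0 = max n1 (max n2 n3)"
  show ?thesis
  proof (intro exI[of _ n0] ballI impI)
   fix s t d d' assume st: "s : I" "t : I" "n0 <= max (fst s) (fst t)" and d: "d : V" "d' : V"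
   obtain n i j where s: "s = (n, i, j)" by (cases s)
   obtain m k l where t: "t = (m, k, l)" by (cases t)
   have lt: "i < n" "j < n" "k < m" "l < m" using st by (auto simp: I_def s t)
   have dc: "d : carrier G" "d' : carrier G" "inv d : V" "inv d' : V" using d Vc V(2) by auto
   consider (eq) "s = t" | (ge) "m <= n" "s ~= t" | (lt) "n < m" by linarith
   then show "avoid2 \<phi> d d' C (p s) (p t)"
   proof cases
    case eq
    then have "ok C n n i j i j" using n3 lt st(3) by (auto simp: s n0_def)
    then show ?thesis using d eq by (auto simp: ok_def p_def s)
   next
    case ge
    then have "ok C n m i j k l" using n1 lt st(3) by (auto simp: s t n0_def)
    then show ?thesis using d by (auto simp: ok_def p_def s t)
   next
    \<comment> \<open>\<open>off\<close> expects the later stage first. Inversion exchanges the two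
      points and replaces \<open>C\<close> by the set of its inverses.\<close>
    case lt
    then have "ok ?iC m n k l i j" using n2 \<open>i < n\<close> \<open>j < n\<close> \<open>k < m\<close> \<open>l < m\<close> st(3) by (auto simp: s t n0_def)
    then have "\<phi> (p t \<otimes> inv d' \<otimes> inv d \<otimes> inv (p s)) ~: \<phi> ` ?iC" "\<phi> (inv (p t) \<otimes> inv d' \<otimes> inv d \<otimes> p s) ~: \<phi> ` ?iC"
     using dc by (auto simp: ok_def p_def s t)
    moreover have "p t \<otimes> inv d' \<otimes> inv d \<otimes> inv (p s) = inv (p s \<otimes> d \<otimes> d' \<otimes> inv (p t))"
     "inv (p t) \<otimes> inv d' \<otimes> inv d \<otimes> p s = inv (inv (p s) \<otimes> d \<otimes> d' \<otimes> p t)"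
     using dc pc by (simp_all add: grp_simps)
    ultimately show ?thesis
     using swap[OF _ Cc, of "p s \<otimes> d \<otimes> d' \<otimes> inv (p t)"] swap[OF _ Cc, of "inv (p s) \<otimes> d \<otimes> d' \<otimes> p t"] dc(1,2) pc
     by (simp only: m_closed inv_closed simp_thms)
   qed
  qed
 qed
 have "iterated S.F"
 proof (rule S.iterated_F[OF C0])
  fix C assume C: "compactin T C" "\<phi> ` C \<inter> \<phi> ` C0 = {}"
  obtain n0 where n0: "ALL s:I. ALL t:I. n0 <= max (fst s) (fst t) --> (avoids2 \<phi> V C (p s) (p t))"
   using main[OF C] by (rule exE)
  show "finite {(x, y). x : E & y : E & (EX d:V. EX d':V. \<phi> (x \<otimes> d \<otimes> d' \<otimes> inv y) : \<phi> ` C)}"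
   by (rule fin[of "%x y d d'. \<phi> (x \<otimes> d \<otimes> d' \<otimes> inv y)"]) (use n0 in blast)
  show "finite {(x, y). x : E & y : E & (EX d:V. EX d':V. \<phi> (inv x \<otimes> d \<otimes> d' \<otimes> y) : \<phi> ` C)}"
   by (rule fin[of "%x y d d'. \<phi> (inv x \<otimes> d \<otimes> d' \<otimes> y)"]) (use n0 in blast)
 qed
 then have WAP: "S.F : WAP G T" using iterated_imp_WAP[OF S.F_CB] by blast
 have "half_graphs G S.F"
  unfolding half_graphs_def
 proof (intro allI)
  fix N
  have "S.F (a N i \<otimes> b N j) = (if i < j then 1 else 0)" if ij: "i < N" "j < N" for i j
  proof (cases "i < j")
   case True
   then have "p (N, i, j) : E" using ij by (auto simp: E_def I_def)
   then have E: "a N i \<otimes> b N j : E" by (simp add: p_def)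
   have "min (h \<one>) (h (inv \<one>)) <= S.smear (a N i \<otimes> b N j)"
    by (rule S.smear_mem[OF _ E]) (use ab in auto)
   then have "S.smear (a N i \<otimes> b N j) = 1" using S.smear_bounds[of "a N i \<otimes> b N j"] h(1) by simp
   then show ?thesis using True ab by (simp add: S.F_def)
  next
   case False
   have "S.smear (a N i \<otimes> b N j) = 0"
   proof (rule ccontr)
    assume "S.smear (a N i \<otimes> b N j) ~= 0"
    then obtain v q w where vqw: "v : V" "q : E" "w : V" "\<phi> (a N i \<otimes> b N j) = \<phi> (v \<otimes> q \<otimes> w)"
     by (rule S.smear_nonzero)
    then obtain m k l where q: "k < l" "l < m" "q = a m k \<otimes> b m l" by (auto simp: E_def I_def p_def)
    have "(N, i, j) ~= (m, k, l)" using q False by auto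
    then show False using sep[of i N j k m l v w] vqw q ij by simp
   qed
   then show ?thesis using False ab by (simp add: S.F_def)
  qed
  then show "EX a b. range a \<subseteq> carrier G & range b \<subseteq> carrier G &
     (ALL i<N. ALL j<N. S.F (a i \<otimes> b j) = (if i < j then 1 else 0))"
   using ab by (intro exI[of _ "a N"] exI[of _ "b N"]) auto
 qed
 then show ?thesis using WAP by blast
qed

section \<open>Half graphs from a homomorphism with non-closed range\<close>

context top_grp
begin

text \<open>The union of the powers of \<open>V\<close> is open and closed, so a connected group is
  exhausted by them, and translates of \<open>U\<close> show that every compact set is contained in
  one of them.\<close>

lemma compact_exhaustion_connected:
 assumes conn: "connected_space T" and U: "openin T U" "\<one> : U" "U \<subseteq> V" and V: "compactin T V" "!!v. v : V ==> inv v : V"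
 obtains W :: "nat => 'a set" where "!!n. compactin T (W n)" "!!n. V \<subseteq> W n" "!!n x. x : W n ==> inv x : W n"
  "!!C. compactin T C ==> EX n0. ALL n>=n0. C \<subseteq> W n"
proof -
 define P where "P = rec_nat V (%_ S. S <#> V)"
 have P0: "P 0 = V" and PS: "P (Suc n) = P n <#> V" for n by (simp_all add: P_def)
 have cP: "compactin T (P n)" for n by (induction n) (simp_all add: P0 PS V compactin_set_mult)
 have Vc: "V \<subseteq> carrier G" using V compactin_carrier by blast
 have Pc: "P n \<subseteq> carrier G" for n using cP compactin_carrier by blast
 have oneV: "\<one> : V" using U by blast
 have step: "x : P n ==> x : P (Suc n)" for x n
  using mem_set_multI[of x "P n" \<one> V] oneV Pc[of n] by (auto simp: PS subset_iff)
 have mono: "m <= n ==> P m \<subseteq> P n" for m n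
  by (induction n) (use step in \<open>auto simp: le_Suc_eq\<close>)
 define H where "H = (\<Union>n. P n)"
 have tr: "openin T {z : carrier G. inv x \<otimes> z : U}" "x : {z : carrier G. inv x \<otimes> z : U}" if "x : carrier G" for x
  using openin_ltranslate[OF U(1), of "inv x"] U(2) that by auto
 have sub: "{z : carrier G. inv x \<otimes> z : U} \<subseteq> P (Suc n)" if "x : P n" for x n
 proof
  fix z assume z: "z : {z : carrier G. inv x \<otimes> z : U}"
  have x: "x : carrier G" using that Pc by blast
  have "x \<otimes> (inv x \<otimes> z) : P (Suc n)" using z U(3) that by (auto simp: PS intro!: mem_set_multI)
  then show "z : P (Suc n)" using z x by (simp add: grp_simps)
 qed
 have "openin T H"
  unfolding openin_subopen[of T H]
 proof
  fix x assume "x : H"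
  then obtain n where n: "x : P n" by (auto simp: H_def)
  then have x: "x : carrier G" using Pc by blast
  show "EX S. openin T S & x : S & S \<subseteq> H" using tr[OF x] sub[OF n] by (auto simp: H_def)
 qed
 moreover have "openin T (carrier G - H)"
  unfolding openin_subopen[of T "carrier G - H"]
 proof
  fix y assume y: "y : carrier G - H"
  have "z ~: H" if z: "z : carrier G" "inv y \<otimes> z : U" for z
  proof
   assume "z : H"
   then obtain n where n: "z : P n" by (auto simp: H_def)
   have "z \<otimes> inv (inv y \<otimes> z) : P (Suc n)" using n V(2) U(3) z by (auto simp: PS intro!: mem_set_multI)
   moreover have "z \<otimes> inv (inv y \<otimes> z) = y" using y z by (simp add: grp_simps)
   ultimately show False using y by (auto simp: H_def)
  qed
  then show "EX S. openin T S & y : S & S \<subseteq> carrier G - H" using tr[of y] y by blast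
 qed
 ultimately have "openin T H & closedin T H" using openin_subset[of T H] by (simp add: closedin_def)
 moreover have "H ~= {}" using oneV P0 by (auto simp: H_def)
 ultimately have H: "H = carrier G" using conn unfolding connected_space_clopen_in by auto
 define W where "W = (%n. P n \<union> (%x. inv x) ` P n)"
 show thesis
 proof (rule that[of W])
  show "compactin T (W n)" for n unfolding W_def using cP compactin_inverses by (simp add: compactin_Un)
  show "V \<subseteq> W n" for n using mono[of 0 n] by (auto simp: W_def P0)
  show "inv x : W n" if "x : W n" for x n using that Pc[of n] by (auto simp: W_def subset_iff)
  fix C assume C: "compactin T C"
  have "ALL x:C. EX n. x : P n" using H compactin_carrier[OF C] by (auto simp: H_def)
  then obtain m where m: "!!x. x : C ==> x : P (m x)" by metis
  obtain F where F: "finite F" "F \<subseteq> C" "C \<subseteq> (\<Union>x\<in>F. {z : carrier G. inv x \<otimes> z : U})"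
   by (rule compactin_finite_cover[OF C, of "%x. {z : carrier G. inv x \<otimes> z : U}"]) (use tr compactin_carrier[OF C] in auto)
  \<comment> \<open>A translate of \<open>U\<close> by a point of \<open>P n\<close> is contained
    only in the next power, hence the successor.\<close>
  define n0 where "n0 = Suc (Max (insert 0 (m ` F)))"
  have "C \<subseteq> P n" if n: "n >= n0" for n
  proof
   fix z assume "z : C"
   then obtain x where x: "x : F" "z : {z : carrier G. inv x \<otimes> z : U}" using F by blast
   then have "z : P (Suc (m x))" using sub[OF m] F by blast
   moreover have "Suc (m x) <= n0" using F(1) x(1) by (simp add: n0_def)
   ultimately show "z : P n" using mono[of "Suc (m x)" n] n by auto
  qed
  then show "EX n0. ALL n>=n0. C \<subseteq> W n" by (auto simp: W_def)
 qed
qed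

lemma outside_compact_near_one:
 fixes Q :: "'b monoid"
 assumes Q: "topological_group Q T'" and hom: "\<phi> : hom G Q" and cont: "continuous_map T T' \<phi>"
  and ncl: "~ closedin T' (\<phi> ` carrier G)" and O: "openin T' O'" "\<one>\<^bsub>Q\<^esub> : O'" and Z: "compactin T Z"
 shows "EX g:carrier G. \<phi> g : O' & \<phi> g ~: \<phi> ` Z"
proof (rule ccontr)
 assume no: "~ ?thesis"
 interpret Q: top_grp Q T' by (unfold_locales) (rule Q)
 interpret \<phi>: group_hom G Q \<phi> using hom by unfold_locales
 have img: "\<phi> ` carrier G \<subseteq> carrier Q" by auto
 have "T' closure_of (\<phi> ` carrier G) \<subseteq> \<phi> ` carrier G"
 proof
  fix y assume y: "y : T' closure_of (\<phi> ` carrier G)"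
  have yc: "y : carrier Q" using y closure_of_subset_topspace by fastforce
  \<comment> \<open>A range element \<open>\<phi> g0\<close> close to \<open>y\<close> is used to
    translate the neighbourhood \<open>O'\<close> of the identity to a neighbourhood of
    \<open>y\<close>; \<open>N\<close> is the set of elements close enough for this.\<close>
  define N where "N = {z : carrier Q. inv\<^bsub>Q\<^esub> z \<otimes>\<^bsub>Q\<^esub> y : O'}"
  have "continuous_map T' T' (%z. inv\<^bsub>Q\<^esub> z \<otimes>\<^bsub>Q\<^esub> y)" using yc by (intro Q.continuous_map_mult Q.continuous_map_inv) auto
  then have "openin T' N" unfolding N_def using openin_continuous_map_preimage[OF _ O(1)] by force
  moreover have "y : N" using yc O(2) by (simp add: N_def)
  ultimately obtain g0 where g0: "g0 : carrier G" "\<phi> g0 : N" using y unfolding in_closure_of by blast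
  define M where "M = {z : carrier Q. inv\<^bsub>Q\<^esub> (\<phi> g0) \<otimes>\<^bsub>Q\<^esub> z : O'}"
  have M: "openin T' M" unfolding M_def using Q.openin_ltranslate[OF O(1)] g0 by auto
  have yM: "y : M" using g0 yc by (auto simp: M_def N_def)
  have K: "compactin T' (\<phi> ` ({g0} <#> Z))"
   by (rule image_compactin[OF _ cont]) (intro compactin_set_mult compactin_single g0 Z)
  have "closedin T' (\<phi> ` ({g0} <#> Z))" by (rule compactin_imp_closedin[OF Q.Hausdorff_T K])
  moreover have "M \<inter> \<phi> ` carrier G \<subseteq> \<phi> ` ({g0} <#> Z)"
  proof
   fix z assume "z : M \<inter> \<phi> ` carrier G"
   then obtain g where g: "g : carrier G" "z = \<phi> g" "inv\<^bsub>Q\<^esub> (\<phi> g0) \<otimes>\<^bsub>Q\<^esub> \<phi> g : O'" by (auto simp: M_def)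
   then have "\<phi> (inv g0 \<otimes> g) : O'" using g0 by simp
   then obtain c where c: "c : Z" "\<phi> (inv g0 \<otimes> g) = \<phi> c" using no g0 g by blast
   have cc: "c : carrier G" using c Z compactin_carrier by blast
   have "\<phi> g = \<phi> g0 \<otimes>\<^bsub>Q\<^esub> \<phi> (inv g0 \<otimes> g)" using g0 g by (simp add: Q.grp_simps)
   also have "\<dots> = \<phi> (g0 \<otimes> c)" using c(2) g0 cc by simp
   finally show "z : \<phi> ` ({g0} <#> Z)" using g(2) c(1) by (auto intro!: imageI mem_set_multI)
  qed
  ultimately have "T' closure_of (M \<inter> \<phi> ` carrier G) \<subseteq> \<phi> ` ({g0} <#> Z)" by (simp add: closure_of_minimal)
  moreover have "y : T' closure_of (M \<inter> \<phi> ` carrier G)"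
   using openin_Int_closure_of_subset[OF M, of "\<phi> ` carrier G"] y yM by blast
  moreover have "{g0} <#> Z \<subseteq> carrier G" using g0 Z compactin_carrier by (auto simp: set_mult_def)
  ultimately show "y : \<phi> ` carrier G" by blast
 qed
 then have "closedin T' (\<phi> ` carrier G)"
  using img by (metis closure_of_subset_eq Q.topspace_T)
 then show False using ncl by blast
qed

text \<open>Conjugation by the identity fixes \<open>\<phi>\<close>
  X\<open>, and the complement of\<close>\<phi> \<open>Y\<close> is open, so disjointness persists
  for conjugation by nearby elements; compactness makes this uniform on \<open>X\<close>.\<close>

lemma conjugation_avoids_compact:
 fixes Q :: "'b monoid"
 assumes Q: "topological_group Q T'" and hom: "\<phi> : hom G Q" and cont: "continuous_map T T' \<phi>"
  and X: "compactin T X" and Y: "compactin T Y" and dis: "\<phi> ` X \<inter> \<phi> ` Y = {}"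
 shows "EX O'. openin T' O' & \<one>\<^bsub>Q\<^esub> : O' & (ALL g:carrier G. \<phi> g : O' -->
  (ALL x:X. \<phi> (g \<otimes> x \<otimes> inv g) ~: \<phi> ` Y & \<phi> (inv g \<otimes> x \<otimes> g) ~: \<phi> ` Y))"
proof -
 interpret Q: top_grp Q T' by (unfold_locales) (rule Q)
 interpret \<phi>: group_hom G Q \<phi> using hom by unfold_locales
 have Xc: "X \<subseteq> carrier G" using X compactin_carrier by blast
 have cl: "openin T' (carrier Q - \<phi> ` Y)"
  using compactin_imp_closedin[OF Q.Hausdorff_T image_compactin[OF Y cont]] by (simp add: closedin_def)
 have KX: "compactin T' (\<phi> ` X)" by (rule image_compactin[OF X cont])
 have tube: "EX A. openin T' A & \<one>\<^bsub>Q\<^esub> : A & (ALL g:A. ALL x:\<phi> ` X. m (g, x) ~: \<phi> ` Y)"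
  if m: "continuous_map (prod_topology T' T') T' m" "!!x. x : carrier Q ==> m (\<one>\<^bsub>Q\<^esub>, x) = x" for m
 proof -
  let ?W = "{p : topspace (prod_topology T' T'). m p : carrier Q - \<phi> ` Y}"
  have W: "openin (prod_topology T' T') ?W" by (rule openin_continuous_map_preimage[OF m(1) cl])
  have "{\<one>\<^bsub>Q\<^esub>} \<times> \<phi> ` X \<subseteq> ?W" using Xc dis m(2) by (auto simp: subset_iff)
  from tube_lemma_right[OF W KX _ this] obtain A B where "openin T' A" "\<one>\<^bsub>Q\<^esub> : A" "\<phi> ` X \<subseteq> B" "A \<times> B \<subseteq> ?W" by auto
  then show ?thesis by (intro exI[of _ A]) blast
 qed
 have "EX A. openin T' A & \<one>\<^bsub>Q\<^esub> : A & (ALL g:A. ALL x:\<phi> ` X. (%p. fst p \<otimes>\<^bsub>Q\<^esub> snd p \<otimes>\<^bsub>Q\<^esub> inv\<^bsub>Q\<^esub> (fst p)) (g, x) ~: \<phi> ` Y)"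
  by (rule tube) (auto intro!: Q.continuous_map_mult Q.continuous_map_inv continuous_map_fst continuous_map_snd)
 then obtain A1 where A1: "openin T' A1" "\<one>\<^bsub>Q\<^esub> : A1" "!!g x. g : A1 ==> x : X ==> g \<otimes>\<^bsub>Q\<^esub> \<phi> x \<otimes>\<^bsub>Q\<^esub> inv\<^bsub>Q\<^esub> g ~: \<phi> ` Y" by auto
 have "EX A. openin T' A & \<one>\<^bsub>Q\<^esub> : A & (ALL g:A. ALL x:\<phi> ` X. (%p. inv\<^bsub>Q\<^esub> (fst p) \<otimes>\<^bsub>Q\<^esub> snd p \<otimes>\<^bsub>Q\<^esub> fst p) (g, x) ~: \<phi> ` Y)"
  by (rule tube) (auto intro!: Q.continuous_map_mult Q.continuous_map_inv continuous_map_fst continuous_map_snd)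
 then obtain A2 where A2: "openin T' A2" "\<one>\<^bsub>Q\<^esub> : A2" "!!g x. g : A2 ==> x : X ==> inv\<^bsub>Q\<^esub> g \<otimes>\<^bsub>Q\<^esub> \<phi> x \<otimes>\<^bsub>Q\<^esub> g ~: \<phi> ` Y" by auto
 show ?thesis
 proof (intro exI[of _ "A1 \<inter> A2"] conjI ballI impI)
  show "openin T' (A1 \<inter> A2)" using A1 A2 by blast
  show "\<one>\<^bsub>Q\<^esub> : A1 \<inter> A2" using A1 A2 by blast
  fix g x assume g: "g : carrier G" "\<phi> g : A1 \<inter> A2" and x: "x : X"
  have xc: "x : carrier G" using x Xc by blast
  show "\<phi> (g \<otimes> x \<otimes> inv g) ~: \<phi> ` Y" using A1(3)[of "\<phi> g" x] g x xc by simp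
  show "\<phi> (inv g \<otimes> x \<otimes> g) ~: \<phi> ` Y" using A2(3)[of "\<phi> g" x] g x xc by simp
 qed
qed

text \<open>All \<open>a i\<close> and \<open>b j\<close> are near the identity in the topology
  induced by \<phi> and yet far out in \<open>G\<close>. Being far out, \<open>b j\<close> separates
  its points from everything formed before. What remains are points with the same
  \<open>b j\<close>: one of their quotients is the conjugate by \<open>b j\<close> of a set that
  depends on the \<open>a i\<close> alone, and conjugation by elements near the identity preserves
  avoidance of compact sets.\<close>

lemma stage_near_one:
 fixes Q :: "'b monoid" and n :: nat
 assumes Q: "topological_group Q T'" and hom: "\<phi> : hom G Q" and cont: "continuous_map T T' \<phi>"
  and ncl: "~ closedin T' (\<phi> ` carrier G)"
  and DD: "compactin T DD" "!!x. x : DD ==> inv x : DD" and W: "compactin T W" "!!x. x : W ==> inv x : W"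
  and W': "compactin T W'" "\<phi> ` DD \<inter> \<phi> ` W' = {}" and P: "finite P" "P \<subseteq> carrier G"
 shows "EX (a :: nat => 'a) (b :: nat => 'a). (ALL i. a i : carrier G) & (ALL i. b i : carrier G) &
  (ALL i<n. ALL j<n. ALL k<n. ALL l<n. (i, j) ~= (k, l) --> (avoids \<phi> DD W (a i \<otimes> b j) (a k \<otimes> b l))) &
  (ALL i<n. ALL j<n. ALL q:P. avoids \<phi> DD W (a i \<otimes> b j) q) &
  (ALL i<n. ALL j<n. avoids \<phi> DD W' (a i \<otimes> b j) (a i \<otimes> b j))"
proof -
 interpret Q: top_grp Q T' by (unfold_locales) (rule Q)
 interpret \<phi>: group_hom G Q \<phi> using hom by unfold_locales
 note far = outside_compact_near_one[OF Q hom cont ncl]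
 note kappa = conjugation_avoids_compact[OF Q hom cont]
 have kappaE: thesis if XY: "compactin T X" "compactin T Y" "\<phi> ` X \<inter> \<phi> ` Y = {}"
  and found: "!!O'. openin T' O' ==> \<one>\<^bsub>Q\<^esub> : O' ==> (!!g x. g : carrier G ==> \<phi> g : O' ==> x : X ==>
   \<phi> (g \<otimes> x \<otimes> inv g) ~: \<phi> ` Y & \<phi> (inv g \<otimes> x \<otimes> g) ~: \<phi> ` Y) ==> thesis" for X Y thesis
 proof -
  obtain O' where "openin T' O' & \<one>\<^bsub>Q\<^esub> : O' & (ALL g:carrier G. \<phi> g : O' -->
   (ALL x:X. \<phi> (g \<otimes> x \<otimes> inv g) ~: \<phi> ` Y & \<phi> (inv g \<otimes> x \<otimes> g) ~: \<phi> ` Y))"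
   using kappa[OF XY] by (rule exE)
  then show thesis by (intro found[of O']) auto
 qed
 have Dc: "d : DD ==> d : carrier G" and Wc: "w : W ==> w : carrier G" and W'c: "w : W' ==> w : carrier G" for d w
  using DD W W' compactin_carrier by blast+
 have subst: "\<phi> (c \<otimes> x \<otimes> c') = \<phi> (c \<otimes> y \<otimes> c')" if "\<phi> x = \<phi> y" "x : carrier G" "y : carrier G" "c : carrier G" "c' : carrier G" for c c' x y
  using that by simp
 obtain O1 where O1: "openin T' O1" "\<one>\<^bsub>Q\<^esub> : O1" "!!g x. g : carrier G ==> \<phi> g : O1 ==> x : DD ==>
   \<phi> (g \<otimes> x \<otimes> inv g) ~: \<phi> ` W' & \<phi> (inv g \<otimes> x \<otimes> g) ~: \<phi> ` W'"
  by (rule kappaE[OF DD(1) W'(1,2)], rule that)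
 \<comment> \<open>Excluding these two products of compact sets means that
   \<open>inv (a i) \<otimes> d \<otimes> a k\<close> avoids \<open>W\<close> and
   \<open>inv (a i) \<otimes> w \<otimes> a k\<close> avoids \<open>DD\<close> for
   \<open>k < i\<close>; symmetry of \<open>DD\<close> and \<open>W\<close> then covers
   \<open>k > i\<close>.\<close>
 define Qa where "Qa = (%i h v. \<phi> v : O1 & (ALL k<i::nat. \<phi> v ~: \<phi> ` (DD <#> {h k} <#> W) & \<phi> v ~: \<phi> ` (W <#> {h k} <#> DD)))"
 have "EX a. ALL i. a i : carrier G & Qa i a (a i)"
 proof (rule history_choice)
  show "Qa n h' v" if "!!i. i < n ==> h i = h' i" "Qa n h v" for n h h' v using that by (simp add: Qa_def)
  fix i :: nat and h assume h: "!!k. k < i ==> h k : carrier G"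
  define Z where "Z = (\<Union>k<i. (DD <#> {h k} <#> W) \<union> (W <#> {h k} <#> DD))"
  have "compactin T Z" unfolding Z_def
   by (rule compactin_Union) (use h DD W in \<open>auto intro!: compactin_Un compactin_set_mult compactin_single\<close>)
  from far[OF O1(1,2) this] obtain g where "g : carrier G" "\<phi> g : O1" "\<phi> g ~: \<phi> ` Z" by blast
  then show "EX v:carrier G. Qa i h v" by (intro bexI[of _ g]) (auto simp: Qa_def Z_def)
 qed
 then obtain a where a: "!!i. a i : carrier G" "!!i. Qa i a (a i)" by blast
 have A1': "\<phi> (inv (a i) \<otimes> d \<otimes> a k) ~: \<phi> ` W" if "k < i" "d : DD" for i k d
 proof
  assume "\<phi> (inv (a i) \<otimes> d \<otimes> a k) : \<phi> ` W"
  then obtain w where w: "w : W" "\<phi> (inv (a i) \<otimes> d \<otimes> a k) = \<phi> w" by blast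
  have c: "w : carrier G" "d : carrier G" using w that Wc Dc by auto
  have "\<phi> (d \<otimes> a k \<otimes> (inv (inv (a i) \<otimes> d \<otimes> a k))) = \<phi> (d \<otimes> a k \<otimes> inv w)" using w c a by simp
  moreover have "d \<otimes> a k \<otimes> (inv (inv (a i) \<otimes> d \<otimes> a k)) = a i" using c a by (simp add: grp_simps)
  ultimately have "\<phi> (a i) : \<phi> ` (DD <#> {a k} <#> W)" using w W(2) that by (auto intro!: imageI mem_set_multI)
  then show False using a(2)[of i] that by (auto simp: Qa_def)
 qed
 have A2': "\<phi> (inv (a i) \<otimes> w \<otimes> a k) ~: \<phi> ` DD" if "k < i" "w : W" for i k w
 proof
  assume "\<phi> (inv (a i) \<otimes> w \<otimes> a k) : \<phi> ` DD"
  then obtain d where d: "d : DD" "\<phi> (inv (a i) \<otimes> w \<otimes> a k) = \<phi> d" by blast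
  have c: "w : carrier G" "d : carrier G" using d that Wc Dc by auto
  have "\<phi> (w \<otimes> a k \<otimes> (inv (inv (a i) \<otimes> w \<otimes> a k))) = \<phi> (w \<otimes> a k \<otimes> inv d)" using d c a by simp
  moreover have "w \<otimes> a k \<otimes> (inv (inv (a i) \<otimes> w \<otimes> a k)) = a i" using c a by (simp add: grp_simps)
  ultimately have "\<phi> (a i) : \<phi> ` (W <#> {a k} <#> DD)" using d DD(2) that by (auto intro!: imageI mem_set_multI)
  then show False using a(2)[of i] that by (auto simp: Qa_def)
 qed
 have swap: "\<phi> (inv x) : \<phi> ` Y" if "\<phi> x : \<phi> ` Y" "x : carrier G" "!!y. y : Y ==> inv y : Y & y : carrier G" for x Y
 proof -
  obtain y where y: "y : Y" "\<phi> x = \<phi> y" using \<open>\<phi> x : \<phi> ` Y\<close> by blast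
  then have "\<phi> (inv x) = \<phi> (inv y)" using that by simp
  then show ?thesis using y that(3) by blast
 qed
 have inv3: "inv (inv x \<otimes> d \<otimes> y) = inv y \<otimes> inv d \<otimes> x" "inv (x \<otimes> d \<otimes> inv y) = y \<otimes> inv d \<otimes> inv x"
  if "x : carrier G" "d : carrier G" "y : carrier G" for x d y
  using that by (simp_all add: grp_simps)
 have A1: "\<phi> (inv (a i) \<otimes> d \<otimes> a k) ~: \<phi> ` W" if "k ~= i" "d : DD" for i k d
 proof (cases "k < i")
  case False
  then have "\<phi> (inv (a k) \<otimes> inv d \<otimes> a i) ~: \<phi> ` W" using A1'[of i k "inv d"] that DD(2) by simp
  then show ?thesis using swap[of "inv (a i) \<otimes> d \<otimes> a k" W] inv3[of "a i" d "a k"] a(1) that Dc W(2) Wc by fastforce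
 qed (use A1' that in auto)
 have A2: "\<phi> (inv (a i) \<otimes> w \<otimes> a k) ~: \<phi> ` DD" if "k ~= i" "w : W" for i k w
 proof (cases "k < i")
  case False
  then have "\<phi> (inv (a k) \<otimes> inv w \<otimes> a i) ~: \<phi> ` DD" using A2'[of i k "inv w"] that W(2) by simp
  then show ?thesis using swap[of "inv (a i) \<otimes> w \<otimes> a k" DD] inv3[of "a i" w "a k"] a(1) that Dc DD(2) Wc by fastforce
 qed (use A2' that in auto)
 define K where "K = (%i S k. {inv (a i)} <#> S <#> {a k})"
 have Kc: "compactin T (K i S k)" if "compactin T S" for i S k
  unfolding K_def using that a by (intro compactin_set_mult compactin_single) auto
 have KI: "inv (a i) \<otimes> s \<otimes> a k : K i S k" if "s : S" for i s k S using that by (auto simp: K_def intro!: mem_set_multI)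
 \<comment> \<open>Neighbourhoods for the \<open>b j\<close>, which are chosen after all
   \<open>a i\<close>. Conjugation by \<open>b j\<close> has to preserve the disjointness just
   obtained for \<open>i ~= k\<close>, and for \<open>i = k\<close> the disjointness of
   \<open>DD\<close> and \<open>W'\<close>, which \<open>O1\<close> keeps under conjugation by
   \<open>a i\<close>.\<close>
 have good: "EX O'. openin T' O' & \<one>\<^bsub>Q\<^esub> : O' & (ALL g:carrier G. \<phi> g : O' -->
   (ALL d:DD. (i ~= k --> \<phi> (inv g \<otimes> (inv (a i) \<otimes> d \<otimes> a k) \<otimes> g) ~: \<phi> ` W & \<phi> (g \<otimes> d \<otimes> inv g) ~: \<phi> ` K i W k) &
    (i = k --> \<phi> (inv g \<otimes> (inv (a i) \<otimes> d \<otimes> a k) \<otimes> g) ~: \<phi> ` W' & \<phi> (g \<otimes> d \<otimes> inv g) ~: \<phi> ` K i W' k)))" for i k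
 proof (cases "i = k")
  case False
  have "\<phi> ` K i DD k \<inter> \<phi> ` W = {}" using A1[of k i] False by (auto simp: K_def set_mult_def)
  then obtain Oa where Oa: "openin T' Oa" "\<one>\<^bsub>Q\<^esub> : Oa" "!!g x. g : carrier G ==> \<phi> g : Oa ==> x : K i DD k ==> \<phi> (inv g \<otimes> x \<otimes> g) ~: \<phi> ` W"
   by (rule kappaE[OF Kc[OF DD(1)] W(1)]) (rule that, assumption, assumption, blast)
  have "\<phi> ` DD \<inter> \<phi> ` K i W k = {}"
  proof (rule ccontr)
   assume "~ ?thesis"
   then obtain d w where dw: "d : DD" "w : W" "\<phi> d = \<phi> (inv (a i) \<otimes> w \<otimes> a k)" by (auto simp: K_def set_mult_def)
   then have "\<phi> (inv (a i) \<otimes> w \<otimes> a k) : \<phi> ` DD" by (metis imageI)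
   then show False using A2[of k i w] False dw(2) by blast
  qed
  then obtain Ob where Ob: "openin T' Ob" "\<one>\<^bsub>Q\<^esub> : Ob" "!!g x. g : carrier G ==> \<phi> g : Ob ==> x : DD ==> \<phi> (g \<otimes> x \<otimes> inv g) ~: \<phi> ` K i W k"
   by (rule kappaE[OF DD(1) Kc[OF W(1)]]) (rule that, assumption, assumption, blast)
  show ?thesis using Oa Ob False KI by (intro exI[of _ "Oa \<inter> Ob"]) auto
 next
  case True
  have ai: "\<phi> (a i) : O1" using a(2) by (simp add: Qa_def)
  have "\<phi> ` K i DD i \<inter> \<phi> ` W' = {}" using O1(3)[OF a(1) ai] by (auto simp: K_def set_mult_def)
  then obtain Oa where Oa: "openin T' Oa" "\<one>\<^bsub>Q\<^esub> : Oa" "!!g x. g : carrier G ==> \<phi> g : Oa ==> x : K i DD i ==> \<phi> (inv g \<otimes> x \<otimes> g) ~: \<phi> ` W'"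
   by (rule kappaE[OF Kc[OF DD(1)] W'(1)]) (rule that, assumption, assumption, blast)
  have "\<phi> ` DD \<inter> \<phi> ` K i W' i = {}"
  proof (rule ccontr)
   assume "~ ?thesis"
   then obtain d w where dw: "d : DD" "w : W'" "\<phi> d = \<phi> (inv (a i) \<otimes> w \<otimes> a i)" by (auto simp: K_def set_mult_def)
   have c: "d : carrier G" "w : carrier G" using dw Dc W'c by auto
   have "\<phi> (a i \<otimes> d \<otimes> inv (a i)) = \<phi> (a i \<otimes> (inv (a i) \<otimes> w \<otimes> a i) \<otimes> inv (a i))"
    by (rule subst[OF dw(3)]) (use c a in auto)
   also have "a i \<otimes> (inv (a i) \<otimes> w \<otimes> a i) \<otimes> inv (a i) = w" using c a by (simp add: grp_simps)
   finally show False using O1(3)[OF a(1) ai dw(1)] dw(2) by auto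
  qed
  then obtain Ob where Ob: "openin T' Ob" "\<one>\<^bsub>Q\<^esub> : Ob" "!!g x. g : carrier G ==> \<phi> g : Ob ==> x : DD ==> \<phi> (g \<otimes> x \<otimes> inv g) ~: \<phi> ` K i W' i"
   by (rule kappaE[OF DD(1) Kc[OF W'(1)]]) (rule that, assumption, assumption, blast)
  show ?thesis using Oa Ob True KI by (intro exI[of _ "Oa \<inter> Ob"]) auto
 qed
 then obtain Nb where Nb: "!!i k. openin T' (Nb i k) & \<one>\<^bsub>Q\<^esub> : Nb i k & (ALL g:carrier G. \<phi> g : Nb i k -->
   (ALL d:DD. (i ~= k --> \<phi> (inv g \<otimes> (inv (a i) \<otimes> d \<otimes> a k) \<otimes> g) ~: \<phi> ` W & \<phi> (g \<otimes> d \<otimes> inv g) ~: \<phi> ` K i W k) &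
    (i = k --> \<phi> (inv g \<otimes> (inv (a i) \<otimes> d \<otimes> a k) \<otimes> g) ~: \<phi> ` W' & \<phi> (g \<otimes> d \<otimes> inv g) ~: \<phi> ` K i W' k)))" by metis
 define O2 where "O2 = carrier Q \<inter> (\<Inter>(i, k)\<in>{..<n} \<times> {..<n}. Nb i k)"
 have O2: "openin T' O2" "\<one>\<^bsub>Q\<^esub> : O2"
 proof -
  have oQ: "openin T' (carrier Q)" using openin_topspace[of T'] by simp
  have "openin T' (topspace T' \<inter> (\<Inter>(i, k)\<in>{..<n} \<times> {..<n}. Nb i k))"
   by (rule openin_Int_Inter) (use Nb oQ in auto)
  then show "openin T' O2" by (simp add: O2_def)
  show "\<one>\<^bsub>Q\<^esub> : O2" using Nb by (auto simp: O2_def)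
 qed
 \<comment> \<open>Points to stay away from are those of earlier stages, collected in
   \<open>P\<close>, and those formed with an earlier \<open>b l\<close>, for every
   \<open>a k\<close> of this stage.\<close>
 define Qb where "Qb = (%j h v. \<phi> v : O2 & (ALL i<n. ALL q:P \<union> (\<Union>l<j::nat. \<Union>k<n. {a k \<otimes> h l}).
   \<phi> v ~: \<phi> ` ({inv (a i)} <#> DD <#> {q} <#> W) & \<phi> v ~: \<phi> ` ({inv (a i)} <#> W <#> {q} <#> DD)))"
 have "EX b. ALL i. b i : carrier G & Qb i b (b i)"
 proof (rule history_choice)
  show "Qb m h' v" if "!!i. i < m ==> h i = h' i" "Qb m h v" for m h h' v
  proof -
   have eq: "(\<Union>l<m. \<Union>k<n. {a k \<otimes> h l}) = (\<Union>l<m. \<Union>k<n. {a k \<otimes> h' l})" using that(1) by auto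
   show ?thesis using that(2) unfolding Qb_def eq .
  qed
  fix j :: nat and h assume h: "!!k. k < j ==> h k : carrier G"
  define P' where "P' = P \<union> (\<Union>l<j. \<Union>k<n. {a k \<otimes> h l})"
  have P': "finite P'" "q : P' ==> q : carrier G" for q using P h a by (auto simp: P'_def)
  define Z where "Z = (\<Union>(i, q)\<in>{..<n} \<times> P'. ({inv (a i)} <#> DD <#> {q} <#> W) \<union> ({inv (a i)} <#> W <#> {q} <#> DD))"
  have "compactin T Z" unfolding Z_def
   by (rule compactin_Union) (use P' a DD W in \<open>auto intro!: compactin_Un compactin_set_mult compactin_single\<close>)
  from far[OF O2 this] obtain g where g: "g : carrier G" "\<phi> g : O2" "\<phi> g ~: \<phi> ` Z" by blast
  have "{inv (a i)} <#> DD <#> {q} <#> W \<subseteq> Z" "{inv (a i)} <#> W <#> {q} <#> DD \<subseteq> Z" if "i < n" "q : P'" for i q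
   unfolding Z_def using that by blast+
  then have "Qb j h g" unfolding Qb_def P'_def[symmetric] using g(2,3) by blast
  then show "EX v:carrier G. Qb j h v" using g(1) by blast
 qed
 then obtain b where b: "!!i. b i : carrier G" "!!i. Qb i b (b i)" by blast
 have pre: "avoid \<phi> d W (a i \<otimes> b j) q"
  if i: "i < n" and q: "q : P \<union> (\<Union>l<j. \<Union>k<n. {a k \<otimes> b l})" and d: "d : DD" for i j q d
 proof
  have qc: "q : carrier G" using q P a b by auto
  have dc: "d : carrier G" using d Dc by blast
  have nb: "\<phi> (b j) ~: \<phi> ` ({inv (a i)} <#> DD <#> {q} <#> W)" "\<phi> (b j) ~: \<phi> ` ({inv (a i)} <#> W <#> {q} <#> DD)"
   using b(2)[of j] i q unfolding Qb_def by blast+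
  show "\<phi> (a i \<otimes> b j \<otimes> d \<otimes> inv q) ~: \<phi> ` W"
  proof
   assume "\<phi> (a i \<otimes> b j \<otimes> d \<otimes> inv q) : \<phi> ` W"
   then obtain w where w: "w : W" "\<phi> (a i \<otimes> b j \<otimes> d \<otimes> inv q) = \<phi> w" by blast
   have wc: "w : carrier G" using w Wc by blast
   have "\<phi> (inv (a i) \<otimes> (a i \<otimes> b j \<otimes> d \<otimes> inv q) \<otimes> (q \<otimes> inv d)) = \<phi> (inv (a i) \<otimes> w \<otimes> (q \<otimes> inv d))"
    by (rule subst[OF w(2)]) (use a b dc qc wc in auto)
   moreover have "inv (a i) \<otimes> (a i \<otimes> b j \<otimes> d \<otimes> inv q) \<otimes> (q \<otimes> inv d) = b j" using a b dc qc by (simp add: grp_simps)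
   moreover have "inv (a i) \<otimes> w \<otimes> (q \<otimes> inv d) = inv (a i) \<otimes> w \<otimes> q \<otimes> inv d" using a wc qc dc by (simp add: grp_simps)
   moreover have "inv (a i) \<otimes> w \<otimes> q \<otimes> inv d : {inv (a i)} <#> W <#> {q} <#> DD" using w d DD(2) by (auto intro!: mem_set_multI)
   ultimately show False using nb(2) by force
  qed
  show "\<phi> (inv (a i \<otimes> b j) \<otimes> d \<otimes> q) ~: \<phi> ` W"
  proof
   assume "\<phi> (inv (a i \<otimes> b j) \<otimes> d \<otimes> q) : \<phi> ` W"
   then obtain w where w: "w : W" "\<phi> (inv (a i \<otimes> b j) \<otimes> d \<otimes> q) = \<phi> w" by blast
   have wc: "w : carrier G" using w Wc by blast
   have "\<phi> (inv (a i) \<otimes> d \<otimes> q \<otimes> inv (inv (a i \<otimes> b j) \<otimes> d \<otimes> q)) = \<phi> (inv (a i) \<otimes> d \<otimes> q \<otimes> inv w)"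
    using w(2) a b dc qc wc by simp
   moreover have "inv (a i) \<otimes> d \<otimes> q \<otimes> inv (inv (a i \<otimes> b j) \<otimes> d \<otimes> q) = b j" using a b dc qc by (simp add: grp_simps)
   moreover have "inv (a i) \<otimes> d \<otimes> q \<otimes> inv w : {inv (a i)} <#> DD <#> {q} <#> W" using w d W(2) by (auto intro!: mem_set_multI)
   ultimately show False using nb(1) by force
  qed
 qed
 have fac: "inv (a i \<otimes> b j) \<otimes> d \<otimes> (a k \<otimes> b j) = inv (b j) \<otimes> (inv (a i) \<otimes> d \<otimes> a k) \<otimes> b j" if "d : carrier G" for i j k d
  using that a b by (simp add: grp_simps)
 have conj: "\<phi> (a i \<otimes> b j \<otimes> d \<otimes> inv (a k \<otimes> b j)) ~: \<phi> ` S" if d: "d : DD" and S: "S \<subseteq> carrier G" and nK: "\<phi> (b j \<otimes> d \<otimes> inv (b j)) ~: \<phi> ` K i S k" for i j k d S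
 proof
  assume "\<phi> (a i \<otimes> b j \<otimes> d \<otimes> inv (a k \<otimes> b j)) : \<phi> ` S"
  then obtain s where s: "s : S" "\<phi> (a i \<otimes> b j \<otimes> d \<otimes> inv (a k \<otimes> b j)) = \<phi> s" by blast
  have dc: "d : carrier G" "s : carrier G" using d Dc s S by auto
  have "\<phi> (inv (a i) \<otimes> (a i \<otimes> b j \<otimes> d \<otimes> inv (a k \<otimes> b j)) \<otimes> a k) = \<phi> (inv (a i) \<otimes> s \<otimes> a k)"
   by (rule subst[OF s(2)]) (use a b dc in auto)
  moreover have "inv (a i) \<otimes> (a i \<otimes> b j \<otimes> d \<otimes> inv (a k \<otimes> b j)) \<otimes> a k = b j \<otimes> d \<otimes> inv (b j)" using a b dc by (simp add: grp_simps)
  ultimately show False using nK KI[OF s(1), of i k] by force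
 qed
 have bO: "\<phi> (b j) : Nb i k" if "i < n" "k < n" for i j k
  using b(2)[of j] that by (auto simp: Qb_def O2_def)
 have Ws: "W \<subseteq> carrier G" "W' \<subseteq> carrier G" using Wc W'c by auto
 have off1: "avoid \<phi> d W (a i \<otimes> b j) (a k \<otimes> b l)"
  if "i < n" "j < n" "k < n" "l < n" "(i, j) ~= (k, l)" "l <= j" "d : DD" for i j k l d
 proof (cases "l < j")
  case True
  then show ?thesis using pre[of i "a k \<otimes> b l" j d] that by blast
 next
  case False
  then have l: "l = j" "i ~= k" using that by auto
  have "\<phi> (inv (b j) \<otimes> (inv (a i) \<otimes> d \<otimes> a k) \<otimes> b j) ~: \<phi> ` W & \<phi> (b j \<otimes> d \<otimes> inv (b j)) ~: \<phi> ` K i W k"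
   using Nb[of i k] bO[of i k j] b(1)[of j] that l by blast
  then show ?thesis using conj[OF that(7) Ws(1), of j i k] fac[OF Dc[OF that(7)], of i j k] l(1) by simp
 qed
 have off: "avoid \<phi> d W (a i \<otimes> b j) (a k \<otimes> b l)"
  if "i < n" "j < n" "k < n" "l < n" "(i, j) ~= (k, l)" "d : DD" for i j k l d
 proof (cases "l <= j")
  case False
  have 1: "\<phi> (a k \<otimes> b l \<otimes> inv d \<otimes> inv (a i \<otimes> b j)) ~: \<phi> ` W & \<phi> (inv (a k \<otimes> b l) \<otimes> inv d \<otimes> (a i \<otimes> b j)) ~: \<phi> ` W"
   by (rule off1) (use that False DD(2) in auto)
  have c: "a i \<otimes> b j : carrier G" "d : carrier G" "a k \<otimes> b l : carrier G" using a b that Dc by auto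
  have sw: "\<phi> x ~: \<phi> ` W" if "\<phi> (inv x) ~: \<phi> ` W" "x : carrier G" for x using swap[of x W] that W(2) Wc by blast
  show ?thesis
  proof
   show "\<phi> (a i \<otimes> b j \<otimes> d \<otimes> inv (a k \<otimes> b l)) ~: \<phi> ` W"
    by (rule sw) (use 1 c in \<open>simp_all only: inv3(2)[OF c] m_closed inv_closed simp_thms not_False_eq_True\<close>)
   show "\<phi> (inv (a i \<otimes> b j) \<otimes> d \<otimes> (a k \<otimes> b l)) ~: \<phi> ` W"
    by (rule sw) (use 1 c in \<open>simp_all only: inv3(1)[OF c] m_closed inv_closed simp_thms not_False_eq_True\<close>)
  qed
 qed (use off1 that in blast)
 have dg: "avoid \<phi> d W' (a i \<otimes> b j) (a i \<otimes> b j)"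
  if "i < n" "j < n" "d : DD" for i j d
 proof -
  have "\<phi> (inv (b j) \<otimes> (inv (a i) \<otimes> d \<otimes> a i) \<otimes> b j) ~: \<phi> ` W' & \<phi> (b j \<otimes> d \<otimes> inv (b j)) ~: \<phi> ` K i W' i"
   using Nb[of i i] bO[of i i j] b(1)[of j] that by blast
  then show ?thesis using conj[OF that(3) Ws(2), of j i i] fac[OF Dc[OF that(3)], of i j i] by simp
 qed
 have "ALL i<n. ALL j<n. ALL k<n. ALL l<n. (i, j) ~= (k, l) --> (avoids \<phi> DD W (a i \<otimes> b j) (a k \<otimes> b l))"
  by (intro allI impI ballI) (rule off)
 moreover have "ALL i<n. ALL j<n. ALL q:P. avoids \<phi> DD W (a i \<otimes> b j) q"
  by (intro allI impI ballI, rule pre) (simp_all only: UnI1)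
 moreover have "ALL i<n. ALL j<n. avoids \<phi> DD W' (a i \<otimes> b j) (a i \<otimes> b j)"
  by (intro allI impI ballI) (rule dg)
 ultimately show ?thesis using a(1) b(1) by (intro exI[of _ a] exI[of _ b] conjI) simp_all
qed

end

context top_grp
begin

text \<open>Common frame of both constructions: stage \<open>n\<close> has to avoid a single compact
  set \<open>W n\<close> and a finite set of earlier points, and \<open>exh\<close> turns this into
  avoidance of every compact set. Only the part of a compact set that products of elements of
  \<open>M\<close> can reach has to be exhausted by the \<open>W n\<close>. The diagonal condition
  \<open>Dg\<close> is left open, because the two constructions satisfy it for different
  reasons.\<close>

lemma half_graphs_from_stage_choice:
 fixes Q :: "'b monoid" and \<phi> :: "'a => 'b" and W :: "nat => 'a set" and Dg :: "nat => 'a => bool"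
 assumes lc: "locally_compact_space T" and Q: "group Q" and hom: "\<phi> : hom G Q"
  and U: "openin T U" "\<one> : U" "U \<subseteq> V" and V: "compactin T V" "!!v. v : V ==> inv v : V"
  and C0: "compactin T C0" and M: "M \<subseteq> carrier G" "!!x y. x : M ==> y : M ==> x \<otimes> y : M"
  and VW: "!!n. V \<subseteq> W n"
  and exh: "!!C. compactin T C ==> EX n0. ALL n>=n0. ALL p:M. ALL q:M. ALL d:V. ALL d':V.
    (\<phi> (p \<otimes> d \<otimes> d' \<otimes> inv q) : \<phi> ` C --> \<phi> (p \<otimes> d \<otimes> d' \<otimes> inv q) : \<phi> ` W n) &
    (\<phi> (inv p \<otimes> d \<otimes> d' \<otimes> q) : \<phi> ` C --> \<phi> (inv p \<otimes> d \<otimes> d' \<otimes> q) : \<phi> ` W n)"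
  and dg: "!!C. compactin T C ==> \<phi> ` C \<inter> \<phi> ` C0 = {} ==> EX n0. ALL n>=n0. ALL p:M. Dg n p --> (avoids2 \<phi> V C p p)"
  and stage: "!!n P. finite P ==> P \<subseteq> M ==> EX (a :: nat => 'a) (b :: nat => 'a). (ALL i. a i : M) & (ALL i. b i : M) &
   (ALL i<n. ALL j<n. ALL k<n. ALL l<n. (i, j) ~= (k, l) --> (avoids2 \<phi> V (W n) (a i \<otimes> b j) (a k \<otimes> b l))) &
   (ALL i<n. ALL j<n. ALL q:P. avoids2 \<phi> V (W n) (a i \<otimes> b j) q) &
   (ALL i<n. ALL j<n. Dg n (a i \<otimes> b j))"
 shows "EX f:WAP G T. half_graphs G f"
proof -
 interpret Q: group Q by (rule Q)
 interpret \<phi>: group_hom G Q \<phi> using hom by unfold_locales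
 define P where "P = (%n (h :: nat => (nat => 'a) \<times> (nat => 'a)). \<Union>m<n. (%(k, l). fst (h m) k \<otimes> snd (h m) l) ` ({..<m} \<times> {..<m}))"
 define ok1 where "ok1 = (%n p q. avoids2 \<phi> V (W n) p q)"
 define Qs where "Qs = (%n h (a, b). 
   (ALL i<n. ALL j<n. ALL k<n. ALL l<n. (i, j) ~= (k, l) --> ok1 n (a i \<otimes> b j) (a k \<otimes> b l)) &
   (ALL i<n. ALL j<n. ALL q:P n h. ok1 n (a i \<otimes> b j) q) & (ALL i<n. ALL j<n. Dg n (a i \<otimes> b j)))"
 define S0 where "S0 = {(a :: nat => 'a, b :: nat => 'a). (ALL i. a i : M) & (ALL i. b i : M)}"
 have "EX s. ALL n. s n : S0 & Qs n s (s n)"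
 proof (rule history_choice)
  show "Qs n h' v" if "!!i. i < n ==> h i = h' i" "Qs n h v" for n h h' v
  proof -
   have "P n h = P n h'" using that(1) by (auto simp: P_def)
   then show ?thesis using that(2) by (simp add: Qs_def)
  qed
  fix n :: nat and h :: "nat => (nat => 'a) \<times> (nat => 'a)" assume h: "!!m. m < n ==> h m : S0"
  have fin: "finite (P n h)" by (simp add: P_def)
  have PM: "P n h \<subseteq> M" using h M(2) by (fastforce simp: P_def S0_def)
  have "EX (a :: nat => 'a) (b :: nat => 'a). (ALL i. a i : M) & (ALL i. b i : M) & Qs n h (a, b)"
   unfolding Qs_def ok1_def prod.case by (rule stage[OF fin PM])
  then show "EX v:S0. Qs n h v" unfolding S0_def by blast
 qed
 then obtain s where s: "!!n. s n : S0" "!!n. Qs n s (s n)" by blast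
 define a where "a = (%n. fst (s n))"
 define b where "b = (%n. snd (s n))"
 have abM: "a n i : M" "b n i : M" for n i using s(1)[of n] by (auto simp: a_def b_def S0_def)
 have ab: "a n i : carrier G" "b n i : carrier G" for n i using abM M by auto
 have Qn: "Qs n s (a n, b n)" for n using s(2)[of n] by (simp add: a_def b_def)
 have comb: "ok1 n (a n i \<otimes> b n j) (a m k \<otimes> b m l)"
  if "m <= n" "i < n" "j < n" "k < m" "l < m" "(n, i, j) ~= (m, k, l)" for n m i j k l
 proof (cases "m = n")
  case True
  then show ?thesis using Qn[of n] that by (auto simp: Qs_def)
 next
  case False
  then have "a m k \<otimes> b m l : P n s" using that by (force simp: P_def a_def b_def)
  then show ?thesis using Qn[of n] that by (simp add: Qs_def)
 qed
 have dgn: "Dg n (a n i \<otimes> b n j)" if "i < n" "j < n" for n i j using Qn[of n] that by (simp add: Qs_def)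
 have oneV: "\<one> : V" using U by blast
 have Vc: "V \<subseteq> carrier G" using V(1) compactin_carrier by blast
 show ?thesis
 proof (rule half_graphs_from_stages[OF lc Q hom U V(1) V(2) C0 ab])
  fix C assume C: "compactin T C"
  obtain n0 where n0: "ALL n>=n0. ALL p:M. ALL q:M. ALL d:V. ALL d':V.
    (\<phi> (p \<otimes> d \<otimes> d' \<otimes> inv q) : \<phi> ` C --> \<phi> (p \<otimes> d \<otimes> d' \<otimes> inv q) : \<phi> ` W n) &
    (\<phi> (inv p \<otimes> d \<otimes> d' \<otimes> q) : \<phi> ` C --> \<phi> (inv p \<otimes> d \<otimes> d' \<otimes> q) : \<phi> ` W n)"
   using exh[OF C] by (rule exE)
  have "avoid2 \<phi> d d' C p q"
   if "n >= n0" "p : M" "q : M" "d : V" "d' : V" "ok1 n p q" for n p q d d'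
   using n0[rule_format, OF that(1-5)] that(4-6) unfolding ok1_def by blast
  then show "EX n0. ALL n>=n0. ALL m<=n. ALL i<n. ALL j<n. ALL k<m. ALL l<m. (n, i, j) ~= (m, k, l) -->
    (avoids2 \<phi> V C (a n i \<otimes> b n j) (a m k \<otimes> b m l))"
   using comb abM M(2) by (intro exI[of _ n0] allI impI ballI) meson
 next
  fix C assume C: "compactin T C" "\<phi> ` C \<inter> \<phi> ` C0 = {}"
  obtain n0 where n0: "ALL n>=n0. ALL p:M. Dg n p --> (avoids2 \<phi> V C p p)"
   using dg[OF C] by (rule exE)
  show "EX n0. ALL n>=n0. ALL i<n. ALL j<n.
    (avoids2 \<phi> V C (a n i \<otimes> b n j) (a n i \<otimes> b n j))"
   by (intro exI[of _ n0] allI impI ballI, rule n0[rule_format]) (use dgn abM M(2) in auto)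
 next
  fix n i j m k l :: nat and v v' assume lt: "i < n" "j < n" "k < m" "l < m" "(n, i, j) ~= (m, k, l)" and v: "v : V" "v' : V"
  define p where "p = a n i \<otimes> b n j"
  define q where "q = a m k \<otimes> b m l"
  have c: "p : carrier G" "q : carrier G" "v : carrier G" "v' : carrier G" using ab v Vc by (auto simp: p_def q_def)
  show "\<phi> (a n i \<otimes> b n j) ~= \<phi> (v \<otimes> (a m k \<otimes> b m l) \<otimes> v')"
   unfolding p_def[symmetric] q_def[symmetric]
  proof
   assume eq: "\<phi> p = \<phi> (v \<otimes> q \<otimes> v')"
   show False
   proof (cases "m <= n")
    case True
    \<comment> \<open>The identity stands in for \<open>d'\<close>. If the two points agreed after
      \<phi>, this element would have the same image as \<open>inv v'\<close>, which lies in
      \<open>V\<close> and so in \<open>W n\<close>.\<close>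
    have "\<phi> (inv p \<otimes> v \<otimes> \<one> \<otimes> q) ~: \<phi> ` W n"
     using comb[OF True lt(1-5)] v oneV unfolding ok1_def p_def q_def by blast
    moreover have "\<phi> (inv p \<otimes> v \<otimes> \<one> \<otimes> q) = \<phi> (inv (v \<otimes> q \<otimes> v') \<otimes> v \<otimes> q)" using eq c by simp
    moreover have "inv (v \<otimes> q \<otimes> v') \<otimes> v \<otimes> q = inv v'" using c by (simp add: grp_simps)
    ultimately show False using VW[of n] V(2)[OF v(2)] by auto
   next
    case False
    then have "ok1 m q p" unfolding p_def q_def using lt by (intro comb) auto
    then have "\<phi> (inv q \<otimes> inv v \<otimes> \<one> \<otimes> p) ~: \<phi> ` W m" using V(2)[OF v(1)] oneV unfolding ok1_def by blast
    moreover have "\<phi> (inv q \<otimes> inv v \<otimes> \<one> \<otimes> p) = \<phi> (inv q \<otimes> inv v \<otimes> (v \<otimes> q \<otimes> v'))" using eq c by simp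
    moreover have "inv q \<otimes> inv v \<otimes> (v \<otimes> q \<otimes> v') = v'" using c by (simp add: grp_simps)
    ultimately show False using VW[of m] v(2) by auto
   qed
  qed
 qed
qed

theorem half_graphs_nonclosed_range:
 fixes Q :: "'b monoid"
 assumes lc: "locally_compact_space T" and conn: "connected_space T"
  and Q: "topological_group Q T'" and hom: "\<phi> : hom G Q" and cont: "continuous_map T T' \<phi>"
  and ncl: "~ closedin T' (\<phi> ` carrier G)"
 shows "EX f:WAP G T. half_graphs G f"
proof -
 interpret Q: top_grp Q T' by (unfold_locales) (rule Q)
 interpret \<phi>: group_hom G Q \<phi> using hom by unfold_locales
 obtain U V where U: "openin T U" "\<one> : U" "U \<subseteq> V" and V: "compactin T V" "!!v. v : V ==> inv v : V"
  by (rule symmetric_compact_neighbourhood[OF lc], rule that)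
 obtain W :: "nat => 'a set" where W: "!!n. compactin T (W n)" "!!n. V \<subseteq> W n" "!!n x. x : W n ==> inv x : W n"
  "!!C. compactin T C ==> EX n0. ALL n>=n0. C \<subseteq> W n"
  by (rule compact_exhaustion_connected[OF conn U V(1)], erule V(2), rule that)
 have Vc: "V \<subseteq> carrier G" using V(1) compactin_carrier by blast
 define B where "B = V <#> V"
 have B: "compactin T B" unfolding B_def by (intro compactin_set_mult V(1))
 have Bc: "B \<subseteq> carrier G" using B compactin_carrier by blast
 have Binv: "inv x : B" if x: "x : B" for x
 proof -
  obtain v v' where v: "v : V" "v' : V" "x = v \<otimes> v'" using x by (auto simp: B_def set_mult_def)
  then have "inv x = inv v' \<otimes> inv v" using Vc by (simp add: inv_mult_group subset_iff)
  then show ?thesis using v V(2) by (auto simp: B_def intro!: mem_set_multI)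
 qed
 \<comment> \<open>\<open>N\<close> is open, saturated for \<phi>, and modulo \<phi> lies between
   \<open>B\<close> and \<open>B <#> V\<close>. Removing it from \<open>W n\<close> leaves a compact
   set disjoint from \<open>B\<close> after \<phi>, and compact sets off \<open>B <#> V\<close> are
   still exhausted; hence \<open>B <#> V\<close> as \<open>C0\<close>.\<close>
 define N where "N = {x : carrier G. \<phi> x : \<phi> ` (B <#> U)}"
 have Uc: "U \<subseteq> carrier G" using U Vc by blast
 have "openin T N"
  unfolding openin_subopen[of T N]
 proof
  fix x assume "x : N"
  then obtain d u where x: "x : carrier G" "d : B" "u : U" "\<phi> x = \<phi> (d \<otimes> u)" by (auto simp: N_def set_mult_def)
  have c: "d : carrier G" "u : carrier G" using x Bc Uc by auto
  define S where "S = {z : carrier G. (u \<otimes> inv x) \<otimes> z : U}"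
  have "openin T S" unfolding S_def using x c by (intro openin_ltranslate U) auto
  moreover have "x : S" using x c by (simp add: S_def grp_simps)
  moreover have "S \<subseteq> N"
  proof
   fix z assume z: "z : S"
   then have zc: "z : carrier G" "u \<otimes> inv x \<otimes> z : U" by (auto simp: S_def)
   have "\<phi> z = \<phi> (x \<otimes> inv u \<otimes> (u \<otimes> inv x \<otimes> z))" using x c zc by (simp add: grp_simps del: \<phi>.hom_mult)
   also have "\<dots> = \<phi> (d \<otimes> u \<otimes> inv u \<otimes> (u \<otimes> inv x \<otimes> z))" using x c zc by simp
   also have "d \<otimes> u \<otimes> inv u \<otimes> (u \<otimes> inv x \<otimes> z) = d \<otimes> (u \<otimes> inv x \<otimes> z)" using x c zc by (simp add: grp_simps)
   finally show "z : N" using zc x(2) by (auto simp: N_def intro!: imageI mem_set_multI)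
  qed
  ultimately show "EX S. openin T S & x : S & S \<subseteq> N" by blast
 qed
 then have clN: "closedin T (carrier G - N)" by (metis closedin_diff closedin_topspace topspace_T)
 define W' where "W' = (%n. W n \<inter> (carrier G - N))"
 have W': "compactin T (W' n)" for n unfolding W'_def using W(1) clN by (simp add: compact_Int_closedin)
 have BN: "b : N" if "b : B" for b
  using that Bc U(2) mem_set_multI[of b B \<one> U] by (auto simp: N_def subset_iff)
 have dis: "\<phi> ` B \<inter> \<phi> ` W' n = {}" for n
 proof (rule ccontr)
  assume "~ ?thesis"
  then obtain b w where bw: "b : B" "w : W' n" "\<phi> b = \<phi> w" by auto
  then have "\<phi> w : \<phi> ` (B <#> U)" using BN[of b] by (simp add: N_def)
  then show False using bw(2) by (auto simp: W'_def N_def)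
 qed
 define Dg where "Dg = (%n p. avoids \<phi> B (W' n) p p)"
 have VB: "d \<otimes> d' : B" if "d : V" "d' : V" for d d' using that by (auto simp: B_def intro!: mem_set_multI)
 have assoc: "p \<otimes> d \<otimes> d' \<otimes> q = p \<otimes> (d \<otimes> d') \<otimes> q" if "p : carrier G" "q : carrier G" "d : V" "d' : V" for p q d d'
  using that Vc by (simp add: m_assoc subset_iff)
 show ?thesis
 proof (rule half_graphs_from_stage_choice[OF lc Q.is_group hom U V(1) V(2) compactin_set_mult[OF B V(1)] order_refl m_closed W(2), where Dg = Dg])
  fix C assume C: "compactin T C"
  obtain n0 where "!!n. n >= n0 ==> C \<subseteq> W n" using W(4)[OF C] by blast
  then show "EX n0. ALL n>=n0. ALL p:carrier G. ALL q:carrier G. ALL d:V. ALL d':V.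
    (\<phi> (p \<otimes> d \<otimes> d' \<otimes> inv q) : \<phi> ` C --> \<phi> (p \<otimes> d \<otimes> d' \<otimes> inv q) : \<phi> ` W n) &
    (\<phi> (inv p \<otimes> d \<otimes> d' \<otimes> q) : \<phi> ` C --> \<phi> (inv p \<otimes> d \<otimes> d' \<otimes> q) : \<phi> ` W n)"
   by (intro exI[of _ n0]) blast
 next
  fix C assume C: "compactin T C" "\<phi> ` C \<inter> \<phi> ` (B <#> V) = {}"
  obtain n0 where n0: "!!n. n >= n0 ==> C \<subseteq> W n" using W(4)[OF C(1)] by blast
  have "B <#> U \<subseteq> B <#> V" using U(3) by (auto simp: set_mult_def)
  then have "C \<inter> N = {}" using C(2) by (auto simp: N_def)
  then have CW: "C \<subseteq> W' n" if "n >= n0" for n using n0[OF that] compactin_carrier[OF C(1)] by (auto simp: W'_def)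
  have "avoid2 \<phi> d d' C p p"
   if "n >= n0" "p : carrier G" "Dg n p" "d : V" "d' : V" for n p d d'
  proof -
   have "\<phi> (p \<otimes> (d \<otimes> d') \<otimes> inv p) ~: \<phi> ` W' n & \<phi> (inv p \<otimes> (d \<otimes> d') \<otimes> p) ~: \<phi> ` W' n"
    using that(3) VB[OF that(4,5)] unfolding Dg_def by blast
   then show ?thesis unfolding assoc[OF that(2) inv_closed[OF that(2)] that(4,5)] assoc[OF inv_closed[OF that(2)] that(2) that(4,5)]
    using CW[OF that(1)] by blast
  qed
  then show "EX n0. ALL n>=n0. ALL p:carrier G. Dg n p --> (avoids2 \<phi> V C p p)"
   by (intro exI[of _ n0] allI impI ballI)
 next
  fix n P assume P: "finite P" "P \<subseteq> carrier G"
  define St where "St = (%(a :: nat => 'a) (b :: nat => 'a). (ALL i. a i : carrier G) & (ALL i. b i : carrier G) &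
  (ALL i<n. ALL j<n. ALL k<n. ALL l<n. (i, j) ~= (k, l) --> (avoids \<phi> B (W n) (a i \<otimes> b j) (a k \<otimes> b l))) &
  (ALL i<n. ALL j<n. ALL q:P. avoids \<phi> B (W n) (a i \<otimes> b j) q) &
  (ALL i<n. ALL j<n. avoids \<phi> B (W' n) (a i \<otimes> b j) (a i \<otimes> b j)))"
  have "EX a b. St a b" unfolding St_def
   by (rule stage_near_one[OF Q hom cont ncl B _ W(1) _ W' dis P]) (fact Binv, fact W(3))
  then obtain a b where "St a b" by blast
  note * = this[unfolded St_def]
  note s1 = *[THEN conjunct2, THEN conjunct2, THEN conjunct1, rule_format]
  note s2 = *[THEN conjunct2, THEN conjunct2, THEN conjunct2, THEN conjunct1, rule_format]
  note s3 = *[THEN conjunct2, THEN conjunct2, THEN conjunct2, THEN conjunct2]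
  have c: "a i : carrier G" "b i : carrier G" "a i \<otimes> b j : carrier G" "inv (a i \<otimes> b j) : carrier G" for i j using * by auto
  have q: "q : carrier G" "inv q : carrier G" if "q : P" for q using that P(2) by auto
  have 1: "avoid2 \<phi> d d' (W n) (a i \<otimes> b j) (a k \<otimes> b l)"
   if "i < n" "j < n" "k < n" "l < n" "(i, j) ~= (k, l)" "d : V" "d' : V" for i j k l d d'
   unfolding assoc[OF c(3) c(4) that(6,7)] assoc[OF c(4) c(3) that(6,7)] by (rule s1[OF that(1-5) VB[OF that(6,7)]])
  have 2: "avoid2 \<phi> d d' (W n) (a i \<otimes> b j) q"
   if "i < n" "j < n" "q : P" "d : V" "d' : V" for i j q d d'
   unfolding assoc[OF c(3) q(2)[OF that(3)] that(4,5)] assoc[OF c(4) q(1)[OF that(3)] that(4,5)]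
   by (rule s2[OF that(1-3) VB[OF that(4,5)]])
  have 3: "ALL i<n. ALL j<n. Dg n (a i \<otimes> b j)" unfolding Dg_def by (rule s3)
  have 1: "ALL i<n. ALL j<n. ALL k<n. ALL l<n. (i, j) ~= (k, l) --> (avoids2 \<phi> V (W n) (a i \<otimes> b j) (a k \<otimes> b l))"
   by (intro allI impI ballI) (rule 1)
  have 2: "ALL i<n. ALL j<n. ALL q:P. avoids2 \<phi> V (W n) (a i \<otimes> b j) q"
   by (intro allI impI ballI) (rule 2)
  show "EX (a :: nat => 'a) (b :: nat => 'a). (ALL i. a i : carrier G) & (ALL i. b i : carrier G) &
   (ALL i<n. ALL j<n. ALL k<n. ALL l<n. (i, j) ~= (k, l) --> (avoids2 \<phi> V (W n) (a i \<otimes> b j) (a k \<otimes> b l))) &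
   (ALL i<n. ALL j<n. ALL q:P. avoids2 \<phi> V (W n) (a i \<otimes> b j) q) &
   (ALL i<n. ALL j<n. Dg n (a i \<otimes> b j))"
   by (intro exI[of _ a] exI[of _ b] conjI 1 2 3 allI c)
 qed
qed

end

section \<open>Half graphs from a subgroup that normalizes a compact neighbourhood\<close>

lemma large_independent_subset:
 assumes "finite S" "n * Suc d <= card S" "!!x. x : S ==> card {y : S. R x y} <= d" "!!x y. R x y ==> R y x"
 shows "\<exists>I\<subseteq>S. card I = n & (ALL x:I. ALL y:I. x ~= y --> ~ R x y)"
 using assms
proof (induction n arbitrary: S)
 case 0 then show ?case by (intro exI[of _ "{}"]) auto
next
 case (Suc n)
 then have "S ~= {}" by auto
 then obtain x where x: "x : S" by blast
 \<comment> \<open>Greedy choice: each selected element costs itself and at most \<open>d\<close>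
   neighbours.\<close>
 define S' where "S' = S - insert x {y : S. R x y}"
 have fin: "finite S'" using Suc.prems(1) by (simp add: S'_def)
 have "card (insert x {y : S. R x y}) <= Suc d"
  using Suc.prems(1,3) x card_insert_le_m1[of "Suc d" "{y : S. R x y}" x] by simp
 then have "n * Suc d <= card S'" unfolding S'_def
  using Suc.prems(1,2) x diff_card_le_card_Diff[of "insert x {y : S. R x y}" S] by simp
 moreover have "card {y : S'. R z y} <= d" if "z : S'" for z
 proof -
  have "card {y : S'. R z y} <= card {y : S. R z y}" using Suc.prems(1) by (intro card_mono) (auto simp: S'_def)
  then show ?thesis using Suc.prems(3)[of z] that by (simp add: S'_def)
 qed
 ultimately obtain I where I: "I \<subseteq> S'" "card I = n" "ALL x:I. ALL y:I. x ~= y --> ~ R x y"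
  using Suc.IH[OF fin] Suc.prems(4) by blast
 have "x ~: I" "finite I" using I(1) fin finite_subset by (auto simp: S'_def)
 moreover have "~ R x y & ~ R y x" if "y : I" for y using that I(1) Suc.prems(4) by (auto simp: S'_def)
 ultimately show ?case using I x by (intro exI[of _ "insert x I"]) (auto simp: S'_def)
qed

context top_grp
begin

lemma small_neighbourhood:
 assumes U: "openin T U" "\<one> : U"
 obtains U' where "openin T U'" "\<one> : U'" "!!x y. x : U' ==> y : U' ==> inv x \<otimes> y : U"
proof -
 let ?W = "{p : topspace (prod_topology T T). inv (fst p) \<otimes> snd p : U}"
 have "continuous_map (prod_topology T T) T (%p. inv (fst p) \<otimes> snd p)"
  by (intro continuous_map_mult continuous_map_inv continuous_map_fst continuous_map_snd)
 then have "openin (prod_topology T T) ?W" by (rule openin_continuous_map_preimage[OF _ U(1)])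
 moreover have "(\<one>, \<one>) : ?W" using U(2) by simp
 ultimately have "EX A B. openin T A & openin T B & \<one> : A & \<one> : B & A \<times> B \<subseteq> ?W"
  by (rule openin_prod_topology_alt[THEN iffD1, THEN spec, THEN spec, THEN mp])
 then obtain A B where AB: "openin T A" "openin T B" "\<one> : A" "\<one> : B" "A \<times> B \<subseteq> ?W" by (elim exE conjE)
 show thesis
  by (rule that[of "A \<inter> B"]) (use AB in auto)
qed

text \<open>Total boundedness in the form used below: among more elements of \<open>C\<close> than
  there are members of the cover, two have their quotient in \<open>U\<close>.\<close>

lemma finite_small_cover:
 assumes C: "compactin T C" and U: "openin T U" "\<one> : U"
 obtains \<F> :: "'a set set" where "finite \<F>" "C \<subseteq> \<Union>\<F>" "!!S x y. S : \<F> ==> x : S ==> y : S ==> inv x \<otimes> y : U"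
  "!!S. S : \<F> ==> S \<subseteq> carrier G"
proof -
 obtain U' where U': "openin T U'" "\<one> : U'" "!!x y. x : U' ==> y : U' ==> inv x \<otimes> y : U"
  by (rule small_neighbourhood[OF U], rule that)
 define t where "t = (%z. {x : carrier G. inv z \<otimes> x : U'})"
 have Cc: "C \<subseteq> carrier G" using C compactin_carrier by blast
 obtain F where F: "finite F" "F \<subseteq> C" "C \<subseteq> (\<Union>z\<in>F. t z)"
  by (rule compactin_finite_cover[OF C, of t]) (use openin_ltranslate[OF U'(1)] U'(2) Cc in \<open>auto simp: t_def\<close>)
 have "inv x \<otimes> y : U" if "z : F" "x : t z" "y : t z" for x y z
 proof -
  have "inv (inv z \<otimes> x) \<otimes> (inv z \<otimes> y) : U" using that by (intro U'(3)) (auto simp: t_def)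
  moreover have "inv (inv z \<otimes> x) \<otimes> (inv z \<otimes> y) = inv x \<otimes> y" using that F(2) Cc by (auto simp: t_def grp_simps)
  ultimately show ?thesis by simp
 qed
 then show thesis by (intro that[of "t ` F"]) (use F in \<open>auto simp: t_def\<close>)
qed

text \<open>
  In a stage a large pool of pairwise distant \<open>b\<close>'s is chosen first and then the \<open>a\<close>'s. Of the
  quotients \<open>a (b j) (b l)\<inverse> a\<inverse>\<close> only boundedly many (in \<open>j\<close>) can lie in a given compact set, because
  conjugation by \<open>M\<close> preserves their distance, so that the pool can be thinned out to avoid this set.
\<close>

theorem half_graphs_normalizing_subgroup:
 assumes lc: "locally_compact_space T"
  and U: "openin T U" "\<one> : U" "U \<subseteq> V" and V: "compactin T V" "!!v. v : V ==> inv v : V"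
  and M: "subgroup M G" and normal: "!!m v. m : M ==> v : V ==> m \<otimes> v \<otimes> inv m : V"
  and unbounded: "!!C. compactin T C ==> ~ M \<subseteq> C"
 shows "EX f:WAP G T. half_graphs G f"
proof -
 have Mc: "M \<subseteq> carrier G" by (rule subgroup.subset[OF M])
 have M1: "\<one> : M" and Mm: "!!x y. x : M ==> y : M ==> x \<otimes> y : M" and Mi: "!!x. x : M ==> inv x : M"
  using M by (auto simp: subgroup.one_closed subgroup.m_closed subgroup.m_inv_closed)
 have Vc: "V \<subseteq> carrier G" using V(1) compactin_carrier by blast
 have oneV: "\<one> : V" using U by blast
 \<comment> \<open>A \<open>V\<close>-separated sequence in \<open>M\<close>. The subgroup
   \<open>M'\<close> generated by it replaces \<open>M\<close>: it is still contained in no compact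
   set, but being countable it is exhausted by the finite sets \<open>F n\<close>.\<close>
 have "EX s. ALL n::nat. s n : M & (ALL k<n. s n ~: {s k} <#> V)"
 proof (rule history_choice)
  fix n :: nat and h assume h: "!!i. i < n ==> h i : M"
  have "compactin T (\<Union>k<n. {h k} <#> V)"
   by (rule compactin_Union) (use h Mc in \<open>auto intro!: compactin_set_mult V compactin_single\<close>)
  then obtain v where "v : M" "v ~: (\<Union>k<n. {h k} <#> V)" using unbounded by blast
  then show "EX v:M. ALL k<n. v ~: {h k} <#> V" by blast
 qed auto
 then obtain s where s0: "ALL n::nat. s n : M & (ALL k<n. s n ~: {s k} <#> V)" by (rule exE)
 have s: "s n : M" "k < n ==> s n ~: {s k} <#> V" for n k using s0[THEN spec, of n] by simp_all
 define F where "F = rec_nat {\<one>} (%n S. (%(x, y). x \<otimes> inv y) ` ((S \<union> {s n, \<one>}) \<times> (S \<union> {s n, \<one>})))"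
 have F0: "F 0 = {\<one>}" and FS: "F (Suc n) = (%(x, y). x \<otimes> inv y) ` ((F n \<union> {s n, \<one>}) \<times> (F n \<union> {s n, \<one>}))" for n
  by (simp_all add: F_def)
 have FM: "F n \<subseteq> M" for n
 proof (induction n)
  case (Suc n)
  then have "F n \<union> {s n, \<one>} \<subseteq> M" using s(1) M1 by auto
  then show ?case unfolding FS using Mm Mi by auto
 qed (simp add: F0 M1)
 have Ff: "finite (F n)" for n by (induction n) (auto simp: F0 FS)
 have FSI: "x \<otimes> inv y : F (Suc n)" if "x : F n \<union> {s n, \<one>}" "y : F n \<union> {s n, \<one>}" for x y n
  unfolding FS by (rule image_eqI[of _ _ "(x, y)"]) (use that in auto)
 have step: "x : F (Suc n)" if "x : F n \<union> {s n, \<one>}" for x n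
 proof -
  have "x : carrier G" using that FM[of n] s(1) Mc by auto
  then show ?thesis using FSI[OF that, of \<one>] by simp
 qed
 have mono: "m <= n ==> F m \<subseteq> F n" for m n
  by (induction n) (use step in \<open>auto simp: le_Suc_eq\<close>)
 define M' where "M' = (\<Union>n. F n)"
 have M'M: "M' \<subseteq> M" using FM by (auto simp: M'_def)
 then have M'c: "M' \<subseteq> carrier G" using Mc by blast
 have M'1: "\<one> : M'" using F0 by (auto simp: M'_def intro!: exI[of _ 0])
 have M'd: "x \<otimes> inv y : M'" if "x : M'" "y : M'" for x y
 proof -
  obtain m n where "x : F m" "y : F n" using \<open>x : M'\<close> \<open>y : M'\<close> by (auto simp: M'_def)
  then have "x : F (max m n)" "y : F (max m n)" using mono[of m "max m n"] mono[of n "max m n"] by auto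
  then show ?thesis using FSI[of x "max m n" y] by (auto simp: M'_def)
 qed
 have M'i: "inv x : M'" if "x : M'" for x using M'd[OF M'1 that] that M'c by auto
 have M'm: "x \<otimes> y : M'" if "x : M'" "y : M'" for x y using M'd[OF that(1) M'i[OF that(2)]] that M'c by auto
 have sM': "s n : M'" for n using step[of "s n" n] by (auto simp: M'_def)
 \<comment> \<open>A compact set containing \<open>M'\<close> would contain the separated sequence,
   against the pigeonhole principle for a finite cover by small sets.\<close>
 have far: "EX x:M'. x ~: C" if C: "compactin T C" for C
 proof (rule ccontr)
  assume "~ ?thesis"
  then have sC: "s n : C" for n using sM' by blast
  obtain \<F> where \<F>: "finite \<F>" "C \<subseteq> \<Union>\<F>" "!!S x y. S : \<F> ==> x : S ==> y : S ==> inv x \<otimes> y : U" "!!S. S : \<F> ==> S \<subseteq> carrier G"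
   by (rule finite_small_cover[OF C U(1,2)], rule that)
  have "ALL n. EX S:\<F>. s n : S" using sC \<F>(2) by blast
  then obtain g where g: "!!n. g n : \<F>" "!!n. s n : g n" by metis
  have "~ inj g" using \<F>(1) g(1) finite_subset[of "range g" \<F>] finite_imageD[of g UNIV] by (auto simp: image_subset_iff)
  then obtain k l where kl: "k < l" "g k = g l" by (metis injI linorder_neqE_nat)
  have "inv (s k) \<otimes> s l : V" using \<F>(3)[OF g(1)[of k] g(2)[of k], of "s l"] g(2)[of l] kl(2) U(3) by auto
  then have "s k \<otimes> (inv (s k) \<otimes> s l) : {s k} <#> V" by (intro mem_set_multI) auto
  moreover have "s k : carrier G" "s l : carrier G" using s(1) Mc by auto
  ultimately show False using s(2)[OF kl(1)] by (simp add: grp_simps)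
 qed
 define V2 where "V2 = V <#> V"
 have V2: "compactin T V2" unfolding V2_def by (intro compactin_set_mult V(1))
 have V2c: "V2 \<subseteq> carrier G" using V2 compactin_carrier by blast
 have V2I: "d : V ==> d' : V ==> d \<otimes> d' : V2" for d d' by (auto simp: V2_def intro!: mem_set_multI)
 have oneV2: "\<one> : V2" using V2I[OF oneV oneV] by simp
 have VV2: "v : V2" if "v : V" for v using V2I[OF that oneV] that Vc by auto
 have V2i: "inv x : V2" if x: "x : V2" for x
 proof -
  obtain v v' where v: "v : V" "v' : V" "x = v \<otimes> v'" using x by (auto simp: V2_def set_mult_def)
  then have "inv x = inv v' \<otimes> inv v" using Vc by (simp add: inv_mult_group subset_iff)
  then show ?thesis using v V(2) V2I by auto
 qed
 \<comment> \<open>As \<open>M'\<close> normalizes \<open>V\<close>, the factors \<open>d\<close>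
   and \<open>d'\<close> can be pulled to the left, and only the product
   \<open>p \<otimes> q\<close> has to be watched.\<close>
 have cv: "EX w:V2. p \<otimes> d \<otimes> d' \<otimes> q = w \<otimes> (p \<otimes> q)" if "p : M'" "q : carrier G" "d : V" "d' : V" for p q d d'
 proof
  have c: "p : carrier G" "d : carrier G" "d' : carrier G" using that M'c Vc by auto
  show "(p \<otimes> d \<otimes> inv p) \<otimes> (p \<otimes> d' \<otimes> inv p) : V2" using that M'M by (intro V2I normal) auto
  show "p \<otimes> d \<otimes> d' \<otimes> q = (p \<otimes> d \<otimes> inv p) \<otimes> (p \<otimes> d' \<otimes> inv p) \<otimes> (p \<otimes> q)" using c that(2) by (simp add: grp_simps)
 qed
 define W where "W = (%n. (V2 <#> V2 <#> F n) \<union> (%x. inv x) ` (V2 <#> V2 <#> F n))"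
 have "compactin T (F n)" for n using Ff[of n] FM[of n] Mc by (intro finite_imp_compactin) auto
 then have WF: "compactin T (V2 <#> V2 <#> F n)" for n by (intro compactin_set_mult V2)
 then have W: "compactin T (W n)" for n unfolding W_def using compactin_inverses by (simp add: compactin_Un)
 have Wc: "W n \<subseteq> carrier G" for n using W compactin_carrier by blast
 have Wi: "inv x : W n" if "x : W n" for x n using that compactin_carrier[OF WF[of n]] by (auto simp: W_def subset_iff)
 have oneF: "\<one> : F n" for n using mono[of 0 n] F0 by auto
 have VW: "V \<subseteq> W n" for n
 proof
  fix v assume v: "v : V"
  have "v \<otimes> \<one> \<otimes> \<one> : V2 <#> V2 <#> F n" using VV2[OF v] oneV2 oneF by (intro mem_set_multI)
  then show "v : W n" using v Vc by (auto simp: W_def)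
 qed
 \<comment> \<open>\<open>C\<close> meets \<open>V2 <#> M'\<close> in finitely many small pieces.
   One element \<open>m0\<close> per piece suffices: the rest of the piece differs from
   \<open>w0 \<otimes> m0\<close> by elements of \<open>V\<close>, which pass to the left of
   \<open>m0\<close>. This accounts for the second factor \<open>V2\<close> in
   \<open>W\<close>.\<close>
 have exh: "EX n0. ALL n>=n0. ALL w:V2. ALL m:M'. w \<otimes> m : C --> w \<otimes> m : W n" if C: "compactin T C" for C
 proof -
  obtain \<F> where \<F>: "finite \<F>" "C \<subseteq> \<Union>\<F>" "!!S x y. S : \<F> ==> x : S ==> y : S ==> inv x \<otimes> y : U" "!!S. S : \<F> ==> S \<subseteq> carrier G"
   by (rule finite_small_cover[OF C U(1,2)], rule that)
  have "EX n. ALL w:V2. ALL m:M'. w \<otimes> m : S --> w \<otimes> m : V2 <#> V2 <#> F n" if S: "S : \<F>" for S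
  proof (cases "EX w:V2. EX m:M'. w \<otimes> m : S")
   case True
   then obtain w0 m0 where wm0: "w0 : V2" "m0 : M'" "w0 \<otimes> m0 : S" by blast
   then obtain n where n: "m0 : F n" by (auto simp: M'_def)
   have "w \<otimes> m : V2 <#> V2 <#> F n" if wm: "w : V2" "m : M'" "w \<otimes> m : S" for w m
   proof -
    have c: "w : carrier G" "m : carrier G" "w0 : carrier G" "m0 : carrier G" using wm wm0 V2c M'c by auto
    define v where "v = inv (w0 \<otimes> m0) \<otimes> (w \<otimes> m)"
    have v: "v : V" unfolding v_def using \<F>(3)[OF S wm0(3) wm(3)] U(3) by blast
    then have vc: "v : carrier G" using Vc by blast
    have "w0 \<otimes> (m0 \<otimes> v \<otimes> inv m0) \<otimes> m0 : V2 <#> V2 <#> F n"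
     using wm0 v n M'M VV2 normal by (intro mem_set_multI) auto
    moreover have "w0 \<otimes> (m0 \<otimes> v \<otimes> inv m0) \<otimes> m0 = (w0 \<otimes> m0) \<otimes> v" using c vc by (simp add: grp_simps)
    moreover have "(w0 \<otimes> m0) \<otimes> v = w \<otimes> m" using c by (simp add: v_def grp_simps)
    ultimately show ?thesis by simp
   qed
   then show ?thesis by blast
  qed blast
  then obtain nn where nn: "!!S w m. S : \<F> ==> w : V2 ==> m : M' ==> w \<otimes> m : S ==> w \<otimes> m : V2 <#> V2 <#> F (nn S)" by metis
  show ?thesis
  proof (intro exI[of _ "Max (insert 0 (nn ` \<F>))"] allI impI ballI)
   fix n w m assume n: "Max (insert 0 (nn ` \<F>)) <= n" and wm: "w : V2" "m : M'" "w \<otimes> m : C"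
   obtain S where S: "S : \<F>" "w \<otimes> m : S" using wm(3) \<F>(2) by blast
   have "nn S <= n" using n S(1) \<F>(1) by auto
   then have "F (nn S) \<subseteq> F n" by (rule mono)
   then have "V2 <#> V2 <#> F (nn S) \<subseteq> V2 <#> V2 <#> F n" by (auto simp: set_mult_def)
   then show "w \<otimes> m : W n" using nn[OF S(1) wm(1,2) S(2)] by (auto simp: W_def)
  qed
 qed
 have id: "(%x. x) : hom G G" by (auto simp: hom_def)
 show ?thesis
 proof (rule half_graphs_from_stage_choice[OF lc is_group id U V(1) V(2) V2 M'c M'm VW, where Dg = "%_ _. True"], unfold image_ident)
  fix C assume C: "compactin T C"
  obtain n0 where n0: "ALL n>=n0. ALL w:V2. ALL m:M'. w \<otimes> m : C --> w \<otimes> m : W n" using exh[OF C] by (rule exE)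
  have "x : W n" if x: "n >= n0" "p : M'" "q : M'" "d : V" "d' : V" "x = p \<otimes> d \<otimes> d' \<otimes> q" "x : C" for n p q d d' x
  proof -
   obtain w where "w : V2" "x = w \<otimes> (p \<otimes> q)" using cv[of p q d d'] x M'c by auto
   then show ?thesis using n0 x(1,7) M'm[OF x(2,3)] by blast
  qed
  then show "EX n0. ALL n>=n0. ALL p:M'. ALL q:M'. ALL d:V. ALL d':V.
    (p \<otimes> d \<otimes> d' \<otimes> inv q : C --> p \<otimes> d \<otimes> d' \<otimes> inv q : W n) &
    (inv p \<otimes> d \<otimes> d' \<otimes> q : C --> inv p \<otimes> d \<otimes> d' \<otimes> q : W n)"
   using M'i by (intro exI[of _ n0] allI impI ballI conjI) blast+
 next
  fix C assume C: "compactin T C" "C \<inter> V2 = {}"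
  have "p \<otimes> d \<otimes> d' \<otimes> inv p : V2" if p: "p : M'" "d : V" "d' : V" for p d d'
  proof -
   have pc: "p : carrier G" using p M'c by blast
   obtain w where "w : V2" "p \<otimes> d \<otimes> d' \<otimes> inv p = w \<otimes> (p \<otimes> inv p)" using cv[of p "inv p" d d'] p pc by auto
   then show ?thesis using pc V2c by auto
  qed
  from this this[OF M'i] have "p \<otimes> d \<otimes> d' \<otimes> inv p : V2" "inv p \<otimes> d \<otimes> d' \<otimes> p : V2" if "p : M'" "d : V" "d' : V" for p d d'
   using that M'c by (auto simp: subset_iff)
  then show "EX n0::nat. ALL n>=n0. ALL p:M'. True --> (ALL d:V. ALL d':V. p \<otimes> d \<otimes> d' \<otimes> inv p ~: C & inv p \<otimes> d \<otimes> d' \<otimes> p ~: C)"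
   using C(2) by (intro exI[of _ 0] allI impI ballI conjI) blast+
 next
  fix n P assume P: "finite P" "P \<subseteq> M'"
  \<comment> \<open>\<open>Wb\<close> absorbs the factor in \<open>V2\<close> produced by
    \<open>cv\<close>, so that avoiding \<open>W n\<close> with \<open>d\<close> and
    \<open>d'\<close> follows from avoiding \<open>Wb\<close> without them.\<close>
  define Wb where "Wb = (V2 <#> W n) \<union> (%x. inv x) ` (V2 <#> W n)"
  have V2W: "compactin T (V2 <#> W n)" by (intro compactin_set_mult V2 W)
  have Wb: "compactin T Wb" unfolding Wb_def using V2W compactin_inverses by (simp add: compactin_Un)
  have Wbc: "Wb \<subseteq> carrier G" using Wb compactin_carrier by blast
  have Wbi: "inv x : Wb" if "x : Wb" for x using that compactin_carrier[OF V2W] by (auto simp: Wb_def subset_iff)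
  have UWb: "U \<subseteq> Wb"
  proof
   fix u assume u: "u : U"
   then have "\<one> \<otimes> u : V2 <#> W n" using oneV2 VW[of n] U(3) by (intro mem_set_multI) auto
   then show "u : Wb" using u U(3) Vc by (auto simp: Wb_def)
  qed
  have Wb_avoid: "p \<otimes> d \<otimes> d' \<otimes> q ~: W n" if pq: "p : M'" "q : M'" "p \<otimes> q ~: Wb" "d : V" "d' : V" for p q d d'
  proof
   assume "p \<otimes> d \<otimes> d' \<otimes> q : W n"
   moreover obtain w where w: "w : V2" "p \<otimes> d \<otimes> d' \<otimes> q = w \<otimes> (p \<otimes> q)" using cv[of p q d d'] pq M'c by auto
   ultimately have "inv w \<otimes> (w \<otimes> (p \<otimes> q)) : V2 <#> W n" using V2i by (intro mem_set_multI) auto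
   moreover have "inv w \<otimes> (w \<otimes> (p \<otimes> q)) = p \<otimes> q" using w V2c pq M'c by (intro inv_cancel) auto
   ultimately show False using pq(3) by (auto simp: Wb_def)
  qed
  obtain \<F> where \<F>: "finite \<F>" "Wb \<subseteq> \<Union>\<F>" "!!S x y. S : \<F> ==> x : S ==> y : S ==> inv x \<otimes> y : U" "!!S. S : \<F> ==> S \<subseteq> carrier G"
   by (rule finite_small_cover[OF Wb U(1,2)], rule that)
  define K where "K = card \<F>"
  have pack: "card J <= K" if J: "finite J" "!!j. j : J ==> x j : Wb" "!!j j'. j : J ==> j' : J ==> j ~= j' ==> inv (x j) \<otimes> x j' ~: U"
   for J :: "nat set" and x
  proof -
   have "ALL j:J. EX S:\<F>. x j : S" using J(2) \<F>(2) by blast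
   then obtain g where g: "!!j. j : J ==> g j : \<F> & x j : g j" by metis
   have "inj_on g J" using g J(3) \<F>(3) by (intro inj_onI) metis
   then show ?thesis unfolding K_def using g \<F>(1) by (intro card_inj_on_le[of g]) auto
  qed
  \<comment> \<open>For fixed \<open>j\<close> each of the \<open>n\<close> elements
    \<open>a i\<close> spoils at most \<open>K\<close> partners, so a pool of this size contains
    \<open>n\<close> indices that are mutually good.\<close>
  define N where "N = n * Suc (n * K)"
  have "EX b. ALL l::nat. b l : M' & (ALL j<l. b l ~: {b j} <#> Wb)"
  proof (rule history_choice)
   fix l :: nat and h assume h: "!!i. i < l ==> h i : M'"
   have "compactin T (\<Union>k<l. {h k} <#> Wb)"
    by (rule compactin_Union) (use h M'c in \<open>auto intro!: compactin_set_mult Wb compactin_single\<close>)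
   from far[OF this] show "EX v:M'. ALL j<l. v ~: {h j} <#> Wb" by blast
  qed auto
  then obtain b where b0: "ALL l::nat. b l : M' & (ALL j<l. b l ~: {b j} <#> Wb)" by (rule exE)
  have b: "b l : M'" "j < l ==> b l ~: {b j} <#> Wb" for j l using b0[THEN spec, of l] by simp_all
  have bc: "b l : carrier G" for l using b(1) M'c by blast
  have bb1: "inv (b j) \<otimes> b l ~: Wb" if "j < l" for j l
  proof
   assume "inv (b j) \<otimes> b l : Wb"
   then have "b j \<otimes> (inv (b j) \<otimes> b l) : {b j} <#> Wb" by (intro mem_set_multI) auto
   then show False using b(2)[OF that] bc by (simp add: inv_cancel)
  qed
  have bb: "inv (b j) \<otimes> b l ~: Wb" if "j ~= l" for j l
  proof (cases "j < l")
   case False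
   then have "inv (b l) \<otimes> b j ~: Wb" using that by (intro bb1) auto
   then show ?thesis using Wbi[of "inv (b j) \<otimes> b l"] bc by (auto simp: inv_mult_group)
  qed (rule bb1)
  \<comment> \<open>Since the whole pool is known, points with different \<open>a\<close>'s are
    separated here for all pool elements at once. Only pairs with the same \<open>a\<close> are left
    to the thinning.\<close>
  define Qa where "Qa = (%(i::nat) h v. ALL q:P \<union> (%(k, l). h k \<otimes> b l) ` ({..<i} \<times> {..<N}). ALL j<N.
    v ~: Wb <#> {q \<otimes> inv (b j)} & v ~: {q} <#> Wb <#> {inv (b j)})"
  have "EX a. ALL i. a i : M' & Qa i a (a i)"
  proof (rule history_choice)
   show "Qa m h' v" if "!!i. i < m ==> h i = h' i" "Qa m h v" for m h h' v
   proof -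
    have eq: "(%(k, l). h k \<otimes> b l) ` ({..<m} \<times> {..<N}) = (%(k, l). h' k \<otimes> b l) ` ({..<m} \<times> {..<N})"
     using that(1) by (intro image_cong) auto
    show ?thesis using that(2) unfolding Qa_def eq .
   qed
   fix i :: nat and h assume h: "!!k. k < i ==> h k : M'"
   define P' where "P' = P \<union> (%(k, l). h k \<otimes> b l) ` ({..<i} \<times> {..<N})"
   have hc: "h k : carrier G" if "k < i" for k using h[OF that] M'c by blast
   have P': "finite P'" "!!q. q : P' ==> q : carrier G" using P hc bc M'c by (auto simp: P'_def)
   define Z where "Z = (\<Union>(q, j)\<in>P' \<times> {..<N}. (Wb <#> {q \<otimes> inv (b j)}) \<union> ({q} <#> Wb <#> {inv (b j)}))"
   have "compactin T Z" unfolding Z_def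
    by (rule compactin_Union) (use P' bc in \<open>auto intro!: compactin_Un compactin_set_mult compactin_single Wb\<close>)
   from far[OF this] obtain g where g: "g : M'" "g ~: Z" by blast
   have "Wb <#> {q \<otimes> inv (b j)} \<subseteq> Z" "{q} <#> Wb <#> {inv (b j)} \<subseteq> Z" if "q : P'" "j < N" for q j
    unfolding Z_def using that by blast+
   then have "Qa i h g" unfolding Qa_def P'_def[symmetric] using g(2) by blast
   then show "EX v:M'. Qa i h v" using g(1) by blast
  qed
  then obtain a where a0: "ALL i. a i : M' & Qa i a (a i)" by (rule exE)
  have a: "a i : M'" "Qa i a (a i)" for i using a0[THEN spec, of i] by simp_all
  have ac: "a i : carrier G" for i using a(1) M'c by blast
  have pre: "(a i \<otimes> b j) \<otimes> inv q ~: Wb & inv (a i \<otimes> b j) \<otimes> q ~: Wb & q \<otimes> inv (a i \<otimes> b j) ~: Wb & inv q \<otimes> (a i \<otimes> b j) ~: Wb"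
   if q: "q : P \<union> (%(k, l). a k \<otimes> b l) ` ({..<i} \<times> {..<N})" and j: "j < N" for i j q
  proof -
   have qc: "q : carrier G" using q P M'c ac bc by auto
   have na: "a i ~: Wb <#> {q \<otimes> inv (b j)}" "a i ~: {q} <#> Wb <#> {inv (b j)}" using a(2)[of i] q j unfolding Qa_def by blast+
   have 1: "(a i \<otimes> b j) \<otimes> inv q ~: Wb"
   proof
    assume "(a i \<otimes> b j) \<otimes> inv q : Wb"
    then have "((a i \<otimes> b j) \<otimes> inv q) \<otimes> (q \<otimes> inv (b j)) : Wb <#> {q \<otimes> inv (b j)}" by (intro mem_set_multI) auto
    then show False using na(1) ac bc qc by (simp add: grp_simps)
   qed
   have 2: "inv q \<otimes> (a i \<otimes> b j) ~: Wb"
   proof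
    assume "inv q \<otimes> (a i \<otimes> b j) : Wb"
    then have "q \<otimes> (inv q \<otimes> (a i \<otimes> b j)) \<otimes> inv (b j) : {q} <#> Wb <#> {inv (b j)}" by (intro mem_set_multI) auto
    then show False using na(2) ac bc qc by (simp add: grp_simps)
   qed
   have "inv (inv (a i \<otimes> b j) \<otimes> q) = inv q \<otimes> (a i \<otimes> b j)" "inv (q \<otimes> inv (a i \<otimes> b j)) = (a i \<otimes> b j) \<otimes> inv q"
    using ac bc qc by (simp_all add: grp_simps)
   then show ?thesis using 1 2 Wbi by metis
  qed
  define R where "R = (%j l. EX i<n. a i \<otimes> b j \<otimes> inv (a i \<otimes> b l) : Wb)"
  have Rsym: "R l j" if R: "R j l" for j l
  proof -
   obtain i where i: "i < n" "a i \<otimes> b j \<otimes> inv (a i \<otimes> b l) : Wb" using R by (auto simp: R_def)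
   have "inv (a i \<otimes> b j \<otimes> inv (a i \<otimes> b l)) = a i \<otimes> b l \<otimes> inv (a i \<otimes> b j)" using ac bc by (simp add: grp_simps)
   then show ?thesis using i Wbi[OF i(2)] by (auto simp: R_def)
  qed
  have deg: "card {l : {..<N}. R j l} <= n * K" for j
  proof -
   have "{l : {..<N}. R j l} \<subseteq> (\<Union>i<n. {l : {..<N}. a i \<otimes> b l \<otimes> inv (a i \<otimes> b j) : Wb})"
    using Rsym[of j] by (auto simp: R_def)
   then have "card {l : {..<N}. R j l} <= card (\<Union>i<n. {l : {..<N}. a i \<otimes> b l \<otimes> inv (a i \<otimes> b j) : Wb})"
    by (intro card_mono) auto
   also have "\<dots> <= (\<Sum>i<n. card {l : {..<N}. a i \<otimes> b l \<otimes> inv (a i \<otimes> b j) : Wb})" by (rule card_UN_le) simp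
   also have "\<dots> <= (\<Sum>i<n. K)"
   proof (rule sum_mono, rule pack)
    fix i l l' :: nat assume "l ~= l'"
    define z where "z = a i \<otimes> b j"
    have zM: "z : M'" using a b M'm by (simp add: z_def)
    have zc: "z : carrier G" using zM M'c by blast
    show "inv (a i \<otimes> b l \<otimes> inv (a i \<otimes> b j)) \<otimes> (a i \<otimes> b l' \<otimes> inv (a i \<otimes> b j)) ~: U"
     unfolding z_def[symmetric]
    proof
     assume u: "inv (a i \<otimes> b l \<otimes> inv z) \<otimes> (a i \<otimes> b l' \<otimes> inv z) : U"
     \<comment> \<open>Conjugating back by an element of \<open>M'\<close> preserves
       \<open>V\<close>; thus two spoiled partners with quotients close to each other would force
       \<open>b l\<close> and \<open>b l'\<close> themselves to be close.\<close>
     have "inv z \<otimes> (inv (a i \<otimes> b l \<otimes> inv z) \<otimes> (a i \<otimes> b l' \<otimes> inv z)) \<otimes> inv (inv z) : V"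
      using u U(3) zM M'i M'M by (intro normal) auto
     moreover have "inv z \<otimes> (inv (a i \<otimes> b l \<otimes> inv z) \<otimes> (a i \<otimes> b l' \<otimes> inv z)) \<otimes> inv (inv z) = inv (b l) \<otimes> b l'"
      using ac bc zc by (simp add: grp_simps)
     ultimately have "inv (b l) \<otimes> b l' : V" by simp
     moreover have "V \<subseteq> Wb"
     proof
      fix v assume v: "v : V"
      then have "\<one> \<otimes> v : V2 <#> W n" using oneV2 VW[of n] by (intro mem_set_multI) auto
      then show "v : Wb" using v Vc by (auto simp: Wb_def)
     qed
     ultimately show False using bb[OF \<open>l ~= l'\<close>] by blast
    qed
   qed auto
   finally show ?thesis by simp
  qed
  have "\<exists>I\<subseteq>{..<N}. card I = n & (ALL x:I. ALL y:I. x ~= y --> ~ R x y)"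
  proof (rule large_independent_subset)
   show "n * Suc (n * K) <= card {..<N}" by (simp add: N_def)
  qed (use deg Rsym in blast)+
  then obtain I where I: "I \<subseteq> {..<N}" "card I = n" "ALL x:I. ALL y:I. x ~= y --> ~ R x y" by (elim exE conjE)
  have "finite I" using I(1) finite_subset by blast
  then obtain c where c: "bij_betw c {..<n} I" using ex_bij_betw_nat_finite[of I] I(2) by (auto simp: atLeast0LessThan)
  have cI: "c j : I" "c j < N" if "j < n" for j using c I(1) that bij_betwE by fastforce+
  have cinj: "c j ~= c l" if "j < n" "l < n" "j ~= l" for j l
   using c that by (auto simp: bij_betw_def inj_on_def)
  define b' where "b' = (%j. b (c j))"
  have off: "(a i \<otimes> b' j) \<otimes> inv (a k \<otimes> b' l) ~: Wb & inv (a i \<otimes> b' j) \<otimes> (a k \<otimes> b' l) ~: Wb"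
   if lt: "i < n" "j < n" "k < n" "l < n" and ne: "(i, j) ~= (k, l)" for i j k l
  proof -
   consider "k < i" | "i < k" | "i = k" "j ~= l" using ne by fastforce
   then show ?thesis
   proof cases
    case 1
    then have "a k \<otimes> b' l : P \<union> (%(k, l). a k \<otimes> b l) ` ({..<i} \<times> {..<N})" using cI(2)[OF lt(4)] by (force simp: b'_def)
    then show ?thesis using pre[of "a k \<otimes> b' l" i "c j"] cI(2)[OF lt(2)] by (simp add: b'_def)
   next
    case 2
    then have "a i \<otimes> b' j : P \<union> (%(k, l). a k \<otimes> b l) ` ({..<k} \<times> {..<N})" using cI(2)[OF lt(2)] by (force simp: b'_def)
    then show ?thesis using pre[of "a i \<otimes> b' j" k "c l"] cI(2)[OF lt(4)] by (simp add: b'_def)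
   next
    case 3
    have "~ R (c j) (c l)" using I(3) cI(1) cinj[OF lt(2,4) 3(2)] lt by blast
    then have "(a i \<otimes> b' j) \<otimes> inv (a k \<otimes> b' l) ~: Wb" using lt(1) 3 by (auto simp: R_def b'_def)
    moreover have "inv (a i \<otimes> b' j) \<otimes> (a k \<otimes> b' l) = inv (b' j) \<otimes> b' l" using ac bc 3 by (simp add: b'_def grp_simps)
    ultimately show ?thesis using bb[OF cinj[OF lt(2,4) 3(2)]] by (simp add: b'_def)
   qed
  qed
  have b'M: "b' j : M'" for j using b(1) by (simp add: b'_def)
  have abM: "a i \<otimes> b' j : M'" for i j using a(1) b'M M'm by blast
  have 1: "ALL i<n. ALL j<n. ALL k<n. ALL l<n. (i, j) ~= (k, l) --> (ALL d:V. ALL d':V. a i \<otimes> b' j \<otimes> d \<otimes> d' \<otimes> inv (a k \<otimes> b' l) ~: W n &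
     inv (a i \<otimes> b' j) \<otimes> d \<otimes> d' \<otimes> (a k \<otimes> b' l) ~: W n)"
   by (intro allI impI ballI conjI Wb_avoid) (use off abM M'i in blast)+
  have 2: "ALL i<n. ALL j<n. ALL q:P. ALL d:V. ALL d':V. a i \<otimes> b' j \<otimes> d \<otimes> d' \<otimes> inv q ~: W n & inv (a i \<otimes> b' j) \<otimes> d \<otimes> d' \<otimes> q ~: W n"
  proof (intro allI impI ballI conjI Wb_avoid)
   fix i j q assume *: "i < n" "j < n" "q : P"
   have "q : P \<union> (%(k, l). a k \<otimes> b l) ` ({..<i} \<times> {..<N})" using *(3) by blast
   from pre[OF this cI(2)[OF *(2)]] show "(a i \<otimes> b' j) \<otimes> inv q ~: Wb" "inv (a i \<otimes> b' j) \<otimes> q ~: Wb" by (simp_all add: b'_def)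
   show "a i \<otimes> b' j : M'" "inv (a i \<otimes> b' j) : M'" "q : M'" "inv q : M'" using abM M'i * P(2) by blast+
  qed
  show "EX (a :: nat => 'a) (b :: nat => 'a). (ALL i. a i : M') & (ALL i. b i : M') &
   (ALL i<n. ALL j<n. ALL k<n. ALL l<n. (i, j) ~= (k, l) --> (ALL d:V. ALL d':V. a i \<otimes> b j \<otimes> d \<otimes> d' \<otimes> inv (a k \<otimes> b l) ~: W n &
     inv (a i \<otimes> b j) \<otimes> d \<otimes> d' \<otimes> (a k \<otimes> b l) ~: W n)) &
   (ALL i<n. ALL j<n. ALL q:P. ALL d:V. ALL d':V. a i \<otimes> b j \<otimes> d \<otimes> d' \<otimes> inv q ~: W n &
     inv (a i \<otimes> b j) \<otimes> d \<otimes> d' \<otimes> q ~: W n) &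
   (ALL i<n. ALL j<n. True)"
   by (intro exI[of _ a] exI[of _ b'] conjI 1 2 allI impI TrueI a(1) b'M)
 qed
qed

end

section \<open>Nilpotent groups and [IN]-groups\<close>

primrec upper_central :: "'a monoid => nat => 'a set" where
 "upper_central G 0 = {\<one>\<^bsub>G\<^esub>}"
| "upper_central G (Suc n) = {x : carrier G. ALL y:carrier G.
   x \<otimes>\<^bsub>G\<^esub> y \<otimes>\<^bsub>G\<^esub> inv\<^bsub>G\<^esub> x \<otimes>\<^bsub>G\<^esub> inv\<^bsub>G\<^esub> y : upper_central G n}"

context top_grp
begin

lemma upper_central_subset: "upper_central G n \<subseteq> carrier G"
 by (induction n) auto

lemma upper_central_subgroup:
 "subgroup (upper_central G n) G & (ALL x:upper_central G n. ALL y:carrier G. y \<otimes> x \<otimes> inv y : upper_central G n)"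
proof (induction n)
 case 0 then show ?case by (simp add: triv_subgroup)
next
 case (Suc n)
 let ?Z = "upper_central G n"
 have sub: "?Z \<subseteq> carrier G" by (rule upper_central_subset)
 have m: "!!x y. x : ?Z ==> y : ?Z ==> x \<otimes> y : ?Z" and i: "!!x. x : ?Z ==> inv x : ?Z" and o: "\<one> : ?Z"
  and c: "!!x y. x : ?Z ==> y : carrier G ==> y \<otimes> x \<otimes> inv y : ?Z"
  using Suc.IH by (auto simp: subgroup.one_closed subgroup.m_closed subgroup.m_inv_closed)
 have "subgroup (upper_central G (Suc n)) G"
 proof (rule subgroupI)
  have "\<one> : upper_central G (Suc n)" using o by simp
  then show "upper_central G (Suc n) ~= {}" by blast
 next
  fix x assume x: "x : upper_central G (Suc n)"
  have "inv x \<otimes> y \<otimes> inv (inv x) \<otimes> inv y : ?Z" if y: "y : carrier G" for y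
  proof -
   have xc: "x : carrier G" using x by simp
   have "inv x \<otimes> inv (x \<otimes> y \<otimes> inv x \<otimes> inv y) \<otimes> inv (inv x) : ?Z" using x y by (intro c i) auto
   also have "inv x \<otimes> inv (x \<otimes> y \<otimes> inv x \<otimes> inv y) \<otimes> inv (inv x) = inv x \<otimes> y \<otimes> inv (inv x) \<otimes> inv y"
    using xc y by (simp add: grp_simps)
   finally show ?thesis .
  qed
  then show "inv x : upper_central G (Suc n)" using x by simp
 next
  fix x z assume x: "x : upper_central G (Suc n)" and z: "z : upper_central G (Suc n)"
  have "x \<otimes> z \<otimes> y \<otimes> inv (x \<otimes> z) \<otimes> inv y : ?Z" if y: "y : carrier G" for y
  proof -
   have xc: "x : carrier G" "z : carrier G" using x z by simp_all
   have "x \<otimes> (z \<otimes> y \<otimes> inv z \<otimes> inv y) \<otimes> inv x \<otimes> (x \<otimes> y \<otimes> inv x \<otimes> inv y) : ?Z" by (rule m[OF c]) (use x z y in auto)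
   also have "x \<otimes> (z \<otimes> y \<otimes> inv z \<otimes> inv y) \<otimes> inv x \<otimes> (x \<otimes> y \<otimes> inv x \<otimes> inv y) = x \<otimes> z \<otimes> y \<otimes> inv (x \<otimes> z) \<otimes> inv y"
    using xc y by (simp add: grp_simps)
   finally show ?thesis .
  qed
  then show "x \<otimes> z : upper_central G (Suc n)" using x z by simp
 qed (rule upper_central_subset)
 moreover have "g \<otimes> x \<otimes> inv g : upper_central G (Suc n)" if x: "x : upper_central G (Suc n)" and g: "g : carrier G" for x g
 proof -
  have xc: "x : carrier G" using x by simp
  have "g \<otimes> x \<otimes> inv g \<otimes> y \<otimes> inv (g \<otimes> x \<otimes> inv g) \<otimes> inv y : ?Z" if y: "y : carrier G" for y
  proof -
   have "g \<otimes> (x \<otimes> (inv g \<otimes> y \<otimes> g) \<otimes> inv x \<otimes> inv (inv g \<otimes> y \<otimes> g)) \<otimes> inv g : ?Z" using x g y by (intro c) auto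
   also have "g \<otimes> (x \<otimes> (inv g \<otimes> y \<otimes> g) \<otimes> inv x \<otimes> inv (inv g \<otimes> y \<otimes> g)) \<otimes> inv g
     = g \<otimes> x \<otimes> inv g \<otimes> y \<otimes> inv (g \<otimes> x \<otimes> inv g) \<otimes> inv y"
    using xc g y by (simp add: grp_simps)
   finally show ?thesis .
  qed
  then show ?thesis using xc g by simp
 qed
 ultimately show ?case by blast
qed

lemma lower_central_subset: "lower_central G n \<subseteq> carrier G"
proof (induction n)
 case (Suc n)
 have "generate G (\<Union>x\<in>lower_central G n. \<Union>y\<in>carrier G. {x \<otimes> y \<otimes> inv x \<otimes> inv y}) \<subseteq> carrier G"
  by (rule generate_incl) (use Suc.IH in auto)
 then show ?case by simp
qed simp

lemma upper_central_top:
 assumes "lower_central G n = {\<one>}"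
 shows "upper_central G n = carrier G"
proof -
 have "k <= n ==> lower_central G (n - k) \<subseteq> upper_central G k" for k
 proof (induction k)
  case 0 then show ?case using assms by simp
 next
  case (Suc k)
  show ?case
  proof
   fix x assume x: "x : lower_central G (n - Suc k)"
   have eq: "n - k = Suc (n - Suc k)" using Suc.prems by simp
   have "x \<otimes> y \<otimes> inv x \<otimes> inv y : upper_central G k" if y: "y : carrier G" for y
   proof -
    have "x \<otimes> y \<otimes> inv x \<otimes> inv y : lower_central G (n - k)"
     unfolding eq lower_central.simps by (rule generate.incl) (use x y in blast)
    then show ?thesis using Suc by auto
   qed
   then show "x : upper_central G (Suc k)" using x lower_central_subset by auto
  qed
 qed
 from this[of n] show ?thesis using upper_central_subset[of n] by auto
qed

lemma closedin_upper_central: "closedin T (upper_central G n)"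
proof (induction n)
 case 0
 then show ?case using closedin_Hausdorff_singleton[OF Hausdorff_T, of \<one>] by simp
next
 case (Suc n)
 have "closedin T {x : topspace T. x \<otimes> y \<otimes> inv x \<otimes> inv y : upper_central G n}" if "y : carrier G" for y
  by (rule closedin_continuous_map_preimage[OF _ Suc.IH], intro continuous_map_mult continuous_map_inv)
   (use that in auto)
 then have "closedin T (\<Inter>y\<in>carrier G. {x : carrier G. x \<otimes> y \<otimes> inv x \<otimes> inv y : upper_central G n})"
  by (intro closedin_INT) auto
 moreover have "(\<Inter>y\<in>carrier G. {x : carrier G. x \<otimes> y \<otimes> inv x \<otimes> inv y : upper_central G n}) = upper_central G (Suc n)"
  by auto
 ultimately show ?case by simp
qed

text \<open>The first non-compact term of the upper central series is closed, hence contained in no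
  compact set, and it commutes with the group modulo the preceding term \<open>N\<close>. As
  \<open>N\<close> is compact and normal, the compact set \<open>V <#> N\<close> is normalized. The
  upper series is used because the terms of the lower one need not be closed.\<close>

lemma half_graphs_nilpotent:
 assumes lc: "locally_compact_space T" and nc: "~ compact_space T" and nil: "nilpotent_group G"
 shows "EX f:WAP G T. half_graphs G f"
proof -
 define k where "k = (LEAST k. ~ compactin T (upper_central G k))"
 obtain n where "lower_central G n = {\<one>}" using nil by (auto simp: nilpotent_group_def)
 then have "~ compactin T (upper_central G n)" using nc upper_central_top by (simp add: compact_space_def)
 then have k: "~ compactin T (upper_central G k)" "!!j. j < k ==> compactin T (upper_central G j)"
  unfolding k_def by (rule LeastI, metis not_less_Least)
 have "k ~= 0"
 proof
  assume "k = 0"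
  then show False using k(1) compactin_single[of \<one>] by simp
 qed
 then obtain m where m: "k = Suc m" using not0_implies_Suc by blast
 define N where "N = upper_central G m"
 have N: "compactin T N" using k(2)[of m] m by (simp add: N_def)
 have Nc: "N \<subseteq> carrier G" using N compactin_carrier by blast
 have No: "\<one> : N" and Nm: "!!x y. x : N ==> y : N ==> x \<otimes> y : N" and Ni: "!!x. x : N ==> inv x : N"
  and Nn: "!!x y. x : N ==> y : carrier G ==> y \<otimes> x \<otimes> inv y : N"
  using upper_central_subgroup[of m]
  by (auto simp: N_def subgroup.one_closed subgroup.m_closed subgroup.m_inv_closed)
 obtain U V where U: "openin T U" "\<one> : U" "U \<subseteq> V" and V: "compactin T V" "!!v. v : V ==> inv v : V"
  by (rule symmetric_compact_neighbourhood[OF lc], rule that)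
 have Vc: "V \<subseteq> carrier G" using V(1) compactin_carrier by blast
 have VN: "EX v:V. EX n:N. x = v \<otimes> n" if "x : V <#> N" for x using that by (auto simp: set_mult_def)
 show ?thesis
 proof (rule half_graphs_normalizing_subgroup[OF lc U(1,2), where V = "V <#> N" and M = "upper_central G k"])
  show "U \<subseteq> V <#> N"
  proof
   fix u assume "u : U"
   then have "u \<otimes> \<one> : V <#> N" "u : carrier G" using U(3) Vc No by (auto intro!: mem_set_multI)
   then show "u : V <#> N" by simp
  qed
  show "compactin T (V <#> N)" by (rule compactin_set_mult[OF V(1) N])
  show "inv x : V <#> N" if x: "x : V <#> N" for x
  proof -
   obtain v n where vn: "v : V" "n : N" "x = v \<otimes> n" using VN[OF x] by blast
   then have c: "v : carrier G" "n : carrier G" using Vc Nc by auto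
   have "inv v \<otimes> (v \<otimes> inv n \<otimes> inv v) : V <#> N" using vn c by (intro mem_set_multI V Nn Ni)
   then show ?thesis using c vn(3) by (simp add: grp_simps)
  qed
  show "subgroup (upper_central G k) G" using upper_central_subgroup by blast
  show "y \<otimes> x \<otimes> inv y : V <#> N" if y: "y : upper_central G k" and x: "x : V <#> N" for x y
  proof -
   obtain v n where vn: "v : V" "n : N" "x = v \<otimes> n" using VN[OF x] by blast
   then have c: "v : carrier G" "n : carrier G" "y : carrier G" using Vc Nc y upper_central_subset by auto
   \<comment> \<open>This inverted commutator is the correction that turns \<open>v\<close> into
     \<open>y \<otimes> v \<otimes> inv y\<close> by multiplication on the right.\<close>
   have "inv (y \<otimes> inv v \<otimes> inv y \<otimes> inv (inv v)) : N" using y c(1) unfolding m upper_central.simps N_def[symmetric] by (intro Ni) blast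
   then have "v \<otimes> (inv (y \<otimes> inv v \<otimes> inv y \<otimes> inv (inv v)) \<otimes> (y \<otimes> n \<otimes> inv y)) : V <#> N"
    using vn c by (intro mem_set_multI Nm Nn)
   then show ?thesis using c vn(3) by (simp add: grp_simps)
  qed
  show "~ upper_central G k \<subseteq> C" if "compactin T C" for C
   using closed_compactin[OF that _ closedin_upper_central] k(1) by blast
 qed
qed

lemma half_graphs_IN:
 assumes lc: "locally_compact_space T" and nc: "~ compact_space T" and IN: "IN_group G T"
 shows "EX f:WAP G T. half_graphs G f"
proof -
 obtain K U where K: "compactin T K" "!!g. g : carrier G ==> (%x. g \<otimes> x \<otimes> inv g) ` K = K"
  and U: "openin T U" "\<one> : U" "U \<subseteq> K" using IN by (auto simp: IN_group_def)
 have Kc: "K \<subseteq> carrier G" using K(1) compactin_carrier by blast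
 have Kn: "g \<otimes> x \<otimes> inv g : K" if "g : carrier G" "x : K" for g x using K(2)[OF that(1)] that(2) by blast
 show ?thesis
 proof (rule half_graphs_normalizing_subgroup[OF lc U(1,2), where V = "K \<union> (%x. inv x) ` K" and M = "carrier G"])
  show "compactin T (K \<union> (%x. inv x) ` K)" using K(1) compactin_inverses by (simp add: compactin_Un)
  show "inv v : K \<union> (%x. inv x) ` K" if "v : K \<union> (%x. inv x) ` K" for v using that Kc by auto
  show "m \<otimes> v \<otimes> inv m : K \<union> (%x. inv x) ` K" if m: "m : carrier G" and v: "v : K \<union> (%x. inv x) ` K" for m v
  proof (cases "v : K")
   case False
   then obtain x where x: "x : K" "v = inv x" using v by blast
   then have "m \<otimes> v \<otimes> inv m = inv (m \<otimes> x \<otimes> inv m)" using m Kc by (simp add: grp_simps subset_iff)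
   then show ?thesis using Kn[OF m x(1)] by blast
  qed (use Kn m in blast)
  show "~ carrier G \<subseteq> C" if "compactin T C" for C
   using that nc compactin_carrier[OF that] by (auto simp: compact_space_def)
 qed (use U in \<open>auto simp: subgroup_self\<close>)
qed

end

theorem WAP_half_graphs:
 fixes G :: "'a monoid" and T :: "'a topology"
 assumes "locally_compact_group G T"
  and "(~ compact_space T & nilpotent_group G) \<or>
     (~ compact_space T & IN_group G T) \<or>
     (connected_space T & ~ totally_minimal TYPE('b) G T)"
 shows "EX f:WAP G T. half_graphs G f"
proof -
 interpret top_grp G T using assms(1) by unfold_locales (simp add: locally_compact_group_def)
 have lc: "locally_compact_space T" using assms(1) by (simp add: locally_compact_group_def)
 from assms(2) show ?thesis
 proof (elim disjE conjE)
  assume c: "connected_space T" and "~ totally_minimal TYPE('b) G T"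
  then obtain Q :: "'b monoid" and T' \<phi> where "topological_group Q T'" "\<phi> : hom G Q" "continuous_map T T' \<phi>"
   "~ closedin T' (\<phi> ` carrier G)" by (auto simp: totally_minimal_def)
  then show ?thesis by (rule half_graphs_nonclosed_range[OF lc c])
 qed (rule half_graphs_nilpotent half_graphs_IN, rule lc; assumption)+
qed

text \<open>A quadratic polynomial in the direction \<open>cnj b\<close> that is never negative. It
  is stated for scalars so as to serve both inner products and semidefinite kernels, for which
  \<open>c = 0\<close> is a genuine case.\<close>

lemma cauchy_schwarz_scalar:
 fixes b :: complex
 assumes "!!z. 0 <= a + 2 * Re (z * b) + (cmod z)\<^sup>2 * c"
 shows "(cmod b)\<^sup>2 <= a * c"
proof -
 have q: "0 <= a - 2 * t * (cmod b)\<^sup>2 + t\<^sup>2 * (cmod b)\<^sup>2 * c" for t :: real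
 proof -
  have "Re (- of_real t * cnj b * b) = - t * (cmod b)\<^sup>2"
   by (simp add: cmod_power2 algebra_simps flip: power2_eq_square)
  then show ?thesis using assms[of "- of_real t * cnj b"] by (simp add: norm_mult power_mult_distrib)
 qed
 show ?thesis
 proof (cases "c = 0")
  case True
  have "b = 0"
  proof (rule ccontr)
   assume "b ~= 0"
   then have r: "(a + 1) / (cmod b)\<^sup>2 * (cmod b)\<^sup>2 = a + 1" by simp
   show False using q[of "(a + 1) / (cmod b)\<^sup>2"] q[of 0] True unfolding mult.assoc r by simp
  qed
  then show ?thesis using True by simp
 next
  case False
  have "0 <= c"
  proof (rule ccontr)
   assume "~ 0 <= c"
   have "0 <= a + (cmod (of_real t))\<^sup>2 * c" for t
    using assms[of "of_real t"] assms[of "- of_real t"] by (simp add: norm_mult)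
   from this[of "sqrt ((a + 1) / - c)"] \<open>~ 0 <= c\<close> q[of 0] show False by (simp add: field_simps)
  qed
  then show ?thesis using q[of "1 / c"] False by (simp add: field_simps power2_eq_square)
 qed
qed

section \<open>Half graphs of Hilbert space coefficients\<close>

text \<open>Completeness is left out: the estimates on coefficients only involve the inner product,
  and it is asserted separately for the Hilbert spaces that are constructed.\<close>

locale pre_hilb =
 fixes H :: "'h hilbert" (structure)
 assumes module_H: "Module.module complex_ring H"
  and ip_add_left: "!!x y z. x : carrier H ==> y : carrier H ==> z : carrier H ==> hinner H (x \<oplus> y) z = hinner H x z + hinner H y z"
  and ip_smult_left: "!!x y c. x : carrier H ==> y : carrier H ==> hinner H (c \<odot>\<^bsub>H\<^esub> x) y = c * hinner H x y"
  and ip_commute: "!!x y. x : carrier H ==> y : carrier H ==> hinner H y x = cnj (hinner H x y)"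
  and ip_nonneg: "!!x. x : carrier H ==> 0 <= Re (hinner H x x)"
  and ip_definite: "!!x. x : carrier H ==> hinner H x x = 0 ==> x = \<zero>"
begin

sublocale Module.module complex_ring H by (rule module_H)

abbreviation "ip \<equiv> hinner H"
abbreviation "hn \<equiv> hnorm H"

lemma smult_carrier [simp]: "x : carrier H ==> c \<odot>\<^bsub>H\<^esub> x : carrier H"
 by (rule smult_closed) (simp add: complex_ring_def)

lemma ip_zero_left: "y : carrier H ==> ip \<zero> y = 0"
 using ip_add_left[of \<zero> \<zero> y] by simp

lemma ip_uminus_left: "x : carrier H ==> y : carrier H ==> ip (\<ominus> x) y = - ip x y"
 using ip_add_left[of x "\<ominus> x" y] by (simp add: r_neg ip_zero_left add_eq_0_iff)

lemma ip_minus_left: "x : carrier H ==> y : carrier H ==> z : carrier H ==> ip (x \<ominus> y) z = ip x z - ip y z"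
 by (simp add: minus_eq ip_add_left ip_uminus_left)

lemma ip_add_right: "x : carrier H ==> y : carrier H ==> z : carrier H ==> ip z (x \<oplus> y) = ip z x + ip z y"
 using ip_add_left[of x y z] by (simp add: ip_commute[of _ z])

lemma ip_minus_right: "x : carrier H ==> y : carrier H ==> z : carrier H ==> ip z (x \<ominus> y) = ip z x - ip z y"
 using ip_minus_left[of x y z] by (simp add: ip_commute[of _ z])

lemma ip_smult_right: "x : carrier H ==> y : carrier H ==> ip x (c \<odot>\<^bsub>H\<^esub> y) = cnj c * ip x y"
 using ip_smult_left[of y x c] by (simp add: ip_commute[of _ x])

lemma minus_carrier [simp]: "x : carrier H ==> y : carrier H ==> x \<ominus> y : carrier H"
 by (simp add: minus_eq)

lemma hn_square: "x : carrier H ==> (hn x)\<^sup>2 = Re (ip x x)"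
 by (simp add: hnorm_def ip_nonneg)

lemma hn_nonneg: "x : carrier H ==> 0 <= hn x"
 by (simp add: hnorm_def ip_nonneg)

lemma cauchy_schwarz: "x : carrier H ==> y : carrier H ==> cmod (ip x y) <= hn x * hn y"
proof -
 assume xy: "x : carrier H" "y : carrier H"
 have "0 <= Re (ip x x) + 2 * Re (z * ip y x) + (cmod z)\<^sup>2 * Re (ip y y)" for z
 proof -
  have "Re (ip (x \<oplus> z \<odot>\<^bsub>H\<^esub> y) (x \<oplus> z \<odot>\<^bsub>H\<^esub> y))
   = Re (ip x x) + (Re (z * ip y x) + Re (cnj z * ip x y)) + Re (z * (cnj z * ip y y))"
   using xy by (simp add: ip_add_left ip_add_right ip_smult_left ip_smult_right algebra_simps)
  moreover have "Re (cnj z * ip x y) = Re (z * ip y x)" using ip_commute[OF xy] by simp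
  moreover have "Re (z * (cnj z * ip y y)) = (cmod z)\<^sup>2 * Re (ip y y)"
   unfolding mult.assoc[symmetric] complex_norm_square[symmetric] by simp
  ultimately show ?thesis using ip_nonneg[of "x \<oplus> z \<odot>\<^bsub>H\<^esub> y"] xy by simp
 qed
 from cauchy_schwarz_scalar[OF this] have "(cmod (ip y x))\<^sup>2 <= (hn x * hn y)\<^sup>2"
  using xy by (simp add: hn_square power_mult_distrib)
 then have "cmod (ip y x) <= hn x * hn y" by (rule power2_le_imp_le) (simp add: hn_nonneg xy)
 then show ?thesis using ip_commute[OF xy] by simp
qed

lemma hn_zero_iff: "x : carrier H ==> hn x = 0 \<longleftrightarrow> x = \<zero>"
proof
 assume x: "x : carrier H" "hn x = 0"
 then have "cmod (ip x x) <= 0" using cauchy_schwarz[of x x] by simp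
 then show "x = \<zero>" using ip_definite x by simp
qed (simp add: hnorm_def ip_zero_left)

lemma parallelogram:
 assumes "x : carrier H" "y : carrier H"
 shows "(hn (x \<oplus> y))\<^sup>2 + (hn (y \<ominus> x))\<^sup>2 = 2 * (hn x)\<^sup>2 + 2 * (hn y)\<^sup>2"
 using assms by (simp add: hn_square ip_add_left ip_add_right ip_minus_left ip_minus_right)

lemma hn_triangle: "x : carrier H ==> y : carrier H ==> hn (x \<oplus> y) <= hn x + hn y"
proof (rule power2_le_imp_le)
 assume xy: "x : carrier H" "y : carrier H"
 have "Re (ip x y) <= hn x * hn y" using cauchy_schwarz[OF xy] complex_Re_le_cmod order_trans by blast
 moreover have "Re (ip y x) = Re (ip x y)" using ip_commute[OF xy] by simp
 ultimately show "(hn (x \<oplus> y))\<^sup>2 <= (hn x + hn y)\<^sup>2"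
  using xy by (simp add: power2_sum hn_square ip_add_left ip_add_right)
qed (simp add: hn_nonneg)

lemma hdist_eq:
 assumes "x : carrier H" "y : carrier H"
 shows "(hdist H x y)\<^sup>2 = Re (ip x x) + Re (ip y y) - 2 * Re (ip x y)"
 using ip_commute[OF assms] assms by (simp add: hdist_def hn_square ip_minus_left ip_minus_right)

lemma hdist_triangle:
 assumes "x : carrier H" "y : carrier H" "z : carrier H"
 shows "hdist H x z <= hdist H x y + hdist H y z"
proof -
 have "x \<ominus> z = (x \<ominus> y) \<oplus> (y \<ominus> z)" using assms by (simp add: minus_eq a_assoc r_neg1)
 then show ?thesis using hn_triangle[of "x \<ominus> y" "y \<ominus> z"] assms by (simp add: hdist_def)
qed

lemma hdist_commute: "x : carrier H ==> y : carrier H ==> hdist H x y = hdist H y x"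
proof -
 assume xy: "x : carrier H" "y : carrier H"
 have "Re (ip y x) = Re (ip x y)" using arg_cong[OF ip_commute[OF xy], of Re] by simp
 then have "(hdist H x y)\<^sup>2 = (hdist H y x)\<^sup>2" by (simp add: hdist_eq xy)
 then show ?thesis by (rule power2_eq_imp_eq) (simp_all add: hdist_def hn_nonneg xy)
qed

lemma hdist_zero:
 assumes "x : carrier H" "y : carrier H"
 shows "hdist H x y = 0 \<longleftrightarrow> x = y"
proof
 assume "hdist H x y = 0"
 then have "x \<ominus> y = \<zero>" using assms by (simp add: hdist_def hn_zero_iff)
 moreover have "x = (x \<ominus> y) \<oplus> y" using assms by (simp add: minus_eq a_assoc l_neg)
 ultimately show "x = y" using assms by simp
qed (use assms in \<open>simp add: hdist_def minus_eq r_neg hnorm_def ip_zero_left\<close>)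

text \<open>
  The theory \<open>Metric_space\<close> demands a total distance, whereas \<open>hdist\<close> is unspecified outside the
  carrier.
\<close>

lemma Metric_space_hdist:
 assumes "!!x y. x \<ominus> y : carrier H" "!!x y. hdist H x y = hdist H y x"
 shows "Metric_space (carrier H) (hdist H)"
proof
 show "0 <= hdist H x y" for x y using hn_nonneg[OF assms(1)] by (simp add: hdist_def)
qed (rule assms(2) hdist_zero hdist_triangle; assumption)+

text \<open>Sums over dyadic blocks in tree form, so that the two halves of a block are the summands
  of the parallelogram law.\<close>

primrec dyadic_sum :: "(nat => 'h) => nat => nat => 'h" where
 "dyadic_sum v 0 s = v s"
| "dyadic_sum v (Suc k) s = dyadic_sum v k s \<oplus> dyadic_sum v k (s + 2 ^ k)"

lemma dyadic_sum_carrier: "(!!j. v j : carrier H) ==> dyadic_sum v k s : carrier H"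
 by (induction k arbitrary: s) auto

lemma dyadic_sum_additive:
 assumes v: "!!j. v j : carrier H"
  and L: "!!x y. x : carrier H ==> y : carrier H ==> L (x \<oplus> y) = L x + (L y :: complex)"
 shows "(ALL j:{s..<s + 2 ^ k}. c <= Re (L (v j))) ==> 2 ^ k * c <= Re (L (dyadic_sum v k s))"
  and "(ALL j:{s..<s + 2 ^ k}. Re (L (v j)) <= c) ==> Re (L (dyadic_sum v k s)) <= 2 ^ k * c"
proof (induction k arbitrary: s)
 case (Suc k)
 note e = L[OF dyadic_sum_carrier[OF v] dyadic_sum_carrier[OF v]]
 {
  case 1
  have "2 ^ k * c <= Re (L (dyadic_sum v k s))" "2 ^ k * c <= Re (L (dyadic_sum v k (s + 2 ^ k)))"
   using 1 by (intro Suc.IH(1); auto)+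
  then show ?case by (simp add: e)
 next
  case 2
  have "Re (L (dyadic_sum v k s)) <= 2 ^ k * c" "Re (L (dyadic_sum v k (s + 2 ^ k))) <= 2 ^ k * c"
   using 2 by (intro Suc.IH(2); auto)+
  then show ?case by (simp add: e)
 }
qed auto

text \<open>
  The functional of the last index of the left half separates the averages over the two halves of a
  dyadic block. By the parallelogram law each doubling therefore lowers the squared norm of the
  averages by a fixed amount.
\<close>

lemma half_graph_bound:
 fixes v :: "nat => 'h" and n :: nat and C \<delta> :: real
 assumes v: "!!j. v j : carrier H" "!!j. hn (v j) <= C"
  and L: "!!i x y. x : carrier H ==> y : carrier H ==> L i (x \<oplus> y) = L i x + L i y"
  and L_le: "!!i x. x : carrier H ==> cmod (L i x) <= D * hn x" and D: "0 < D"
  and hi: "!!i j. i < j ==> j < 2 ^ n ==> c + \<delta> <= Re (L i (v j))"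
  and lo: "!!i j. j <= i ==> i < 2 ^ n ==> Re (L i (v j)) <= c" and \<delta>: "0 < \<delta>"
 shows "n * \<delta>\<^sup>2 <= 4 * C\<^sup>2 * D\<^sup>2"
proof -
 \<comment> \<open>Each doubling loses the square of \<open>2 ^ k * (\<delta> / D)\<close>, which
   equals \<open>4 ^ (k + 1) * e\<close>; relative to the block length this is a loss of
   \<open>e\<close>.\<close>
 define e where "e = (\<delta> / D)\<^sup>2 / 4"
 have "s + 2 ^ k <= 2 ^ n ==> (hn (dyadic_sum v k s))\<^sup>2 <= 4 ^ k * (C\<^sup>2 - k * e)" for k s :: nat
 proof (induction k arbitrary: s)
  case 0
  then show ?case using power_mono[OF v(2)[of s] hn_nonneg[OF v(1)], of 2] by simp
 next
  case (Suc k)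
  define x y where "x = dyadic_sum v k s" and "y = dyadic_sum v k (s + 2 ^ k)"
  define t where "t = s + 2 ^ k - 1"
  have xy: "x : carrier H" "y : carrier H" unfolding x_def y_def by (intro dyadic_sum_carrier v(1))+
  have p: "0 < (2::nat) ^ k" by simp
  have t: "t < 2 ^ n" "s + 2 ^ k = Suc t" using Suc.prems[unfolded power_Suc] p unfolding t_def by linarith+
  have "Re (L t x) <= 2 ^ k * c" unfolding x_def
   by (rule dyadic_sum_additive(2)[OF v(1) L]) (use t in \<open>auto intro!: lo\<close>)
  moreover have "2 ^ k * (c + \<delta>) <= Re (L t y)" unfolding y_def
   by (rule dyadic_sum_additive(1)[OF v(1) L]) (use t Suc.prems in \<open>auto intro!: hi\<close>)
  moreover have "L t y = L t (y \<ominus> x) + L t x"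
   using L[of "y \<ominus> x" x t] xy by (simp add: minus_eq a_assoc l_neg)
  ultimately have "2 ^ k * \<delta> <= Re (L t (y \<ominus> x))" by (simp add: algebra_simps)
  also have "\<dots> <= D * hn (y \<ominus> x)" using complex_Re_le_cmod L_le[of "y \<ominus> x" t] xy order_trans by fastforce
  finally have "2 ^ k * (\<delta> / D) <= hn (y \<ominus> x)" using D by (simp add: field_simps)
  then have "(2 ^ k * (\<delta> / D))\<^sup>2 <= (hn (y \<ominus> x))\<^sup>2" using \<delta> D by (intro power_mono) auto
  moreover have "(2 ^ k * (\<delta> / D))\<^sup>2 = 4 ^ k * (4 * e)"
   by (simp add: e_def power_mult_distrib power_mult[symmetric] power2_eq_square power_mult_distrib[symmetric])
  moreover have "(hn x)\<^sup>2 <= 4 ^ k * (C\<^sup>2 - k * e)" "(hn y)\<^sup>2 <= 4 ^ k * (C\<^sup>2 - k * e)"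
   unfolding x_def y_def by (rule Suc.IH, use Suc.prems in simp)+
  ultimately have "(hn (x \<oplus> y))\<^sup>2 <= 4 * (4 ^ k * (C\<^sup>2 - k * e)) - 4 ^ k * (4 * e)"
   using parallelogram[OF xy] by linarith
  also have "\<dots> = 4 ^ Suc k * (C\<^sup>2 - Suc k * e)" by (simp add: algebra_simps)
  finally show ?case by (simp add: x_def y_def)
 qed
 from this[of 0 n] have "0 <= 4 ^ n * (C\<^sup>2 - n * e)" by (metis add_0 order_refl order_trans zero_le_power2)
 then have "n * e <= C\<^sup>2" using zero_less_power[of "4::real" n] unfolding zero_le_mult_iff by linarith
 then show ?thesis using D by (simp add: e_def field_simps power2_eq_square)
qed

lemma contraction_coefficient_half_graph:
 fixes v :: "nat => 'h" and n :: nat and C \<delta> :: real and A :: "nat => 'h => 'h"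
 assumes v: "!!j. v j : carrier H" "!!j. hn (v j) <= C" and A: "!!i. A i : contractions H"
  and \<eta>: "\<eta> : carrier H" and \<delta>: "0 < \<delta>" and n: "4 * C\<^sup>2 * (hn \<eta> + 1)\<^sup>2 < n * \<delta>\<^sup>2"
  and hg: "!!i j. i < 2 ^ n ==> j < 2 ^ n ==> cmod (ip (A i (v j)) \<eta> - (if i < j then q else p)) <= \<delta>"
 shows "cmod (q - p) <= 3 * \<delta>"
proof (rule ccontr)
 assume big: "~ cmod (q - p) <= 3 * \<delta>"
 \<comment> \<open>Rotation by \<open>w\<close> makes the jump \<open>q - p\<close> real and
   positive. A jump above \<open>3 * \<delta>\<close>, less an error of \<delta> on each side,
   leaves the gap \<delta> that \<open>half_graph_bound\<close> requires.\<close>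
 define w where "w = cnj (q - p) / cmod (q - p)"
 have cp: "0 < cmod (q - p)" using big \<delta> by linarith
 then have w1: "cmod w = 1" unfolding w_def by (simp add: norm_divide del: complex_cnj_diff)
 have "w * (q - p) = of_real (cmod (q - p))"
  using cp by (simp add: w_def complex_norm_square[symmetric] power2_eq_square mult.commute[of "cnj _"] del: complex_cnj_diff)
 then have wq: "Re (w * q) = Re (w * p) + cmod (q - p)" by (metis Re_complex_of_real diff_eq_eq add.commute right_diff_distrib minus_complex.simps(1))
 have near: "\<bar>Re (w * ip (A i (v j)) \<eta>) - Re (w * (if i < j then q else p))\<bar> <= \<delta>" if "i < 2 ^ n" "j < 2 ^ n" for i j
 proof -
  have "\<bar>Re (w * (ip (A i (v j)) \<eta> - (if i < j then q else p)))\<bar> <= cmod (ip (A i (v j)) \<eta> - (if i < j then q else p))"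
   using abs_Re_le_cmod[of "w * (ip (A i (v j)) \<eta> - (if i < j then q else p))"] by (simp only: norm_mult w1 mult_1)
  then show ?thesis using hg[OF that] by (simp only: right_diff_distrib minus_complex.simps(1))
 qed
 have Ac: "A i x : carrier H" "hn (A i x) <= hn x" if "x : carrier H" for i x
  using A[of i] that by (auto simp: contractions_def linear_operators_def)
 have "n * \<delta>\<^sup>2 <= 4 * C\<^sup>2 * (hn \<eta> + 1)\<^sup>2"
 proof (rule half_graph_bound[where L = "%i x. w * ip (A i x) \<eta>" and c = "Re (w * p) + \<delta>"])
  show "w * ip (A i (x \<oplus> y)) \<eta> = w * ip (A i x) \<eta> + w * ip (A i y) \<eta>" if "x : carrier H" "y : carrier H" for i x y
  proof -
   have "A i (x \<oplus> y) = A i x \<oplus> A i y" using A[of i] that by (auto simp: contractions_def linear_operators_def)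
   then show ?thesis using that Ac \<eta> by (simp add: ip_add_left algebra_simps)
  qed
  show "cmod (w * ip (A i x) \<eta>) <= (hn \<eta> + 1) * hn x" if "x : carrier H" for i x
  proof -
   have "cmod (ip (A i x) \<eta>) <= hn (A i x) * hn \<eta>" using cauchy_schwarz Ac(1) that \<eta> by blast
   also have "\<dots> <= hn x * (hn \<eta> + 1)" using Ac that \<eta> by (intro mult_mono) (auto simp: hn_nonneg)
   finally show ?thesis using w1 by (simp add: norm_mult mult.commute)
  qed
  show "0 < hn \<eta> + 1" using hn_nonneg[OF \<eta>] by simp
  show "Re (w * p) + \<delta> + \<delta> <= Re (w * ip (A i (v j)) \<eta>)" if "i < j" "j < 2 ^ n" for i j
   using near[of i j] that wq big by simp
  show "Re (w * ip (A i (v j)) \<eta>) <= Re (w * p) + \<delta>" if "j <= i" "i < 2 ^ n" for i j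
   using near[of i j] that by simp
 qed (use v \<delta> in auto)
 then show False using n by simp
qed

end


section \<open>Stability and continuous functions of many coefficients\<close>

lemma hilbert_space_iff_pre_hilb:
 "hilbert_space H \<longleftrightarrow> pre_hilb H & Metric_space.mcomplete (carrier H) (hdist H)"
 unfolding hilbert_space_def pre_hilb_def by blast

text \<open>The finitary content of the bound on half graphs: long approximate ones have a small
  jump. The factor 6 is 3 times 2, namely the constant of
  \<open>contraction_coefficient_half_graph\<close> applied to the error of the graph plus that of
  an approximating coefficient.\<close>

definition stable :: "'a set => ('a => 'a => complex) => bool" where
 "stable X k \<longleftrightarrow> (ALL \<delta>>0. EX N::nat. ALL p q a b. range a \<subseteq> X --> range b \<subseteq> X -->
   (ALL i<N. ALL j<N. cmod (k (a i) (b j) - (if i < j then q else p)) <= \<delta>) --> cmod (q - p) <= 6 * \<delta>)"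

lemma stable_if_contraction_coefficients:
 fixes X :: "'a set"
 assumes "!!\<delta>. 0 < \<delta> ==> EX (H :: 'h hilbert) A v \<eta> C. pre_hilb H & \<eta> : carrier H &
   (ALL x:X. A x : contractions H & v x : carrier H & hnorm H (v x) <= C) &
   (ALL x:X. ALL y:X. cmod (k x y - hinner H (A x (v y)) \<eta>) <= \<delta>)"
 shows "stable X k"
 unfolding stable_def
proof (intro allI impI)
 fix \<delta> :: real assume \<delta>: "0 < \<delta>"
 from assms[OF \<delta>] obtain H :: "'h hilbert" and A v \<eta> C where H: "pre_hilb H" and \<eta>: "\<eta> : carrier H"
  and Av: "ALL x:X. A x : contractions H & v x : carrier H & hnorm H (v x) <= C"
  and k: "ALL x:X. ALL y:X. cmod (k x y - hinner H (A x (v y)) \<eta>) <= \<delta>"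
  by (elim exE conjE) (rule that)
 interpret pre_hilb H by (rule H)
 \<comment> \<open>The threshold is taken for \<open>2 * \<delta>\<close>, since replacing
   \<open>k\<close> by the coefficient adds another \<delta> to the error.\<close>
 obtain n where n: "4 * C\<^sup>2 * (hn \<eta> + 1)\<^sup>2 < of_nat n * (2 * \<delta>)\<^sup>2"
  using spec[OF reals_Archimedean3[of "(2 * \<delta>)\<^sup>2"]] \<delta> by (metis mult_pos_pos zero_less_numeral zero_less_power)
 show "EX N::nat. ALL p q a b. range a \<subseteq> X --> range b \<subseteq> X -->
   (ALL i<N. ALL j<N. cmod (k (a i) (b j) - (if i < j then q else p)) <= \<delta>) --> cmod (q - p) <= 6 * \<delta>"
 proof (intro exI[of _ "2 ^ n"] allI impI)
  fix p q and a b :: "nat => 'a"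
  assume ab: "range a \<subseteq> X" "range b \<subseteq> X"
   and hg: "ALL i<2 ^ n. ALL j<2 ^ n. cmod (k (a i) (b j) - (if i < j then q else p)) <= \<delta>"
  have X: "a i : X" "b i : X" for i using ab by auto
  have "cmod (q - p) <= 3 * (2 * \<delta>)"
  proof (rule contraction_coefficient_half_graph[where v = "%j. v (b j)" and C = C and A = "%i. A (a i)"])
   show "cmod (ip (A (a i) (v (b j))) \<eta> - (if i < j then q else p)) <= 2 * \<delta>" if "i < 2 ^ n" "j < 2 ^ n" for i j
    using hg[rule_format, OF that] k[rule_format, OF X(1)[of i] X(2)[of j]] norm_triangle_ineq[of
     "ip (A (a i) (v (b j))) \<eta> - k (a i) (b j)" "k (a i) (b j) - (if i < j then q else p)"]
    by (simp only: norm_minus_commute[of "ip _ _" "k _ _"] add_diff_eq diff_add_cancel)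
  qed (use Av X n \<delta> \<eta> in auto)
  then show "cmod (q - p) <= 6 * \<delta>" by simp
 qed
qed

text \<open>Ordered pairs and an increasing enumeration of the homogeneous set are used because
  \<open>i < j\<close> and \<open>j < i\<close> play different roles in a half graph.\<close>

lemma ramsey_pairs:
 assumes C: "finite C"
 shows "EX M::nat. ALL col. (ALL i j. i < j --> j < M --> col i j : C) -->
  (EX h c. (ALL i<n::nat. h i < M) & (ALL i j. i < j --> j < n --> h i < h j & col (h i) (h j) = c))"
proof -
 obtain g where g: "bij_betw g C {..<card C}" using ex_bij_betw_finite_nat[OF C] by (auto simp: atLeast0LessThan)
 obtain M :: nat where M: "partn_lst {..<M} (replicate (card C) n) 2" using ramsey_full by blast
 show ?thesis
 proof (intro exI[of _ M] allI impI)
  fix col assume col: "ALL i j. i < j --> j < M --> col i j : C"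
  define f where "f = (%e. g (col (Min e) (Max e)))"
  have "f : nsets {..<M} 2 \<rightarrow> {..<length (replicate (card C) n)}"
  proof
   fix e :: "nat set" assume "e : nsets {..<M} 2"
   then obtain x y where e: "e = {x, y}" "x < y" "y < M"
    by (elim nsets2_E) (metis insert_commute lessThan_iff linorder_neqE_nat)
   then show "f e : {..<length (replicate (card C) n)}" using col g by (auto simp: f_def bij_betw_def)
  qed
  then obtain i where "i < card C" "monochromatic {..<M} n 2 f i" using M by (auto simp: partn_lst_def)
  then obtain S where S: "S : nsets {..<M} n" "!!e. e : nsets S 2 ==> f e = i" by (auto simp: monochromatic_def)
  have S': "finite S" "card S = n" "S \<subseteq> {..<M}" using S(1) by (auto simp: nsets_def)
  define h where "h = (%i. sorted_list_of_set S ! i)"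
  have hS: "h j : S" if "j < n" for j using that S' by (metis h_def length_sorted_list_of_set nth_mem set_sorted_list_of_set)
  have hm: "h j < h l" if "j < l" "l < n" for j l
   using that S' strict_sorted_list_of_set[of S] by (auto simp: h_def sorted_wrt_iff_nth_less)
  have "col (h j) (h l) = inv_into C g i" if "j < l" "l < n" for j l
  proof -
   have e: "{h j, h l} : nsets S 2" using hS[of j] hS[of l] hm[OF that] that by simp
   have "g (col (h j) (h l)) = i" using S(2)[OF e] hm[OF that] by (simp add: f_def)
   moreover have "col (h j) (h l) : C" using col hm[OF that] hS[OF that(2)] S'(3) by auto
   ultimately show ?thesis using g by (metis bij_betw_def inv_into_f_f)
  qed
  then show "EX h c. (ALL i<n. h i < M) & (ALL i j. i < j --> j < n --> h i < h j & col (h i) (h j) = c)"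
   using hS S'(3) hm by blast
 qed
qed

text \<open>The compact square is covered by the open set on which \<psi> varies by less than
  \<open>e\<close> and by open sets on which some coordinate separates by a fixed positive amount. A
  finite subcover names the coordinates that matter.\<close>

lemma finite_coordinate_dependence:
 fixes c :: "'s => 'x => complex" and \<psi> :: "'x => complex"
 assumes X: "compact_space X" and c: "!!s. s : S ==> continuous_map X euclidean (c s)"
  and sep: "!!z z'. z : topspace X ==> z' : topspace X ==> z ~= z' ==> EX s:S. c s z ~= c s z'"
  and \<psi>: "continuous_map X euclidean \<psi>" and e: "0 < e"
 shows "EX F \<delta>. finite F & F \<subseteq> S & 0 < \<delta> & (ALL z:topspace X. ALL z':topspace X.
  (ALL s:F. cmod (c s z - c s z') <= \<delta>) --> cmod (\<psi> z - \<psi> z') < e)"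
proof -
 let ?P = "prod_topology X X"
 have P: "compactin ?P (topspace X \<times> topspace X)" using X by (metis compact_space_def compact_space_prod_topology topspace_prod_topology)
 have op: "openin ?P {p : topspace ?P. cmod (h (fst p) - h (snd p)) : U}"
  if "continuous_map X euclidean h" "open U" for h :: "'x => complex" and U
 proof -
  have "continuous_map ?P euclidean (%p. h (fst p))" "continuous_map ?P euclidean (%p. h (snd p))"
   using continuous_map_compose[OF continuous_map_fst that(1)] continuous_map_compose[OF continuous_map_snd that(1)]
   by (simp_all add: o_def)
  from continuous_map_norm[OF continuous_map_diff[OF this]]
  have "continuous_map ?P euclidean (%p. cmod (h (fst p) - h (snd p)))" .
  then show ?thesis by (rule openin_continuous_map_preimage) (use that(2) in \<open>simp only: open_openin\<close>)
 qed
 \<comment> \<open>The label \<open>d = 0\<close> marks the set on which \<psi> varies little, so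
   that one type of labels describes the whole cover.\<close>
 define W where "W = (%(s, d). if d = 0 then {p : topspace ?P. cmod (\<psi> (fst p) - \<psi> (snd p)) : {..<e}}
   else {p : topspace ?P. cmod (c s (fst p) - c s (snd p)) : {d<..}})"
 have ex: "EX i. openin ?P (W i) & p : W i & (snd i = 0 \<or> snd i > 0 & fst i : S)" if p: "p : topspace X \<times> topspace X" for p
 proof (cases "fst p = snd p")
  case True
  then show ?thesis using p e op[OF \<psi>, of "{..<e}"] by (intro exI[of _ "(undefined, 0)"]) (auto simp: W_def)
 next
  case False
  then obtain s where s: "s : S" "c s (fst p) ~= c s (snd p)" using sep[of "fst p" "snd p"] p by auto
  then show ?thesis using p op[OF c[OF s(1)], of "{cmod (c s (fst p) - c s (snd p)) / 2<..}"]
   by (intro exI[of _ "(s, cmod (c s (fst p) - c s (snd p)) / 2)"]) (auto simp: W_def)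
 qed
 define \<iota> where "\<iota> = (%p. SOME i. openin ?P (W i) & p : W i & (snd i = 0 \<or> snd i > 0 & fst i : S))"
 have \<iota>: "openin ?P (W (\<iota> p)) & p : W (\<iota> p) & (snd (\<iota> p) = 0 \<or> snd (\<iota> p) > 0 & fst (\<iota> p) : S)"
  if "p : topspace X \<times> topspace X" for p
  unfolding \<iota>_def by (rule someI_ex[OF ex[OF that]])
 then have \<iota>': "openin ?P (W (\<iota> p)) & p : W (\<iota> p)" if "p : topspace X \<times> topspace X" for p using that by blast
 obtain I where I: "finite I" "I \<subseteq> topspace X \<times> topspace X" "topspace X \<times> topspace X \<subseteq> (\<Union>p\<in>I. W (\<iota> p))"
  by (rule compactin_finite_cover[OF P, of "%p. W (\<iota> p)"], rule \<iota>', assumption, rule that)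
 define J where "J = {i : \<iota> ` I. snd i > 0}"
 define \<delta> where "\<delta> = Min (insert 1 (snd ` J))"
 have J: "finite J" using I(1) by (simp add: J_def)
 have d: "0 < \<delta>" "!!i. i : J ==> \<delta> <= snd i" using J by (auto simp: \<delta>_def J_def)
 have "cmod (\<psi> z - \<psi> z') < e" if z: "z : topspace X" "z' : topspace X" and cl: "ALL s:fst ` J. cmod (c s z - c s z') <= \<delta>" for z z'
 proof -
  obtain p where p: "p : I" "(z, z') : W (\<iota> p)" using I(3) z by blast
  show ?thesis
  proof (cases "snd (\<iota> p) = 0")
   case True
   then show ?thesis using p(2) by (auto simp: W_def split: prod.splits)
  next
   case False
   then have "\<iota> p : J" using \<iota>[of p] p(1) I(2) by (auto simp: J_def)
   then have "cmod (c (fst (\<iota> p)) z - c (fst (\<iota> p)) z') <= snd (\<iota> p)" using cl d(2) by fastforce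
   then show ?thesis using p(2) False by (auto simp: W_def split: prod.splits)
  qed
 qed
 moreover have "fst ` J \<subseteq> S"
 proof
  fix s assume "s : fst ` J"
  then obtain p where p: "p : I" "0 < snd (\<iota> p)" "s = fst (\<iota> p)" by (auto simp: J_def)
  then show "s : S" using \<iota>[of p] I(2) by auto
 qed
 ultimately show ?thesis using J d(1) by (intro exI[of _ "fst ` J"] exI[of _ \<delta>]) blast
qed

text \<open>A jump of \<open>f\<close> between 0 and 1 must show in one of finitely many
  coordinates. Ramsey's theorem makes all of them nearly constant on each side of the diagonal of a
  long half graph, where stability rules out such a jump.\<close>

lemma half_graphs_not_stable:
 fixes c :: "'s => 'x => complex" and G :: "'a monoid"
 assumes hg: "half_graphs G f" and X: "compact_space X" and c: "!!s. s : S ==> continuous_map X euclidean (c s)"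
  and sep: "!!z z'. z : topspace X ==> z' : topspace X ==> z ~= z' ==> EX s:S. c s z ~= c s z'"
  and \<psi>: "continuous_map X euclidean \<psi>" and \<epsilon>: "!!x. x : carrier G ==> \<epsilon> x : topspace X & \<psi> (\<epsilon> x) = f x"
  and closed: "!!x y. x : carrier G ==> y : carrier G ==> x \<otimes>\<^bsub>G\<^esub> y : carrier G"
  and st: "!!s. s : S ==> stable (carrier G) (%x y. c s (\<epsilon> (x \<otimes>\<^bsub>G\<^esub> y)))"
 shows False
proof -
 obtain F \<delta>' where F: "finite F" "F \<subseteq> S" "0 < \<delta>'" and dep: "!!z z'. z : topspace X ==> z' : topspace X ==>
  (ALL s:F. cmod (c s z - c s z') <= \<delta>') ==> cmod (\<psi> z - \<psi> z') < 1"
  using finite_coordinate_dependence[OF X c sep \<psi>, of 1] by auto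
 \<comment> \<open>Stability bounds the jumps by \<open>6 * \<delta>\<close>, which is below
   \<open>\<delta>'\<close>.\<close>
 define \<delta> where "\<delta> = \<delta>' / 8"
 have \<delta>: "0 < \<delta>" using F(3) by (simp add: \<delta>_def)
 have "ALL s:F. EX N::nat. ALL p q a b. range a \<subseteq> carrier G --> range b \<subseteq> carrier G -->
   (ALL i<N. ALL j<N. cmod (c s (\<epsilon> (a i \<otimes>\<^bsub>G\<^esub> b j)) - (if i < j then q else p)) <= \<delta>) --> cmod (q - p) <= 6 * \<delta>"
  using st F(2) \<delta> unfolding stable_def by blast
 from bchoice[OF this] obtain Ns :: "'s => nat" where Ns: "ALL s:F. ALL p q a b. range a \<subseteq> carrier G --> range b \<subseteq> carrier G -->
   (ALL i<Ns s. ALL j<Ns s. cmod (c s (\<epsilon> (a i \<otimes>\<^bsub>G\<^esub> b j)) - (if i < j then q else p)) <= \<delta>) --> cmod (q - p) <= 6 * \<delta>"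
  by (rule exE)
 define N where "N = Max (insert 1 (Ns ` F))"
 have N: "Ns s <= N" if "s : F" for s using F(1) that by (simp add: N_def)
 have N1: "1 <= N" using F(1) by (simp add: N_def)
 obtain key :: "complex => int \<times> int" where key: "!!z z'. key z = key z' ==> cmod (z - z') < \<delta>" "!!B. finite (key ` cball 0 B)"
  by (rule finite_complex_grid[OF \<delta>], rule that)
 have "EX B. c s ` topspace X \<subseteq> cball 0 B" if "s : F" for s
 proof -
  have "compactin euclidean (c s ` topspace X)"
   using c[of s] that F(2) X by (intro image_compactin[where X = X]) (auto simp: compact_space_def)
  then have "bounded (c s ` topspace X)" by (simp add: compact_imp_bounded)
  then show ?thesis unfolding bounded_iff by (metis image_subsetI mem_cball_0 imageI)
 qed
 then obtain B where B: "!!s. s : F ==> c s ` topspace X \<subseteq> cball 0 (B s)" by metis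
 define Col where "Col = PiE F (%s. key ` cball 0 (B s) \<times> key ` cball 0 (B s))"
 have fin: "finite Col" unfolding Col_def using F(1) key(2) by (intro finite_PiE) auto
 obtain M :: nat where M: "ALL col. (ALL i j. i < j --> j < M --> col i j : Col) -->
  (EX h k. (ALL i<2 * N + 2. h i < M) & (ALL i j. i < j --> j < 2 * N + 2 --> h i < h j & col (h i) (h j) = k))"
  by (rule exE[OF ramsey_pairs[OF fin, of "2 * N + 2"]]) (rule that)
 obtain a b where ab: "range a \<subseteq> carrier G" "range b \<subseteq> carrier G"
  and fab: "ALL i<M. ALL j<M. f (a i \<otimes>\<^bsub>G\<^esub> b j) = (if i < j then 1 else 0)"
  using hg[unfolded half_graphs_def, THEN spec, of M] by (elim exE conjE) (rule that)
 have abX: "\<epsilon> (a i \<otimes>\<^bsub>G\<^esub> b j) : topspace X" and \<psi>ab: "\<psi> (\<epsilon> (a i \<otimes>\<^bsub>G\<^esub> b j)) = f (a i \<otimes>\<^bsub>G\<^esub> b j)" for i j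
  using \<epsilon>[OF closed, of "a i" "b j"] ab by auto
 define u where "u = (%s i j. c s (\<epsilon> (a i \<otimes>\<^bsub>G\<^esub> b j)))"
 \<comment> \<open>The colour records the grid cells on both sides of the diagonal, so that one
   homogeneous set controls both.\<close>
 define col where "col = (%i j. \<lambda>s\<in>F. (key (u s i j), key (u s j i)))"
 have kB: "key (u s i j) : key ` cball 0 (B s)" if "s : F" for s i j
  using B[OF that] abX[of i j] unfolding u_def by blast
 have "col i j : Col" for i j
  unfolding Col_def col_def by (rule restrict_PiE_iff[THEN iffD2]) (use kB in blast)
 then obtain h k where hk: "ALL i<2 * N + 2. h i < M" "ALL i j. i < j --> j < 2 * N + 2 --> h i < h j & col (h i) (h j) = k"
  using M[THEN spec, of col] by (elim impE exE conjE) (blast, rule that)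
 have h: "i < 2 * N + 2 ==> h i < M" "i < j ==> j < 2 * N + 2 ==> h i < h j" "i < j ==> j < 2 * N + 2 ==> col (h i) (h j) = k" for i j
  using hk by blast+
 have same: "key (u s (h i) (h j)) = key (u s (h 0) (h 1))" "key (u s (h j) (h i)) = key (u s (h 1) (h 0))"
  if "i < j" "j < 2 * N + 2" "s : F" for i j s
 proof -
  have "col (h i) (h j) = col (h 0) (h 1)" using h(3)[OF that(1,2)] h(3)[of 0 1] by simp
  from fun_cong[OF this, of s] show "key (u s (h i) (h j)) = key (u s (h 0) (h 1))" "key (u s (h j) (h i)) = key (u s (h 1) (h 0))"
   using that(3) by (simp_all add: col_def)
 qed
 have "cmod (u s (h 0) (h 1) - u s (h 1) (h 0)) <= 6 * \<delta>" if s: "s : F" for s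
 \<comment> \<open>The colouring says nothing about the diagonal. Odd indices for \<open>a\<close>
   and even ones for \<open>b\<close> avoid it: \<open>2 * i + 1 < 2 * j\<close> holds exactly for
   \<open>i < j\<close>, and otherwise the reverse strict inequality holds.\<close>
 proof (rule Ns[rule_format, OF s, of "%i. a (h (2 * i + 1))" "%j. b (h (2 * j))"])
   fix i j assume ij: "i < Ns s" "j < Ns s"
   show "cmod (c s (\<epsilon> (a (h (2 * i + 1)) \<otimes>\<^bsub>G\<^esub> b (h (2 * j)))) - (if i < j then u s (h 0) (h 1) else u s (h 1) (h 0))) <= \<delta>"
    using ij N[OF s] same[of "2 * i + 1" "2 * j" s] same[of "2 * j" "2 * i + 1" s] s
    by (cases "i < j") (auto simp: u_def intro!: less_imp_le[OF key(1)])
 qed (use ab in auto)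
 then have "ALL s:F. cmod (c s (\<epsilon> (a (h 0) \<otimes>\<^bsub>G\<^esub> b (h 1))) - c s (\<epsilon> (a (h 1) \<otimes>\<^bsub>G\<^esub> b (h 0)))) <= \<delta>'"
  using \<delta> by (fastforce simp: u_def \<delta>_def)
 from dep[OF abX abX this] have "cmod (f (a (h 0) \<otimes>\<^bsub>G\<^esub> b (h 1)) - f (a (h 1) \<otimes>\<^bsub>G\<^esub> b (h 0))) < 1"
  by (simp only: \<psi>ab)
 moreover have "h 0 < h 1" "h 0 < M" "h 1 < M" using h(1)[of 0] h(1)[of 1] h(2)[of 0 1] by simp_all
 ultimately show False using fab[rule_format, of "h 0" "h 1"] fab[rule_format, of "h 1" "h 0"] by (auto split: if_splits)
qed

section \<open>Positive definite kernels\<close>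

text \<open>
  Finite linear combinations of points are lists of pairs of a coefficient and a point. The
  completion of this space for a positive definite kernel is realised by functions on the points.
\<close>

type_synonym 'x comb = "(complex \<times> 'x) list"

definition form :: "('x => 'x => complex) => 'x comb => 'x comb => complex" where
 "form K l m = (\<Sum>p\<leftarrow>l. \<Sum>r\<leftarrow>m. fst p * cnj (fst r) * K (snd p) (snd r))"

definition pd :: "('x => 'x => complex) => bool" where
 "pd K \<longleftrightarrow> (ALL x y. K y x = cnj (K x y)) & (ALL l. 0 <= Re (form K l l))"

definition scl :: "complex => 'x comb => 'x comb" where "scl c l = map (%p. (c * fst p, snd p)) l"
definition mn :: "'x comb => 'x comb => 'x comb" where "mn l m = l @ scl (-1) m"
definition mv :: "('x => 'y) => 'x comb => 'y comb" where "mv \<tau> l = map (%p. (fst p, \<tau> (snd p))) l"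

lemma form_simps [simp]:
 "form K [] m = 0" "form K l [] = 0"
 "form K (l @ l') m = form K l m + form K l' m"
 "form K l (m @ m') = form K l m + form K l m'"
 "form K (scl c l) m = c * form K l m"
 "form K l (scl c m) = cnj c * form K l m"
 "form K (mn l l') m = form K l m - form K l' m"
 "form K l (mn m m') = form K l m - form K l m'"
proof -
 show 1: "form K [] m = 0" "form K l [] = 0" "form K (l @ l') m = form K l m + form K l' m" for l l' m
  by (simp_all add: form_def)
 show 2: "form K l (m @ m') = form K l m + form K l m'" for l m m'
  by (induction l) (simp_all add: form_def algebra_simps)
 show 3: "form K (scl c l) m = c * form K l m" for c l m
  by (induction l) (simp_all add: form_def scl_def algebra_simps sum_list_const_mult)
 show 4: "form K l (scl c m) = cnj c * form K l m" for c l m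
  by (induction l) (simp_all add: form_def scl_def algebra_simps o_def flip: sum_list_const_mult)
 show "form K (mn l l') m = form K l m - form K l' m" "form K l (mn m m') = form K l m - form K l m'"
  by (simp_all add: mn_def 1 2 3 4)
qed

lemma form_singletons: "form K [(c, x)] [(d, y)] = c * cnj d * K x y"
 by (simp add: form_def)

lemma form_points: "form K l m = (\<Sum>r\<leftarrow>m. cnj (fst r) * form K l [(1, snd r)])"
proof (induction m)
 case (Cons r m)
 have "form K l (r # m) = form K l (scl (fst r) [(1, snd r)] @ m)" by (simp add: scl_def)
 then show ?case using Cons by (simp del: append_Cons)
qed simp

lemma mv_simps [simp]: "mv \<tau> (l @ m) = mv \<tau> l @ mv \<tau> m" "mv \<tau> (scl c l) = scl c (mv \<tau> l)"
 "mv \<tau> (mn l m) = mn (mv \<tau> l) (mv \<tau> m)" "mv \<tau> (mv \<sigma> l) = mv (\<tau> \<circ> \<sigma>) l"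
 by (simp_all add: mv_def scl_def mn_def)

lemma form_mv: "form K (mv \<tau> l) (mv \<sigma> m) = form (%x y. K (\<tau> x) (\<sigma> y)) l m"
 by (simp add: form_def mv_def o_def)

section \<open>The Hilbert space of a positive definite kernel\<close>

locale kernel =
 fixes K :: "'x => 'x => complex"
 assumes pd: "pd K"
begin

abbreviation "B \<equiv> form K"

lemma B_commute: "B m l = cnj (B l m)"
proof -
 have 1: "B m [p] = cnj (B [p] m)" for p
 proof (induction m)
  case (Cons r m)
  have "K (snd r) (snd p) = cnj (K (snd p) (snd r))" using pd unfolding pd_def by blast
  then show ?case using Cons by (simp add: form_def)
 qed simp
 show ?thesis
 proof (induction l)
  case (Cons p l)
  have "B m (p # l) = B m [p] + B m l" "B (p # l) m = B [p] m + B l m"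
   using form_simps(3)[of K "[p]" l m] form_simps(4)[of K m "[p]" l] by simp_all
  then show ?case using 1[of p] Cons by (simp only: complex_cnj_add)
 qed simp
qed

definition q :: "'x comb => real" where "q l = sqrt (Re (B l l))"

lemma B_nonneg: "0 <= Re (B l l)" using pd unfolding pd_def by blast

lemma q_square: "(q l)\<^sup>2 = Re (B l l)" by (simp add: q_def B_nonneg)

lemma q_nonneg [simp]: "0 <= q l" by (simp add: q_def B_nonneg)

lemma B_le: "cmod (B l m) <= q l * q m"
proof -
 have "0 <= Re (B l l) + 2 * Re (z * B m l) + (cmod z)\<^sup>2 * Re (B m m)" for z
 proof -
  have "Re (B (l @ scl z m) (l @ scl z m)) = Re (B l l) + (Re (z * B m l) + Re (cnj z * B l m)) + Re (z * (cnj z * B m m))"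
   by (simp add: algebra_simps)
  moreover have "Re (cnj z * B l m) = Re (z * B m l)" using B_commute[of m l] by simp
  moreover have "Re (z * (cnj z * B m m)) = (cmod z)\<^sup>2 * Re (B m m)"
   unfolding mult.assoc[symmetric] complex_norm_square[symmetric] by simp
  ultimately show ?thesis using B_nonneg[of "l @ scl z m"] by simp
 qed
 from cauchy_schwarz_scalar[OF this] have "(cmod (B m l))\<^sup>2 <= (q l * q m)\<^sup>2"
  by (simp add: q_square power_mult_distrib)
 then have "cmod (B m l) <= q l * q m" by (rule power2_le_imp_le) simp
 then show ?thesis using B_commute[of m l] by simp
qed

lemma q_append: "q (l @ m) <= q l + q m"
proof (rule power2_le_imp_le)
 have "Re (B l m) <= q l * q m" using B_le complex_Re_le_cmod order_trans by blast
 moreover have "Re (B m l) = Re (B l m)" using B_commute[of m l] by simp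
 ultimately show "(q (l @ m))\<^sup>2 <= (q l + q m)\<^sup>2" by (simp add: power2_sum q_square)
qed simp

text \<open>Different lists may stand for the same combination; comparing them through
  \<open>B\<close> takes the place of a normal form for lists.\<close>

lemma q_cong: "(!!z. B l z = B m z) ==> q l = q m"
proof -
 assume h: "!!z. B l z = B m z"
 have "B l l = cnj (B l m)" using h[of l] B_commute[of m l] by (rule trans)
 also have "B l m = B m m" by (rule h)
 finally show ?thesis by (simp add: q_def)
qed

lemma q_scl: "q (scl c l) = cmod c * q l"
proof -
 have "Re (c * (cnj c * B l l)) = (cmod c)\<^sup>2 * Re (B l l)"
  unfolding mult.assoc[symmetric] complex_norm_square[symmetric] by simp
 then have "Re (B (scl c l) (scl c l)) = (cmod c)\<^sup>2 * Re (B l l)" by (simp only: form_simps mult.left_commute[of "cnj c"])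
 then show ?thesis by (simp add: q_def real_sqrt_mult del: form_simps)
qed

lemma q_mn_commute: "q (mn l m) = q (mn m l)"
 using q_cong[of "mn l m" "scl (-1) (mn m l)"] by (simp add: q_scl)

lemma q_le_mn: "q l <= q m + q (mn l m)"
 using q_append[of m "mn l m"] q_cong[of l "m @ mn l m"] by simp

lemma q_mn_mn: "q (mn (mn l l') (mn m m')) <= q (mn l m) + q (mn l' m')"
 using q_append[of "mn l m" "mn m' l'"] q_cong[of "mn (mn l l') (mn m m')" "mn l m @ mn m' l'"]
 by (simp add: q_mn_commute[of m' l'])

definition cau :: "(nat => 'x comb) => bool" where
 "cau l \<longleftrightarrow> (ALL e>0. EX N. ALL i>=N. ALL j>=N. q (mn (l i) (l j)) < e)"

lemma cauD: assumes "cau l" "0 < e" obtains N where "!!i j. N <= i ==> N <= j ==> q (mn (l i) (l j)) < e"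
 using assms unfolding cau_def by blast

lemma cauI_add:
 assumes l: "cau l" "cau l'"
  and k: "!!i j. q (mn (k i) (k j)) <= q (mn (l i) (l j)) + q (mn (l' i) (l' j))"
 shows "cau k"
 unfolding cau_def
proof (intro allI impI)
 fix e :: real assume "0 < e"
 then have e: "0 < e / 2" by simp
 obtain N where N: "!!i j. N <= i ==> N <= j ==> q (mn (l i) (l j)) < e / 2" by (rule cauD[OF l(1) e], rule that)
 obtain M where M: "!!i j. M <= i ==> M <= j ==> q (mn (l' i) (l' j)) < e / 2" by (rule cauD[OF l(2) e], rule that)
 have "q (mn (k i) (k j)) < e" if "max N M <= i" "max N M <= j" for i j
  using N[of i j] M[of i j] k[of i j] that by simp
 then show "EX N. ALL i>=N. ALL j>=N. q (mn (k i) (k j)) < e" by blast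
qed

lemma cau_const: "cau (%_. l)"
 using q_cong[of "mn l l" "[]"] by (simp add: cau_def q_def)

lemma cau_mn: "cau l ==> cau m ==> cau (%n. mn (l n) (m n))"
 by (erule (1) cauI_add) (rule q_mn_mn)

lemma cau_append: "cau l ==> cau m ==> cau (%n. l n @ m n)"
proof (erule (1) cauI_add)
 show "q (mn (l i @ m i) (l j @ m j)) <= q (mn (l i) (l j)) + q (mn (m i) (m j))" for i j
  using q_append[of "mn (l i) (l j)" "mn (m i) (m j)"]
   q_cong[of "mn (l i @ m i) (l j @ m j)" "mn (l i) (l j) @ mn (m i) (m j)"] by simp
qed

lemma cau_scl: assumes "cau l" shows "cau (%n. scl c (l n))"
 unfolding cau_def
proof (intro allI impI)
 fix e :: real assume "0 < e"
 then have e: "0 < e / (cmod c + 1)" by (simp add: add_nonneg_pos)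
 obtain N where N: "!!i j. N <= i ==> N <= j ==> q (mn (l i) (l j)) < e / (cmod c + 1)" by (rule cauD[OF assms e], rule that)
 have "q (mn (scl c (l i)) (scl c (l j))) < e" if "N <= i" "N <= j" for i j
 proof -
  have "q (mn (scl c (l i)) (scl c (l j))) = cmod c * q (mn (l i) (l j))"
   using q_cong[of "mn (scl c (l i)) (scl c (l j))" "scl c (mn (l i) (l j))"] by (simp add: q_scl algebra_simps)
  also have "\<dots> <= (cmod c + 1) * q (mn (l i) (l j))" by (simp add: algebra_simps)
  also have "\<dots> < e" using N[OF that] by (subst mult.commute, subst pos_less_divide_eq[symmetric]) (simp_all add: add_nonneg_pos)
  finally show ?thesis .
 qed
 then show "EX N. ALL i>=N. ALL j>=N. q (mn (scl c (l i)) (scl c (l j))) < e" by blast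
qed

lemma cau_bounded:
 assumes "cau l"
 obtains C where "0 < C" "!!i. q (l i) <= C"
proof -
 obtain N where N: "!!i j. N <= i ==> N <= j ==> q (mn (l i) (l j)) < 1" by (rule cauD[OF assms zero_less_one], rule that)
 define C where "C = Max (q ` l ` {..N}) + 1"
 have C: "q (l i) <= C - 1" if "i <= N" for i using that by (simp add: C_def)
 have "q (l i) <= C" for i
 proof (cases "i <= N")
  case False
  then show ?thesis using N[of i N] q_le_mn[of "l i" "l N"] C[of N] by simp
 qed (use C[of i] in simp)
 moreover have "0 < C" using C[of 0] q_nonneg[of "l 0"] by linarith
 ultimately show thesis by (rule that[rotated])
qed

lemma cau_convergent:
 assumes l: "cau l" and m: "cau m"
 shows "convergent (%n. B (l n) (m n))"
proof -
 obtain C where C: "0 < C" "!!i. q (l i) <= C" by (rule cau_bounded[OF l], rule that)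
 obtain D where D: "0 < D" "!!i. q (m i) <= D" by (rule cau_bounded[OF m], rule that)
 have "Cauchy (%n. B (l n) (m n))"
 proof (rule metric_CauchyI)
  fix e :: real assume e: "0 < e"
  have e1: "0 < e / (2 * D)" "0 < e / (2 * C)" using e C(1) D(1) by simp_all
  obtain N where N: "!!i j. N <= i ==> N <= j ==> q (mn (l i) (l j)) < e / (2 * D)" by (rule cauD[OF l e1(1)], rule that)
  obtain M where M: "!!i j. M <= i ==> M <= j ==> q (mn (m i) (m j)) < e / (2 * C)" by (rule cauD[OF m e1(2)], rule that)
  have "dist (B (l i) (m i)) (B (l j) (m j)) < e" if "max N M <= i" "max N M <= j" for i j
  proof -
   have eq: "B (l i) (m i) - B (l j) (m j) = B (mn (l i) (l j)) (m i) + B (l j) (mn (m i) (m j))" by simp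
   have "cmod (B (l i) (m i) - B (l j) (m j)) <= q (mn (l i) (l j)) * q (m i) + q (l j) * q (mn (m i) (m j))"
    unfolding eq using norm_triangle_ineq[of "B (mn (l i) (l j)) (m i)" "B (l j) (mn (m i) (m j))"]
     B_le[of "mn (l i) (l j)" "m i"] B_le[of "l j" "mn (m i) (m j)"] by linarith
   also have "\<dots> <= q (mn (l i) (l j)) * D + C * q (mn (m i) (m j))"
    using C D by (intro add_mono mult_mono) auto
   also have "\<dots> < e / (2 * D) * D + C * (e / (2 * C))"
    using N[of i j] M[of i j] that C(1) D(1) by (intro add_strict_mono mult_strict_right_mono mult_strict_left_mono) auto
   also have "\<dots> = e" using C(1) D(1) by simp
   finally show ?thesis by (simp add: dist_norm)
  qed
  then show "EX N. ALL i>=N. ALL j>=N. dist (B (l i) (m i)) (B (l j) (m j)) < e" by blast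
 qed
 then show ?thesis by (simp add: Cauchy_convergent_iff)
qed

text \<open>A Cauchy sequence of combinations is determined by its limits at the points: against a
  fixed late term \<open>m N\<close> only finitely many points matter, and the rest of
  \<open>m\<close> is controlled by its Cauchy property.\<close>

lemma null_against:
 assumes l: "cau l" and m: "cau m" and null: "!!y. (%n. B (l n) [(1, y)]) ----> 0"
 shows "(%n. B (l n) (m n)) ----> 0"
proof (rule LIMSEQ_I)
 fix e :: real assume e: "0 < e"
 have fixed: "(%n. B (l n) k) ----> 0" for k
 proof (induction k)
  case (Cons r k)
  have "(%n. cnj (fst r) * B (l n) [(1, snd r)] + B (l n) k) ----> cnj (fst r) * 0 + 0"
   by (intro tendsto_intros null Cons)
  moreover have "B (l n) (r # k) = cnj (fst r) * B (l n) [(1, snd r)] + B (l n) k" for n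
   by (subst form_points) (simp add: form_points[of K "l n" k])
  ultimately show ?case by simp
 qed simp
 obtain C where C: "0 < C" "!!i. q (l i) <= C" by (rule cau_bounded[OF l], rule that)
 have e1: "0 < e / (2 * C)" using e C(1) by simp
 obtain N where N: "!!i j. N <= i ==> N <= j ==> q (mn (m i) (m j)) < e / (2 * C)" by (rule cauD[OF m e1], rule that)
 obtain M where M: "!!n. M <= n ==> cmod (B (l n) (m N)) < e / 2"
  using LIMSEQ_D[OF fixed[of "m N"], of "e / 2"] e by auto
 have "norm (B (l n) (m n) - 0) < e" if n: "max N M <= n" for n
 proof -
  have "cmod (B (l n) (mn (m n) (m N))) <= C * q (mn (m n) (m N))"
   using B_le[of "l n" "mn (m n) (m N)"] C(2)[of n] by (meson mult_right_mono order_trans q_nonneg)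
  also have "\<dots> < C * (e / (2 * C))" using N[of n N] n C(1) by (intro mult_strict_left_mono) auto
  also have "\<dots> = e / 2" using C(1) by simp
  finally show ?thesis using M[of n] n norm_triangle_ineq[of "B (l n) (mn (m n) (m N))" "B (l n) (m N)"] by simp
 qed
 then show "EX n0. ALL n>=n0. norm (B (l n) (m n) - 0) < e" by blast
qed

text \<open>The reproducing kernel picture: the limit of \<open>l\<close> is recorded as the
  function of its inner products with the points. Thus the completion lives on the type of functions
  on points.\<close>

definition rep :: "(nat => 'x comb) => ('x => complex) => bool" where
 "rep l F \<longleftrightarrow> cau l & (ALL y. (%n. B (l n) [(1, y)]) ----> F y)"

lemma rep_cau: "rep l F ==> cau l" and rep_tendsto_at: "rep l F ==> (%n. B (l n) [(1, y)]) ----> F y"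
 by (simp_all add: rep_def)

lemma rep_null: "rep l (%_. 0) ==> cau m ==> (%n. B (l n) (m n)) ----> 0"
 by (rule null_against) (erule rep_cau | assumption | erule rep_tendsto_at)+

lemma rep_unique: "rep l F ==> rep l G ==> F = G"
 unfolding rep_def by (meson ext LIMSEQ_unique)

lemma rep_exists: "cau l ==> EX F. rep l F"
proof -
 assume l: "cau l"
 have "rep l (%y. lim (%n. B (l n) [(1, y)]))"
  using l cau_convergent[OF l cau_const] by (simp add: rep_def convergent_LIMSEQ_iff)
 then show ?thesis by (rule exI[of "rep l"])
qed

lemma rep_const: "rep (%_. l) (%y. B l [(1, y)])" by (simp add: rep_def cau_const)

lemma rep_add: "rep l F ==> rep m G ==> rep (%n. l n @ m n) (%y. F y + G y)"
 by (auto simp: rep_def cau_append intro!: tendsto_intros)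

lemma rep_scl: "rep l F ==> rep (%n. scl c (l n)) (%y. c * F y)"
 by (auto simp: rep_def cau_scl intro!: tendsto_intros)

lemma rep_mn: "rep l F ==> rep m G ==> rep (%n. mn (l n) (m n)) (%y. F y - G y)"
 by (auto simp: rep_def cau_mn intro!: tendsto_intros)

definition rp :: "('x => complex) => nat => 'x comb" where "rp F = (SOME l. rep l F)"

definition space :: "('x => complex) set" where "space = {F. EX l. rep l F}"

definition inner :: "('x => complex) => ('x => complex) => complex" where
 "inner F G = lim (%n. B (rp F n) (rp G n))"

lemma rep_rp: "F : space ==> rep (rp F) F"
 unfolding space_def rp_def by (drule CollectD) (erule someI_ex)

lemma spaceI: "rep l F ==> F : space" by (auto simp: space_def)

lemma rep_same_q:
 assumes "rep l F" "rep m F"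
 shows "(%n. q (mn (l n) (m n))) ----> 0"
proof -
 have r: "rep (%n. mn (l n) (m n)) (%_. 0)" using rep_mn[OF assms] by simp
 have "(%n. B (mn (l n) (m n)) (mn (l n) (m n))) ----> 0" by (rule rep_null[OF r rep_cau[OF r]])
 from tendsto_real_sqrt[OF tendsto_Re[OF this]] show ?thesis by (simp add: q_def)
qed

text \<open>Two representatives of the same vector differ by a null sequence, so the limit does not
  depend on the choice made by \<open>rp\<close>.\<close>

lemma inner_lim:
 assumes l: "rep l F" and m: "rep m G"
 shows "(%n. B (l n) (m n)) ----> inner F G"
proof -
 have r: "rep (rp F) F" "rep (rp G) G" using assms by (blast intro: rep_rp spaceI)+
 then have c: "cau (rp F)" "cau (rp G)" "cau l" "cau m" using assms by (blast intro: rep_cau)+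
 have 1: "(%n. B (rp F n) (rp G n)) ----> inner F G"
  unfolding inner_def using cau_convergent[OF c(1,2)] by (simp add: convergent_LIMSEQ_iff)
 have 2: "(%n. B (mn (l n) (rp F n)) (m n)) ----> 0"
  by (rule rep_null) (use rep_mn[OF l r(1)] c in simp_all)
 have "(%n. B (mn (m n) (rp G n)) (rp F n)) ----> 0"
  by (rule rep_null) (use rep_mn[OF m r(2)] c in simp_all)
 then have 3: "(%n. cnj (B (mn (m n) (rp G n)) (rp F n))) ----> cnj 0" by (rule tendsto_cnj)
 have eq: "B (mn (l n) (rp F n)) (m n) + cnj (B (mn (m n) (rp G n)) (rp F n)) + B (rp F n) (rp G n) = B (l n) (m n)" for n
  unfolding B_commute[of "rp F n" "mn (m n) (rp G n)", symmetric] by simp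
 from tendsto_add[OF tendsto_add[OF 2 3] 1] show ?thesis unfolding eq by simp
qed

definition proj :: "('x => complex) => 'x => complex" where "proj F = (if F : space then F else (%_. 0))"

text \<open>
  Addition treats functions outside the space as zero. This makes the distance of the Hilbert space
  total, as the theory of metric spaces requires.
\<close>

definition hs :: "('x => complex) hilbert" where
 "hs = \<lparr>carrier = space, mult = undefined, one = undefined, zero = (%_. 0),
   add = (%F G y. proj F y + proj G y), smult = (%c F y. c * F y), hinner = inner\<rparr>"

lemma hs_simps [simp]:
 "carrier hs = space" "hinner hs = inner" "\<zero>\<^bsub>hs\<^esub> = (%_. 0)" "c \<odot>\<^bsub>hs\<^esub> F = (%y. c * F y)"
 by (simp_all add: hs_def)

lemma hs_add [simp]: "F : space ==> G : space ==> F \<oplus>\<^bsub>hs\<^esub> G = (%y. F y + G y)"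
 by (simp add: hs_def proj_def)

lemma space_add: "F : space ==> G : space ==> (%y. F y + G y) : space"
 and space_scl: "F : space ==> (%y. c * F y) : space"
 and space_zero: "(%_. 0) : space"
 by (rule spaceI[OF rep_add[OF rep_rp rep_rp]], assumption+)
  (rule spaceI[OF rep_scl[OF rep_rp]], assumption, use spaceI[OF rep_const[of "[]"]] in simp)

lemma space_diff: "F : space ==> G : space ==> (%y. F y - G y) : space"
 by (rule spaceI[OF rep_mn[OF rep_rp rep_rp]])

lemma inner_self: assumes "rep l F" shows "(%n. (q (l n))\<^sup>2) ----> Re (inner F F)"
 using tendsto_Re[OF inner_lim[OF assms assms]] by (simp add: q_square)

lemma pre_hilb_hs: "pre_hilb hs"
proof (rule pre_hilb.intro)
 show "Module.module complex_ring hs"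
 proof (rule moduleI)
  show "cring complex_ring"
   by (rule cringI, rule abelian_groupI, auto simp: complex_ring_def algebra_simps intro!: exI[of _ "- _"] comm_monoidI)
  show "abelian_group hs"
  proof (rule abelian_groupI)
   show "EX G:carrier hs. G \<oplus>\<^bsub>hs\<^esub> F = \<zero>\<^bsub>hs\<^esub>" if "F : carrier hs" for F
    by (rule bexI[of _ "%y. -1 * F y"]) (use that space_scl[of F "-1"] in auto)
  qed (auto simp: space_add space_zero algebra_simps)
 qed (auto simp: complex_ring_def space_add space_scl algebra_simps)
 show "hinner hs (F \<oplus>\<^bsub>hs\<^esub> G) E = hinner hs F E + hinner hs G E" if "F : carrier hs" "G : carrier hs" "E : carrier hs" for F G E
 proof -
  have r: "rep (rp F) F" "rep (rp G) G" "rep (rp E) E" using that by (auto intro: rep_rp)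
  have "(%n. B (rp F n @ rp G n) (rp E n)) ----> inner F E + inner G E"
   using tendsto_add[OF inner_lim[OF r(1,3)] inner_lim[OF r(2,3)]] by simp
  from LIMSEQ_unique[OF inner_lim[OF rep_add[OF r(1,2)] r(3)] this] show ?thesis using that by simp
 qed
 show "hinner hs (c \<odot>\<^bsub>hs\<^esub> F) E = c * hinner hs F E" if "F : carrier hs" "E : carrier hs" for F E c
 proof -
  have r: "rep (rp F) F" "rep (rp E) E" using that by (auto intro: rep_rp)
  have "(%n. B (scl c (rp F n)) (rp E n)) ----> c * inner F E"
   using tendsto_mult_left[OF inner_lim[OF r], of c] by simp
  from LIMSEQ_unique[OF inner_lim[OF rep_scl[OF r(1)] r(2)] this] show ?thesis by simp
 qed
 show "hinner hs E F = cnj (hinner hs F E)" if "F : carrier hs" "E : carrier hs" for F E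
 proof -
  have r: "rep (rp F) F" "rep (rp E) E" using that by (auto intro: rep_rp)
  have "(%n. B (rp E n) (rp F n)) ----> cnj (inner F E)"
   using tendsto_cnj[OF inner_lim[OF r]] by (simp only: B_commute[symmetric])
  from LIMSEQ_unique[OF inner_lim[OF r(2,1)] this] show ?thesis by simp
 qed
 show "0 <= Re (hinner hs F F)" if "F : carrier hs" for F
  by (simp, rule LIMSEQ_le_const[OF inner_self[OF rep_rp]]) (use that in auto)
 show "F = \<zero>\<^bsub>hs\<^esub>" if F: "F : carrier hs" "hinner hs F F = 0" for F
 proof -
  have r: "rep (rp F) F" using F by (auto intro: rep_rp)
  from tendsto_real_sqrt[OF inner_self[OF r]] have q0: "(%n. q (rp F n)) ----> 0" using F by simp
  have "F y = 0" for y
  proof -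
   have "(%n. q (rp F n) * q [(1, y)]) ----> 0" using tendsto_mult_right[OF q0, of "q [(1, y)]"] by simp
   then have "(%n. B (rp F n) [(1, y)]) ----> 0" by (rule Lim_null_comparison[rotated]) (simp add: B_le)
   then show ?thesis by (rule LIMSEQ_unique[OF rep_tendsto_at[OF r]])
  qed
  then show ?thesis by auto
 qed
qed

interpretation hs: pre_hilb hs by (rule pre_hilb_hs)

lemma hs_minus: "F \<ominus>\<^bsub>hs\<^esub> G = (%y. proj F y - proj G y)"
proof -
 have inv: "\<ominus>\<^bsub>hs\<^esub> G = (%y. - proj G y)" for G
 proof (cases "G : space")
  case True
  then have "(%y. - G y) : space" using space_scl[of G "-1"] by simp
  then have "(%y. - G y) \<oplus>\<^bsub>hs\<^esub> G = \<zero>\<^bsub>hs\<^esub>" using True by simp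
  from hs.minus_equality[OF this] show ?thesis using True \<open>(%y. - G y) : space\<close> by (simp add: proj_def)
 next
  case False
  \<comment> \<open>The additive inverse is a definite description. For \<open>G\<close> outside the
    space, which counts as zero, the zero function is its only solution.\<close>
  have "(THE E. E : space & G \<oplus>\<^bsub>hs\<^esub> E = (%_. 0) & E \<oplus>\<^bsub>hs\<^esub> G = (%_. 0)) = (%_. 0)"
   by (rule the_equality) (use False in \<open>auto simp: hs_def proj_def space_zero\<close>)
  then show ?thesis using False by (simp add: a_inv_def m_inv_def proj_def)
 qed
 have "proj (%y. - proj G y) = (%y. - proj G y)" for G
  using space_scl[of G "-1"] space_zero by (auto simp: proj_def)
 then show ?thesis unfolding a_minus_def inv by (simp add: hs_def)
qed

lemma hdist_rep:
 assumes "rep l F" "rep m G"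
 shows "(%n. q (mn (l n) (m n))) ----> hdist hs F G"
proof -
 have "F : space" "G : space" using assms spaceI by auto
 then show ?thesis
  using tendsto_real_sqrt[OF inner_self[OF rep_mn[OF assms]]]
  by (simp add: hdist_def hnorm_def hs_minus proj_def)
qed

lemma Metric_space_hs: "Metric_space space (hdist hs)"
proof -
 have p: "proj F : space" "proj (proj F) = proj F" for F by (auto simp: proj_def space_zero)
 have "hdist hs F G = hdist hs G F" for F G
 proof -
  have "hdist hs F G = hdist hs (proj F) (proj G)" for F G by (simp add: hdist_def hs_minus p)
  moreover have "hdist hs (proj F) (proj G) = hdist hs (proj G) (proj F)"
   using LIMSEQ_unique[OF hdist_rep[OF rep_rp[OF p(1)[of F]] rep_rp[OF p(1)[of G]]]]
    hdist_rep[OF rep_rp[OF p(1)[of G]] rep_rp[OF p(1)[of F]]] by (simp add: q_mn_commute)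
  ultimately show ?thesis by metis
 qed
 moreover have "F \<ominus>\<^bsub>hs\<^esub> G : space" for F G unfolding hs_minus by (intro space_diff p)
 ultimately show ?thesis using hs.Metric_space_hdist by simp
qed

abbreviation "point l \<equiv> (%y. B l [(1, y)])"

lemma point_space: "point l : space" by (rule spaceI[OF rep_const])

lemma hdist_point: "hdist hs (point l) (point m) = q (mn l m)"
 using LIMSEQ_unique[OF hdist_rep[OF rep_const rep_const] tendsto_const] .

lemma inner_point: "inner (point l) (point m) = B l m"
 using LIMSEQ_unique[OF inner_lim[OF rep_const rep_const] tendsto_const] .

lemma rep_tendsto:
 assumes l: "rep l F"
 shows "(%k. hdist hs F (point (l k))) ----> 0"
proof (rule LIMSEQ_I)
 fix e :: real assume "0 < e"
 then have e: "0 < e / 2" by simp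
 obtain N where N: "!!i j. N <= i ==> N <= j ==> q (mn (l i) (l j)) < e / 2"
  by (rule cauD[OF rep_cau[OF l] e], rule that)
 have "norm (hdist hs F (point (l k)) - 0) < e" if "N <= k" for k
 proof -
  have "hdist hs F (point (l k)) <= e / 2"
   by (rule LIMSEQ_le_const2[OF hdist_rep[OF l rep_const]], rule exI[of _ N]) (use N that in \<open>auto intro: less_imp_le\<close>)
  moreover have "0 <= hdist hs F (point (l k))" using Metric_space.nonneg[OF Metric_space_hs] .
  ultimately show ?thesis using \<open>0 < e\<close> by simp
 qed
 then show "EX n0. ALL k>=n0. norm (hdist hs F (point (l k)) - 0) < e" by blast
qed

lemma point_dense:
 assumes "F : space" "0 < e" obtains l where "hdist hs F (point l) < e"
proof -
 from LIMSEQ_D[OF rep_tendsto[OF rep_rp[OF assms(1)]] assms(2)] obtain n where "norm (hdist hs F (point (rp F n)) - 0) < e" by blast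
 then show thesis by (intro that[of "rp F n"]) simp
qed

text \<open>The terms of a Cauchy sequence are replaced by combinations at distance below
  \<open>1 / (k + 1)\<close>. These form a Cauchy sequence of combinations, and the function that it
  represents is the limit.\<close>

lemma hilbert_space_hs: "hilbert_space hs"
proof -
 interpret M: Metric_space space "hdist hs" by (rule Metric_space_hs)
 have "M.mcomplete"
  unfolding M.mcomplete_def
 proof (intro allI impI)
  fix \<sigma> assume \<sigma>: "M.MCauchy \<sigma>"
  have sp: "\<sigma> k : space" for k using \<sigma> by (auto simp: M.MCauchy_def)
  have "ALL k. EX l. hdist hs (\<sigma> k) (point l) < 1 / Suc k" by (intro allI, rule point_dense[OF sp, of "1 / Suc _"]) auto
  then obtain p where p: "!!k. hdist hs (\<sigma> k) (point (p k)) < 1 / Suc k" by metis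
  have inv0: "(%k. 1 / real (Suc k)) ----> 0" using LIMSEQ_inverse_real_of_nat by (simp add: inverse_eq_divide)
  have "cau p" unfolding cau_def
  proof (intro allI impI)
   fix e :: real assume "0 < e"
   then have e: "0 < e / 3" by simp
   obtain N where N: "!!i j. N <= i ==> N <= j ==> hdist hs (\<sigma> i) (\<sigma> j) < e / 3" using \<sigma> e unfolding M.MCauchy_def by blast
   obtain M where M: "!!k. M <= k ==> 1 / real (Suc k) < e / 3" using LIMSEQ_D[OF inv0 e] by auto
   have "q (mn (p i) (p j)) < e" if "max N M <= i" "max N M <= j" for i j
   proof -
    have "q (mn (p i) (p j)) <= hdist hs (point (p i)) (\<sigma> i) + (hdist hs (\<sigma> i) (\<sigma> j) + hdist hs (\<sigma> j) (point (p j)))"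
     unfolding hdist_point[symmetric]
     using M.triangle[OF point_space sp[of i] point_space, of "p i" "p j"] M.triangle[OF sp[of i] sp[of j] point_space, of "p j"] by simp
    then show ?thesis using p[of i] p[of j] N[of i j] M[of i] M[of j] that M.commute[of "point (p i)" "\<sigma> i"] by simp
   qed
   then show "EX N. ALL i>=N. ALL j>=N. q (mn (p i) (p j)) < e" by blast
  qed
  then obtain F where F: "rep p F" using rep_exists by blast
  then have Fs: "F : space" by (rule spaceI)
  have "(%k. 1 / Suc k + hdist hs F (point (p k))) ----> 0"
   using tendsto_add[OF inv0 rep_tendsto[OF F]] by simp
  then have "(%k. hdist hs (\<sigma> k) F) ----> 0"
  proof (rule Lim_null_comparison[rotated], intro always_eventually allI)
   show "norm (hdist hs (\<sigma> k) F) <= 1 / Suc k + hdist hs F (point (p k))" for k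
    using M.triangle[OF sp[of k] point_space Fs, of "p k"] p[of k] M.commute[of F "point (p k)"] by simp
  qed
  then show "EX x. limitin M.mtopology \<sigma> x sequentially"
   using Fs sp by (intro exI[of _ F]) (simp add: M.limitin_metric_dist_null)
 qed
 then show ?thesis using pre_hilb_hs by (simp add: hilbert_space_iff_pre_hilb)
qed

end

lemma continuous_map_uniform_approx:
 fixes f :: "'x => complex"
 assumes "!!e. 0 < e ==> EX g. continuous_map X euclidean g & (ALL x:topspace X. cmod (f x - g x) <= e)"
 shows "continuous_map X euclidean f"
 unfolding continuous_map_to_metric_iff
proof (intro ballI allI impI)
 fix x and e :: real assume x: "x : topspace X" and "0 < e"
 then have e: "0 < e / 4" by simp
 from assms[OF e] obtain g where g: "continuous_map X euclidean g" "ALL x:topspace X. cmod (f x - g x) <= e / 4" by (elim exE conjE)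
 obtain U where U: "openin X U" "x : U" "!!y. y : U ==> dist (g y) (g x) < e / 4"
  using g(1)[unfolded continuous_map_to_metric_iff, rule_format, OF x e] by blast
 have "dist (f y) (f x) < e" if y: "y : U" for y
 proof -
  have yX: "y : topspace X" using openin_subset[OF U(1)] y by blast
  have "f y - f x = (f y - g y) + (g y - g x) - (f x - g x)" by simp
  then have "cmod (f y - f x) <= cmod (f y - g y) + cmod (g y - g x) + cmod (f x - g x)"
   by (metis norm_triangle_ineq norm_triangle_ineq4 add_mono_thms_linordered_semiring(3) order_trans)
  then show ?thesis using bspec[OF g(2) x] bspec[OF g(2) yX] U(3)[OF y] \<open>0 < e\<close> by (simp add: dist_norm)
 qed
 then show "EX U. openin X U & x : U & (ALL y:U. dist (f y) (f x) < e)" using U by blast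
qed

section \<open>Contractions and the weak* topology\<close>

context pre_hilb
begin

lemma contraction_simps:
 assumes "A : contractions H" "x : carrier H"
 shows "A x : carrier H" "hn (A x) <= hn x" "y : carrier H ==> A (x \<oplus> y) = A x \<oplus> A y"
  "A (c \<odot>\<^bsub>H\<^esub> x) = c \<odot>\<^bsub>H\<^esub> A x" "y : carrier H ==> A (x \<ominus> y) = A x \<ominus> A y"
proof -
 show *: "A x : carrier H" "hn (A x) <= hn x" "A (c \<odot>\<^bsub>H\<^esub> x) = c \<odot>\<^bsub>H\<^esub> A x"
  using assms by (auto simp: contractions_def linear_operators_def)
 have add: "A (u \<oplus> y) = A u \<oplus> A y" if "u : carrier H" "y : carrier H" for u y
  using assms that by (auto simp: contractions_def linear_operators_def)
 show "A (x \<oplus> y) = A x \<oplus> A y" if "y : carrier H" using add that assms(2) by blast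
 assume y: "y : carrier H"
 have c: "A z : carrier H" if "z : carrier H" for z using assms(1) that by (auto simp: contractions_def linear_operators_def)
 have "(x \<ominus> y) \<oplus> y = x" using assms y by (simp add: minus_eq a_assoc l_neg)
 then have "A (x \<ominus> y) \<oplus> A y = A x" using add[of "x \<ominus> y" y] assms y by simp
 then show "A (x \<ominus> y) = A x \<ominus> A y" using c y assms(2) by (metis add.m_assoc add.r_inv_ex minus_carrier minus_eq r_neg r_zero a_inv_closed)
qed

text \<open>On bounded sets the weak* topology is the weak operator topology.\<close>

lemma continuous_map_weak_star:
 assumes A: "!!r. r : topspace X ==> A r : contractions H"
  and c: "!!\<xi> \<eta>. \<xi> : carrier H ==> \<eta> : carrier H ==> continuous_map X euclidean (%r. ip (A r \<xi>) \<eta>)"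
 shows "continuous_map X (weak_star_topology H) A"
 unfolding weak_star_topology_def
proof (rule continuous_map_pullback')
 show "topspace X \<subseteq> A -` bounded_operators H"
  using A by (force simp: bounded_operators_def contractions_def intro: exI[of _ 1])
 let ?S = "square_summable H \<times> square_summable H"
 have "continuous_map X euclidean (%r. \<Sum>n. ip (A r (fst p n)) (snd p n))" if p: "p : ?S" for p
 proof (rule continuous_map_uniform_approx)
  fix e :: real assume e: "0 < e"
  have pc: "fst p n : carrier H" "snd p n : carrier H" for n using p by (auto simp: square_summable_def)
  \<comment> \<open>A summable majorant valid for all contractions at once, whence the series of
    weak operator coordinates converges uniformly in \<open>r\<close>.\<close>
  define M where "M = (%n. (hn (fst p n))\<^sup>2 + (hn (snd p n))\<^sup>2)"
  have M: "summable M" unfolding M_def using p by (intro summable_add) (auto simp: square_summable_def)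
  have le: "norm (ip (A r (fst p n)) (snd p n)) <= M n" if "r : topspace X" for r n
  proof -
   have "cmod (ip (A r (fst p n)) (snd p n)) <= hn (A r (fst p n)) * hn (snd p n)"
    by (intro cauchy_schwarz contraction_simps[OF A[OF that]] pc)
   also have "\<dots> <= hn (fst p n) * hn (snd p n)"
    by (intro mult_right_mono contraction_simps[OF A[OF that]] hn_nonneg pc)
   also have "\<dots> <= M n"
    using sum_squares_bound[of "hn (fst p n)" "hn (snd p n)"] mult_nonneg_nonneg[OF hn_nonneg[OF pc(1)[of n]] hn_nonneg[OF pc(2)[of n]]]
    unfolding M_def by linarith
   finally show ?thesis .
  qed
  have "uniform_limit (topspace X) (%N r. \<Sum>n<N. ip (A r (fst p n)) (snd p n)) (%r. \<Sum>n. ip (A r (fst p n)) (snd p n)) sequentially"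
   by (rule Weierstrass_m_test[OF le M])
  from uniform_limitD[OF this e] obtain N where N: "ALL r:topspace X.
   dist (\<Sum>n<N. ip (A r (fst p n)) (snd p n)) (\<Sum>n. ip (A r (fst p n)) (snd p n)) < e"
   by (auto simp: eventually_sequentially)
  have "continuous_map X euclidean (%r. \<Sum>n<N. ip (A r (fst p n)) (snd p n))"
   by (induction N) (simp_all add: continuous_map_add c pc)
  then show "EX g. continuous_map X euclidean g & (ALL r:topspace X. cmod ((\<Sum>n. ip (A r (fst p n)) (snd p n)) - g r) <= e)"
   using N by (intro exI[of _ "%r. \<Sum>n<N. ip (A r (fst p n)) (snd p n)"])
    (auto simp: dist_norm norm_minus_commute intro: less_imp_le)
 qed
 then show "continuous_map X (product_topology (%_. euclidean) ?S)
   ((%A. \<lambda>p\<in>?S. \<Sum>n. ip (A (fst p n)) (snd p n)) \<circ> A)"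
  unfolding continuous_map_componentwise o_def by auto
qed

lemma weak_star_coordinate:
 assumes "\<xi> : carrier H" "\<eta> : carrier H"
 shows "continuous_map (weak_star_topology H) euclidean (%A. ip (A \<xi>) \<eta>)"
proof -
 \<comment> \<open>Sequences supported at index 0 reduce the trace class functional to a single
   coefficient.\<close>
 define p :: "(nat => 'h) \<times> (nat => 'h)" where
  "p = ((%n. if n = 0 then \<xi> else \<zero>), (%n. if n = 0 then \<eta> else \<zero>))"
 let ?S = "square_summable H \<times> square_summable H"
 let ?J = "%A. \<lambda>p\<in>?S. \<Sum>n. ip (A (fst p n)) (snd p n)"
 have hz: "hn \<zero> = 0" by (simp add: hn_zero_iff)
 have sq: "(%n. if n = 0 then x else \<zero>) : square_summable H" if "x : carrier H" for x
 proof -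
  have "summable (%n. (hn (if n = 0 then x else \<zero>))\<^sup>2)"
   by (rule summable_finite[of "{0}"]) (auto simp: hz)
  then show ?thesis using that by (auto simp: square_summable_def)
 qed
 then have p: "p : ?S" using assms by (simp add: p_def)
 have "continuous_map (weak_star_topology H) euclidean ((%h. h p) \<circ> ?J)"
  unfolding weak_star_topology_def
  by (rule continuous_map_pullback[OF continuous_map_product_projection[OF p]])
 moreover have "((%h. h p) \<circ> ?J) A = ip (A \<xi>) \<eta>" if "A : topspace (weak_star_topology H)" for A
 proof -
  have A: "A : bounded_operators H" using that by (auto simp: weak_star_topology_def topspace_pullback_topology)
  have Ac: "A x : carrier H" if "x : carrier H" for x using A that by (auto simp: bounded_operators_def linear_operators_def)
  have z: "ip x \<zero> = 0" if "x : carrier H" for x using ip_commute[of \<zero> x] ip_zero_left[of x] that by simp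
  have "(\<Sum>n. ip (A (fst p n)) (snd p n)) = (\<Sum>n\<in>{0}. ip (A (fst p n)) (snd p n))"
   by (rule suminf_finite) (auto simp: p_def z Ac)
  then show ?thesis using p by (simp add: p_def)
 qed
 ultimately show ?thesis by (rule continuous_map_eq)
qed

lemma operators_separated:
 assumes "A : linear_operators H" "A' : linear_operators H" "A ~= A'"
 obtains \<xi> \<eta> where "\<xi> : carrier H" "\<eta> : carrier H" "ip (A \<xi>) \<eta> ~= ip (A' \<xi>) \<eta>"
proof -
 have "A : extensional (carrier H)" "A' : extensional (carrier H)"
  using assms by (auto simp: linear_operators_def PiE_def)
 then obtain \<xi> where \<xi>: "\<xi> : carrier H" "A \<xi> ~= A' \<xi>" using assms(3) extensionalityI by metis
 have c: "A \<xi> : carrier H" "A' \<xi> : carrier H" using assms \<xi>(1) by (auto simp: linear_operators_def)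
 show thesis
 proof (rule that[of \<xi> "A \<xi> \<ominus> A' \<xi>"])
  have "hdist H (A \<xi>) (A' \<xi>) ~= 0" using \<xi> c by (simp add: hdist_zero)
  then have "ip (A \<xi> \<ominus> A' \<xi>) (A \<xi> \<ominus> A' \<xi>) ~= 0" by (auto simp: hdist_def hnorm_def)
  then show "ip (A \<xi>) (A \<xi> \<ominus> A' \<xi>) ~= ip (A' \<xi>) (A \<xi> \<ominus> A' \<xi>)" using c by (simp add: ip_minus_left)
 qed (use \<xi> c in auto)
qed

primrec lsum :: "('x => 'h) => 'x comb => 'h" where
 "lsum v [] = \<zero>"
| "lsum v (p # l) = (fst p \<odot>\<^bsub>H\<^esub> v (snd p)) \<oplus> lsum v l"

lemma lsum_carrier: "(!!x. v x : carrier H) ==> lsum v l : carrier H"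
 by (induction l) auto

lemma form_gram:
 assumes v: "!!x. v x : carrier H"
 shows "form (%x y. ip (v x) (v y)) l m = ip (lsum v l) (lsum v m)"
proof -
 have z: "ip x \<zero> = 0" if "x : carrier H" for x using ip_commute[of \<zero> x] ip_zero_left[of x] that by simp
 have 1: "form (%x y. ip (v x) (v y)) [p] m = ip (fst p \<odot>\<^bsub>H\<^esub> v (snd p)) (lsum v m)" for p
  by (induction m) (simp_all add: form_def z v ip_add_right ip_smult_left ip_smult_right lsum_carrier)
 show ?thesis
 proof (induction l)
  case (Cons p l)
  have "form (%x y. ip (v x) (v y)) (p # l) m = form (%x y. ip (v x) (v y)) [p] m + form (%x y. ip (v x) (v y)) l m"
   by (simp add: form_def)
  then show ?case unfolding 1 using Cons by (simp add: ip_add_left lsum_carrier v)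
 qed (simp add: ip_zero_left lsum_carrier v)
qed

lemma pd_gram: "(!!x. v x : carrier H) ==> pd (%x y. ip (v x) (v y))"
 unfolding pd_def by (simp add: form_gram ip_nonneg lsum_carrier) (metis ip_commute)

end

lemma tendsto_form:
 fixes K :: "'x => 'x => complex"
 assumes "!!x y. ((%n. k n x y) \<longlongrightarrow> K x y) F"
 shows "((%n. form (k n) l m) \<longlongrightarrow> form K l m) F"
proof (induction l)
 case (Cons p l)
 have "((%n. form (k n) [p] m) \<longlongrightarrow> form K [p] m) F"
 proof (induction m)
  case (Cons r m)
  have "form K [p] (r # m) = fst p * cnj (fst r) * K (snd p) (snd r) + form K [p] m" for K :: "'x => 'x => complex"
   by (simp add: form_def)
  then show ?case using Cons by (auto intro!: tendsto_intros assms)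
 qed simp
 moreover have "form K (p # l) m = form K [p] m + form K l m" for K :: "'x => 'x => complex"
  by (simp add: form_def)
 ultimately show ?case using Cons by (auto intro!: tendsto_intros)
qed simp

lemma continuous_map_form:
 assumes "!!x y. continuous_map X euclidean (%r. k r x y)"
 shows "continuous_map X euclidean (%r. form (k r) l m)"
 using assms by (simp add: continuous_map_atin tendsto_form)

lemma pd_limit:
 assumes pd: "!!n. pd (k n)" and lim: "!!x y. (%n. k n x y) ----> K x y"
 shows "pd K"
 unfolding pd_def
proof (intro conjI allI)
 fix x y
 have "k n y x = cnj (k n x y)" for n using pd[of n] unfolding pd_def by blast
 then have "(%n. k n y x) = (%n. cnj (k n x y))" by (rule ext)
 then show "K y x = cnj (K x y)" using LIMSEQ_unique[OF lim[of y x]] tendsto_cnj[OF lim[of x y]] by simp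
next
 fix l
 show "0 <= Re (form K l l)"
  by (rule LIMSEQ_le_const[OF tendsto_Re[OF tendsto_form[OF lim]]]) (use pd in \<open>unfold pd_def, blast\<close>)
qed

lemma form_weight:
 "form (%x y. w x * cnj (w y) * K x y) l m = form K (map (%p. (fst p * w (snd p), snd p)) l) (map (%p. (fst p * w (snd p), snd p)) m)"
 by (simp add: form_def o_def mult.assoc mult.left_commute)

lemma pd_weight:
 assumes "pd K" shows "pd (%x y. w x * cnj (w y) * K x y)"
 unfolding pd_def form_weight
proof (intro conjI allI)
 fix x y
 have "K y x = cnj (K x y)" using assms unfolding pd_def by blast
 then show "w y * cnj (w x) * K y x = cnj (w x * cnj (w y) * K x y)" by simp
qed (use assms in \<open>unfold pd_def, blast\<close>)

lemma form_add_kernel: "form (%x y. K x y + L x y) l m = form K l m + form L l m"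
 by (simp add: form_def algebra_simps sum_list_addf)

lemma pd_add: assumes "pd K" "pd L" shows "pd (%x y. K x y + L x y)"
 unfolding pd_def form_add_kernel
proof (intro conjI allI)
 fix x y
 have "K y x = cnj (K x y)" "L y x = cnj (L x y)" using assms unfolding pd_def by blast+
 then show "K y x + L y x = cnj (K x y + L x y)" by simp
next
 fix l
 have "0 <= Re (form K l l)" "0 <= Re (form L l l)" using assms unfolding pd_def by blast+
 then show "0 <= Re (form K l l + form L l l)" by simp
qed

lemma pd_one: "pd (%_ _. 1)"
proof -
 have "form (%_ _. 1) l m = (\<Sum>p\<leftarrow>l. fst p) * cnj (\<Sum>p\<leftarrow>m. fst p)" for l m :: "'a comb"
 proof -
  have "(\<Sum>r\<leftarrow>m. c * cnj (fst r)) = c * cnj (\<Sum>p\<leftarrow>m. fst p)" for c by (induction m) (simp_all add: algebra_simps)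
  then show ?thesis by (induction l) (simp_all add: form_def algebra_simps)
 qed
 then show ?thesis by (simp add: pd_def)
qed

lemma pd_pullback: assumes "pd K" shows "pd (%x y. K (d x) (d y))"
 using assms unfolding pd_def form_mv[symmetric] by blast

text \<open>
  Schur's product theorem. A point at which the diagonal of \<open>L\<close> is positive is removed from \<open>L\<close> by
  subtracting a kernel of rank one, for which the claim is clear.
\<close>

lemma pd_mult_finite_support:
 fixes K :: "'x => 'x => complex"
 assumes K: "pd K"
 shows "finite S ==> pd L ==> (!!p. p : set l ==> snd p ~: S ==> L (snd p) (snd p) = 0) ==>
  0 <= Re (form (%x y. K x y * L x y) l l)"
proof (induction S arbitrary: L rule: finite_induct)
 case empty
 interpret L: kernel L by unfold_locales (rule empty)
 have "L (snd p) y = 0" if "p : set l" for p y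
 proof -
  have "L.q [(1, snd p)] = 0" using empty(2)[OF that] by (simp add: L.q_def form_singletons)
  then show ?thesis using L.B_le[of "[(1, snd p)]" "[(1, y)]"] by (simp add: form_singletons)
 qed
 then have "form (%x y. K x y * L x y) l l = (\<Sum>p\<leftarrow>l. 0)" unfolding form_def by (intro arg_cong[of _ _ sum_list] map_cong) auto
 then show ?case by simp
next
 case (insert a S)
 interpret L: kernel L by unfold_locales (rule insert)
 have herm: "L y x = cnj (L x y)" for x y using insert.prems(1) unfolding pd_def by blast
 show ?case
 proof (cases "L a a = 0")
  case True
  then show ?thesis using insert.prems by (intro insert.IH) auto
 next
  case False
  define c where "c = Re (L a a)"
  have La: "L a a = of_real c" using herm[of a a] by (simp add: c_def complex_eq_iff)
  have "0 <= c" using L.B_nonneg[of "[(1, a)]"] by (simp add: form_singletons c_def)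
  then have c: "0 < c" using False La by (simp add: less_le)
  define w where "w = (%x. L x a / of_real (sqrt c))"
  \<comment> \<open>The rank one kernel is scaled so that \<open>L'\<close> vanishes at
    \<open>a\<close>, \<open>a\<close>. Positivity of \<open>L'\<close> is the Cauchy-Schwarz
    inequality for \<open>L\<close> against the point \<open>a\<close>.\<close>
  define L' where "L' = (%x y. L x y - w x * cnj (w y) * 1)"
  have sc: "of_real (sqrt c) * of_real (sqrt c) = (of_real c :: complex)" using c by (simp flip: of_real_mult)
  have fw: "form (%x y. w x * cnj (w y) * 1) l l = of_real ((cmod (L.B l [(1, a)]))\<^sup>2 / c)" for l
  proof -
   have 1: "(\<Sum>r\<leftarrow>m. k * cnj (fst r) * cnj (w (snd r))) = k * cnj (L.B m [(1, a)] / of_real (sqrt c))" for k m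
    by (induction m) (simp_all add: form_def w_def add_divide_distrib algebra_simps)
   have "form (%x y. w x * cnj (w y) * 1) l m = (L.B l [(1, a)] / of_real (sqrt c)) * cnj (L.B m [(1, a)] / of_real (sqrt c))" for m
   proof (induction l)
    case (Cons p l)
    have "form (%x y. w x * cnj (w y) * 1) (p # l) m = (\<Sum>r\<leftarrow>m. (fst p * w (snd p)) * cnj (fst r) * cnj (w (snd r))) + form (%x y. w x * cnj (w y) * 1) l m"
     by (simp add: form_def mult_ac)
    then show ?case unfolding 1 Cons by (simp add: form_def w_def add_divide_distrib algebra_simps)
   qed (simp add: form_def)
   moreover have "L.B l [(1, a)] * cnj (L.B l [(1, a)]) = of_real ((cmod (L.B l [(1, a)]))\<^sup>2)"
    by (rule complex_norm_square[symmetric])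
   ultimately show ?thesis using sc by simp
  qed
  have form_diff: "form (%x y. M x y - N x y) l m = form M l m - form N l m" for M N :: "'x => 'x => complex" and l m
   by (simp add: form_def algebra_simps sum_list_subtractf)
  have "pd L'"
   unfolding pd_def
  proof (intro conjI allI)
   show "L' y x = cnj (L' x y)" for x y using herm[of y x] by (simp add: L'_def)
   fix l
   have "(cmod (L.B l [(1, a)]))\<^sup>2 <= Re (L.B l l) * c"
    using power_mono[OF L.B_le[of l "[(1, a)]"], of 2] by (simp add: power_mult_distrib L.q_square form_singletons c_def)
   then show "0 <= Re (form L' l l)" unfolding L'_def form_diff fw using c by (simp add: field_simps)
  qed
  moreover have "L' (snd p) (snd p) = 0" if p: "p : set l" "snd p ~: S" for p
  proof (cases "snd p = a")
   case True
   then show ?thesis using c sc by (simp add: L'_def w_def La field_simps)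
  next
   case False
   then have "L (snd p) (snd p) = 0" using insert.prems(2) p by blast
   then have "L.q [(1, snd p)] = 0" by (simp add: L.q_def form_singletons)
   then have "L (snd p) a = 0" using L.B_le[of "[(1, snd p)]" "[(1, a)]"] by (simp add: form_singletons)
   then show ?thesis using \<open>L (snd p) (snd p) = 0\<close> by (simp add: L'_def w_def)
  qed
  ultimately have 1: "0 <= Re (form (%x y. K x y * L' x y) l l)" by (rule insert.IH)
  have 2: "0 <= Re (form (%x y. w x * cnj (w y) * K x y) l l)" using pd_weight[OF K, of w] unfolding pd_def by blast
  have "(%x y. K x y * L x y) = (%x y. K x y * L' x y + w x * cnj (w y) * K x y)" by (simp add: L'_def algebra_simps)
  then show ?thesis using 1 2 by (simp only: form_add_kernel plus_complex.simps)
 qed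
qed

lemma pd_mult: assumes "pd K" "pd L" shows "pd (%x y. K x y * L x y)"
 unfolding pd_def
proof (intro conjI allI)
 fix x y
 have "K y x = cnj (K x y)" "L y x = cnj (L x y)" using assms unfolding pd_def by blast+
 then show "K y x * L y x = cnj (K x y * L x y)" by simp
next
 show "0 <= Re (form (%x y. K x y * L x y) l l)" for l
  by (rule pd_mult_finite_support[OF assms(1), of "snd ` set l"]) (use assms(2) in auto)
qed

section \<open>Operators induced by maps of points\<close>

context kernel
begin

interpretation hs: pre_hilb hs by (rule pre_hilb_hs)

definition contr :: "('x => 'x) => bool" where "contr \<tau> \<longleftrightarrow> (ALL l. q (mv \<tau> l) <= q l)"

definition induced :: "('x => 'x) => ('x => complex) => 'x => complex" where
 "induced \<tau> = (\<lambda>F\<in>space. %y. lim (%n. B (mv \<tau> (rp F n)) [(1, y)]))"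

text \<open>A map of points that does not increase the seminorm preserves Cauchy sequences and null
  sequences, and so acts on the completion independently of representatives.\<close>

lemma rep_induced:
 assumes \<tau>: "contr \<tau>" and l: "rep l F"
 shows "rep (%n. mv \<tau> (l n)) (induced \<tau> F)"
proof -
 have F: "F : space" and r: "rep (rp F) F" using l by (auto intro: rep_rp spaceI)
 have cau: "cau (%n. mv \<tau> (k n))" if k: "cau k" for k
  unfolding cau_def
 proof (intro allI impI)
  fix e :: real assume e: "0 < e"
  obtain N where N: "!!i j. N <= i ==> N <= j ==> q (mn (k i) (k j)) < e" by (rule cauD[OF k e], rule that)
  have "q (mn (mv \<tau> (k i)) (mv \<tau> (k j))) < e" if "N <= i" "N <= j" for i j
   using N[OF that] \<tau>[unfolded contr_def, THEN spec, of "mn (k i) (k j)"] by simp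
  then show "EX N. ALL i>=N. ALL j>=N. q (mn (mv \<tau> (k i)) (mv \<tau> (k j))) < e" by blast
 qed
 have "(%n. B (mv \<tau> (l n)) [(1, y)]) ----> induced \<tau> F y" for y
 proof -
  have 1: "(%n. B (mv \<tau> (rp F n)) [(1, y)]) ----> induced \<tau> F y"
   using cau_convergent[OF cau[OF rep_cau[OF r]] cau_const] F by (simp add: induced_def convergent_LIMSEQ_iff)
  have "(%n. q (mn (l n) (rp F n)) * q [(1, y)]) ----> 0"
   using tendsto_mult_right[OF rep_same_q[OF l r], of "q [(1, y)]"] by simp
  then have 2: "(%n. B (mv \<tau> (mn (l n) (rp F n))) [(1, y)]) ----> 0"
  proof (rule Lim_null_comparison[rotated], intro always_eventually allI)
   show "norm (B (mv \<tau> (mn (l n) (rp F n))) [(1, y)]) <= q (mn (l n) (rp F n)) * q [(1, y)]" for n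
    using B_le[of "mv \<tau> (mn (l n) (rp F n))" "[(1, y)]"] mult_right_mono[OF \<tau>[unfolded contr_def, THEN spec, of "mn (l n) (rp F n)"], of "q [(1, y)]"]
    by (simp del: mv_simps)
  qed
  from tendsto_add[OF 2 1] show ?thesis by simp
 qed
 then show ?thesis using cau[OF rep_cau[OF l]] by (simp add: rep_def)
qed

lemma induced_space: "contr \<tau> ==> F : space ==> induced \<tau> F : space"
 by (rule spaceI[OF rep_induced[OF _ rep_rp]])

lemma induced_point: "contr \<tau> ==> induced \<tau> (point l) = point (mv \<tau> l)"
 by (rule rep_unique[OF rep_induced[OF _ rep_const] rep_const])

lemma induced_contraction:
 assumes \<tau>: "contr \<tau>" shows "induced \<tau> : contractions hs"
proof -
 have "induced \<tau> (%y. F y + G y) = (%y. induced \<tau> F y + induced \<tau> G y)" if "F : space" "G : space" for F G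
  using rep_unique[OF rep_induced[OF \<tau> rep_add[OF rep_rp rep_rp]], of F G] rep_add[OF rep_induced[OF \<tau> rep_rp] rep_induced[OF \<tau> rep_rp], of F G] that by simp
 moreover have "induced \<tau> (%y. c * F y) = (%y. c * induced \<tau> F y)" if "F : space" for c F
  using rep_unique[OF rep_induced[OF \<tau> rep_scl[OF rep_rp]], of F] rep_scl[OF rep_induced[OF \<tau> rep_rp], of F] that by simp
 moreover have "hnorm hs (induced \<tau> F) <= hnorm hs F" if "F : space" for F
 proof -
  have "Re (inner (induced \<tau> F) (induced \<tau> F)) <= Re (inner F F)"
   by (rule LIMSEQ_le[OF inner_self[OF rep_induced[OF \<tau> rep_rp]] inner_self[OF rep_rp]])
    (use that \<tau> in \<open>auto simp: contr_def power_mono\<close>)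
  then show ?thesis by (simp add: hnorm_def)
 qed
 moreover have "induced \<tau> : space \<rightarrow>\<^sub>E space" using induced_space[OF \<tau>] by (auto simp: induced_def)
 ultimately show ?thesis by (simp add: contractions_def linear_operators_def induced_space[OF \<tau>])
qed

lemma induced_comp:
 assumes "contr \<tau>" "contr \<sigma>" "contr (\<tau> \<circ> \<sigma>)"
 shows "induced (\<tau> \<circ> \<sigma>) = compose space (induced \<tau>) (induced \<sigma>)"
proof
 fix F
 show "induced (\<tau> \<circ> \<sigma>) F = compose space (induced \<tau>) (induced \<sigma>) F"
 proof (cases "F : space")
  case True
  have "rep (%n. mv (\<tau> \<circ> \<sigma>) (rp F n)) (induced \<tau> (induced \<sigma> F))"
   using rep_induced[OF assms(1) rep_induced[OF assms(2) rep_rp[OF True]]] by simp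
  from rep_unique[OF rep_induced[OF assms(3) rep_rp[OF True]] this] show ?thesis using True by (simp add: compose_def)
 qed (simp add: induced_def compose_def)
qed

text \<open>The operators are uniformly bounded, so \<open>F\<close> and \<open>G\<close> may be
  replaced by combinations of points, for which the coefficient is a finite sum of kernel
  values.\<close>

lemma continuous_map_inner_induced:
 assumes \<tau>: "!!r. r : topspace X ==> contr (\<tau> r)"
  and c: "!!x y. continuous_map X euclidean (%r. K (\<tau> r x) y)"
  and F: "F : space" and G: "G : space"
 shows "continuous_map X euclidean (%r. inner (induced (\<tau> r) F) G)"
proof (rule continuous_map_uniform_approx)
 fix e :: real assume e: "0 < e"
 note cs = hs.cauchy_schwarz[simplified] and nn = hs.hn_nonneg[simplified]
 have e1: "0 < e / (2 * (hnorm hs G + 1))" using e nn[OF G] by simp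
 obtain l where l: "hdist hs F (point l) < e / (2 * (hnorm hs G + 1))" by (rule point_dense[OF F e1], rule that)
 have hl: "0 <= hnorm hs (point l)" by (rule nn[OF point_space])
 then have e2: "0 < e / (2 * (hnorm hs (point l) + 1))" using e by simp
 obtain m where m: "hdist hs G (point m) < e / (2 * (hnorm hs (point l) + 1))" by (rule point_dense[OF G e2], rule that)
 have "cmod (inner (induced (\<tau> r) F) G - form (%x y. K (\<tau> r x) y) l m) <= e" if r: "r : topspace X" for r
 proof -
  note T = hs.contraction_simps[OF induced_contraction[OF \<tau>[OF r]], simplified]
  have d: "F \<ominus>\<^bsub>hs\<^esub> point l : space" "G \<ominus>\<^bsub>hs\<^esub> point m : space"
   using hs.minus_carrier F G point_space by simp_all
  have "form (%x y. K (\<tau> r x) y) l m = inner (induced (\<tau> r) (point l)) (point m)"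
   unfolding induced_point[OF \<tau>[OF r]] inner_point by (simp add: form_def mv_def o_def)
  then have "inner (induced (\<tau> r) F) G - form (%x y. K (\<tau> r x) y) l m
    = inner (induced (\<tau> r) (F \<ominus>\<^bsub>hs\<^esub> point l)) G + inner (induced (\<tau> r) (point l)) (G \<ominus>\<^bsub>hs\<^esub> point m)"
   using F G by (simp add: T point_space hs.ip_minus_left[simplified] hs.ip_minus_right[simplified])
  then have "cmod (inner (induced (\<tau> r) F) G - form (%x y. K (\<tau> r x) y) l m)
    <= cmod (inner (induced (\<tau> r) (F \<ominus>\<^bsub>hs\<^esub> point l)) G) + cmod (inner (induced (\<tau> r) (point l)) (G \<ominus>\<^bsub>hs\<^esub> point m))"
   by (simp add: norm_triangle_ineq)
  also have "\<dots> <= hnorm hs (induced (\<tau> r) (F \<ominus>\<^bsub>hs\<^esub> point l)) * hnorm hs G + hnorm hs (induced (\<tau> r) (point l)) * hnorm hs (G \<ominus>\<^bsub>hs\<^esub> point m)"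
   using d F G by (intro add_mono cs T(1) point_space)
  also have "\<dots> <= hdist hs F (point l) * (hnorm hs G + 1) + (hnorm hs (point l) + 1) * hdist hs G (point m)"
   unfolding hdist_def using T(2)[OF d(1)] T(2)[OF point_space, of l] nn[OF d(1)] nn[OF d(2)] nn[OF G] hl
   by (intro add_mono mult_mono) auto
  also have "\<dots> <= e / (2 * (hnorm hs G + 1)) * (hnorm hs G + 1) + (hnorm hs (point l) + 1) * (e / (2 * (hnorm hs (point l) + 1)))"
   using l m nn[OF G] hl by (intro add_mono mult_right_mono mult_left_mono) auto
  also have "\<dots> = e"
  proof -
   have "e / (2 * a) * a = e / 2" if "0 < a" for a :: real using that by simp
   from this[of "hnorm hs G + 1"] this[of "hnorm hs (point l) + 1"] show ?thesis
    using nn[OF G] hl by (simp only: mult.commute[of "hnorm hs (point l) + 1"])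
  qed
  finally show ?thesis .
 qed
 then show "EX g. continuous_map X euclidean g & (ALL r:topspace X. cmod (inner (induced (\<tau> r) F) G - g r) <= e)"
  by (intro exI[of _ "%r. form (%x y. K (\<tau> r x) y) l m"] conjI continuous_map_form c ballI)
qed

end

section \<open>Vectors of nearly minimal norm\<close>

inductive_set mid_hull :: "'h hilbert => 'h set => 'h set" for H S where
 base: "x : S ==> x : mid_hull H S"
| mid: "x : mid_hull H S ==> y : mid_hull H S ==> (1 / 2) \<odot>\<^bsub>H\<^esub> (x \<oplus>\<^bsub>H\<^esub> y) : mid_hull H S"

lemma mid_hull_mono: "S \<subseteq> S' ==> mid_hull H S \<subseteq> mid_hull H S'"
proof
 fix x assume "S \<subseteq> S'" "x : mid_hull H S"
 from this(2,1) show "x : mid_hull H S'" by induction (auto intro: mid_hull.intros)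
qed

context pre_hilb
begin

lemma mid_hull_bounds:
 assumes "x : mid_hull H S" "!!s. s : S ==> s : carrier H & hn s <= C"
 shows "x : carrier H & hn x <= C"
 using assms(1)
proof induction
 case (mid x y)
 have "hn ((1 / 2) \<odot>\<^bsub>H\<^esub> (x \<oplus> y)) = hn (x \<oplus> y) / 2"
 proof (rule power2_eq_imp_eq)
  show "(hn ((1 / 2) \<odot>\<^bsub>H\<^esub> (x \<oplus> y)))\<^sup>2 = (hn (x \<oplus> y) / 2)\<^sup>2"
   using mid by (simp add: hn_square ip_smult_left ip_smult_right power_divide)
 qed (use mid in \<open>simp_all add: hn_nonneg\<close>)
 then show ?case using mid hn_triangle[of x y] by simp
qed (use assms(2) in blast)

text \<open>The classical argument for vectors of minimal norm in a convex set only forms midpoints,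
  so closure under midpoints stands in for convexity; nearly minimal vectors stand in for a minimum
  that need not be attained.\<close>

lemma near_minimal_close:
 assumes xy: "x : M" "y : M" "M \<subseteq> carrier H" and M: "!!x y. x : M ==> y : M ==> (1 / 2) \<odot>\<^bsub>H\<^esub> (x \<oplus> y) : M"
  and min: "!!z. z : M ==> m <= (hn z)\<^sup>2" and e: "(hn x)\<^sup>2 <= m + e" "(hn y)\<^sup>2 <= m + e"
 shows "(hdist H y x)\<^sup>2 <= 4 * e"
proof -
 have c: "x : carrier H" "y : carrier H" using xy by auto
 have "(hn ((1 / 2) \<odot>\<^bsub>H\<^esub> (x \<oplus> y)))\<^sup>2 = (hn (x \<oplus> y))\<^sup>2 / 4"
  using c by (simp add: hn_square ip_smult_left ip_smult_right)
 then show ?thesis using min[OF M[OF xy(1,2)]] parallelogram[OF c] e by (simp add: hdist_def)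
qed

text \<open>An instance of \<open>cau_convergent\<close> for the Gram kernel, with single points as
  combinations; vectors outside the carrier are sent to zero to make the kernel total.\<close>

lemma cauchy_ip_convergent:
 assumes a: "!!n. a n : carrier H" "!!e. 0 < e ==> EX N::nat. ALL i>=N. ALL j>=N. hdist H (a i) (a j) < e"
  and b: "!!n. b n : carrier H" "!!e. 0 < e ==> EX N::nat. ALL i>=N. ALL j>=N. hdist H (b i) (b j) < e"
 shows "convergent (%n. ip (a n) (b n))"
proof -
 define v where "v = (%x. if x : carrier H then x else \<zero>)"
 have v: "v x : carrier H" for x by (simp add: v_def)
 have vx: "v x = x" if "x : carrier H" for x using that by (simp add: v_def)
 interpret K: kernel "%x y. ip (v x) (v y)" by unfold_locales (rule pd_gram[OF v])
 have q: "K.q (mn [(1, x)] [(1, y)]) = hdist H x y" if "x : carrier H" "y : carrier H" for x y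
  using that by (simp add: K.q_def form_singletons vx hdist_def hnorm_def ip_minus_left ip_minus_right)
 have "convergent (%n. K.B [(1, a n)] [(1, b n)])"
  by (rule K.cau_convergent) (use a b in \<open>simp_all add: K.cau_def q\<close>)
 then show ?thesis using a(1) b(1) by (simp add: form_singletons vx)
qed

end

section \<open>Continuous approximation of coefficients\<close>

text \<open>
  Invariant kernels on two copies of the group. The matrix coefficient of a representation for
  \<open>\<zeta> False\<close> and \<open>\<zeta> True\<close> is the value at \<open>(x, False)\<close>, \<open>(1, True)\<close> of the kernel
  \<open>\<langle>\<pi> x (\<zeta> s), \<pi> y (\<zeta> t)\<rangle>\<close>.
\<close>

definition group_kernel :: "'a monoid => 'a topology => ('a \<times> bool => 'a \<times> bool => complex) => bool" where
 "group_kernel G T K \<longleftrightarrow> pd K & (ALL x y s t. x ~: carrier G --> K (x, s) (y, t) = 0) &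
   (ALL g:carrier G. ALL x:carrier G. ALL y:carrier G. ALL s t. K (g \<otimes>\<^bsub>G\<^esub> x, s) (g \<otimes>\<^bsub>G\<^esub> y, t) = K (x, s) (y, t)) &
   (ALL y:carrier G. ALL s t. continuous_map T euclidean (%x. K (x, s) (y, t)))"

locale isometric_action = top_grp G T + H: pre_hilb H
 for G :: "'a monoid" (structure) and T and H :: "'h hilbert" +
 fixes U :: "'a => 'h => 'h"
 assumes U_contr: "x : carrier G ==> U x : contractions H"
  and U_ip: "x : carrier G ==> v : carrier H ==> w : carrier H ==> hinner H (U x v) (U x w) = hinner H v w"
  and U_mult: "x : carrier G ==> y : carrier G ==> v : carrier H ==> U (x \<otimes> y) v = U x (U y v)"
begin

lemmas U_simps = H.contraction_simps[OF U_contr]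

lemma U_norm: "x : carrier G ==> v : carrier H ==> hnorm H (U x v) = hnorm H v"
 by (simp add: hnorm_def U_ip)

lemma U_hdist: "x : carrier G ==> v : carrier H ==> w : carrier H ==> hdist H (U x v) (U x w) = hdist H v w"
 by (simp add: hdist_def U_simps(5)[symmetric] U_norm)

lemma U_one: assumes "v : carrier H" shows "U \<one> v = v"
proof -
 have c: "U \<one> v : carrier H" using U_simps(1) assms by simp
 have "hdist H (U \<one> v) v = hdist H (U \<one> (U \<one> v)) (U \<one> v)" using U_hdist[of \<one> "U \<one> v" v] c assms by simp
 also have "\<dots> = 0" using U_mult[of \<one> \<one> v] c assms by (simp add: H.hdist_zero)
 finally show ?thesis using c assms by (simp add: H.hdist_zero)
qed

abbreviation "nbhd V \<equiv> openin T V & \<one> : V"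
abbreviation "orb \<zeta> V \<equiv> mid_hull H ((%v. U v \<zeta>) ` V)"

lemma orb_bounds: "\<zeta> : carrier H ==> V \<subseteq> carrier G ==> z : orb \<zeta> V ==> z : carrier H & hnorm H z <= hnorm H \<zeta>"
 by (rule H.mid_hull_bounds) (auto simp: U_simps(1) U_norm subset_iff)

text \<open>
  The vectors of nearly minimal norm in the convex hulls of \<open>U V \<zeta>\<close>, for \<open>V\<close> shrinking to the
  identity, form a Cauchy sequence, whose limit is moved continuously by \<open>U\<close>.
\<close>

lemma continuous_vector:
 assumes \<zeta>: "\<zeta> : carrier H"
 shows "EX w :: nat => 'h. (ALL n. w n : carrier H & hnorm H (w n) <= hnorm H \<zeta>) &
  (ALL e>0. EX N. ALL i>=N. ALL j>=N. hdist H (w i) (w j) < e) &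
  (ALL V. ALL e>0. nbhd V --> (EX N. ALL n>=N. EX z:orb \<zeta> V. hdist H (w n) z < e)) &
  (ALL e>0. EX V N. nbhd V & (ALL n>=N. ALL x:V. hdist H (U x (w n)) (w n) < e))"
proof -
 have Vc: "V \<subseteq> carrier G" if "nbhd V" for V using that openin_subset by fastforce
 \<comment> \<open>\<open>Sup R\<close> is the limit, for shrinking \<open>V\<close>, of the infimum
   of the squared norm on the hulls. It is finite because \<zeta> belongs to each of them.\<close>
 define R where "R = {r. EX V. nbhd V & (ALL z:orb \<zeta> V. r <= (hnorm H z)\<^sup>2)}"
 have R0: "0 : R" using openin_topspace[of T] unfolding R_def topspace_T by (intro CollectI exI[of _ "carrier G"]) auto
 have \<zeta>orb: "\<zeta> : orb \<zeta> V" if "nbhd V" for V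
  by (rule mid_hull.base, rule image_eqI[of _ _ \<one>]) (use that U_one[OF \<zeta>] in auto)
 have bdd: "bdd_above R" by (rule bdd_aboveI[of _ "(hnorm H \<zeta>)\<^sup>2"]) (use \<zeta>orb in \<open>auto simp: R_def\<close>)
 define d where "d = Sup R"
 define e where "e = (%n. 1 / real (Suc n))"
 have e0: "0 < e n" for n by (simp add: e_def)
 have emono: "e n <= e N" if "N <= n" for n N using that by (simp add: e_def frac_le)
 have "EX V. nbhd V & (ALL z:orb \<zeta> V. d - e n <= (hnorm H z)\<^sup>2)" for n
 proof -
  have "d - e n < Sup R" using e0[of n] by (simp add: d_def)
  then obtain r where "r : R" "d - e n < r" using less_cSupE R0 by (metis empty_iff)
  then show ?thesis unfolding R_def by (smt (verit) mem_Collect_eq)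
 qed
 then obtain V where V: "!!n. nbhd (V n)" "!!n z. z : orb \<zeta> (V n) ==> d - e n <= (hnorm H z)\<^sup>2" by metis
 have low: "EX z:orb \<zeta> W. (hnorm H z)\<^sup>2 <= d + a" if W: "nbhd W" and a: "0 < a" for W a
 proof (rule ccontr)
  assume "~ ?thesis"
  then have "d + a : R" unfolding R_def using W by (intro CollectI exI[of _ W]) (auto simp: not_le intro: less_imp_le)
  from cSup_upper[OF this bdd] have "d + a <= d" by (simp add: d_def)
  then show False using a by simp
 qed
 have "EX w. ALL n. w n : orb \<zeta> (V n) & (hnorm H (w n))\<^sup>2 <= d + e n"
  using low[OF V(1) e0] by (intro choice allI) blast
 then obtain w where w: "!!n. w n : orb \<zeta> (V n)" "!!n. (hnorm H (w n))\<^sup>2 <= d + e n" by blast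
 have wc: "w n : carrier H & hnorm H (w n) <= hnorm H \<zeta>" for n by (rule orb_bounds[OF \<zeta> Vc[OF V(1)] w(1)])
 \<comment> \<open>Two vectors of one hull with squared norms between \<open>d - e n\<close> and
   \<open>d + e n\<close> are at distance at most the root of \<open>4 * (2 * e n)\<close>.\<close>
 define s where "s = (%n. sqrt (8 * e n))"
 have s0: "0 <= s n" for n using e0[of n] by (simp add: s_def)
 have smono: "s n <= s N" if "N <= n" for n N using emono[OF that] by (simp add: s_def)
 have small: "EX N. s N < a" if "0 < a" for a
 proof -
  have "(%n. sqrt (8 * (1 / real (Suc n)))) ----> sqrt (8 * 0)"
   using LIMSEQ_inverse_real_of_nat by (intro tendsto_intros) (simp add: inverse_eq_divide)
  from LIMSEQ_D[OF this that] show ?thesis by (auto simp: s_def e_def)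
 qed
 have close: "hdist H y x <= s n" if "x : orb \<zeta> (V n)" "y : orb \<zeta> (V n)" "(hnorm H x)\<^sup>2 <= d + e n" "(hnorm H y)\<^sup>2 <= d + e n" for x y n
 proof -
  have "(hdist H y x)\<^sup>2 <= 4 * (2 * e n)"
   by (rule H.near_minimal_close[of x "orb \<zeta> (V n)" y "d - e n"])
    (use that V(2) orb_bounds[OF \<zeta> Vc[OF V(1)]] in \<open>auto intro: mid_hull.mid\<close>)
  from real_sqrt_le_mono[OF this] show ?thesis by (simp add: s_def)
 qed
 have sub: "orb \<zeta> W \<subseteq> orb \<zeta> W'" if "W \<subseteq> W'" for W W' using that by (intro mid_hull_mono image_mono)
 have hc: "hdist H x y = hdist H y x" if "x : carrier H" "y : carrier H" for x y by (rule H.hdist_commute[OF that])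
 have 1: "EX N. ALL i>=N. ALL j>=N. hdist H (w i) (w j) < a" if a: "0 < a" for a
 proof -
  obtain N where N: "s N < a / 2" using small[of "a / 2"] a by auto
  have "hdist H (w i) (w j) < a" if ij: "N <= i" "N <= j" for i j
  proof -
   have nb: "nbhd (V i \<inter> V j)" using V(1)[of i] V(1)[of j] by auto
   obtain z where z: "z : orb \<zeta> (V i \<inter> V j)" "(hnorm H z)\<^sup>2 <= d + min (e i) (e j)"
    using low[OF nb, of "min (e i) (e j)"] e0 by auto
   have zi: "z : orb \<zeta> (V i)" "z : orb \<zeta> (V j)" using z(1) sub[of "V i \<inter> V j"] by blast+
   have zc: "z : carrier H" using orb_bounds[OF \<zeta> Vc[OF V(1)] zi(1)] by blast
   have "hdist H (w i) z <= s i" "hdist H (w j) z <= s j" using close w z zi by auto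
   then show ?thesis using H.hdist_triangle[of "w i" z "w j"] wc zc hc[of z "w j"] smono[of N i] smono[of N j] ij N by auto
  qed
  then show ?thesis by blast
 qed
 \<comment> \<open>A nearly minimal vector of the hull for \<open>W \<inter> V n\<close> is nearly
   minimal in the larger hull for \<open>V n\<close> too, and hence close to
   \<open>w n\<close>.\<close>
 have near: "EX z:orb \<zeta> (W \<inter> V n). hdist H (w n) z <= s n & (hnorm H z)\<^sup>2 <= d + e n" if W: "nbhd W" for W n
 proof -
  have nb: "nbhd (W \<inter> V n)" using V(1)[of n] W by auto
  obtain z where z: "z : orb \<zeta> (W \<inter> V n)" "(hnorm H z)\<^sup>2 <= d + e n" using low[OF nb e0] by blast
  then show ?thesis using close[of z n "w n"] w sub[of "W \<inter> V n" "V n"] by blast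
 qed
 have 2: "EX N. ALL n>=N. EX z:orb \<zeta> W. hdist H (w n) z < a" if W: "nbhd W" and a: "0 < a" for W a
 proof -
  obtain N where N: "s N < a" using small[OF a] by blast
  have "EX z:orb \<zeta> W. hdist H (w n) z < a" if "N <= n" for n
  proof -
   obtain z where "z : orb \<zeta> (W \<inter> V n)" "hdist H (w n) z <= s n" using near[OF W, of n] by blast
   then show ?thesis using smono[OF that] N sub[of "W \<inter> V n" W] by (intro bexI[of _ z]) auto
  qed
  then show ?thesis by blast
 qed
 have 3: "EX W N. nbhd W & (ALL n>=N. ALL x:W. hdist H (U x (w n)) (w n) < a)" if a: "0 < a" for a
 proof -
  \<comment> \<open>The fifths are spent as \<open>2 + 1 + 2\<close>: from \<open>U x (w n)\<close>
    to \<open>U x z\<close>, on to \<open>z\<close>, and back to \<open>w n\<close>.\<close>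
  obtain N where N: "s N < a / 5" using small[of "a / 5"] a by auto
  obtain W' where W': "openin T W'" "\<one> : W'" "!!x y. x : W' ==> y : W' ==> inv x \<otimes> y : V N"
   by (rule small_neighbourhood[of "V N"]) (use V(1)[of N] that in blast)+
  define W where "W = W' \<inter> {x : topspace T. inv x : W'}"
  have W: "nbhd W" unfolding W_def
   using W'(1,2) openin_continuous_map_preimage[OF continuous_map_inv[OF continuous_map_id[unfolded id_def]] W'(1)] by auto
  have Wc: "W \<subseteq> carrier G" by (rule Vc[OF W])
  have WW: "x \<otimes> y : V N" if "x : W" "y : W" for x y
   using W'(3)[of "inv x" y] that Wc by (auto simp: W_def)
  have WV: "W \<subseteq> V N"
  proof
   fix x assume "x : W"
   then show "x : V N" using WW[of x \<one>] W Wc by auto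
  qed
  obtain z where z: "z : orb \<zeta> W" "(hnorm H z)\<^sup>2 <= d + e N" using low[OF W e0] by blast
  have zV: "z : orb \<zeta> (V N)" using z(1) sub[OF WV] by blast
  have zc: "z : carrier H" using orb_bounds[OF \<zeta> Wc z(1)] by blast
  have "hdist H (U x (w n)) (w n) < a" if n: "N <= n" and x: "x : W" for n x
  proof -
   have xc: "x : carrier G" using x Wc by blast
   \<comment> \<open>Products of two elements of \<open>W\<close> lie in \<open>V N\<close>, so
     \<open>U x\<close> maps the hull for \<open>W\<close> into the hull for \<open>V N\<close>,
     where the estimate for nearly minimal vectors applies.\<close>
   have "U x z : orb \<zeta> (V N)" using z(1)
   proof induction
    case (base y)
    then obtain v where v: "v : W" "y = U v \<zeta>" by blast
    then show ?case using U_mult[OF xc, of v \<zeta>] WW[OF x v(1)] Wc \<zeta> by (auto intro!: mid_hull.base image_eqI[of _ _ "x \<otimes> v"])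
   next
    case (mid y y')
    have "y : carrier H" "y' : carrier H" using orb_bounds[OF \<zeta> Wc] mid(1,2) by blast+
    then have "U x ((1 / 2) \<odot>\<^bsub>H\<^esub> (y \<oplus>\<^bsub>H\<^esub> y')) = (1 / 2) \<odot>\<^bsub>H\<^esub> (U x y \<oplus>\<^bsub>H\<^esub> U x y')" by (simp add: U_simps(3,4) xc)
    then show ?case using mid_hull.mid[OF mid(3,4)] by simp
   qed
   then have a1: "hdist H (U x z) z <= s N" using zV z(2) by (intro close) (simp_all add: U_norm xc zc)
   obtain z' where z': "z' : orb \<zeta> (W \<inter> V n)" "hdist H (w n) z' <= s n" "(hnorm H z')\<^sup>2 <= d + e n" using near[OF W] by blast
   have z'N: "z' : orb \<zeta> (V N)" using z'(1) sub[of "W \<inter> V n" "V N"] WV by blast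
   have z'c: "z' : carrier H" using orb_bounds[OF \<zeta> Vc[OF V(1)] z'N] by blast
   have a2: "hdist H z' z <= s N" using zV z'N z(2) z'(3) emono[OF n] by (intro close) auto
   have wnz: "hdist H (w n) z <= 2 * s N" using H.hdist_triangle[of "w n" z' z] wc z'c zc z'(2) a2 smono[OF n] by auto
   have Uc: "U x (w n) : carrier H" "U x z : carrier H" using U_simps(1) xc wc zc by blast+
   have "hdist H (U x (w n)) (w n) <= hdist H (U x (w n)) (U x z) + (hdist H (U x z) z + hdist H z (w n))"
    using H.hdist_triangle[of "U x (w n)" "U x z" "w n"] H.hdist_triangle[of "U x z" z "w n"] Uc zc wc[of n] by auto
   also have "\<dots> <= 2 * s N + (s N + 2 * s N)"
    using wnz a1 U_hdist[OF xc, of "w n" z] hc[of z "w n"] wc zc by auto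
   finally show ?thesis using N by simp
  qed
  then show ?thesis using W by blast
 qed
 show ?thesis by (intro exI[of _ w] conjI allI impI; (rule wc[THEN conjunct1] wc[THEN conjunct2] 1 2 3)?; assumption?)
qed

text \<open>The given action need not be continuous: the kernel is made of the vectors of the previous lemma.\<close>

lemma continuous_group_kernel:
 assumes f: "f : CBG" and \<xi>: "\<xi> : carrier H" and \<eta>: "\<eta> : carrier H"
  and close: "!!x. x : carrier G ==> cmod (f x - hinner H (U x \<xi>) \<eta>) <= \<epsilon>"
 shows "EX K. group_kernel G T K & (ALL x:carrier G. cmod (f x - K (x, False) (\<one>, True)) <= \<epsilon>)"
proof -
 define \<zeta> where "\<zeta> = (%s. if s then \<eta> else \<xi>)"
 have \<zeta>: "\<zeta> s : carrier H" for s using \<xi> \<eta> by (simp add: \<zeta>_def)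
 define P where "P = (%\<zeta> w. (ALL n::nat. w n : carrier H & hnorm H (w n) <= hnorm H \<zeta>) &
  (ALL e>0. EX N. ALL i>=N. ALL j>=N. hdist H (w i) (w j) < e) &
  (ALL V. ALL e>0. nbhd V --> (EX N. ALL n>=N. EX z:orb \<zeta> V. hdist H (w n) z < e)) &
  (ALL e>0. EX V N. nbhd V & (ALL n>=N. ALL x:V. hdist H (U x (w n)) (w n) < e)))"
 have "ALL s. EX w. P (\<zeta> s) w" unfolding P_def by (rule allI, rule continuous_vector[OF \<zeta>])
 from choice[OF this] obtain w where P: "!!s. P (\<zeta> s) (w s)" by (elim exE) (rule that, erule spec)
 have w: "w s n : carrier H & hnorm H (w s n) <= hnorm H (\<zeta> s)" for s n using P[of s] unfolding P_def by (elim conjE) (erule spec)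
 have cau: "EX N. ALL i>=N. ALL j>=N. hdist H (w s i) (w s j) < e" if "0 < e" for s e
  using P[of s] that unfolding P_def by (elim conjE) simp
 have near: "EX N. ALL n>=N. EX z:orb (\<zeta> s) V. hdist H (w s n) z < e" if "nbhd V" "0 < e" for s V e
  using P[of s] that unfolding P_def by (elim conjE) simp
 have cont: "EX V N. nbhd V & (ALL n>=N. ALL x:V. hdist H (U x (w s n)) (w s n) < e)" if "0 < e" for s e
  using P[of s] that unfolding P_def by (elim conjE) simp
 \<comment> \<open>The vectors vanish outside the group, as \<open>group_kernel\<close> demands; the
   second component selects the approximants of \<xi> or of \<eta>.\<close>
 define v where "v = (%n (x, s). if x : carrier G then U x (w s n) else \<zero>\<^bsub>H\<^esub>)"
 have v: "v n p : carrier H" for n p using w U_simps(1) by (auto simp: v_def split: prod.splits)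
 have vs: "v n (x, s) = U x (w s n)" if "x : carrier G" for n x s using that by (simp add: v_def)
 have vcau: "EX N. ALL i>=N. ALL j>=N. hdist H (v i p) (v j p) < e" if e: "0 < e" for e p
 proof (cases "fst p : carrier G")
  case True
  obtain N where "ALL i>=N. ALL j>=N. hdist H (w (snd p) i) (w (snd p) j) < e" using cau[OF e] by (rule exE)
  then show ?thesis using True w by (intro exI[of _ N]) (simp add: v_def split_def U_hdist)
 qed (use e H.hdist_zero[OF H.zero_closed H.zero_closed] in \<open>simp add: v_def split_def\<close>)
 define K where "K = (%p r. lim (%n. hinner H (v n p) (v n r)))"
 have lim: "(%n. hinner H (v n p) (v n r)) ----> K p r" for p r
  using H.cauchy_ip_convergent[OF v vcau v vcau] by (simp add: K_def convergent_LIMSEQ_iff)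
 have "pd K" by (rule pd_limit[OF H.pd_gram[OF v] lim])
 moreover have "K (x, s) (y, t) = 0" if "x ~: carrier G" for x y s t
  using that v by (simp add: K_def v_def H.ip_zero_left)
 moreover have "K (g \<otimes> x, s) (g \<otimes> y, t) = K (x, s) (y, t)" if "g : carrier G" "x : carrier G" "y : carrier G" for g x y s t
  using that w by (simp add: K_def vs U_mult U_ip U_simps(1))
 moreover have "continuous_map T euclidean (%x. K (x, s) (y, t))" if y: "y : carrier G" for y s t
  unfolding continuous_map_to_metric_iff topspace_T
 proof (intro ballI allI impI)
  fix x and e :: real assume x: "x : carrier G" and e: "0 < e"
  define C where "C = hnorm H (\<zeta> t) + 1"
  have C: "0 < C" using H.hn_nonneg[OF \<zeta>] by (simp add: C_def add_nonneg_pos)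
  obtain V N where V: "nbhd V" "!!n u. N <= n ==> u : V ==> hdist H (U u (w s n)) (w s n) < e / (2 * C)"
   using cont[of "e / (2 * C)" s] e C by auto
  have "dist (K (x', s) (y, t)) (K (x, s) (y, t)) < e" if x': "x' : carrier G" "inv x \<otimes> x' : V" for x'
  proof -
   have "norm (hinner H (v n (x', s)) (v n (y, t)) - hinner H (v n (x, s)) (v n (y, t))) <= e / 2" if n: "N <= n" for n
   proof -
    have "cmod (hinner H (v n (x', s) \<ominus>\<^bsub>H\<^esub> v n (x, s)) (v n (y, t))) <= hdist H (v n (x', s)) (v n (x, s)) * hnorm H (v n (y, t))"
     unfolding hdist_def by (intro H.cauchy_schwarz H.minus_carrier v)
    also have "hdist H (v n (x', s)) (v n (x, s)) = hdist H (U (inv x \<otimes> x') (w s n)) (w s n)"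
    proof -
     have "x' = x \<otimes> (inv x \<otimes> x')" using x x' by (simp add: grp_simps)
     then have "v n (x', s) = U x (U (inv x \<otimes> x') (w s n))" using U_mult[of x "inv x \<otimes> x'" "w s n"] x x' w by (simp add: vs)
     then show ?thesis using x x' w U_simps(1)[of "inv x \<otimes> x'" "w s n"] by (simp add: vs U_hdist)
    qed
    also have "\<dots> * hnorm H (v n (y, t)) <= e / (2 * C) * C"
     using V(2)[OF n x'(2)] w[of t n] y C e by (intro mult_mono) (auto simp: vs U_norm C_def H.hn_nonneg)
    also have "\<dots> = e / 2" using C by simp
    finally show ?thesis using v by (simp add: H.ip_minus_left)
   qed
   then have "norm (K (x', s) (y, t) - K (x, s) (y, t)) <= e / 2"
    by (intro LIMSEQ_le_const2[OF tendsto_norm[OF tendsto_diff[OF lim lim]]] exI[of _ N]) blast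
   then show ?thesis using e by (simp add: dist_norm)
  qed
  then show "EX W. openin T W & x : W & (ALL x':W. dist (K (x', s) (y, t)) (K (x, s) (y, t)) < e)"
   using openin_ltranslate[of V "inv x"] V(1) x by (intro exI[of _ "{x' : carrier G. inv x \<otimes> x' : V}"]) auto
 qed
 ultimately have K: "group_kernel G T K" by (simp add: group_kernel_def)
 have "cmod (f x - K (x, False) (\<one>, True)) <= \<epsilon>" if x: "x : carrier G" for x
 proof (rule field_le_epsilon)
  fix e :: real assume e: "0 < e"
  \<comment> \<open>The kernel is built from averaged vectors. Therefore \<open>f x\<close> is first
    compared with the coefficient at \<open>U b \<xi>\<close> and \<open>U a \<eta>\<close>, which
    belongs to \<open>f (inv a \<otimes> x \<otimes> b)\<close>; the estimate then extends to the
    hulls in one variable after the other, because discs are convex.\<close>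
  let ?W = "{p : topspace (prod_topology T T). f (inv (fst p) \<otimes> x \<otimes> snd p) : ball (f x) (e / 2)}"
  have fc: "continuous_map T euclidean f" using f by (simp add: CB_def)
  have "continuous_map (prod_topology T T) T (%p. inv (fst p) \<otimes> x \<otimes> snd p)"
   by (intro continuous_map_mult continuous_map_inv continuous_map_fst continuous_map_snd) (use x in simp)
  from continuous_map_compose[OF this fc] have "openin (prod_topology T T) ?W"
   unfolding o_def by (rule openin_continuous_map_preimage) simp
  moreover have "(\<one>, \<one>) : ?W" using x e by simp
  ultimately have "EX A B. openin T A & openin T B & \<one> : A & \<one> : B & A \<times> B \<subseteq> ?W"
   by (rule openin_prod_topology_alt[THEN iffD1, THEN spec, THEN spec, THEN mp])
  then obtain A B where AB: "nbhd A" "nbhd B" "A \<times> B \<subseteq> ?W" by auto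
  have ABc: "A \<subseteq> carrier G" "B \<subseteq> carrier G" using AB openin_subset by fastforce+
  have fv: "cmod (f x - hinner H (U x (U b \<xi>)) (U a \<eta>)) <= \<epsilon> + e / 2" if ab: "a : A" "b : B" for a b
  proof -
   have c: "a : carrier G" "b : carrier G" using ab ABc by auto
   have "hinner H (U x (U b \<xi>)) (U a \<eta>) = hinner H (U a (U (inv a \<otimes> x \<otimes> b) \<xi>)) (U a \<eta>)"
    using c x \<xi> by (simp add: U_mult[symmetric] grp_simps)
   also have "\<dots> = hinner H (U (inv a \<otimes> x \<otimes> b) \<xi>) \<eta>" using c x \<xi> \<eta> U_simps(1) by (simp add: U_ip)
   finally have "cmod (f (inv a \<otimes> x \<otimes> b) - hinner H (U x (U b \<xi>)) (U a \<eta>)) <= \<epsilon>" using close[of "inv a \<otimes> x \<otimes> b"] c x by simp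
   moreover have "cmod (f x - f (inv a \<otimes> x \<otimes> b)) < e / 2" using AB(3) ab by (auto simp: dist_norm)
   ultimately show ?thesis
    using norm_triangle_ineq[of "f x - f (inv a \<otimes> x \<otimes> b)" "f (inv a \<otimes> x \<otimes> b) - hinner H (U x (U b \<xi>)) (U a \<eta>)"] by simp
  qed
  have convex: "cmod (c - (1 / 2) * (a + b)) <= r" if "cmod (c - a) <= r" "cmod (c - b) <= r" for a b c :: complex and r
  proof -
   have "c - (1 / 2) * (a + b) = (1 / 2) * (c - a) + (1 / 2) * (c - b)" by (simp add: field_simps)
   then show ?thesis using norm_triangle_ineq[of "(1 / 2) * (c - a)" "(1 / 2) * (c - b)"] that by (simp add: norm_divide)
  qed
  have oc: "z : carrier H" "hnorm H z <= hnorm H \<xi>" if "z : orb \<xi> B" for z using orb_bounds[OF \<xi> ABc(2) that] by auto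
  have oc': "z : carrier H" "hnorm H z <= hnorm H \<eta>" if "z : orb \<eta> A" for z using orb_bounds[OF \<eta> ABc(1) that] by auto
  have 1: "cmod (f x - hinner H (U x z) (U a \<eta>)) <= \<epsilon> + e / 2" if "z : orb \<xi> B" "a : A" for z a
   using that(1)
  proof induction
   case (mid y z)
   have "U a \<eta> : carrier H" using U_simps(1) \<eta> that(2) ABc by blast
   then have "hinner H (U x ((1 / 2) \<odot>\<^bsub>H\<^esub> (y \<oplus>\<^bsub>H\<^esub> z))) (U a \<eta>) = (1 / 2) * (hinner H (U x y) (U a \<eta>) + hinner H (U x z) (U a \<eta>))"
    using oc[OF mid(1)] oc[OF mid(2)] x by (simp add: U_simps H.ip_smult_left H.ip_add_left)
   then show ?case using convex[OF mid(3,4)] by (simp only:)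
  qed (use fv that in auto)
  have 2: "cmod (f x - hinner H (U x z) z') <= \<epsilon> + e / 2" if z: "z : orb \<xi> B" "z' : orb \<eta> A" for z z'
   using z(2)
  proof induction
   case (mid y y')
   have "U x z : carrier H" using U_simps(1) x oc z(1) by blast
   then have "hinner H (U x z) ((1 / 2) \<odot>\<^bsub>H\<^esub> (y \<oplus>\<^bsub>H\<^esub> y')) = (1 / 2) * (hinner H (U x z) y + hinner H (U x z) y')"
    using oc'[OF mid(1)] oc'[OF mid(2)] by (simp add: H.ip_smult_right H.ip_add_right)
   then show ?case using convex[OF mid(3,4)] by (simp only:)
  qed (use 1 z in auto)
  define C where "C = hnorm H \<xi> + hnorm H \<eta> + 1"
  have C: "0 < C" "hnorm H \<xi> <= C" "hnorm H \<eta> <= C" using H.hn_nonneg \<xi> \<eta> by (auto simp: C_def add_nonneg_pos)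
  have eC: "0 < e / (4 * C)" using e C(1) by simp
  obtain N M where N: "!!n. N <= n ==> EX z:orb \<xi> B. hdist H (w False n) z < e / (4 * C)"
   and M: "!!n. M <= n ==> EX z:orb \<eta> A. hdist H (w True n) z < e / (4 * C)"
   using near[OF AB(2) eC, of False] near[OF AB(1) eC, of True] by (auto simp: \<zeta>_def)
  have "norm (f x - hinner H (v n (x, False)) (v n (\<one>, True))) <= \<epsilon> + e" if n: "max N M <= n" for n
  proof -
   obtain z z' where z: "z : orb \<xi> B" "hdist H (w False n) z < e / (4 * C)" and z': "z' : orb \<eta> A" "hdist H (w True n) z' < e / (4 * C)"
    using N[of n] M[of n] n by auto
   note zc = oc[OF z(1)] oc'[OF z'(1)]
   have wc: "w s n : carrier H" "hnorm H (w True n) <= hnorm H \<eta>" for s using w[of s n] w[of True n] by (auto simp: \<zeta>_def)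
   have Uw: "U x (w False n) : carrier H" "U x z : carrier H" using U_simps(1) x wc zc by auto
   have "hinner H (U x (w False n)) (w True n) - hinner H (U x z) z'
    = hinner H (U x (w False n) \<ominus>\<^bsub>H\<^esub> U x z) (w True n) + hinner H (U x z) (w True n \<ominus>\<^bsub>H\<^esub> z')"
    using Uw wc zc by (simp add: H.ip_minus_left H.ip_minus_right)
   then have "cmod (hinner H (U x (w False n)) (w True n) - hinner H (U x z) z')
    <= cmod (hinner H (U x (w False n) \<ominus>\<^bsub>H\<^esub> U x z) (w True n)) + cmod (hinner H (U x z) (w True n \<ominus>\<^bsub>H\<^esub> z'))"
    by (simp add: norm_triangle_ineq)
   also have "\<dots> <= hdist H (U x (w False n)) (U x z) * hnorm H (w True n) + hnorm H (U x z) * hdist H (w True n) z'"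
    unfolding hdist_def using Uw wc zc by (intro add_mono H.cauchy_schwarz) auto
   also have "\<dots> <= e / (4 * C) * C + C * (e / (4 * C))"
   proof (intro add_mono mult_mono)
    show "hdist H (U x (w False n)) (U x z) <= e / (4 * C)" using z(2) wc zc x by (simp add: U_hdist)
    show "0 <= hdist H (w True n) z'" unfolding hdist_def by (intro H.hn_nonneg H.minus_carrier wc zc)
   qed (use z'(2) wc zc x C H.hn_nonneg eC in \<open>auto simp: U_norm\<close>)
   also have "\<dots> = e / 2" using C(1) by simp
   finally have "cmod (hinner H (U x (w False n)) (w True n) - hinner H (U x z) z') <= e / 2" .
   moreover have "v n (\<one>, True) = w True n" "v n (x, False) = U x (w False n)" using x wc U_one by (simp_all add: vs)
   ultimately show ?thesis using 2[OF z(1) z'(1)]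
     norm_triangle_ineq4[of "f x - hinner H (U x z) z'" "hinner H (U x (w False n)) (w True n) - hinner H (U x z) z'"] by simp
  qed
  then show "cmod (f x - K (x, False) (\<one>, True)) <= \<epsilon> + e"
   by (intro LIMSEQ_le_const2[OF tendsto_norm[OF tendsto_diff[OF tendsto_const lim]]] exI[of _ "max N M"]) blast
 qed
 then show ?thesis using K by blast
qed

end

section \<open>The Eberlein algebra\<close>

context top_grp
begin

lemma group_kernelD:
 assumes "group_kernel G T K"
 shows "pd K" "x ~: carrier G ==> K (x, s) (y, t) = 0"
  "g : carrier G ==> x : carrier G ==> y : carrier G ==> K (g \<otimes> x, s) (g \<otimes> y, t) = K (x, s) (y, t)"
  "y : carrier G ==> continuous_map T euclidean (%x. K (x, s) (y, t))"
 using assms unfolding group_kernel_def by blast+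

lemma group_kernel_outside: "group_kernel G T K ==> y ~: carrier G ==> K (x, s) (y, t) = 0"
 using group_kernelD(1,2)[of K] unfolding pd_def by (metis complex_cnj_zero)

lemma fourier_stieltjes_action:
 assumes "unitary_representation G T H \<pi>"
 shows "isometric_action G T H \<pi>"
proof -
 have H: "pre_hilb H" using assms by (simp add: unitary_representation_def hilbert_space_iff_pre_hilb)
 then interpret pre_hilb H .
 have u: "\<pi> x : unitaries H" if "x : carrier G" for x using assms that by (auto simp: unitary_representation_def)
 show ?thesis
 proof (intro isometric_action.intro isometric_action_axioms.intro H)
  show "top_grp G T" by unfold_locales
  show "hinner H (\<pi> x v) (\<pi> x w) = hinner H v w" if "x : carrier G" "v : carrier H" "w : carrier H" for x v w
   using u[OF that(1)] that by (simp add: unitaries_def)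
  then show "\<pi> x : contractions H" if "x : carrier G" for x
   using u[OF that] that by (simp add: unitaries_def contractions_def hnorm_def)
  show "\<pi> (x \<otimes> y) v = \<pi> x (\<pi> y v)" if "x : carrier G" "y : carrier G" "v : carrier H" for x y v
   using assms that by (simp add: unitary_representation_def compose_def)
 qed
qed

lemma eberlein_approx:
 assumes "f : eberlein_algebra G T" "0 < e"
 obtains H :: "('a => complex) hilbert" and \<pi> \<xi> \<eta> where "isometric_action G T H \<pi>" "\<xi> : carrier H" "\<eta> : carrier H"
  "!!x. x : carrier G ==> cmod (f x - hinner H (\<pi> x \<xi>) \<eta>) <= e"
proof -
 obtain u where u: "u : fourier_stieltjes G T" "nrm (FN x. f x - u x) < e" and f: "f : CBG"
  using assms by (auto simp: eberlein_algebra_def)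
 obtain H :: "('a => complex) hilbert" and \<pi> \<xi> \<eta> where H: "unitary_representation G T H \<pi>" "\<xi> : carrier H" "\<eta> : carrier H"
  and u_def: "u = (FN x. hinner H (\<pi> x \<xi>) \<eta>)" using u(1) unfolding fourier_stieltjes_def by blast
 interpret isometric_action G T H \<pi> by (rule fourier_stieltjes_action[OF H(1)])
 obtain C where C: "0 < C" "!!x. x : carrier G ==> cmod (f x) <= C" by (rule CB_bound[OF f], rule that)
 \<comment> \<open>The uniform norm is a supremum of reals and dominates the values only of bounded
   functions, so boundedness of the difference comes first.\<close>
 have "cmod (f x - hinner H (\<pi> x \<xi>) \<eta>) <= C + hnorm H \<xi> * hnorm H \<eta>" if "x : carrier G" for x
  using norm_triangle_ineq4[of "f x" "hinner H (\<pi> x \<xi>) \<eta>"] C(2)[OF that] H.cauchy_schwarz[of "\<pi> x \<xi>" \<eta>] U_simps(1) U_norm H(2,3) that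
  by (smt (verit))
 then have bdd: "bdd_above ((%x. cmod ((FN x. f x - u x) x)) ` carrier G)"
  by (intro bdd_aboveI2) (simp add: u_def)
 show thesis
 proof (rule that[OF _ H(2,3)])
  show "isometric_action G T H \<pi>" by unfold_locales
  fix x assume x: "x : carrier G"
  have "cmod (f x - u x) <= nrm (FN x. f x - u x)"
   using cSUP_upper[OF x bdd] x by (simp add: uniform_norm_def)
  then show "cmod (f x - hinner H (\<pi> x \<xi>) \<eta>) <= e" using u(2) x by (simp add: u_def)
 qed
qed

lemma stable_eberlein:
 assumes "f : eberlein_algebra G T"
 shows "stable (carrier G) (%x y. f (x \<otimes> y))"
proof (rule stable_if_contraction_coefficients)
 fix e :: real assume e: "0 < e"
 obtain H :: "('a => complex) hilbert" and \<pi> \<xi> \<eta> where "isometric_action G T H \<pi>" and H: "\<xi> : carrier H" "\<eta> : carrier H"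
  "!!x. x : carrier G ==> cmod (f x - hinner H (\<pi> x \<xi>) \<eta>) <= e" by (rule eberlein_approx[OF assms e], rule that)
 then interpret isometric_action G T H \<pi> by simp
 show "EX (H :: ('a => complex) hilbert) A v \<eta> C. pre_hilb H & \<eta> : carrier H &
   (ALL x:carrier G. A x : contractions H & v x : carrier H & hnorm H (v x) <= C) &
   (ALL x:carrier G. ALL y:carrier G. cmod (f (x \<otimes> y) - hinner H (A x (v y)) \<eta>) <= e)"
  using H U_contr U_simps(1) U_norm U_mult H(3)[OF m_closed] H.pre_hilb_axioms
  by (intro exI[of _ H] exI[of _ \<pi>] exI[of _ "%x. \<pi> x \<xi>"] exI[of _ \<eta>] exI[of _ "hnorm H \<xi>"]) auto
qed

text \<open>Translation of points is a representation on the Hilbert space of the kernel. The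
  infinite type \<open>'a\<close> absorbs the factor \<open>bool\<close>, which brings this space to
  the type that \<open>fourier_stieltjes\<close> prescribes.\<close>

lemma eberlein_if_kernels:
 assumes inf: "infinite (UNIV :: 'a set)" and f: "f : CBG"
  and ap: "!!e. 0 < e ==> EX K. group_kernel G T K & (ALL x:carrier G. cmod (f x - K (x, False) (\<one>, True)) <= e)"
 shows "f : eberlein_algebra G T"
proof -
 have "EX u:fourier_stieltjes G T. nrm (FN x. f x - u x) < e" if e: "0 < e" for e
 proof -
  from ap[of "e / 2"] e obtain K where K: "group_kernel G T K" "!!x. x : carrier G ==> cmod (f x - K (x, False) (\<one>, True)) <= e / 2" by auto
  have "(UNIV :: 'a set) - {\<one>} ~= {}" using inf by (metis finite.emptyI finite_insert finite_Diff2 infinite_imp_nonempty)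
  then obtain b where "b ~= \<one>" by blast
  then have "inj (%s. if s then b else \<one>)" by (auto simp: inj_def)
  then have "(card_of (UNIV :: bool set), card_of (UNIV :: 'a set)) : ordLeq" by (intro card_of_ordLeq[THEN iffD1]) blast
  then have "(card_of ((UNIV :: 'a set) \<times> (UNIV :: bool set)), card_of (UNIV :: 'a set)) : ordIso"
   using inf by (intro card_of_Times_infinite[THEN conjunct1]) auto
  then obtain \<iota> :: "'a \<times> bool => 'a" where \<iota>: "inj \<iota>"
   unfolding card_of_ordIso[symmetric] by (auto simp: bij_betw_def)
  define d where "d = inv_into UNIV \<iota>"
  have d: "d (\<iota> p) = p" for p using \<iota> by (simp add: d_def)
  \<comment> \<open>Points outside the group stay fixed; as the kernel vanishes there, translation
    preserves it everywhere.\<close>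
  define act where "act = (%x (p :: 'a \<times> bool). (if fst p : carrier G then x \<otimes> fst p else fst p, snd p))"
  define \<tau> where "\<tau> = (%x z. \<iota> (act x (d z)))"
  interpret kernel "%z w. K (d z) (d w)" by unfold_locales (rule pd_pullback[OF group_kernelD(1)[OF K(1)]])
  have K\<tau>: "K (d (\<tau> x z)) (d (\<tau> x w)) = K (d z) (d w)" if "x : carrier G" for x z w
   using group_kernelD(2,3)[OF K(1)] group_kernel_outside[OF K(1)] that
   by (cases "d z"; cases "d w") (auto simp: \<tau>_def d act_def)
  have B\<tau>: "B (mv (\<tau> x) l) (mv (\<tau> x) m) = B l m" if "x : carrier G" for x l m using K\<tau>[OF that] by (simp add: form_mv)
  have contr: "contr (\<tau> x)" if "x : carrier G" for x using B\<tau>[OF that] by (simp add: contr_def q_def)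
  have \<tau>\<tau>: "\<tau> (x \<otimes> y) = \<tau> x \<circ> \<tau> y" if "x : carrier G" "y : carrier G" for x y
   using that by (auto simp: \<tau>_def act_def d m_assoc fun_eq_iff)
  have mult: "induced (\<tau> (x \<otimes> y)) = compose space (induced (\<tau> x)) (induced (\<tau> y))" if "x : carrier G" "y : carrier G" for x y
   using induced_comp[of "\<tau> x" "\<tau> y"] contr that \<tau>\<tau>[OF that] contr[of "x \<otimes> y"] by simp
  have ip: "inner (induced (\<tau> x) F) (induced (\<tau> x) E) = inner F E" if "x : carrier G" "F : space" "E : space" for x F E
   using LIMSEQ_unique[OF inner_lim[OF rep_induced[OF contr rep_rp] rep_induced[OF contr rep_rp]], of x F x E] inner_lim[OF rep_rp rep_rp, of F E] that
   by (simp add: B\<tau>)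
  have "isometric_action G T hs (%x. induced (\<tau> x))"
   by (intro isometric_action.intro isometric_action_axioms.intro pre_hilb_hs induced_contraction contr, unfold_locales)
    (simp_all add: ip mult compose_def)
  then interpret I: isometric_action G T hs "%x. induced (\<tau> x)" .
  have inverse: "induced (\<tau> (inv x)) (induced (\<tau> x) F) = F & induced (\<tau> x) (induced (\<tau> (inv x)) F) = F" if "x : carrier G" "F : space" for x F
   using I.U_mult[of "inv x" x F] I.U_mult[of x "inv x" F] I.U_one[of F] that by simp
  have unitary: "induced (\<tau> x) : unitaries hs" if x: "x : carrier G" for x
  proof -
   have "bij_betw (induced (\<tau> x)) space space"
    by (rule bij_betw_byWitness[of _ "induced (\<tau> (inv x))"]) (use x inverse induced_space contr in auto)
   then show ?thesis using induced_contraction[OF contr[OF x]] ip[OF x] by (simp add: unitaries_def contractions_def)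
  qed
  interpret M: Metric_space space "hdist hs" by (rule Metric_space_hs)
  have cont: "continuous_map T euclidean (%x. K (d (\<tau> x z)) (d w))" for z w
  proof (cases "fst (d z) : carrier G & fst (d w) : carrier G")
   case True
   have "continuous_map T euclidean ((%x. K (x, snd (d z)) (fst (d w), snd (d w))) \<circ> (%x. x \<otimes> fst (d z)))"
    by (rule continuous_map_compose[OF continuous_map_rmult group_kernelD(4)[OF K(1)]]) (use True in auto)
   then show ?thesis using True by (simp add: o_def \<tau>_def d act_def)
  next
   case False
   then have "K (d (\<tau> x z)) (d w) = 0" for x
    using group_kernelD(2)[OF K(1)] group_kernel_outside[OF K(1)] by (cases "d z"; cases "d w") (auto simp: \<tau>_def d act_def)
   then show ?thesis by simp
  qed
  \<comment> \<open>For isometries strong continuity follows from weak continuity, since the squared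
    distance of two translates of a combination is determined by their inner product. Uniform
    boundedness then passes from combinations to all vectors.\<close>
  have strong: "continuous_map T M.mtopology (%x. induced (\<tau> x) F)" if F: "F : space" for F
   unfolding M.continuous_map_to_metric topspace_T
  proof (intro ballI allI impI)
   fix x and a :: real assume x: "x : carrier G" and a: "0 < a"
   obtain l where l: "hdist hs F (point l) < a / 4" by (rule point_dense[OF F, of "a / 4"]) (use a in auto)
   have "continuous_map T euclidean (%x'. form (%z w. K (d (\<tau> x' z)) (d w)) l (mv (\<tau> x) l))" by (rule continuous_map_form[OF cont])
   moreover have "form (%z w. K (d (\<tau> x' z)) (d w)) l m = B (mv (\<tau> x') l) m" for x' m by (simp add: form_def mv_def o_def)
   ultimately have "continuous_map T euclidean (%x'. B (mv (\<tau> x') l) (mv (\<tau> x) l))" by simp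
   then obtain U where U: "openin T U" "x : U" "!!x'. x' : U ==> dist (B (mv (\<tau> x') l) (mv (\<tau> x) l)) (B (mv (\<tau> x) l) (mv (\<tau> x) l)) < (a / 4)\<^sup>2 / 2"
    unfolding continuous_map_to_metric_iff topspace_T using x a by (metis half_gt_zero zero_less_divide_iff zero_less_numeral zero_less_power)
   have "induced (\<tau> x') F : M.mball (induced (\<tau> x) F) a" if x': "x' : U" for x'
   proof -
    have x'c: "x' : carrier G" using openin_subset[OF U(1)] x' by auto
    have "(q (mn (mv (\<tau> x) l) (mv (\<tau> x') l)))\<^sup>2 = 2 * Re (B l l) - 2 * Re (B (mv (\<tau> x') l) (mv (\<tau> x) l))"
     using B_commute[of "mv (\<tau> x') l" "mv (\<tau> x) l"] by (simp add: q_square B\<tau> x x'c)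
    also have "\<dots> <= 2 * dist (B (mv (\<tau> x') l) (mv (\<tau> x) l)) (B (mv (\<tau> x) l) (mv (\<tau> x) l))"
     using abs_Re_le_cmod[of "B (mv (\<tau> x') l) (mv (\<tau> x) l) - B l l"] by (simp add: dist_norm B\<tau> x)
    also have "\<dots> <= (a / 4)\<^sup>2" using U(3)[OF x'] by simp
    finally have "q (mn (mv (\<tau> x) l) (mv (\<tau> x') l)) <= a / 4" by (rule power2_le_imp_le) (use a in simp)
    then have m: "hdist hs (induced (\<tau> x) (point l)) (induced (\<tau> x') (point l)) <= a / 4"
     by (simp only: induced_point contr x x'c hdist_point)
    have s: "induced (\<tau> y) E : space" if "y : carrier G" "E : space" for y E by (rule induced_space[OF contr]) (use that in auto)
    have "hdist hs (induced (\<tau> x) F) (induced (\<tau> x') F) <= hdist hs F (point l) + (a / 4 + hdist hs F (point l))"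
     using M.triangle[OF s[OF x F] s[OF x point_space] s[OF x'c F], of l] M.triangle[OF s[OF x point_space] s[OF x'c point_space] s[OF x'c F], of l l]
      I.U_hdist[OF x, of F "point l"] I.U_hdist[OF x'c, of "point l" F] F point_space[of l] m M.commute[of F "point l"] by simp
    then show ?thesis using l a s[OF x F] s[OF x'c F] by (simp add: M.mball_def)
   qed
   then show "EX U. openin T U & x : U & (ALL x':U. induced (\<tau> x') F : M.mball (induced (\<tau> x) F) a)" using U(1,2) by blast
  qed
  define u where "u = (FN x. inner (induced (\<tau> x) (point [(1, \<iota> (\<one>, False))])) (point [(1, \<iota> (\<one>, True))]))"
  have ux: "u x = K (x, False) (\<one>, True)" if "x : carrier G" for x
  proof -
   have "u x = B (mv (\<tau> x) [(1, \<iota> (\<one>, False))]) [(1, \<iota> (\<one>, True))]"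
    unfolding u_def restrict_apply'[OF that] induced_point[OF contr[OF that]] inner_point ..
   then show ?thesis using that by (simp add: mv_def form_singletons \<tau>_def d act_def)
  qed
  have "unitary_representation G T hs (%x. induced (\<tau> x))"
   unfolding unitary_representation_def using hilbert_space_hs unitary mult strong by auto
  then have "u : fourier_stieltjes G T"
   unfolding fourier_stieltjes_def u_def using point_space
   by (intro CollectI exI[of _ hs] exI[of _ "%x. induced (\<tau> x)"] exI conjI refl) (auto simp only: hs_simps)
  moreover have "nrm (FN x. f x - u x) <= e / 2" using K(2) by (intro uniform_norm_le) (simp add: ux)
  ultimately show ?thesis using e by (intro bexI[of _ u]) auto
 qed
 then show ?thesis using f by (simp add: eberlein_algebra_def)
qed

lemma eberlein_kernel:
 assumes f: "f : eberlein_algebra G T" and e: "0 < e"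
 shows "EX K. group_kernel G T K & (ALL x:carrier G. cmod (f x - K (x, False) (\<one>, True)) <= e)"
proof -
 obtain H :: "('a => complex) hilbert" and \<pi> \<xi> \<eta> where "isometric_action G T H \<pi>" and H: "\<xi> : carrier H" "\<eta> : carrier H"
  "!!x. x : carrier G ==> cmod (f x - hinner H (\<pi> x \<xi>) \<eta>) <= e" by (rule eberlein_approx[OF f e], rule that)
 then interpret isometric_action G T H \<pi> by simp
 show ?thesis by (rule continuous_group_kernel[OF _ H]) (use f in \<open>simp add: eberlein_algebra_def\<close>)
qed

text \<open>Places the closure of the evaluations inside the Gelfand spectrum, on which the map of a
  comparison is defined. Sums and Schur products of kernels take the place of direct sums and tensor
  products of representations.\<close>

lemma function_algebra_eberlein:
 assumes inf: "infinite (UNIV :: 'a set)"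
 shows "function_algebra (eberlein_algebra G T)"
 unfolding function_algebra_def
proof (intro conjI ballI allI)
 have ECB: "f : CBG" if "f : eberlein_algebra G T" for f using that by (simp add: eberlein_algebra_def)
 then show "eberlein_algebra G T \<subseteq> CBG" by blast
 have cmult: "continuous_map T euclidean (%x. u x * v x)" if "continuous_map T euclidean u" "continuous_map T euclidean v" for u v :: "'a => complex"
  using that by (simp add: continuous_map_atin tendsto_mult)
 note I = eberlein_if_kernels[OF inf]
 show "(FN x. 1) : eberlein_algebra G T"
 proof (rule I[OF CB_const])
  define w :: "'a \<times> bool => complex" where "w = (%p. if fst p : carrier G then 1 else 0)"
  have "continuous_map T euclidean w'" if "!!x. x : carrier G ==> w' x = 1" for w' :: "'a => complex"
   by (rule continuous_map_eq[of _ _ "%_. 1"]) (simp_all add: that)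
  then have "group_kernel G T (%p r. w p * cnj (w r) * 1)"
   unfolding group_kernel_def using pd_weight[OF pd_one, of w] by (simp add: w_def)
  then show "EX K. group_kernel G T K & (ALL x:carrier G. cmod ((FN x. 1) x - K (x, False) (\<one>, True)) <= e)" if "0 < e" for e
   using that by (intro exI[of _ "%p r. w p * cnj (w r) * 1"]) (simp add: w_def)
 qed
 fix f assume f: "f : eberlein_algebra G T"
 show "(FN x. c * f x) : eberlein_algebra G T" for c
 proof (rule I[OF CB_scale[OF ECB[OF f]]])
  fix e :: real assume e: "0 < e"
  have c: "0 < cmod c + 1" by (simp add: add_nonneg_pos)
  obtain K where K: "group_kernel G T K" "ALL x:carrier G. cmod (f x - K (x, False) (\<one>, True)) <= e / (cmod c + 1)"
   using eberlein_kernel[OF f, of "e / (cmod c + 1)"] e c by auto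
  \<comment> \<open>The weight affects the copy \<open>False\<close> only, so the coefficient picks
    up the factor \<open>c\<close> while the kernel remains positive definite.\<close>
  define w where "w = (%p :: 'a \<times> bool. if snd p then 1 else c)"
  have "group_kernel G T (%p r. w p * cnj (w r) * K p r)"
   unfolding group_kernel_def using pd_weight[OF group_kernelD(1)[OF K(1)], of w] group_kernelD[OF K(1)]
   by (auto simp: w_def intro!: cmult)
  moreover have "cmod (c * f x - c * K (x, False) (\<one>, True)) <= e" if "x : carrier G" for x
  proof -
   have "cmod (c * f x - c * K (x, False) (\<one>, True)) <= (cmod c + 1) * cmod (f x - K (x, False) (\<one>, True))"
    by (simp add: right_diff_distrib[symmetric] norm_mult mult_right_mono)
   also have "\<dots> <= (cmod c + 1) * (e / (cmod c + 1))" using K(2) that c by (intro mult_left_mono) auto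
   finally show ?thesis using c by simp
  qed
  ultimately show "EX K. group_kernel G T K & (ALL x:carrier G. cmod ((FN x. c * f x) x - K (x, False) (\<one>, True)) <= e)"
   by (intro exI[of _ "%p r. w p * cnj (w r) * K p r"]) (simp add: w_def)
 qed
 fix g assume g: "g : eberlein_algebra G T"
 show "(FN x. f x + g x) : eberlein_algebra G T"
 proof (rule I[OF CB_add[OF ECB[OF f] ECB[OF g]]])
  fix e :: real assume "0 < e"
  then have e: "0 < e / 2" by simp
  obtain K where K: "group_kernel G T K" "ALL x:carrier G. cmod (f x - K (x, False) (\<one>, True)) <= e / 2" using eberlein_kernel[OF f e] by (elim exE conjE)
  obtain L where L: "group_kernel G T L" "ALL x:carrier G. cmod (g x - L (x, False) (\<one>, True)) <= e / 2" using eberlein_kernel[OF g e] by (elim exE conjE)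
  have "group_kernel G T (%p r. K p r + L p r)"
   unfolding group_kernel_def using pd_add[OF group_kernelD(1)[OF K(1)] group_kernelD(1)[OF L(1)]] group_kernelD[OF K(1)] group_kernelD[OF L(1)]
   by (auto intro!: continuous_map_add)
  moreover have "cmod (f x + g x - (K (x, False) (\<one>, True) + L (x, False) (\<one>, True))) <= e" if "x : carrier G" for x
   unfolding add_diff_add using norm_triangle_ineq[of "f x - K (x, False) (\<one>, True)" "g x - L (x, False) (\<one>, True)"] bspec[OF K(2) that] bspec[OF L(2) that] by simp
  ultimately show "EX K. group_kernel G T K & (ALL x:carrier G. cmod ((FN x. f x + g x) x - K (x, False) (\<one>, True)) <= e)"
   by (intro exI[of _ "%p r. K p r + L p r"]) simp
 qed
 show "(FN x. f x * g x) : eberlein_algebra G T"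
 proof (rule I[OF CB_mult[OF ECB[OF f] ECB[OF g]]])
  fix e :: real assume e: "0 < e"
  obtain C where C: "0 < C" "!!x. x : carrier G ==> cmod (f x) <= C" by (rule CB_bound[OF ECB[OF f]], rule that)
  obtain D where D: "0 < D" "!!x. x : carrier G ==> cmod (g x) <= D" by (rule CB_bound[OF ECB[OF g]], rule that)
  \<comment> \<open>\<open>a <= 1\<close> bounds the second coefficient by \<open>D + 1\<close>, and
    the error of the product is then at most \<open>C * a + a * (D + 1)\<close>.\<close>
  define a where "a = min 1 (e / (C + D + 1))"
  have a: "0 < a" "a <= 1" "a <= e / (C + D + 1)" using e C(1) D(1) by (simp_all add: a_def)
  then have "a * (C + D + 1) <= e" using C(1) D(1) by (simp add: pos_le_divide_eq)
  note a = a(1,2) this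
  obtain K where K: "group_kernel G T K" "ALL x:carrier G. cmod (f x - K (x, False) (\<one>, True)) <= a" using eberlein_kernel[OF f a(1)] by (elim exE conjE)
  obtain L where L: "group_kernel G T L" "ALL x:carrier G. cmod (g x - L (x, False) (\<one>, True)) <= a" using eberlein_kernel[OF g a(1)] by (elim exE conjE)
  have "group_kernel G T (%p r. K p r * L p r)"
   unfolding group_kernel_def using pd_mult[OF group_kernelD(1)[OF K(1)] group_kernelD(1)[OF L(1)]] group_kernelD[OF K(1)] group_kernelD[OF L(1)]
   by (auto intro!: cmult)
  moreover have "cmod (f x * g x - K (x, False) (\<one>, True) * L (x, False) (\<one>, True)) <= e" if x: "x : carrier G" for x
  proof -
   define k l where "k = K (x, False) (\<one>, True)" and "l = L (x, False) (\<one>, True)"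
   have kl: "cmod (f x - k) <= a" "cmod (g x - l) <= a" using K(2) L(2) x by (auto simp: k_def l_def)
   then have l: "cmod l <= D + 1" using D(2)[OF x] a(2) norm_triangle_ineq3[of l "g x"] by (simp add: norm_minus_commute)
   have "f x * g x - k * l = f x * (g x - l) + (f x - k) * l" by (simp add: algebra_simps)
   then have "cmod (f x * g x - k * l) <= cmod (f x) * cmod (g x - l) + cmod (f x - k) * cmod l"
    by (metis norm_mult norm_triangle_ineq)
   also have "\<dots> <= C * a + a * (D + 1)" using kl l C D(1) x a(1) by (intro add_mono mult_mono) auto
   also have "\<dots> <= e" using a(3) by (simp add: algebra_simps)
   finally show ?thesis by (simp add: k_def l_def)
  qed
  ultimately show "EX K. group_kernel G T K & (ALL x:carrier G. cmod ((FN x. f x * g x) x - K (x, False) (\<one>, True)) <= e)"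
   by (intro exI[of _ "%p r. K p r * L p r"]) simp
 qed
qed

text \<open>The comparison map is restricted to the closure of the evaluations, a compact part of
  the spectrum. The coordinates there are the functions of the Eberlein algebra, all of them stable,
  whereas coordinate \<open>f\<close> of the image has half graphs of every length.\<close>

theorem not_WAP_le_eberlein:
 assumes inf: "infinite (UNIV :: 'a set)" and f: "f : WAPG" and hg: "half_graphs G f"
 shows "~ compactification_le (group_semigroup G T) (evaluation WAPG) WC
   (evaluation (eberlein_algebra G T)) (eberlein_compactification G T)"
proof
 let ?E = "eberlein_algebra G T"
 let ?K = "prodtop ?E closure_of (evaluation ?E ` carrier G)"
 let ?X = "subtopology (prodtop ?E) ?K"
 note A = function_algebra_eberlein[OF inf]
 assume "compactification_le (group_semigroup G T) (evaluation WAPG) WC (evaluation ?E) (eberlein_compactification G T)"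
 then obtain \<theta> where \<theta>: "continuous_map (subtopology (prodtop ?E) (gelfand_spectrum G ?E)) (sg_top WC) \<theta>"
  "!!x. x : carrier G ==> \<theta> (evaluation ?E x) = evaluation WAPG x"
  by (auto simp: compactification_le_def continuous_hom_def group_semigroup_def eberlein_compactification_def spectrum_semigroup_def)
 have K: "?K \<subseteq> topspace (prodtop ?E)" by (rule closure_of_subset_topspace)
 have tX: "topspace ?X = ?K" using K by auto
 show False
 proof (rule half_graphs_not_stable[OF hg, of ?X ?E "%g \<mu>. \<mu> g" "%\<mu>. \<theta> \<mu> f" "evaluation ?E"])
  show "compact_space ?X"
   by (intro compact_space_subtopology compactin_closure_of_evaluations(1)) (use A in \<open>auto simp: function_algebra_def\<close>)
  show "continuous_map ?X euclidean (%\<mu>. \<mu> g)" if "g : ?E" for g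
   by (intro continuous_map_from_subtopology continuous_map_coord that)
  show "EX g:?E. \<mu> g ~= \<nu> g" if "\<mu> : topspace ?X" "\<nu> : topspace ?X" "\<mu> ~= \<nu>" for \<mu> \<nu>
  proof -
   have "\<mu> : extensional ?E" "\<nu> : extensional ?E" using that(1,2) K by (auto simp: PiE_def)
   then show ?thesis using that(3) extensionalityI by metis
  qed
  have "continuous_map ?X (sg_top WC) \<theta>"
   by (rule continuous_map_from_subtopology_mono[OF \<theta>(1) closure_of_evaluations_subset_spectrum[OF A]])
  then have "continuous_map ?X (prodtop WAPG) \<theta>" unfolding sg_top_WC by (simp add: continuous_map_in_subtopology)
  from continuous_map_compose[OF this continuous_map_coord[OF f]] show "continuous_map ?X euclidean (%\<mu>. \<theta> \<mu> f)" by (simp add: o_def)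
  show "evaluation ?E x : topspace ?X & \<theta> (evaluation ?E x) f = f x" if "x : carrier G" for x
   using evaluation_in_spectrum(1)[OF A that] \<theta>(2)[OF that] f unfolding tX by (simp add: evaluation_def)
  show "stable (carrier G) (%x y. evaluation ?E (x \<otimes> y) g)" if "g : ?E" for g
   using stable_eberlein[OF that] that by (simp add: evaluation_def)
 qed simp
qed

end

section \<open>Direct sums of kernels and of contractions\<close>

lemma pd_blocks:
 fixes k :: "'p => 's => 's => complex"
 assumes k: "!!p. pd (k p)"
 shows "pd (%x y. if fst x = fst y then k (fst x) (snd x) (snd y) else 0)" (is "pd ?K")
proof -
 define w where "w = (%p (x :: 'p \<times> 's). if fst x = p then 1 else 0 :: complex)"
 \<comment> \<open>A list meets only finitely many blocks, so positivity reduces to finite sums of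
   weighted pullbacks.\<close>
 define KP where "KP = (%P (x :: 'p \<times> 's) y. if fst x : P then ?K x y else 0)"
 have KP: "pd (KP P)" if "finite P" for P
  using that
 proof induction
  case empty
  have "form (KP {}) l l = (\<Sum>p\<leftarrow>l. 0)" for l unfolding form_def KP_def by (intro arg_cong[of _ _ sum_list] map_cong) auto
  then show ?case by (simp add: pd_def KP_def)
 next
  case (insert p P)
  have "KP (insert p P) = (%x y. w p x * cnj (w p y) * k p (snd x) (snd y) + KP P x y)"
   using insert.hyps by (auto simp: KP_def w_def fun_eq_iff)
  then show ?case using pd_add[OF pd_weight[OF pd_pullback[OF k[of p], of snd], of "w p"] insert.IH] by simp
 qed
 show ?thesis
  unfolding pd_def
 proof (intro conjI allI)
  fix x y :: "'p \<times> 's"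
  have "k (fst x) (snd y) (snd x) = cnj (k (fst x) (snd x) (snd y))" using k[of "fst x"] unfolding pd_def by blast
  then show "?K y x = cnj (?K x y)" by simp
 next
  fix l
  have "form ?K l l = form (KP (fst ` snd ` set l)) l l"
   unfolding form_def KP_def by (intro arg_cong[of _ _ sum_list] map_cong) auto
  then show "0 <= Re (form ?K l l)" using KP[of "fst ` snd ` set l"] by (simp add: pd_def)
 qed
qed

context pre_hilb
begin

text \<open>Contractivity of \<open>A\<close>, written as positivity of the kernel of
  \<open>1 - A* A\<close>. In this form it can be assembled from blocks.\<close>

lemma pd_gram_diff:
 assumes A: "A : contractions H" and v: "!!x. v x : carrier H"
 shows "pd (%x y. ip (v x) (v y) - ip (A (v x)) (A (v y)))"
proof -
 note Av = contraction_simps[OF A]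
 have "lsum (%x. A (v x)) l = A (lsum v l)" for l
 proof (induction l)
  case Nil
  have "hn (A \<zero>) <= 0" using Av(2)[OF zero_closed] hn_zero_iff[OF zero_closed] by simp
  then show ?case using hn_zero_iff[OF Av(1)[OF zero_closed]] hn_nonneg[OF Av(1)[OF zero_closed]] by simp
 qed (simp add: Av v lsum_carrier)
 then have 1: "form (%x y. ip (A (v x)) (A (v y))) l l = ip (A (lsum v l)) (A (lsum v l))" for l
  using form_gram[of "%x. A (v x)" l l] Av(1) v by simp
 have 2: "form (%x y. ip (v x) (v y) - ip (A (v x)) (A (v y))) l l = form (%x y. ip (v x) (v y)) l l - form (%x y. ip (A (v x)) (A (v y))) l l" for l
  by (simp add: form_def algebra_simps sum_list_subtractf)
 have "Re (ip (A (lsum v l)) (A (lsum v l))) <= Re (ip (lsum v l) (lsum v l))" for l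
  using power_mono[OF Av(2) hn_nonneg, of "lsum v l" 2] Av(1) v by (simp add: lsum_carrier hn_square)
 then have pos: "0 <= Re (form (%x y. ip (v x) (v y) - ip (A (v x)) (A (v y))) l l)" for l
  unfolding 2 1 form_gram[OF v] by simp
 have herm: "ip (v y) (v x) - ip (A (v y)) (A (v x)) = cnj (ip (v x) (v y) - ip (A (v x)) (A (v y)))" for x y
  unfolding ip_commute[OF v v, of x y] ip_commute[OF Av(1)[OF v] Av(1)[OF v], of x y] by simp
 show ?thesis unfolding pd_def by (intro conjI allI herm pos)
qed

lemma Hausdorff_weak_star: "Hausdorff_space (weak_star_topology H)"
proof -
 let ?S = "square_summable H \<times> square_summable H"
 let ?J = "%A. \<lambda>p\<in>?S. \<Sum>n. ip (A (fst p n)) (snd p n)"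
 have t: "topspace (weak_star_topology H) = bounded_operators H"
  by (auto simp: weak_star_topology_def topspace_pullback_topology)
 show ?thesis
  unfolding Hausdorff_space_def t
 proof (intro allI impI, elim conjE)
  fix A A' assume A: "A : bounded_operators H" "A' : bounded_operators H" "A ~= A'"
  obtain \<xi> \<eta> where x: "\<xi> : carrier H" "\<eta> : carrier H" "ip (A \<xi>) \<eta> ~= ip (A' \<xi>) \<eta>"
   by (rule operators_separated[of A A']) (use A in \<open>auto simp: bounded_operators_def\<close>)
  obtain U V where UV: "open U" "open V" "ip (A \<xi>) \<eta> : U" "ip (A' \<xi>) \<eta> : V" "U \<inter> V = {}" using separation_t2[THEN iffD1, OF x(3)] by blast
  note c = openin_continuous_map_preimage[OF weak_star_coordinate[OF x(1,2)]]
  show "EX U V. openin (weak_star_topology H) U & openin (weak_star_topology H) V & A : U & A' : V & disjnt U V"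
   by (rule exI[of _ "{B : topspace (weak_star_topology H). ip (B \<xi>) \<eta> : U}"],
     rule exI[of _ "{B : topspace (weak_star_topology H). ip (B \<xi>) \<eta> : V}"], intro conjI c)
    (use UV A t in \<open>auto simp: disjnt_def\<close>)
 qed
qed

end

lemma infinite_inj_triple:
 assumes "infinite (UNIV :: 's set)" obtains \<iota> :: "('s \<times> 's) \<times> 's => 's" where "inj \<iota>"
proof -
 have "(card_of ((UNIV :: 's set) \<times> (UNIV :: 's set)), card_of (UNIV :: 's set)) : ordIso"
  by (rule card_of_Times_same_infinite[OF assms])
 then obtain g :: "'s \<times> 's => 's" where "inj g" unfolding card_of_ordIso[symmetric] by (auto simp: bij_betw_def)
 then have "inj (%z. g (g (fst z), snd z))" by (intro injI) (metis injD prod.collapse prod.inject)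
 then show thesis by (rule that)
qed

section \<open>The universal (CH)-compactification\<close>

locale compact_semigroup =
 fixes W :: "'w top_semigroup"
 assumes compact: "compact_space (sg_top W)"
  and closed: "x : sg_carrier W ==> y : sg_carrier W ==> x \<cdot>\<^bsub>W\<^esub> y : sg_carrier W"
  and unit: "EX u:sg_carrier W. ALL x:sg_carrier W. x \<cdot>\<^bsub>W\<^esub> u = x"
  and inf: "infinite (UNIV :: 'w set set set)"
begin

text \<open>
  The points of the universal compactification are the classes of points not distinguished by any
  (CH)-compactification on the given type, and its topology is the initial one.
\<close>

definition I :: "(('w => 'w set set) \<times> 'w set set top_semigroup) set" where
 "I = {i. CH_compactification W (fst i) (snd i)}"

text \<open>The additional braces put the class on the type \<open>'w set set\<close>, the one on
  which universality is tested.\<close>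

definition cls :: "'w => 'w set set" where "cls x = {{y : sg_carrier W. ALL i:I. fst i x = fst i y}}"
definition pt :: "'w set set => 'w" where "pt \<rho> = (SOME x. x : sg_carrier W & cls x = \<rho>)"

abbreviation "RC \<equiv> cls ` sg_carrier W"
abbreviation "PT \<equiv> product_topology (%i. sg_top (snd i)) I"
abbreviation "J \<equiv> %\<rho>. \<lambda>i\<in>I. fst i (pt \<rho>)"
abbreviation "RT \<equiv> pullback_topology RC J PT"
abbreviation "ml \<rho> \<sigma> \<equiv> cls (pt \<rho> \<cdot>\<^bsub>W\<^esub> pt \<sigma>)"

definition R :: "'w set set top_semigroup" where "R = \<lparr>sg_top = RT, sg_mult = ml\<rparr>"

lemma ID:
 assumes "i : I"
 shows "continuous_map (sg_top W) (sg_top (snd i)) (fst i)" "Hausdorff_space (sg_top (snd i))"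
  "semitopological_semigroup (snd i)" "CH_semigroup (snd i)"
  "x : sg_carrier W ==> y : sg_carrier W ==> fst i (x \<cdot>\<^bsub>W\<^esub> y) = fst i x \<cdot>\<^bsub>snd i\<^esub> fst i y"
  "x : sg_carrier W ==> fst i x : sg_carrier (snd i)"
proof -
 have c: "compactification W (fst i) (snd i)" and S: "CH_semigroup (snd i)" using assms by (simp_all add: I_def CH_compactification_def)
 note c' = c[unfolded compactification_def continuous_hom_def]
 show *: "continuous_map (sg_top W) (sg_top (snd i)) (fst i)"
  by (rule c'[THEN conjunct2, THEN conjunct2, THEN conjunct2, THEN conjunct1, THEN conjunct1])
 show "Hausdorff_space (sg_top (snd i))" by (rule c'[THEN conjunct2, THEN conjunct2, THEN conjunct1])
 show "semitopological_semigroup (snd i)" by (rule c'[THEN conjunct1])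
 show "CH_semigroup (snd i)" by (rule S)
 show "x : sg_carrier W ==> y : sg_carrier W ==> fst i (x \<cdot>\<^bsub>W\<^esub> y) = fst i x \<cdot>\<^bsub>snd i\<^esub> fst i y"
  using c unfolding compactification_def continuous_hom_def multiplicative_map_def by (elim conjE) simp
 show "x : sg_carrier W ==> fst i x : sg_carrier (snd i)" using continuous_map_image_subset_topspace[OF *] by blast
qed

lemma cls_eq: "x : sg_carrier W ==> y : sg_carrier W ==> cls x = cls y \<longleftrightarrow> (ALL i:I. fst i x = fst i y)"
 unfolding cls_def by auto

lemma pt: "\<rho> : RC ==> pt \<rho> : sg_carrier W & cls (pt \<rho>) = \<rho>"
 unfolding pt_def by (rule someI_ex) auto

lemma at_pt_cls: "x : sg_carrier W ==> i : I ==> fst i (pt (cls x)) = fst i x"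
 using cls_eq[of "pt (cls x)" x] pt[of "cls x"] by auto

lemma at_carrier: "\<rho> : RC ==> i : I ==> fst i (pt \<rho>) : sg_carrier (snd i)"
 by (rule ID(6)) (simp_all only: pt)

lemma topspace_RT: "topspace RT = RC"
 using at_carrier by (auto simp: topspace_pullback_topology PiE_def Pi_def)

lemma ml_closed: "\<rho> : RC ==> \<sigma> : RC ==> ml \<rho> \<sigma> : RC" 
 by (intro imageI closed) (simp_all add: pt[THEN conjunct1])

lemma at_ml: "\<rho> : RC ==> \<sigma> : RC ==> i : I ==> fst i (pt (ml \<rho> \<sigma>)) = fst i (pt \<rho>) \<cdot>\<^bsub>snd i\<^esub> fst i (pt \<sigma>)"
 using pt[of \<rho>] pt[of \<sigma>] by (simp add: at_pt_cls closed ID(5))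

lemma RC_eqI:
 assumes "\<rho> : RC" "\<sigma> : RC" "!!i. i : I ==> fst i (pt \<rho>) = fst i (pt \<sigma>)"
 shows "\<rho> = \<sigma>"
 using cls_eq[of "pt \<rho>" "pt \<sigma>"] pt[OF assms(1)] pt[OF assms(2)] assms(3) by simp

lemma ml_assoc:
 assumes r: "\<rho> : RC" "\<sigma> : RC" "\<kappa> : RC"
 shows "ml (ml \<rho> \<sigma>) \<kappa> = ml \<rho> (ml \<sigma> \<kappa>)"
proof (rule RC_eqI)
 fix i assume i: "i : I"
 have "fst i (pt \<rho>) : sg_carrier (snd i)" "fst i (pt \<sigma>) : sg_carrier (snd i)" "fst i (pt \<kappa>) : sg_carrier (snd i)"
  by (rule at_carrier[OF _ i], rule r)+
 then have "(fst i (pt \<rho>) \<cdot>\<^bsub>snd i\<^esub> fst i (pt \<sigma>)) \<cdot>\<^bsub>snd i\<^esub> fst i (pt \<kappa>) = fst i (pt \<rho>) \<cdot>\<^bsub>snd i\<^esub> (fst i (pt \<sigma>) \<cdot>\<^bsub>snd i\<^esub> fst i (pt \<kappa>))"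
  using ID(3)[OF i] unfolding semitopological_semigroup_def by blast
 then show "fst i (pt (ml (ml \<rho> \<sigma>) \<kappa>)) = fst i (pt (ml \<rho> (ml \<sigma> \<kappa>)))"
  using r by (simp only: at_ml[OF _ _ i] ml_closed)
qed (intro ml_closed r)+

lemma continuous_map_RT:
 assumes "!!x. x : topspace X ==> g x : RC" "!!i. i : I ==> continuous_map X (sg_top (snd i)) (%x. fst i (pt (g x)))"
 shows "continuous_map X RT g"
proof (rule continuous_map_pullback')
 show "continuous_map X PT (J \<circ> g)"
  unfolding continuous_map_componentwise using assms(2) by (auto simp: o_def)
qed (use assms(1) in auto)

lemma continuous_map_at: assumes "i : I" shows "continuous_map RT (sg_top (snd i)) (%\<rho>. fst i (pt \<rho>))"
proof -
 have "continuous_map RT (sg_top (snd i)) ((%h. h i) \<circ> J)"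
  by (rule continuous_map_pullback[OF continuous_map_product_projection[OF assms]])
 then show ?thesis using assms by (simp add: o_def)
qed

lemma compactification_R: "compactification W cls R"
proof -
 have cls: "continuous_map (sg_top W) RT cls"
 proof (rule continuous_map_RT)
  show "continuous_map (sg_top W) (sg_top (snd i)) (%x. fst i (pt (cls x)))" if i: "i : I" for i
   by (rule continuous_map_eq[OF ID(1)[OF i]]) (simp add: at_pt_cls i)
 qed blast
 have "compactin RT (cls ` sg_carrier W)" by (rule image_compactin[OF _ cls]) (use compact in \<open>simp add: compact_space_def\<close>)
 then have "compact_space RT" by (simp add: compact_space_def topspace_RT)
 moreover have "Hausdorff_space RT"
  unfolding Hausdorff_space_def topspace_RT
 proof (intro allI impI, elim conjE)
  fix \<rho> \<sigma> assume r: "\<rho> : RC" "\<sigma> : RC" "\<rho> ~= \<sigma>"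
  then obtain i where i: "i : I" "fst i (pt \<rho>) ~= fst i (pt \<sigma>)" using RC_eqI by blast
  have "EX U V. openin (sg_top (snd i)) U & openin (sg_top (snd i)) V & fst i (pt \<rho>) : U & fst i (pt \<sigma>) : V & disjnt U V"
   by (rule ID(2)[OF i(1), unfolded Hausdorff_space_def, THEN spec, THEN spec, THEN mp])
    (intro conjI at_carrier r i)
  then obtain U V where UV: "openin (sg_top (snd i)) U" "openin (sg_top (snd i)) V" "fst i (pt \<rho>) : U" "fst i (pt \<sigma>) : V" "disjnt U V" by (elim exE conjE)
  note c = openin_continuous_map_preimage[OF continuous_map_at[OF i(1)]]
  show "EX U V. openin RT U & openin RT V & \<rho> : U & \<sigma> : V & disjnt U V"
   by (rule exI[of _ "{\<rho> : topspace RT. fst i (pt \<rho>) : U}"], rule exI[of _ "{\<rho> : topspace RT. fst i (pt \<rho>) : V}"], intro conjI c UV)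
    (use UV r topspace_RT in \<open>auto simp: disjnt_def\<close>)
 qed
 moreover have "semitopological_semigroup R"
  unfolding semitopological_semigroup_def R_def top_semigroup.simps topspace_RT
 proof (intro conjI ballI)
  show "ml \<rho> \<sigma> : RC" if "\<rho> : RC" "\<sigma> : RC" for \<rho> \<sigma> by (rule ml_closed[OF that])
  show "ml (ml \<rho> \<sigma>) \<kappa> = ml \<rho> (ml \<sigma> \<kappa>)" if "\<rho> : RC" "\<sigma> : RC" "\<kappa> : RC" for \<rho> \<sigma> \<kappa> by (rule ml_assoc[OF that])
  fix \<rho> assume r: "\<rho> : RC"
  have c: "fst i (pt \<rho>) : sg_carrier (snd i)" if "i : I" for i by (rule at_carrier[OF r that])
  have mult: "continuous_map (sg_top (snd i)) (sg_top (snd i)) (%y. fst i (pt \<rho>) \<cdot>\<^bsub>snd i\<^esub> y)"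
   "continuous_map (sg_top (snd i)) (sg_top (snd i)) (%y. y \<cdot>\<^bsub>snd i\<^esub> fst i (pt \<rho>))" if "i : I" for i
   using ID(3)[OF that] c[OF that] unfolding semitopological_semigroup_def by blast+
  show "continuous_map RT RT (ml \<rho>)"
  proof (rule continuous_map_RT)
   show "continuous_map RT (sg_top (snd i)) (%\<sigma>. fst i (pt (ml \<rho> \<sigma>)))" if i: "i : I" for i
    by (rule continuous_map_eq[OF continuous_map_compose[OF continuous_map_at[OF i] mult(1)[OF i]]]) (use i r topspace_RT in \<open>simp add: at_ml\<close>)
  qed (use r in \<open>simp only: topspace_RT, intro ml_closed\<close>)
  show "continuous_map RT RT (%\<sigma>. ml \<sigma> \<rho>)"
  proof (rule continuous_map_RT)
   show "continuous_map RT (sg_top (snd i)) (%\<sigma>. fst i (pt (ml \<sigma> \<rho>)))" if i: "i : I" for i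
    by (rule continuous_map_eq[OF continuous_map_compose[OF continuous_map_at[OF i] mult(2)[OF i]]]) (use i r topspace_RT in \<open>simp add: at_ml\<close>)
  qed (use r in \<open>simp only: topspace_RT, intro ml_closed\<close>)
 qed
 moreover have "cls (x \<cdot>\<^bsub>W\<^esub> y) = ml (cls x) (cls y)" if "x : sg_carrier W" "y : sg_carrier W" for x y
  by (rule RC_eqI) (use that closed ml_closed in \<open>auto simp: at_pt_cls at_ml ID(5)\<close>)
 moreover have "RT closure_of RC = RC" using closure_of_topspace[of RT] by (simp only: topspace_RT)
 ultimately show ?thesis
  using cls unfolding compactification_def continuous_hom_def multiplicative_map_def
  by (simp add: R_def topspace_RT)
qed

text \<open>One vector per pair of classes is enough for separation, and vectors indexed by pairs
  and classes are few enough for the Hilbert space below to fit its type.\<close>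

definition faithful_at :: "'w set set \<times> 'w set set => ('w set set => complex) hilbert =>
  ('w set set => ('w set set => complex) => 'w set set => complex) => ('w set set => complex) => bool" where
 "faithful_at p H V \<xi> \<longleftrightarrow> pre_hilb H & \<xi> : carrier H & (ALL \<rho>:RC. V \<rho> : contractions H) &
   (ALL \<rho>:RC. ALL \<sigma>:RC. V (ml \<rho> \<sigma>) = compose (carrier H) (V \<rho>) (V \<sigma>)) &
   continuous_map RT (weak_star_topology H) V & V (fst p) \<xi> ~= V (snd p) \<xi>"

lemma faithful_at_exists:
 assumes p: "fst p : RC" "snd p : RC" "fst p ~= snd p"
 shows "EX H V \<xi>. faithful_at p H V \<xi>"
proof -
 have "~ (ALL i:I. fst i (pt (fst p)) = fst i (pt (snd p)))" using RC_eqI[OF p(1,2)] p(3) by blast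
 then obtain i where i: "i : I" "fst i (pt (fst p)) ~= fst i (pt (snd p))" by blast
 have at: "fst i (pt \<rho>) : sg_carrier (snd i)" if "\<rho> : RC" for \<rho> by (rule at_carrier[OF that i(1)])
 obtain H :: "('w set set => complex) hilbert" and C \<Phi> where H: "hilbert_space H" and C: "closed_contraction_semigroup H C"
  and \<Phi>: "semigroup_iso (snd i) (operator_semigroup H C) \<Phi>" using ID(4)[OF i(1)] unfolding CH_semigroup_def by blast
 interpret pre_hilb H using H by (simp add: hilbert_space_iff_pre_hilb)
 have cont: "continuous_map (sg_top (snd i)) (subtopology (weak_star_topology H) C) \<Phi>" and inj: "inj_on \<Phi> (sg_carrier (snd i))"
  using \<Phi> by (auto simp: semigroup_iso_def operator_semigroup_def homeomorphic_map_def quotient_imp_continuous_map)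
 have \<Phi>C: "\<Phi> s : contractions H" if "s : sg_carrier (snd i)" for s
  using continuous_map_image_subset_topspace[OF cont] that C by (auto simp: closed_contraction_semigroup_def)
 have "\<Phi> (fst i (pt (fst p))) ~= \<Phi> (fst i (pt (snd p)))" using inj i(2) at p by (auto simp: inj_on_def)
 moreover have "\<Phi> (fst i (pt \<rho>)) : linear_operators H" if "\<rho> : RC" for \<rho> using \<Phi>C[OF at[OF that]] by (simp add: contractions_def)
 ultimately obtain \<xi> \<eta> where "\<xi> : carrier H" "ip (\<Phi> (fst i (pt (fst p))) \<xi>) \<eta> ~= ip (\<Phi> (fst i (pt (snd p))) \<xi>) \<eta>"
  using p by (elim operators_separated[rotated 2]) auto
 moreover have "continuous_map RT (weak_star_topology H) (%\<rho>. \<Phi> (fst i (pt \<rho>)))"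
  using continuous_map_compose[OF continuous_map_at[OF i(1)] continuous_map_into_fulltopology[OF cont]] by (simp add: o_def)
 moreover have "\<Phi> (fst i (pt (ml \<rho> \<sigma>))) = compose (carrier H) (\<Phi> (fst i (pt \<rho>))) (\<Phi> (fst i (pt \<sigma>)))" if "\<rho> : RC" "\<sigma> : RC" for \<rho> \<sigma>
  using \<Phi> at that i(1) by (simp add: at_ml semigroup_iso_def multiplicative_map_def operator_semigroup_def)
 ultimately have "faithful_at p H (%\<rho>. \<Phi> (fst i (pt \<rho>))) \<xi>"
  unfolding faithful_at_def using \<Phi>C at pre_hilb_axioms by auto
 then show ?thesis by blast
qed

text \<open>The direct sum, over all pairs of distinct classes, of the cyclic parts of
  representations that separate the pair. It is formed as a block kernel on pairs and classes, whose
  Hilbert space then lies on the type that \<open>CH_semigroup\<close> prescribes. The image of the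
  compact \<open>R\<close> is compact, hence closed.\<close>

lemma CH_semigroup_R: "CH_semigroup R"
proof -
 define P where "P = {p : RC \<times> RC. fst p ~= snd p}"
 have "ALL p. EX D. p : P --> faithful_at p (fst D) (fst (snd D)) (snd (snd D))"
  using faithful_at_exists unfolding P_def by fastforce
 from choice[OF this] obtain D where D: "!!p. p : P ==> faithful_at p (fst (D p)) (fst (snd (D p))) (snd (snd (D p)))" by blast
 define H V \<xi> where "H = (%p. fst (D p))" and "V = (%p. fst (snd (D p)))" and "\<xi> = (%p. snd (snd (D p)))"
 have F: "faithful_at p (H p) (V p) (\<xi> p)" if "p : P" for p using D[OF that] by (simp add: H_def V_def \<xi>_def)
 have pre: "pre_hilb (H p)" and \<xi>c: "\<xi> p : carrier (H p)" and Vc: "\<rho> : RC ==> V p \<rho> : contractions (H p)"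
  and Vm: "\<rho> : RC ==> \<sigma> : RC ==> V p (ml \<rho> \<sigma>) = compose (carrier (H p)) (V p \<rho>) (V p \<sigma>)"
  and Vt: "continuous_map RT (weak_star_topology (H p)) (V p)" and Vn: "V p (fst p) (\<xi> p) ~= V p (snd p) (\<xi> p)"
  if "p : P" for p \<rho> \<sigma> using F[OF that] unfolding faithful_at_def by blast+
 define v where "v = (%p s. if s : RC then V p s (\<xi> p) else \<zero>\<^bsub>H p\<^esub>)"
 have vc: "v p s : carrier (H p)" if "p : P" for p s
  using pre_hilb.contraction_simps(1)[OF pre Vc \<xi>c] that Module.module.axioms(2)[OF pre_hilb.module_H[OF pre[OF that]]]
  by (auto simp: v_def abelian_group_def abelian_monoid.zero_closed)
 define act where "act = (%r s. if s : RC then ml r s else s)"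
 have vact: "v p (act r s) = V p r (v p s)" if p: "p : P" and r: "r : RC" for p r s
 proof (cases "s : RC")
  case True
  then show ?thesis using Vm[OF p r True] \<xi>c[OF p] r by (simp add: act_def v_def ml_closed compose_def)
 next
  case False
  interpret pre_hilb "H p" by (rule pre[OF p])
  note c = contraction_simps[OF Vc[OF p r] zero_closed]
  have "hn (V p r \<zero>\<^bsub>H p\<^esub>) = 0" using c(2) hn_nonneg[OF c(1)] hn_zero_iff[OF zero_closed] by simp
  then show ?thesis using False c(1) hn_zero_iff by (simp add: act_def v_def)
 qed
 define k where "k = (%p s t. if p : P then hinner (H p) (v p s) (v p t) else 0)"
 define K0 where "K0 = (%x y :: ('w set set \<times> 'w set set) \<times> 'w set set. if fst x = fst y then k (fst x) (snd x) (snd y) else 0)"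
 have zero_pd: "pd (%_ _. 0)" using pd_weight[OF pd_one, of "%_. 0"] by simp
 have "pd (k p)" for p
  using pre_hilb.pd_gram[OF pre vc] zero_pd by (cases "p : P") (simp_all add: k_def)
 then have pdK0: "pd K0" unfolding K0_def by (rule pd_blocks)
 have inf': "infinite (UNIV :: 'w set set set)" by (rule inf)
 obtain \<iota> :: "('w set set \<times> 'w set set) \<times> 'w set set => 'w set set" where \<iota>: "inj \<iota>" by (rule infinite_inj_triple[OF inf'])
 define d where "d = inv_into UNIV \<iota>"
 have d: "d (\<iota> p) = p" for p using \<iota> by (simp add: d_def)
 define \<tau>0 where "\<tau>0 = (%r (x :: ('w set set \<times> 'w set set) \<times> 'w set set). (fst x, act r (snd x)))"
 define \<tau> where "\<tau> = (%r z. \<iota> (\<tau>0 r (d z)))"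
 interpret kernel "%z w. K0 (d z) (d w)" by unfold_locales (rule pd_pullback[OF pdK0])
 interpret hs: pre_hilb hs by (rule pre_hilb_hs)
 \<comment> \<open>The kernel minus its translate is, block by block, the kernel of
   \<open>1 - A* A\<close> for the contraction \<open>V p r\<close>.\<close>
 have contr: "contr (\<tau> r)" if r: "r : RC" for r
 proof -
  define k' where "k' = (%p s t. k p s t - k p (act r s) (act r t))"
  have "pd (k' p)" for p
  proof (cases "p : P")
   case True
   show ?thesis using pre_hilb.pd_gram_diff[OF pre[OF True] Vc[OF True r] vc[OF True]] by (simp add: k'_def k_def True vact r)
  qed (use zero_pd in \<open>simp add: k'_def k_def\<close>)
  from pd_pullback[OF pd_blocks[of k', OF this], of d]
  have "0 <= Re (form (%z w. if fst (d z) = fst (d w) then k' (fst (d z)) (snd (d z)) (snd (d w)) else 0) l l)" for l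
   unfolding pd_def by blast
  moreover have "form (%z w. if fst (d z) = fst (d w) then k' (fst (d z)) (snd (d z)) (snd (d w)) else 0) l l = B l l - B (mv (\<tau> r) l) (mv (\<tau> r) l)" for l
  proof -
   have "(%z w. if fst (d z) = fst (d w) then k' (fst (d z)) (snd (d z)) (snd (d w)) else 0) = (%z w. K0 (d z) (d w) - K0 (d (\<tau> r z)) (d (\<tau> r w)))"
    by (auto simp: fun_eq_iff K0_def k'_def \<tau>_def \<tau>0_def d)
   then show ?thesis unfolding form_mv by (simp add: form_def algebra_simps sum_list_subtractf)
  qed
  ultimately have "Re (B (mv (\<tau> r) l) (mv (\<tau> r) l)) <= Re (B l l)" for l by simp
  then show ?thesis by (simp add: contr_def q_def)
 qed
 define \<Psi> where "\<Psi> = (%r. induced (\<tau> r))"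
 have \<Psi>c: "\<Psi> r : contractions hs" if "r : RC" for r unfolding \<Psi>_def by (rule induced_contraction[OF contr[OF that]])
 have \<Psi>m: "\<Psi> (ml r s) = compose (carrier hs) (\<Psi> r) (\<Psi> s)" if rs: "r : RC" "s : RC" for r s
 proof -
  have "\<tau> (ml r s) = \<tau> r \<circ> \<tau> s" using ml_assoc[OF rs] rs ml_closed by (auto simp: fun_eq_iff \<tau>_def \<tau>0_def act_def d)
  then show ?thesis using induced_comp[OF contr[OF rs(1)] contr[OF rs(2)]] contr[OF ml_closed[OF rs]] by (simp add: \<Psi>_def)
 qed
 have cK: "continuous_map RT euclidean (%r. K0 (d (\<tau> r x)) y)" for x y
 proof -
  define p s t where "p = fst (d x)" and "s = snd (d x)" and "t = snd y"
  have "continuous_map RT euclidean (%r. hinner (H p) (V p r (v p s)) (v p t))" if p: "p : P"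
   using continuous_map_compose[OF Vt[OF p] pre_hilb.weak_star_coordinate[OF pre[OF p] vc[OF p] vc[OF p]]] by (simp add: o_def)
  then have "continuous_map RT euclidean (%r. if fst (d x) = fst y & p : P then hinner (H p) (V p r (v p s)) (v p t) else 0)" by (simp split: if_split)
  then show ?thesis
   by (rule continuous_map_eq) (auto simp: K0_def \<tau>_def \<tau>0_def d k_def p_def s_def t_def vact topspace_RT)
 qed
 have \<Psi>t: "continuous_map RT (weak_star_topology hs) \<Psi>"
  unfolding \<Psi>_def
  by (rule hs.continuous_map_weak_star) (use contr induced_contraction topspace_RT in blast, simp, rule continuous_map_inner_induced[OF _ cK], use contr topspace_RT in auto)
 \<comment> \<open>Acting on the point at the class of the right unit reaches the point at any
   class, so \<open>\<Psi> r\<close> determines the vector \<open>V p r (\<xi> p)\<close>, and these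
   vectors separate the pair.\<close>
 obtain u where u: "u : sg_carrier W" "!!x. x : sg_carrier W ==> x \<cdot>\<^bsub>W\<^esub> u = x" using unit by blast
 have mlu: "ml \<rho> (cls u) = \<rho>" if r: "\<rho> : RC" for \<rho>
  by (rule RC_eqI) (use r u ml_closed pt[OF r] in \<open>auto simp: at_ml at_pt_cls ID(5)[symmetric]\<close>)
 have inj: "inj_on \<Psi> RC"
 proof (rule inj_onI, rule ccontr)
  fix r r' assume r: "r : RC" "r' : RC" "\<Psi> r = \<Psi> r'" "r ~= r'"
  define p where "p = (r, r')"
  have p: "p : P" using r by (simp add: P_def p_def)
  interpret Hp: pre_hilb "H p" by (rule pre[OF p])
  have uc: "cls u : RC" using u by blast
  define z where "z = (%r. \<iota> (p, r))"
  have "mv (\<tau> r) [(1, z (cls u))] = [(1, z r)]" if "r : RC" for r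
   using that uc by (simp add: mv_def z_def \<tau>_def \<tau>0_def d act_def mlu)
  then have "point [(1, z r)] = point [(1, z r')]"
   using induced_point[OF contr, of r "[(1, z (cls u))]"] induced_point[OF contr, of r' "[(1, z (cls u))]"] r unfolding \<Psi>_def by simp
  then have "B [(1, z r)] [(1, y)] = B [(1, z r')] [(1, y)]" for y by (rule fun_cong)
  from this[of "z r"] this[of "z r'"] have "hdist (H p) (V p r (\<xi> p)) (V p r' (\<xi> p)) = 0"
   using Hp.hdist_eq[of "V p r (\<xi> p)" "V p r' (\<xi> p)"] Hp.ip_commute[of "V p r (\<xi> p)" "V p r' (\<xi> p)"]
    Hp.contraction_simps(1)[OF Vc[OF p] \<xi>c[OF p]] r p
   by (simp add: form_singletons K0_def k_def z_def d v_def)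
  then show False using Vn[OF p] Hp.hdist_zero Hp.contraction_simps(1)[OF Vc[OF p] \<xi>c[OF p]] r by (simp add: p_def)
 qed
 have RTc: "compact_space RT" using compactification_R by (simp add: compactification_def R_def)
 have "compactin (weak_star_topology hs) (\<Psi> ` RC)"
  by (rule image_compactin[OF _ \<Psi>t]) (use RTc topspace_RT in \<open>simp add: compact_space_def\<close>)
 then have cl: "closedin (weak_star_topology hs) (\<Psi> ` RC)" by (rule compactin_imp_closedin[OF hs.Hausdorff_weak_star])
 have "closed_contraction_semigroup hs (\<Psi> ` RC)"
  unfolding closed_contraction_semigroup_def
 proof (intro conjI ballI cl)
  show "\<Psi> ` RC \<subseteq> contractions hs" using \<Psi>c by blast
  fix A A' assume "A : \<Psi> ` RC" "A' : \<Psi> ` RC"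
  then obtain r s where rs: "r : RC" "s : RC" "A = \<Psi> r" "A' = \<Psi> s" by blast
  show "compose (carrier hs) A A' : \<Psi> ` RC" unfolding rs(3,4) \<Psi>m[OF rs(1,2), symmetric] by (intro imageI ml_closed rs)
 qed
 moreover have "semigroup_iso R (operator_semigroup hs (\<Psi> ` RC)) \<Psi>"
  unfolding semigroup_iso_def
 proof
  have top: "topspace (subtopology (weak_star_topology hs) (\<Psi> ` RC)) = \<Psi> ` RC" using closedin_subset[OF cl] by auto
  have "homeomorphic_map RT (subtopology (weak_star_topology hs) (\<Psi> ` RC)) \<Psi>"
   by (rule continuous_imp_homeomorphic_map[OF _ RTc])
    (use \<Psi>t top inj topspace_RT hs.Hausdorff_weak_star in \<open>auto simp: continuous_map_in_subtopology Hausdorff_space_subtopology\<close>)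
  then show "homeomorphic_map (sg_top R) (sg_top (operator_semigroup hs (\<Psi> ` RC))) \<Psi>" by (simp add: R_def operator_semigroup_def)
  show "multiplicative_map R (operator_semigroup hs (\<Psi> ` RC)) \<Psi>"
   using \<Psi>m by (simp add: multiplicative_map_def R_def operator_semigroup_def topspace_RT)
 qed
 ultimately show ?thesis unfolding CH_semigroup_def using hilbert_space_hs by blast
qed

theorem universal_CH_compactification_R: "universal_CH_compactification W cls R"
 unfolding universal_CH_compactification_def CH_compactification_def[of W cls R]
proof (intro conjI compactification_R CH_semigroup_R allI impI)
 fix \<delta> and S :: "'w set set top_semigroup" assume "CH_compactification W \<delta> S"
 then have i: "(\<delta>, S) : I" by (simp add: I_def)
 show "compactification_le W \<delta> S cls R"
  unfolding compactification_le_def continuous_hom_def multiplicative_map_def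
  using continuous_map_at[OF i] at_pt_cls[OF _ i] at_ml[OF _ _ i]
  by (intro exI[of _ "%\<rho>. \<delta> (pt \<rho>)"]) (simp add: R_def topspace_RT)
qed

end

section \<open>Separation of the compactifications\<close>

lemma half_graphs_infinite:
 fixes G :: "'a monoid"
 assumes "half_graphs G f"
 shows "infinite (UNIV :: 'a set)"
proof
 assume fin: "finite (UNIV :: 'a set)"
 define N where "N = card (UNIV :: 'a set) + 2"
 obtain a b :: "nat => 'a" where ab: "ALL i<N. ALL j<N. f (a i \<otimes>\<^bsub>G\<^esub> b j) = (if i < j then 1 else 0)"
  using assms[unfolded half_graphs_def, THEN spec, of N] by (elim exE conjE)
 \<comment> \<open>Column \<open>j\<close> tells \<open>a i\<close>, where \<open>f\<close> takes
   the value 1, from \<open>a j\<close> on the diagonal, where it takes the value 0.\<close>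
 have ne: "a i ~= a j" if "i < j" "j < N" for i j
  using ab[rule_format, of i j] ab[rule_format, of j j] that by auto
 have "inj_on a {..<N}"
  by (rule linorder_inj_onI) (use ne in auto)
 then have "N <= card (UNIV :: 'a set)" using card_inj_on_le[of a "{..<N}" UNIV] fin by simp
 then show False by (simp add: N_def)
qed

context top_grp
begin

lemma evaluation_one_unit:
 assumes "\<mu> : sg_carrier WC"
 shows "\<mu> \<cdot>\<^bsub>WC\<^esub> evaluation WAPG \<one> = \<mu>"
proof -
 have "translate G x f : WAPG & translate G x f \<one> = f x" if "x : carrier G" "f : WAPG" for x f
  using translate_WAP[OF that(2,1)] that by (simp add: translate_def)
 then have "(FN x. evaluation WAPG \<one> (translate G x f)) = f" if "f : WAPG" for f
  using that WAP_CB[OF that] by (auto simp: evaluation_def CB_def extensional_def fun_eq_iff)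
 then have "\<mu> \<cdot>\<^bsub>WC\<^esub> evaluation WAPG \<one> = (\<lambda>f\<in>WAPG. \<mu> f)" unfolding sg_mult_WC by (intro restrict_ext) simp
 also have "\<dots> = \<mu>" using assms by (intro extensional_restrict) (simp add: sg_carrier_WC gelfand_spectrum_def)
 finally show ?thesis .
qed

lemma evaluation_WC: "x : carrier G ==> evaluation WAPG x : sg_carrier WC"
 unfolding sg_carrier_WC by (rule evaluation_in_spectrum(2)[OF function_algebra_WAP])

theorem universal_CH_compactification_WC:
 assumes "infinite (UNIV :: 'a set)"
 shows "EX \<epsilon> (R :: (('a => complex) => complex) set set top_semigroup). universal_CH_compactification WC \<epsilon> R"
proof -
 interpret W: compact_semigroup WC
 proof
  show "compact_space (sg_top WC)" by (rule compact_WC)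
  show "\<mu> \<cdot>\<^bsub>WC\<^esub> \<nu> : sg_carrier WC" if "\<mu> : sg_carrier WC" "\<nu> : sg_carrier WC" for \<mu> \<nu> by (rule WC_mult_closed[OF that])
  show "EX u:sg_carrier WC. ALL \<mu>:sg_carrier WC. \<mu> \<cdot>\<^bsub>WC\<^esub> u = \<mu>"
   by (rule bexI[of _ "evaluation WAPG \<one>"]) (use evaluation_one_unit evaluation_WC in auto)
  \<comment> \<open>Doubly wrapped point evaluations carry the infinity of the group type over to
    the type of classes.\<close>
  have "inj (%x :: 'a. {{%f :: 'a => complex. f x}})"
  proof (rule injI)
   fix x y :: 'a assume "{{%f :: 'a => complex. f x}} = {{%f. f y}}"
   then have "(%f :: 'a => complex. f x) = (%f. f y)" by simp
   from fun_cong[OF this, of "%z. if z = x then 1 else 0"] show "x = y" by (simp split: if_splits)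
  qed
  from finite_imageD[OF finite_subset[OF subset_UNIV] this] show "infinite (UNIV :: (('a => complex) => complex) set set set)"
   using assms by blast
 qed
 show ?thesis using W.universal_CH_compactification_R by blast
qed

text \<open>An injective \<epsilon> would be a homeomorphism and make \<open>f\<close> a continuous
  function on a weak* compact semigroup of contractions. Its coordinates are coefficients, hence
  stable along the group, which contradicts the half graphs of \<open>f\<close>.\<close>

theorem universal_CH_proper_quotient:
 assumes f: "f : WAPG" and hg: "half_graphs G f" and R: "CH_compactification WC \<epsilon> R"
 shows "proper_quotient WC \<epsilon> R"
 unfolding proper_quotient_def
proof (intro conjI notI)
 have c: "compactification WC \<epsilon> R" and "CH_semigroup R" using R by (simp_all add: CH_compactification_def)
 then have cont: "continuous_map (sg_top WC) (sg_top R) \<epsilon>" and Haus: "Hausdorff_space (sg_top R)"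
  and dense: "sg_top R closure_of (\<epsilon> ` sg_carrier WC) = sg_carrier R"
  by (simp_all add: compactification_def continuous_hom_def)
 show mult: "multiplicative_map WC R \<epsilon>" using c by (simp add: compactification_def continuous_hom_def)
 have closed: "closed_map (sg_top WC) (sg_top R) \<epsilon>" by (rule continuous_imp_closed_map[OF cont compact_WC Haus])
 then have "closedin (sg_top R) (\<epsilon> ` sg_carrier WC)" by (simp add: closed_map_def)
 then have surj: "\<epsilon> ` sg_carrier WC = sg_carrier R" using dense by (simp add: closure_of_closedin)
 show "quotient_map (sg_top WC) (sg_top R) \<epsilon>"
  by (rule continuous_closed_imp_quotient_map[OF cont closed surj])
 assume inj: "inj_on \<epsilon> (sg_carrier WC)"
 have hom: "homeomorphic_map (sg_top WC) (sg_top R) \<epsilon>"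
  by (rule continuous_imp_homeomorphic_map[OF cont compact_WC Haus surj inj])
 obtain H :: "('b => complex) hilbert" and C \<Phi> where H: "hilbert_space H" and C: "closed_contraction_semigroup H C"
  and \<Phi>: "semigroup_iso R (operator_semigroup H C) \<Phi>" using \<open>CH_semigroup R\<close> unfolding CH_semigroup_def by blast
 interpret pre_hilb H using H by (simp add: hilbert_space_iff_pre_hilb)
 let ?X = "sg_top (operator_semigroup H C)"
 have Xdef: "?X = subtopology (weak_star_topology H) C" by (simp add: operator_semigroup_def)
 have \<Phi>h: "homeomorphic_map (sg_top R) ?X \<Phi>" using \<Phi> by (simp add: semigroup_iso_def)
 have h: "homeomorphic_map (sg_top WC) ?X (\<Phi> \<circ> \<epsilon>)" by (rule homeomorphic_map_compose[OF hom \<Phi>h])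
 then obtain g where g: "homeomorphic_maps (sg_top WC) ?X (\<Phi> \<circ> \<epsilon>) g" using homeomorphic_map_maps by blast
 have XC: "topspace ?X \<subseteq> contractions H" using C by (auto simp: Xdef closed_contraction_semigroup_def)
 define \<delta> where "\<delta> = (%x. \<Phi> (\<epsilon> (evaluation WAPG x)))"
 have \<delta>X: "\<delta> x : topspace ?X" if "x : carrier G" for x
  using homeomorphic_imp_surjective_map[OF h] evaluation_WC[OF that] by (auto simp: \<delta>_def)
 have \<delta>m: "\<delta> (x \<otimes> y) = compose (carrier H) (\<delta> x) (\<delta> y)" if "x : carrier G" "y : carrier G" for x y
 proof -
  have e: "evaluation WAPG x : sg_carrier WC" "evaluation WAPG y : sg_carrier WC" using evaluation_WC that by auto
  have "\<delta> (x \<otimes> y) = \<Phi> (\<epsilon> (evaluation WAPG x) \<cdot>\<^bsub>R\<^esub> \<epsilon> (evaluation WAPG y))"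
   using mult[unfolded multiplicative_map_def, rule_format, OF e] by (simp only: \<delta>_def evaluation_mult[OF that])
  also have "\<dots> = compose (carrier H) (\<delta> x) (\<delta> y)"
   using \<Phi> e surj by (auto simp: \<delta>_def semigroup_iso_def multiplicative_map_def operator_semigroup_def)
  finally show ?thesis .
 qed
 show False
 proof (rule half_graphs_not_stable[OF hg, of ?X "carrier H \<times> carrier H" "%p A. hinner H (A (fst p)) (snd p)" "%A. g A f" \<delta>])
  show "compact_space ?X" using homeomorphic_map_imp_homeomorphic_space[OF h] compact_WC homeomorphic_compact_space by blast
  show "continuous_map ?X euclidean (%A. hinner H (A (fst p)) (snd p))" if "p : carrier H \<times> carrier H" for p
   unfolding Xdef using that by (intro continuous_map_from_subtopology weak_star_coordinate) auto
  show "EX p:carrier H \<times> carrier H. hinner H (A (fst p)) (snd p) ~= hinner H (A' (fst p)) (snd p)"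
   if A: "A : topspace ?X" "A' : topspace ?X" "A ~= A'" for A A'
  proof -
   obtain \<xi> \<eta> where "\<xi> : carrier H" "\<eta> : carrier H" "hinner H (A \<xi>) \<eta> ~= hinner H (A' \<xi>) \<eta>"
    by (rule operators_separated[of A A']) (use A XC in \<open>auto simp: contractions_def\<close>)
   then show ?thesis by (intro bexI[of _ "(\<xi>, \<eta>)"]) auto
  qed
  have "continuous_map ?X (prodtop WAPG) g"
   using g by (simp add: homeomorphic_maps_def sg_top_WC continuous_map_in_subtopology)
  from continuous_map_compose[OF this continuous_map_coord[OF f]] show "continuous_map ?X euclidean (%A. g A f)" by (simp add: o_def)
  show "\<delta> x : topspace ?X & g (\<delta> x) f = f x" if "x : carrier G" for x
   using \<delta>X[OF that] g evaluation_WC[OF that] f by (simp add: homeomorphic_maps_def \<delta>_def evaluation_def)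
  show "stable (carrier G) (%x y. hinner H (\<delta> (x \<otimes> y) (fst p)) (snd p))" if p: "p : carrier H \<times> carrier H" for p
  proof (rule stable_if_contraction_coefficients)
   fix e :: real assume e: "0 < e"
   have pc: "fst p : carrier H" "snd p : carrier H" using p by auto
   have \<delta>c: "\<delta> x : contractions H" if "x : carrier G" for x using \<delta>X[OF that] XC by blast
   have "\<delta> (x \<otimes> y) (fst p) = \<delta> x (\<delta> y (fst p))" if "x : carrier G" "y : carrier G" for x y
    using \<delta>m[OF that] pc by (simp add: compose_def)
   then show "EX (L :: ('b => complex) hilbert) A v \<eta> C. pre_hilb L & \<eta> : carrier L &
     (ALL x:carrier G. A x : contractions L & v x : carrier L & hnorm L (v x) <= C) &
     (ALL x:carrier G. ALL y:carrier G. cmod (hinner H (\<delta> (x \<otimes> y) (fst p)) (snd p) - hinner L (A x (v y)) \<eta>) <= e)"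
    using pc \<delta>c contraction_simps(1,2)[OF \<delta>c pc(1)] e pre_hilb_axioms
    by (intro exI[of _ H] exI[of _ \<delta>] exI[of _ "%y. \<delta> y (fst p)"] exI[of _ "snd p"] exI[of _ "hn (fst p)"]) simp
  qed
 qed simp
qed

end

theorem corollary3p15:
  fixes G :: "'a monoid" and T :: "'a topology"
  assumes "locally_compact_group G T"
    and "(\<not> compact_space T \<and> nilpotent_group G) \<or>
         (\<not> compact_space T \<and> IN_group G T) \<or>
         (connected_space T \<and> \<not> totally_minimal TYPE('b) G T)"
  shows "\<not> compactification_le (group_semigroup G T)
             (evaluation (WAP G T)) (WAP_compactification G T)
             (evaluation (eberlein_algebra G T)) (eberlein_compactification G T) \<and>
         (\<exists>\<epsilon> (R :: (('a \<Rightarrow> complex) \<Rightarrow> complex) set set top_semigroup).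
             universal_CH_compactification (WAP_compactification G T) \<epsilon> R) \<and>
         (\<forall>\<epsilon> (R :: 'r top_semigroup).
             universal_CH_compactification (WAP_compactification G T) \<epsilon> R \<longrightarrow>
             proper_quotient (WAP_compactification G T) \<epsilon> R)"
proof -
 interpret top_grp G T using assms(1) by unfold_locales (simp add: locally_compact_group_def)
 obtain f where f: "f : WAPG" "half_graphs G f" using WAP_half_graphs[OF assms] by blast
 note inf = half_graphs_infinite[OF f(2)]
 show ?thesis
  by (intro conjI allI impI not_WAP_le_eberlein[OF inf f] universal_CH_compactification_WC[OF inf]
   universal_CH_proper_quotient[OF f]) (simp add: universal_CH_compactification_def)
qed

end
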